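(* Let $(A,G)$ be a C*-dynamical system with $A$ abelian and $G$ a countable discrete group. Then the following properties are equivalent: (i) For every $G$-invariant ideal $I$ in $A$, the action of $G$ on $A/I$ is topologically free in the sense of Archbold and Spielberg. (ii) The action of $G$ on $\widehat{A}$ is essentially free. (iii) The action of $G$ on $A$ has the residual Rokhlin* property. (iv) For every $G$-invariant ideal $I\neq A$ of $A$ and every $t\in G$ with $t\neq e$, the automorphism $[a]\mapsto [t.a]$ of $A/I$ is properly outer in the sense of Elliott.
   Context: A C*-dynamical system $(A,G)$ with $G$ discrete consists of a C*-algebra $A$ and a discrete group $G$ acting on $A$ by *-automorphisms. Ideals are closed and two-sided. $\widehat{A}$ is the spectrum of $A$ (unitary equivalence classes of irreducible representations, with the topology induced from $\mathrm{Prim}(A)$), with $G$-action $(t.x)(a):=x(t^{-1}.a)$. An action of $G$ on a C*-algebra $B$ is topologically free in the sense of Archbold and Spielberg if for every finite subset $F\subseteq G\setminus\{e\}$ the set $\bigcap_{t\in F}\{x\in\widehat{B}: t.x\neq x\}$ is dense in $\widehat{B}$. An action of $G$ on a topological space $X$ is essentially free if for every closed $G$-invariant subset $Y\subseteq X$ the set of points in $Y$ with trivial isotropy group is dense in $Y$. For a C*-algebra $B$, $B_\infty:=\ell^\infty(B)/c_0(B)$ (bounded sequences in $B$ modulo null sequences), and $B\subseteq B_\infty\subseteq (B_\infty)^{**}$ via constant sequences and the canonical embedding in the bidual. An action of $G$ on $B$ induces an action on $B_\infty$ entrywise and, by double dualization, on $(B_\infty)^{**}$. The action of $G$ on $B$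 has the Rokhlin* property if there is a projection $p_e\in B'\cap (B_\infty)^{**}$ (i.e. commuting with $B$) such that (1) $p_e\perp t.p_e$ for all $t\neq e$; (2) for every non-zero $b\in B$ there is $t\in G$ with $b(t.p_e)\neq 0$. The action of $G$ on $A$ has the residual Rokhlin* property if for every $G$-invariant ideal $I$ of $A$ the induced action on $A/I$ has the Rokhlin* property. An automorphism $\alpha$ of a C*-algebra $B$ is properly outer (Elliott) if for every non-zero $\alpha$-invariant ideal $I$ in $B$ (invariant under the group generated by $\alpha$) and every inner automorphism $\beta$ of $I$ (i.e. $\beta=\mathrm{Ad}(u)$ with $u$ a unitary in the multiplier algebra $\mathcal{M}(I)$), $\|\alpha|_I-\beta\|=2$. *)

theory Defs
  imports "HOL-Analysis.Analysis" "HOL-Algebra.Group"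
begin

section \<open>Normed spaces and C*-algebras on carrier sets\<close>

text \<open>
  The statement quantifies over the invariant ideals of an algebra and speaks about the
  corresponding quotients, so all spaces are records with an explicit carrier.
\<close>

record 'a normed = "'a partial_object" +
  vadd :: "'a \<Rightarrow> 'a \<Rightarrow> 'a" (infixl "\<boxplus>\<index>" 65)
  vzero :: 'a ("\<zero>v\<index>")
  vscale :: "complex \<Rightarrow> 'a \<Rightarrow> 'a" (infixr "\<boxdot>\<index>" 75)
  vnorm :: "'a \<Rightarrow> real"

record 'a cstar = "'a normed" +
  amult :: "'a \<Rightarrow> 'a \<Rightarrow> 'a" (infixl "\<boxtimes>\<index>" 70)
  astar :: "'a \<Rightarrow> 'a"

record 'a hilbert = "'a normed" +
  hinner :: "'a \<Rightarrow> 'a \<Rightarrow> complex"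

definition vminus :: "('a, 'm) normed_scheme \<Rightarrow> 'a \<Rightarrow> 'a \<Rightarrow> 'a" where
  "vminus V x y = x \<boxplus>\<^bsub>V\<^esub> (- 1) \<boxdot>\<^bsub>V\<^esub> y"

text \<open>Set to 0 off the carrier, because \<^locale>\<open>Metric_space\<close> has conditions on all of the type.\<close>

definition vdist :: "('a, 'm) normed_scheme \<Rightarrow> 'a \<Rightarrow> 'a \<Rightarrow> real" where
  "vdist V x y = (if x \<in> carrier V \<and> y \<in> carrier V then vnorm V (vminus V x y) else 0)"

definition norm_topology :: "('a, 'm) normed_scheme \<Rightarrow> 'a topology" where
  "norm_topology V = Metric_space.mtopology (carrier V) (vdist V)"

locale complex_normed_space =
  fixes V :: "('a, 'm) normed_scheme" (structure)
  assumes add_closed: "\<lbrakk>x \<in> carrier V; y \<in> carrier V\<rbrakk> \<Longrightarrow> x \<boxplus> y \<in> carrier V"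
    and zero_closed: "\<zero>v \<in> carrier V"
    and scale_closed: "x \<in> carrier V \<Longrightarrow> c \<boxdot> x \<in> carrier V"
    and add_assoc: "\<lbrakk>x \<in> carrier V; y \<in> carrier V; z \<in> carrier V\<rbrakk>
          \<Longrightarrow> (x \<boxplus> y) \<boxplus> z = x \<boxplus> (y \<boxplus> z)"
    and add_comm: "\<lbrakk>x \<in> carrier V; y \<in> carrier V\<rbrakk> \<Longrightarrow> x \<boxplus> y = y \<boxplus> x"
    and add_zero: "x \<in> carrier V \<Longrightarrow> x \<boxplus> \<zero>v = x"
    and add_inverse: "x \<in> carrier V \<Longrightarrow> \<exists>y\<in>carrier V. x \<boxplus> y = \<zero>v"
    and scale_add_right: "\<lbrakk>x \<in> carrier V; y \<in> carrier V\<rbrakk>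
          \<Longrightarrow> c \<boxdot> (x \<boxplus> y) = c \<boxdot> x \<boxplus> c \<boxdot> y"
    and scale_add_left: "x \<in> carrier V \<Longrightarrow> (c + d) \<boxdot> x = c \<boxdot> x \<boxplus> d \<boxdot> x"
    and scale_scale: "x \<in> carrier V \<Longrightarrow> (c * d) \<boxdot> x = c \<boxdot> d \<boxdot> x"
    and scale_one: "x \<in> carrier V \<Longrightarrow> 1 \<boxdot> x = x"
    and norm_eq_zero: "x \<in> carrier V \<Longrightarrow> vnorm V x = 0 \<longleftrightarrow> x = \<zero>v"
    and norm_triangle: "\<lbrakk>x \<in> carrier V; y \<in> carrier V\<rbrakk>
          \<Longrightarrow> vnorm V (x \<boxplus> y) \<le> vnorm V x + vnorm V y"
    and norm_scale: "x \<in> carrier V \<Longrightarrow> vnorm V (c \<boxdot> x) = cmod c * vnorm V x"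

locale complex_banach_space = complex_normed_space +
  assumes complete: "Metric_space.mcomplete (carrier V) (vdist V)"

locale cstar_algebra = complex_banach_space A for A :: "('a, 'm) cstar_scheme" (structure) +
  assumes mult_closed: "\<lbrakk>a \<in> carrier A; b \<in> carrier A\<rbrakk> \<Longrightarrow> a \<boxtimes> b \<in> carrier A"
    and mult_assoc: "\<lbrakk>a \<in> carrier A; b \<in> carrier A; c \<in> carrier A\<rbrakk>
          \<Longrightarrow> (a \<boxtimes> b) \<boxtimes> c = a \<boxtimes> (b \<boxtimes> c)"
    and mult_add_left: "\<lbrakk>a \<in> carrier A; b \<in> carrier A; c \<in> carrier A\<rbrakk>
          \<Longrightarrow> (a \<boxplus> b) \<boxtimes> c = (a \<boxtimes> c) \<boxplus> (b \<boxtimes> c)"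
    and mult_add_right: "\<lbrakk>a \<in> carrier A; b \<in> carrier A; c \<in> carrier A\<rbrakk>
          \<Longrightarrow> a \<boxtimes> (b \<boxplus> c) = (a \<boxtimes> b) \<boxplus> (a \<boxtimes> c)"
    and mult_scale_left: "\<lbrakk>a \<in> carrier A; b \<in> carrier A\<rbrakk>
          \<Longrightarrow> (k \<boxdot> a) \<boxtimes> b = k \<boxdot> (a \<boxtimes> b)"
    and mult_scale_right: "\<lbrakk>a \<in> carrier A; b \<in> carrier A\<rbrakk>
          \<Longrightarrow> a \<boxtimes> (k \<boxdot> b) = k \<boxdot> (a \<boxtimes> b)"
    and norm_mult: "\<lbrakk>a \<in> carrier A; b \<in> carrier A\<rbrakk>
          \<Longrightarrow> vnorm A (a \<boxtimes> b) \<le> vnorm A a * vnorm A b"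
    and star_closed: "a \<in> carrier A \<Longrightarrow> astar A a \<in> carrier A"
    and star_star: "a \<in> carrier A \<Longrightarrow> astar A (astar A a) = a"
    and star_add: "\<lbrakk>a \<in> carrier A; b \<in> carrier A\<rbrakk>
          \<Longrightarrow> astar A (a \<boxplus> b) = astar A a \<boxplus> astar A b"
    and star_scale: "a \<in> carrier A \<Longrightarrow> astar A (k \<boxdot> a) = cnj k \<boxdot> astar A a"
    and star_mult: "\<lbrakk>a \<in> carrier A; b \<in> carrier A\<rbrakk>
          \<Longrightarrow> astar A (a \<boxtimes> b) = astar A b \<boxtimes> astar A a"
    and cstar_identity: "a \<in> carrier A \<Longrightarrow> vnorm A (astar A a \<boxtimes> a) = (vnorm A a)\<^sup>2"

locale abelian_cstar_algebra = cstar_algebra +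
  assumes mult_comm: "\<lbrakk>a \<in> carrier A; b \<in> carrier A\<rbrakk> \<Longrightarrow> a \<boxtimes> b = b \<boxtimes> a"

locale hilbert_space = complex_banach_space H for H :: "('a, 'm) hilbert_scheme" (structure) +
  assumes inner_add: "\<lbrakk>x \<in> carrier H; y \<in> carrier H; z \<in> carrier H\<rbrakk>
          \<Longrightarrow> hinner H (x \<boxplus> y) z = hinner H x z + hinner H y z"
    and inner_scale: "\<lbrakk>x \<in> carrier H; y \<in> carrier H\<rbrakk>
          \<Longrightarrow> hinner H (c \<boxdot> x) y = c * hinner H x y"
    and inner_commute: "\<lbrakk>x \<in> carrier H; y \<in> carrier H\<rbrakk>
          \<Longrightarrow> hinner H y x = cnj (hinner H x y)"
    and inner_self: "x \<in> carrier H \<Longrightarrow> hinner H x x = complex_of_real ((vnorm H x)\<^sup>2)"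


section \<open>Linear maps, duals and closed subspaces\<close>

definition linear_map ::
  "('a, 'm) normed_scheme \<Rightarrow> ('b, 'n) normed_scheme \<Rightarrow> ('a \<Rightarrow> 'b) \<Rightarrow> bool" where
  "linear_map V W f \<longleftrightarrow>
     f \<in> carrier V \<rightarrow> carrier W \<and>
     (\<forall>x\<in>carrier V. \<forall>y\<in>carrier V. f (x \<boxplus>\<^bsub>V\<^esub> y) = f x \<boxplus>\<^bsub>W\<^esub> f y) \<and>
     (\<forall>c. \<forall>x\<in>carrier V. f (c \<boxdot>\<^bsub>V\<^esub> x) = c \<boxdot>\<^bsub>W\<^esub> f x)"

definition bounded_linear_map ::
  "('a, 'm) normed_scheme \<Rightarrow> ('b, 'n) normed_scheme \<Rightarrow> ('a \<Rightarrow> 'b) \<Rightarrow> bool" where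
  "bounded_linear_map V W f \<longleftrightarrow>
     linear_map V W f \<and> (\<exists>K. \<forall>x\<in>carrier V. vnorm W (f x) \<le> K * vnorm V x)"

definition opnorm ::
  "('a, 'm) normed_scheme \<Rightarrow> ('b, 'n) normed_scheme \<Rightarrow> ('a \<Rightarrow> 'b) \<Rightarrow> real" where
  "opnorm V W f = (SUP x\<in>{x \<in> carrier V. vnorm V x \<le> 1}. vnorm W (f x))"

definition complex_space :: "complex normed" where
  "complex_space = \<lparr>carrier = UNIV, vadd = (+), vzero = 0, vscale = (*), vnorm = cmod\<rparr>"

text \<open>Functionals are extensional, so that equality in the dual is equality on the carrier.\<close>

definition dual :: "('a, 'm) normed_scheme \<Rightarrow> ('a \<Rightarrow> complex) normed" where
  "dual V = \<lparr>
     carrier = {\<phi> \<in> extensional (carrier V). bounded_linear_map V complex_space \<phi>},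
     vadd = (\<lambda>\<phi> \<psi>. \<lambda>v\<in>carrier V. \<phi> v + \<psi> v),
     vzero = (\<lambda>v\<in>carrier V. 0),
     vscale = (\<lambda>c \<phi>. \<lambda>v\<in>carrier V. c * \<phi> v),
     vnorm = opnorm V complex_space\<rparr>"

definition closed_subspace :: "('a, 'm) normed_scheme \<Rightarrow> 'a set \<Rightarrow> bool" where
  "closed_subspace V M \<longleftrightarrow>
     \<zero>v\<^bsub>V\<^esub> \<in> M \<and>
     (\<forall>x\<in>M. \<forall>y\<in>M. x \<boxplus>\<^bsub>V\<^esub> y \<in> M) \<and>
     (\<forall>c. \<forall>x\<in>M. c \<boxdot>\<^bsub>V\<^esub> x \<in> M) \<and>
     closedin (norm_topology V) M"

definition closed_ideal :: "('a, 'm) cstar_scheme \<Rightarrow> 'a set \<Rightarrow> bool" where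
  "closed_ideal A I \<longleftrightarrow>
     closed_subspace A I \<and>
     (\<forall>a\<in>carrier A. \<forall>x\<in>I. a \<boxtimes>\<^bsub>A\<^esub> x \<in> I \<and> x \<boxtimes>\<^bsub>A\<^esub> a \<in> I)"


section \<open>Quotients, sequence algebras and the bidual\<close>

definition coset :: "('a, 'm) normed_scheme \<Rightarrow> 'a set \<Rightarrow> 'a \<Rightarrow> 'a set" where
  "coset A I a = (\<lambda>x. a \<boxplus>\<^bsub>A\<^esub> x) ` I"

text \<open>
  The unions below range over all representatives; they are unions of a single coset when
  \<open>I\<close> is a closed ideal of a C*-algebra.
\<close>

definition quotient_algebra :: "('a, 'm) cstar_scheme \<Rightarrow> 'a set \<Rightarrow> 'a set cstar" where
  "quotient_algebra A I = \<lparr>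
     carrier = coset A I ` carrier A,
     vadd = (\<lambda>X Y. \<Union>x\<in>X. \<Union>y\<in>Y. coset A I (x \<boxplus>\<^bsub>A\<^esub> y)),
     vzero = I,
     vscale = (\<lambda>c X. \<Union>x\<in>X. coset A I (c \<boxdot>\<^bsub>A\<^esub> x)),
     vnorm = (\<lambda>X. INF x\<in>X. vnorm A x),
     amult = (\<lambda>X Y. \<Union>x\<in>X. \<Union>y\<in>Y. coset A I (x \<boxtimes>\<^bsub>A\<^esub> y)),
     astar = (\<lambda>X. \<Union>x\<in>X. coset A I (astar A x))\<rparr>"

definition linf :: "('a, 'm) cstar_scheme \<Rightarrow> (nat \<Rightarrow> 'a) cstar" where
  "linf B = \<lparr>
     carrier = {f. range f \<subseteq> carrier B \<and> bdd_above (range (\<lambda>n. vnorm B (f n)))},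
     vadd = (\<lambda>f g n. f n \<boxplus>\<^bsub>B\<^esub> g n),
     vzero = (\<lambda>n. \<zero>v\<^bsub>B\<^esub>),
     vscale = (\<lambda>c f n. c \<boxdot>\<^bsub>B\<^esub> f n),
     vnorm = (\<lambda>f. SUP n. vnorm B (f n)),
     amult = (\<lambda>f g n. f n \<boxtimes>\<^bsub>B\<^esub> g n),
     astar = (\<lambda>f n. astar B (f n))\<rparr>"

definition c0_ideal :: "('a, 'm) cstar_scheme \<Rightarrow> (nat \<Rightarrow> 'a) set" where
  "c0_ideal B = {f \<in> carrier (linf B). (\<lambda>n. vnorm B (f n)) \<longlonglongrightarrow> 0}"

definition B_infty :: "('a, 'm) cstar_scheme \<Rightarrow> (nat \<Rightarrow> 'a) set cstar" where
  "B_infty B = quotient_algebra (linf B) (c0_ideal B)"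

definition const_embed :: "('a, 'm) cstar_scheme \<Rightarrow> 'a \<Rightarrow> (nat \<Rightarrow> 'a) set" where
  "const_embed B b = coset (linf B) (c0_ideal B) (\<lambda>n. b)"

text \<open>
  The bidual with the first Arens product
  \<open>(\<Phi>\<Psi>)(\<phi>) = \<Phi>(\<Psi>\<cdot>\<phi>)\<close>, \<open>(\<Psi>\<cdot>\<phi>)(a) = \<Psi>(\<phi>\<cdot>a)\<close>, \<open>(\<phi>\<cdot>a)(b) = \<phi>(ab)\<close>,
  and the involution \<open>\<Phi>\<^sup>*(\<phi>) = cnj (\<Phi>(\<phi>\<^sup>*))\<close>, \<open>\<phi>\<^sup>*(a) = cnj (\<phi>(a\<^sup>*))\<close>. For a C*-algebra
  this is the usual von Neumann algebra structure of the bidual.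
\<close>

definition arens_mult ::
  "('a, 'm) cstar_scheme \<Rightarrow> (('a \<Rightarrow> complex) \<Rightarrow> complex) \<Rightarrow> (('a \<Rightarrow> complex) \<Rightarrow> complex)
     \<Rightarrow> (('a \<Rightarrow> complex) \<Rightarrow> complex)" where
  "arens_mult A \<Phi> \<Psi> =
     (\<lambda>\<phi>\<in>carrier (dual A).
        \<Phi> (\<lambda>a\<in>carrier A. \<Psi> (\<lambda>b\<in>carrier A. \<phi> (a \<boxtimes>\<^bsub>A\<^esub> b))))"

definition bidual_star ::
  "('a, 'm) cstar_scheme \<Rightarrow> (('a \<Rightarrow> complex) \<Rightarrow> complex) \<Rightarrow> (('a \<Rightarrow> complex) \<Rightarrow> complex)" where
  "bidual_star A \<Phi> =
     (\<lambda>\<phi>\<in>carrier (dual A). cnj (\<Phi> (\<lambda>a\<in>carrier A. cnj (\<phi> (astar A a)))))"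

definition bidual :: "('a, 'm) cstar_scheme \<Rightarrow> (('a \<Rightarrow> complex) \<Rightarrow> complex) cstar" where
  "bidual A = \<lparr>
     carrier = carrier (dual (dual A)),
     vadd = vadd (dual (dual A)),
     vzero = vzero (dual (dual A)),
     vscale = vscale (dual (dual A)),
     vnorm = vnorm (dual (dual A)),
     amult = arens_mult A,
     astar = bidual_star A\<rparr>"

definition bidual_embed :: "('a, 'm) normed_scheme \<Rightarrow> 'a \<Rightarrow> (('a \<Rightarrow> complex) \<Rightarrow> complex)" where
  "bidual_embed V v = (\<lambda>\<phi>\<in>carrier (dual V). \<phi> v)"

definition bidual_map ::
  "('a, 'm) normed_scheme \<Rightarrow> ('a \<Rightarrow> 'a) \<Rightarrow> (('a \<Rightarrow> complex) \<Rightarrow> complex)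
     \<Rightarrow> (('a \<Rightarrow> complex) \<Rightarrow> complex)" where
  "bidual_map V f \<Phi> = (\<lambda>\<phi>\<in>carrier (dual V). \<Phi> (\<lambda>v\<in>carrier V. \<phi> (f v)))"


section \<open>The spectrum\<close>

text \<open>
  A representation of \<open>B\<close> is a pair of a Hilbert space and a *-homomorphism into its bounded
  operators. The Hilbert spaces are taken on the type of the elements of \<open>B\<close>. No class of
  irreducible representations is lost: if \<open>\<pi>\<close> is irreducible on \<open>H\<close>, then \<open>H = \<pi>(B)\<xi>\<close> for
  every \<open>\<xi> \<noteq> 0\<close> by Kadison's transitivity theorem, so \<open>H\<close> has a copy inside this type.
\<close>

type_synonym 'b rep = "'b hilbert \<times> ('b \<Rightarrow> 'b \<Rightarrow> 'b)"

definition representation :: "('b, 'm) cstar_scheme \<Rightarrow> 'b rep \<Rightarrow> bool" where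
  "representation B = (\<lambda>(H, \<pi>).
     hilbert_space H \<and>
     (\<forall>a\<in>carrier B. bounded_linear_map H H (\<pi> a)) \<and>
     (\<forall>a\<in>carrier B. \<forall>b\<in>carrier B. \<forall>x\<in>carrier H.
        \<pi> (a \<boxplus>\<^bsub>B\<^esub> b) x = \<pi> a x \<boxplus>\<^bsub>H\<^esub> \<pi> b x \<and> \<pi> (a \<boxtimes>\<^bsub>B\<^esub> b) x = \<pi> a (\<pi> b x)) \<and>
     (\<forall>c. \<forall>a\<in>carrier B. \<forall>x\<in>carrier H. \<pi> (c \<boxdot>\<^bsub>B\<^esub> a) x = c \<boxdot>\<^bsub>H\<^esub> \<pi> a x) \<and>
     (\<forall>a\<in>carrier B. \<forall>x\<in>carrier H. \<forall>y\<in>carrier H.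
        hinner H (\<pi> a x) y = hinner H x (\<pi> (astar B a) y)))"

text \<open>Irreducible representations are required to be non-zero.\<close>

definition irreducible_rep :: "('b, 'm) cstar_scheme \<Rightarrow> 'b rep \<Rightarrow> bool" where
  "irreducible_rep B = (\<lambda>(H, \<pi>).
     representation B (H, \<pi>) \<and>
     (\<exists>a\<in>carrier B. \<exists>x\<in>carrier H. \<pi> a x \<noteq> \<zero>v\<^bsub>H\<^esub>) \<and>
     (\<forall>M. closed_subspace H M \<and> (\<forall>a\<in>carrier B. \<pi> a ` M \<subseteq> M)
        \<longrightarrow> M = {\<zero>v\<^bsub>H\<^esub>} \<or> M = carrier H))"

definition unitarily_equivalent :: "('b, 'm) cstar_scheme \<Rightarrow> 'b rep \<Rightarrow> 'b rep \<Rightarrow> bool" where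
  "unitarily_equivalent B = (\<lambda>(H, \<pi>) (K, \<sigma>).
     \<exists>U. linear_map H K U \<and> bij_betw U (carrier H) (carrier K) \<and>
         (\<forall>x\<in>carrier H. \<forall>y\<in>carrier H. hinner K (U x) (U y) = hinner H x y) \<and>
         (\<forall>a\<in>carrier B. \<forall>x\<in>carrier H. U (\<pi> a x) = \<sigma> a (U x)))"

definition unitary_equivalence :: "('b, 'm) cstar_scheme \<Rightarrow> ('b rep \<times> 'b rep) set" where
  "unitary_equivalence B =
     {(\<rho>, \<sigma>). irreducible_rep B \<rho> \<and> irreducible_rep B \<sigma> \<and> unitarily_equivalent B \<rho> \<sigma>}"

definition spectrum :: "('b, 'm) cstar_scheme \<Rightarrow> 'b rep set set" where
  "spectrum B = {\<rho>. irreducible_rep B \<rho>} // unitary_equivalence B"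

definition rep_kernel :: "('b, 'm) cstar_scheme \<Rightarrow> 'b rep \<Rightarrow> 'b set" where
  "rep_kernel B = (\<lambda>(H, \<pi>). {a \<in> carrier B. \<forall>x\<in>carrier H. \<pi> a x = \<zero>v\<^bsub>H\<^esub>})"

definition prim :: "('b, 'm) cstar_scheme \<Rightarrow> 'b set set" where
  "prim B = rep_kernel B ` {\<rho>. irreducible_rep B \<rho>}"

text \<open>The hull-kernel topology.\<close>

definition prim_topology :: "('b, 'm) cstar_scheme \<Rightarrow> 'b set topology" where
  "prim_topology B = topology_generated_by {{P \<in> prim B. \<not> J \<subseteq> P} |J. closed_ideal B J}"

text \<open>Equivalent representations have the same kernel.\<close>

definition class_kernel :: "('b, 'm) cstar_scheme \<Rightarrow> 'b rep set \<Rightarrow> 'b set" where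
  "class_kernel B x = (\<Inter>\<rho>\<in>x. rep_kernel B \<rho>)"

definition spectrum_topology :: "('b, 'm) cstar_scheme \<Rightarrow> 'b rep set topology" where
  "spectrum_topology B = pullback_topology (spectrum B) (class_kernel B) (prim_topology B)"


section \<open>Actions\<close>

definition star_automorphism :: "('a, 'm) cstar_scheme \<Rightarrow> ('a \<Rightarrow> 'a) \<Rightarrow> bool" where
  "star_automorphism A f \<longleftrightarrow>
     linear_map A A f \<and> bij_betw f (carrier A) (carrier A) \<and>
     (\<forall>a\<in>carrier A. \<forall>b\<in>carrier A. f (a \<boxtimes>\<^bsub>A\<^esub> b) = f a \<boxtimes>\<^bsub>A\<^esub> f b) \<and>
     (\<forall>a\<in>carrier A. f (astar A a) = astar A (f a))"

locale cstar_dynamical_system =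
  cstar_algebra A + group G for A :: "('a, 'm) cstar_scheme" and G :: "('g, 'n) monoid_scheme" +
  fixes \<alpha> :: "'g \<Rightarrow> 'a \<Rightarrow> 'a"
  assumes action_aut: "t \<in> carrier G \<Longrightarrow> star_automorphism A (\<alpha> t)"
    and action_one: "a \<in> carrier A \<Longrightarrow> \<alpha> \<one>\<^bsub>G\<^esub> a = a"
    and action_mult: "\<lbrakk>s \<in> carrier G; t \<in> carrier G; a \<in> carrier A\<rbrakk>
          \<Longrightarrow> \<alpha> (s \<otimes>\<^bsub>G\<^esub> t) a = \<alpha> s (\<alpha> t a)"

definition invariant :: "('g, 'n) monoid_scheme \<Rightarrow> ('g \<Rightarrow> 'x \<Rightarrow> 'x) \<Rightarrow> 'x set \<Rightarrow> bool" where
  "invariant G act Y \<longleftrightarrow> (\<forall>t\<in>carrier G. act t ` Y \<subseteq> Y)"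

text \<open>For an invariant ideal \<open>I\<close>, the image of the coset of \<open>a\<close> under \<open>\<alpha> t\<close> is the coset of \<open>\<alpha> t a\<close>.\<close>

definition quotient_action :: "('g \<Rightarrow> 'a \<Rightarrow> 'a) \<Rightarrow> 'g \<Rightarrow> 'a set \<Rightarrow> 'a set" where
  "quotient_action \<alpha> t X = \<alpha> t ` X"

definition linf_action :: "('g \<Rightarrow> 'a \<Rightarrow> 'a) \<Rightarrow> 'g \<Rightarrow> (nat \<Rightarrow> 'a) \<Rightarrow> (nat \<Rightarrow> 'a)" where
  "linf_action \<alpha> t f = (\<lambda>n. \<alpha> t (f n))"

definition B_infty_action ::
  "('g \<Rightarrow> 'a \<Rightarrow> 'a) \<Rightarrow> 'g \<Rightarrow> (nat \<Rightarrow> 'a) set \<Rightarrow> (nat \<Rightarrow> 'a) set" where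
  "B_infty_action \<alpha> = quotient_action (linf_action \<alpha>)"

text \<open>\<open>(t.x)(a) = x(t\<inverse>.a)\<close> on equivalence classes \<open>x\<close> of representations.\<close>

definition spectrum_action ::
  "('b, 'm) cstar_scheme \<Rightarrow> ('g, 'n) monoid_scheme \<Rightarrow> ('g \<Rightarrow> 'b \<Rightarrow> 'b) \<Rightarrow> 'g
     \<Rightarrow> 'b rep set \<Rightarrow> 'b rep set" where
  "spectrum_action B G \<beta> t x =
     unitary_equivalence B `` ((\<lambda>(H, \<pi>). (H, \<lambda>a. \<pi> (\<beta> (inv\<^bsub>G\<^esub> t) a))) ` x)"


section \<open>The four properties\<close>

definition topologically_free ::
  "('b, 'm) cstar_scheme \<Rightarrow> ('g, 'n) monoid_scheme \<Rightarrow> ('g \<Rightarrow> 'b \<Rightarrow> 'b) \<Rightarrow> bool" where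
  "topologically_free B G \<beta> \<longleftrightarrow>
     (\<forall>F. finite F \<and> F \<subseteq> carrier G - {\<one>\<^bsub>G\<^esub>} \<longrightarrow>
        spectrum_topology B closure_of
          (spectrum B \<inter> (\<Inter>t\<in>F. {x \<in> spectrum B. spectrum_action B G \<beta> t x \<noteq> x}))
        = spectrum B)"

definition essentially_free ::
  "'x topology \<Rightarrow> ('g, 'n) monoid_scheme \<Rightarrow> ('g \<Rightarrow> 'x \<Rightarrow> 'x) \<Rightarrow> bool" where
  "essentially_free X G act \<longleftrightarrow>
     (\<forall>Y. closedin X Y \<and> invariant G act Y \<longrightarrow>
        subtopology X Y closure_of {y \<in> Y. {t \<in> carrier G. act t y = y} = {\<one>\<^bsub>G\<^esub>}} = Y)"

definition rokhlin_star ::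
  "('b, 'm) cstar_scheme \<Rightarrow> ('g, 'n) monoid_scheme \<Rightarrow> ('g \<Rightarrow> 'b \<Rightarrow> 'b) \<Rightarrow> bool" where
  "rokhlin_star B G \<beta> \<longleftrightarrow>
     (let N = bidual (B_infty B);
          \<iota> = (\<lambda>b. bidual_embed (B_infty B) (const_embed B b));
          act = (\<lambda>t. bidual_map (B_infty B) (B_infty_action \<beta> t))
      in \<exists>p\<in>carrier N.
           p \<boxtimes>\<^bsub>N\<^esub> p = p \<and> astar N p = p \<and>
           (\<forall>b\<in>carrier B. \<iota> b \<boxtimes>\<^bsub>N\<^esub> p = p \<boxtimes>\<^bsub>N\<^esub> \<iota> b) \<and>
           (\<forall>t\<in>carrier G - {\<one>\<^bsub>G\<^esub>}. p \<boxtimes>\<^bsub>N\<^esub> act t p = \<zero>v\<^bsub>N\<^esub>) \<and>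
           (\<forall>b\<in>carrier B - {\<zero>v\<^bsub>B\<^esub>}. \<exists>t\<in>carrier G. \<iota> b \<boxtimes>\<^bsub>N\<^esub> act t p \<noteq> \<zero>v\<^bsub>N\<^esub>))"

definition residual_rokhlin_star ::
  "('a, 'm) cstar_scheme \<Rightarrow> ('g, 'n) monoid_scheme \<Rightarrow> ('g \<Rightarrow> 'a \<Rightarrow> 'a) \<Rightarrow> bool" where
  "residual_rokhlin_star A G \<alpha> \<longleftrightarrow>
     (\<forall>I. closed_ideal A I \<and> invariant G \<alpha> I \<longrightarrow>
        rokhlin_star (quotient_algebra A I) G (quotient_action \<alpha>))"

text \<open>
  The multiplier algebra as the algebra of double centralizers \<open>(L, R)\<close>; a multiplier \<open>u\<close>
  corresponds to \<open>L a = u a\<close>, \<open>R a = a u\<close>.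
\<close>

definition multiplier_algebra ::
  "('a, 'm) cstar_scheme \<Rightarrow> (('a \<Rightarrow> 'a) \<times> ('a \<Rightarrow> 'a)) cstar" where
  "multiplier_algebra B = \<lparr>
     carrier = {(L, R).
       L \<in> extensional (carrier B) \<and> R \<in> extensional (carrier B) \<and>
       bounded_linear_map B B L \<and> bounded_linear_map B B R \<and>
       (\<forall>a\<in>carrier B. \<forall>b\<in>carrier B.
          L (a \<boxtimes>\<^bsub>B\<^esub> b) = L a \<boxtimes>\<^bsub>B\<^esub> b \<and>
          R (a \<boxtimes>\<^bsub>B\<^esub> b) = a \<boxtimes>\<^bsub>B\<^esub> R b \<and>
          R a \<boxtimes>\<^bsub>B\<^esub> b = a \<boxtimes>\<^bsub>B\<^esub> L b)},
     vadd = (\<lambda>(L, R) (L', R').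
       (\<lambda>a\<in>carrier B. L a \<boxplus>\<^bsub>B\<^esub> L' a, \<lambda>a\<in>carrier B. R a \<boxplus>\<^bsub>B\<^esub> R' a)),
     vzero = (\<lambda>a\<in>carrier B. \<zero>v\<^bsub>B\<^esub>, \<lambda>a\<in>carrier B. \<zero>v\<^bsub>B\<^esub>),
     vscale = (\<lambda>c (L, R). (\<lambda>a\<in>carrier B. c \<boxdot>\<^bsub>B\<^esub> L a, \<lambda>a\<in>carrier B. c \<boxdot>\<^bsub>B\<^esub> R a)),
     vnorm = (\<lambda>(L, R). opnorm B B L),
     amult = (\<lambda>(L, R) (L', R'). (\<lambda>a\<in>carrier B. L (L' a), \<lambda>a\<in>carrier B. R' (R a))),
     astar = (\<lambda>(L, R).
       (\<lambda>a\<in>carrier B. astar B (R (astar B a)), \<lambda>a\<in>carrier B. astar B (L (astar B a))))\<rparr>"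

definition multiplier_one :: "('a, 'm) cstar_scheme \<Rightarrow> ('a \<Rightarrow> 'a) \<times> ('a \<Rightarrow> 'a)" where
  "multiplier_one B = (\<lambda>a\<in>carrier B. a, \<lambda>a\<in>carrier B. a)"

definition multiplier_unitary ::
  "('a, 'm) cstar_scheme \<Rightarrow> ('a \<Rightarrow> 'a) \<times> ('a \<Rightarrow> 'a) \<Rightarrow> bool" where
  "multiplier_unitary B u \<longleftrightarrow>
     (let M = multiplier_algebra B
      in u \<in> carrier M \<and>
         astar M u \<boxtimes>\<^bsub>M\<^esub> u = multiplier_one B \<and> u \<boxtimes>\<^bsub>M\<^esub> astar M u = multiplier_one B)"

text \<open>\<open>Ad(u)(a) = u (a u\<^sup>*)\<close>.\<close>

definition Ad ::
  "('a, 'm) cstar_scheme \<Rightarrow> ('a \<Rightarrow> 'a) \<times> ('a \<Rightarrow> 'a) \<Rightarrow> 'a \<Rightarrow> 'a" where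
  "Ad B u a = fst u (snd (astar (multiplier_algebra B) u) a)"

definition ideal_algebra :: "('a, 'm) cstar_scheme \<Rightarrow> 'a set \<Rightarrow> ('a, 'm) cstar_scheme" where
  "ideal_algebra B I = B\<lparr>carrier := I\<rparr>"

text \<open>Invariance under the group generated by \<open>\<gamma>\<close> means \<open>\<gamma> ` I = I\<close>.\<close>

definition properly_outer :: "('a, 'm) cstar_scheme \<Rightarrow> ('a \<Rightarrow> 'a) \<Rightarrow> bool" where
  "properly_outer B \<gamma> \<longleftrightarrow>
     (\<forall>I. closed_ideal B I \<and> I \<noteq> {\<zero>v\<^bsub>B\<^esub>} \<and> \<gamma> ` I = I \<longrightarrow>
        (\<forall>u. multiplier_unitary (ideal_algebra B I) u \<longrightarrow>
           opnorm (ideal_algebra B I) B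
             (\<lambda>a. vminus B (\<gamma> a) (Ad (ideal_algebra B I) u a)) = 2))"

end

theory Submission
  imports Defs "HOL-Computational_Algebra.Fundamental_Theorem_Algebra"
begin

text \<open>
Characters of an abelian C*-algebra \<open>A\<close> come from power-multiplicative seminorms: a minimal one
with value \<open>\<parallel>a\<parallel>\<close> at a given \<open>a\<close> is multiplicative, hence by Ostrowski's argument the modulus of a
character. With Stone-Weierstrass, \<open>A\<close> is \<open>C\<^sub>0(X)\<close> for the space \<open>X\<close> of its non-zero characters,
\<open>X\<close> is the spectrum of \<open>A\<close>, and quotients of \<open>A\<close> correspond to closed subsets of \<open>X\<close>. A set of
characters is dense iff only \<open>0\<close> vanishes on all of them. For a single action each property says
that the characters with trivial isotropy are dense; by the Baire category theorem and countability
of \<open>G\<close>, this amounts to density of the characters moved by \<open>t\<close>, separately for each \<open>t \<noteq> e\<close>.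

Rokhlin*: given density, the sum of the point masses over a set of representatives of the free
orbits is a projection in \<open>A\<^sup>*\<^sup>*\<close> which does the job. Conversely, if \<open>t \<noteq> e\<close> fixes all characters
not vanishing at some \<open>b \<noteq> 0\<close>, then with \<open>q = s.p\<^sub>e\<close> one gets \<open>bq = t.(bq) = b(t.q)\<close>, and so
\<open>bq = bqq = b(t.q)q = 0\<close> for every \<open>s\<close>.

Proper outerness: inner automorphisms of abelian ideals are trivial. If \<open>t\<close> moves the character \<open>x\<close>
of an ideal, some \<open>f\<close> of norm one in it takes the values \<open>1\<close> and \<open>-1\<close> at \<open>x\<close> and \<open>t\<^sup>-\<^sup>1.x\<close>, whence
\<open>\<parallel>t.f - f\<parallel> = 2\<close>.
\<close>

text \<open>No unit is available, and this shapes the whole construction. The zero functional is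
  kept in \<open>chars0\<close> as a point at infinity: it makes the character space compact, so
  that Tychonoff, Stone-Weierstrass and Urysohn apply, and every function to be realised in the
  algebra must vanish there. Elements u of norm 1, or with x(u) = 1, stand in for the unit.
  Seminorms replace maximal ideals and the spectral radius, because commutativity and the
  C*-identity make the norm power-multiplicative at once. Measures are replaced too: the mass of a
  functional at y is its limit along an ultrafilter of functions peaking at y, which suffices to
  define sums of point masses in the bidual. Such a sum is carried to the sequence algebra by
  evaluating functionals on constant sequences. All four properties are compared with one statement
  about each invariant ideal I: an element vanishing at all free characters that annihilate I
  belongs to I.\<close>

context complex_normed_space
begin

section \<open>Arithmetic and convergence in a normed space with a carrier\<close>

lemma norm_zero [simp]: "vnorm V \<zero>v = 0"
  using norm_eq_zero zero_closed by blast

text \<open>The norm replaces the usual cancellation argument: 0 x has norm 0 by homogeneity, hence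
  is the zero vector.\<close>

lemma scale_zero_left [simp]: "x \<in> carrier V \<Longrightarrow> 0 \<boxdot> x = \<zero>v"
  using norm_eq_zero[OF scale_closed, of x 0] norm_scale[of x 0] by simp

lemma scale_zero_right [simp]: "c \<boxdot> \<zero>v = \<zero>v"
  using norm_eq_zero[OF scale_closed, of "\<zero>v" c] norm_scale[of "\<zero>v" c] zero_closed by simp

lemma add_zero_left: "x \<in> carrier V \<Longrightarrow> \<zero>v \<boxplus> x = x"
  using add_comm add_zero zero_closed by metis

lemma add_left_comm:
  "\<lbrakk>x \<in> carrier V; y \<in> carrier V; z \<in> carrier V\<rbrakk> \<Longrightarrow> x \<boxplus> (y \<boxplus> z) = y \<boxplus> (x \<boxplus> z)"
  using add_assoc add_comm by metis

lemma add_neg: "x \<in> carrier V \<Longrightarrow> x \<boxplus> (- 1) \<boxdot> x = \<zero>v"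
  using scale_add_left[of x 1 "-1"] scale_one[of x] by simp

lemma minus_closed: "\<lbrakk>x \<in> carrier V; y \<in> carrier V\<rbrakk> \<Longrightarrow> vminus V x y \<in> carrier V"
  by (simp add: vminus_def add_closed scale_closed)

lemmas vclosed = add_closed zero_closed scale_closed minus_closed

lemma minus_self [simp]: "x \<in> carrier V \<Longrightarrow> vminus V x x = \<zero>v"
  by (simp add: vminus_def add_neg)

lemma minus_zero [simp]: "x \<in> carrier V \<Longrightarrow> vminus V x \<zero>v = x"
  by (simp add: vminus_def add_zero)

lemma minus_add_cancel: "\<lbrakk>x \<in> carrier V; y \<in> carrier V\<rbrakk> \<Longrightarrow> vminus V x y \<boxplus> y = x"
  by (simp add: vminus_def add_assoc vclosed add_comm[of "(-1) \<boxdot> y" y] add_neg add_zero)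

lemma add_minus_cancel: "\<lbrakk>x \<in> carrier V; y \<in> carrier V\<rbrakk> \<Longrightarrow> vminus V (x \<boxplus> y) y = x"
  by (simp add: vminus_def add_assoc vclosed add_neg add_zero)

lemma add_minus_cancel': "\<lbrakk>x \<in> carrier V; y \<in> carrier V\<rbrakk> \<Longrightarrow> x \<boxplus> vminus V y x = y"
  using add_comm minus_add_cancel minus_closed by metis

lemma minus_eq_zero: "\<lbrakk>x \<in> carrier V; y \<in> carrier V\<rbrakk> \<Longrightarrow> vminus V x y = \<zero>v \<longleftrightarrow> x = y"
  using minus_add_cancel add_zero_left by (metis minus_self)

lemma scale_minus: "\<lbrakk>x \<in> carrier V; y \<in> carrier V\<rbrakk> \<Longrightarrow> c \<boxdot> vminus V x y = vminus V (c \<boxdot> x) (c \<boxdot> y)"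
  by (simp add: vminus_def scale_add_right vclosed flip: scale_scale)

lemma minus_commute: "\<lbrakk>x \<in> carrier V; y \<in> carrier V\<rbrakk> \<Longrightarrow> vminus V x y = (- 1) \<boxdot> vminus V y x"
  by (simp add: vminus_def scale_add_right vclosed scale_one add_comm flip: scale_scale)

text \<open>The zero vector is x + (-1) x, so the triangle inequality gives 0 \<le> 2
  \<open>vnorm V x\<close>.\<close>

lemma norm_nonneg: "x \<in> carrier V \<Longrightarrow> 0 \<le> vnorm V x"
  using norm_triangle[of x "(-1) \<boxdot> x"] norm_scale[of x "-1"] by (simp add: add_neg vclosed)

lemma norm_minus_commute:
  "\<lbrakk>x \<in> carrier V; y \<in> carrier V\<rbrakk> \<Longrightarrow> vnorm V (vminus V x y) = vnorm V (vminus V y x)"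
  by (subst minus_commute) (simp_all add: norm_scale vclosed)

lemma minus_add_minus:
  "\<lbrakk>x \<in> carrier V; y \<in> carrier V; z \<in> carrier V\<rbrakk> \<Longrightarrow> vminus V x y \<boxplus> vminus V y z = vminus V x z"
proof -
  assume *: "x \<in> carrier V" "y \<in> carrier V" "z \<in> carrier V"
  then have "vminus V x y \<boxplus> vminus V y z = vminus V x y \<boxplus> y \<boxplus> (-1) \<boxdot> z"
    by (simp add: vminus_def[of V y z] add_assoc vclosed)
  then show ?thesis using * by (simp add: minus_add_cancel) (simp add: vminus_def)
qed

lemma norm_minus_triangle:
  "\<lbrakk>x \<in> carrier V; y \<in> carrier V; z \<in> carrier V\<rbrakk>
     \<Longrightarrow> vnorm V (vminus V x z) \<le> vnorm V (vminus V x y) + vnorm V (vminus V y z)"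
  using norm_triangle[of "vminus V x y" "vminus V y z"] by (simp add: minus_add_minus vclosed)

lemma norm_le_norm_minus:
  "\<lbrakk>x \<in> carrier V; y \<in> carrier V\<rbrakk> \<Longrightarrow> vnorm V x \<le> vnorm V (vminus V x y) + vnorm V y"
  using norm_triangle[of "vminus V x y" y] by (simp add: minus_add_cancel vclosed)

lemma add_minus_add:
  "\<lbrakk>x \<in> carrier V; y \<in> carrier V; x' \<in> carrier V; y' \<in> carrier V\<rbrakk>
    \<Longrightarrow> vminus V (x \<boxplus> y) (x' \<boxplus> y') = vminus V x x' \<boxplus> vminus V y y'"
  by (simp add: vminus_def scale_add_right vclosed add_assoc add_left_comm)

lemma metric: "Metric_space (carrier V) (vdist V)"
proof
  fix x y z
  show "0 \<le> vdist V x y" by (simp add: vdist_def norm_nonneg minus_closed)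
  show "vdist V x y = vdist V y x" by (simp add: vdist_def norm_minus_commute)
  show "\<lbrakk>x \<in> carrier V; y \<in> carrier V\<rbrakk> \<Longrightarrow> (vdist V x y = 0) = (x = y)"
    by (simp add: vdist_def norm_eq_zero minus_closed minus_eq_zero)
  show "\<lbrakk>x \<in> carrier V; y \<in> carrier V; z \<in> carrier V\<rbrakk> \<Longrightarrow> vdist V x z \<le> vdist V x y + vdist V y z"
    by (simp add: vdist_def norm_minus_triangle)
qed

definition converges :: "(nat \<Rightarrow> 'a) \<Rightarrow> 'a \<Rightarrow> bool" where
  "converges f l \<longleftrightarrow> (\<lambda>n. vnorm V (vminus V (f n) l)) \<longlonglongrightarrow> 0"

lemma limitin_iff:
  assumes "range f \<subseteq> carrier V" "l \<in> carrier V"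
  shows "limitin (norm_topology V) f l sequentially \<longleftrightarrow> converges f l"
proof -
  interpret M: Metric_space "carrier V" "vdist V" by (rule metric)
  have "f n \<in> carrier V" for n using assms by auto
  then show ?thesis
    using assms unfolding norm_topology_def M.limitin_metric_dist_null converges_def
    by (simp add: vdist_def)
qed

lemma topspace_norm_topology [simp]: "topspace (norm_topology V) = carrier V"
proof -
  interpret M: Metric_space "carrier V" "vdist V" by (rule metric)
  show ?thesis by (simp add: norm_topology_def)
qed

lemma closedin_sequential:
  "closedin (norm_topology V) S \<longleftrightarrow>
    S \<subseteq> carrier V \<and> (\<forall>f l. range f \<subseteq> S \<and> l \<in> carrier V \<and> converges f l \<longrightarrow> l \<in> S)"
proof -
  interpret M: Metric_space "carrier V" "vdist V" by (rule metric)
  have "closedin (norm_topology V) S \<longleftrightarrow>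
    S \<subseteq> carrier V \<and> (\<forall>f l. range f \<subseteq> S \<and> limitin (norm_topology V) f l sequentially \<longrightarrow> l \<in> S)"
    using M.metric_closedin_iff_sequentially_closed unfolding norm_topology_def by blast
  also have "\<dots> \<longleftrightarrow> S \<subseteq> carrier V \<and> (\<forall>f l. range f \<subseteq> S \<and> l \<in> carrier V \<and> converges f l \<longrightarrow> l \<in> S)"
    using limitin_iff limitin_topspace topspace_norm_topology by (metis subset_trans)
  finally show ?thesis .
qed

definition cauchy_seq :: "(nat \<Rightarrow> 'a) \<Rightarrow> bool" where
  "cauchy_seq f \<longleftrightarrow> (\<forall>e>0. \<exists>N. \<forall>m\<ge>N. \<forall>n\<ge>N. vnorm V (vminus V (f m) (f n)) < e)"

lemma mcomplete_iff:
  "Metric_space.mcomplete (carrier V) (vdist V) \<longleftrightarrow>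
    (\<forall>f. range f \<subseteq> carrier V \<and> cauchy_seq f \<longrightarrow> (\<exists>l\<in>carrier V. converges f l))"
proof -
  interpret M: Metric_space "carrier V" "vdist V" by (rule metric)
  have 1: "M.MCauchy f \<longleftrightarrow> range f \<subseteq> carrier V \<and> cauchy_seq f" for f
  proof (cases "range f \<subseteq> carrier V")
    case True
    then have "f n \<in> carrier V" for n by auto
    then show ?thesis using True by (simp add: M.MCauchy_def cauchy_seq_def vdist_def)
  qed (simp add: M.MCauchy_def)
  have "(\<exists>l. limitin M.mtopology f l sequentially) \<longleftrightarrow> (\<exists>l\<in>carrier V. converges f l)"
    if "range f \<subseteq> carrier V" for f
    using limitin_iff[OF that] limitin_topspace topspace_norm_topology
    unfolding norm_topology_def by metis
  then show ?thesis by (metis 1 M.mcomplete_def)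
qed

end

section \<open>Multiplicative seminorms on \<open>\<complex>[X]\<close>\<close>

text \<open>
  The distance of \<open>X\<close> to the constants attains its minimum \<open>\<mu>\<close>. If \<open>\<mu> > 0\<close>, then factoring
  \<open>(X - z)\<^sup>n - w\<^sup>n\<close> shows that the minimum is attained on discs around every minimum point,
  hence everywhere, although the distance tends to infinity.
\<close>

lemma monic_cofactor:
  fixes h :: "complex poly"
  assumes "g = [:-z, 1:] * h" "degree g = Suc n" "lead_coeff g = 1"
  shows "degree h = n" "lead_coeff h = 1"
proof -
  have "h \<noteq> 0" using assms by auto
  then have "degree g = 1 + degree h"
    unfolding assms(1) by (subst degree_mult_eq) auto
  then show "degree h = n" using assms(2) by simp
  have "lead_coeff g = lead_coeff h" unfolding assms(1) lead_coeff_mult by simp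
  then show "lead_coeff h = 1" using assms(3) by simp
qed

lemma multiplicative_seminorm_poly_point:
  fixes N :: "complex poly \<Rightarrow> real"
  assumes mult: "\<And>f g. N (f * g) = N f * N g"
    and add: "\<And>f g. N (f + g) \<le> N f + N g"
    and const: "\<And>c. N [:c:] = cmod c"
  shows "\<exists>z. N [:-z, 1:] = 0"
proof (rule ccontr)
  assume nz: "\<not> ?thesis"
  define m where "m z = N [:-z, 1:]" for z
  have tri: "m z \<le> m w + cmod (z - w)" for z w
    using add[of "[:-w,1:]" "[:w - z:]"] const[of "w - z"] by (simp add: m_def norm_minus_commute)
  \<comment> \<open>Coercivity: z is the difference of X and X - z, so \<open>m z\<close> grows at
    least like the modulus of z.\<close>
  have m0: "cmod z \<le> m z + m 0" for z
  proof -
    have "N ([:-1:] * [:-z,1:]) = m z" unfolding mult by (simp add: const m_def)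
    then show ?thesis using add[of "[:0,1:]" "[:-1:] * [:-z,1:]"] const[of z] by (simp add: m_def)
  qed
  have "0 \<le> m 0" using m0[of 0] by simp
  have cont: "continuous_on S m" for S
  proof (rule continuous_on_subset[of UNIV], rule lipschitz_on_continuous_on)
    show "1-lipschitz_on UNIV m"
    proof (rule lipschitz_onI)
      fix x y show "dist (m x) (m y) \<le> 1 * dist x y"
        using tri[of x y] tri[of y x] by (simp add: dist_norm abs_le_iff diff_le_eq norm_minus_commute)
    qed simp
  qed auto
  \<comment> \<open>Beyond radius 2 \<open>m 0\<close> coercivity forces \<open>m z\<close> to be at
    least \<open>m 0\<close>, so the minimum over this disc is the global minimum.\<close>
  obtain z0 where z0: "z0 \<in> cball 0 (2 * m 0)" "\<And>z. z \<in> cball 0 (2 * m 0) \<Longrightarrow> m z0 \<le> m z"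
    using continuous_attains_inf[OF compact_cball _ cont, of 0 "2 * m 0"] \<open>0 \<le> m 0\<close> by force
  define \<mu> where "\<mu> = m z0"
  have min: "\<mu> \<le> m z" for z
  proof (cases "z \<in> cball 0 (2 * m 0)")
    case False
    then have "m 0 \<le> m z" using m0[of z] by simp
    moreover have "\<mu> \<le> m 0" unfolding \<mu>_def by (rule z0(2)) (simp add: \<open>0 \<le> m 0\<close>)
    ultimately show ?thesis by simp
  qed (simp add: z0 \<mu>_def)
  have nn: "0 \<le> m z" for z
    using add[of "[:-z,1:]" "[:-1:] * [:-z,1:]"] mult[of "[:-1:]" "[:-z,1:]"] const[of "-1"] const[of 0]
    by (simp add: m_def)
  have \<mu>: "\<mu> > 0" using nz nn[of z0] unfolding \<mu>_def m_def by (metis less_eq_real_def)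
  \<comment> \<open>A monic polynomial is a product of linear factors X - z, each of value at least
    \<mu>.\<close>
  have monic: "\<mu> ^ n \<le> N g" if "degree g = n" "lead_coeff g = 1" for g n
    using that
  proof (induction n arbitrary: g)
    case 0
    then have "g = [:1:]" by (metis degree_0_id lead_coeff_pCons(2) pCons_0_0 degree_eq_zeroE leading_coeff_0_iff)
    then show ?case using const[of 1] by simp
  next
    case (Suc n)
    obtain z where "poly g z = 0"
      using fundamental_theorem_of_algebra_alt[of g] Suc.prems by (metis degree_pCons_0 nat.distinct(1))
    then obtain h where h: "g = [:-z,1:] * h" using poly_eq_0_iff_dvd by (auto simp: dvd_def)
    have "\<mu> ^ n \<le> N h" using monic_cofactor[OF h] Suc by blast
    then have "\<mu> * \<mu> ^ n \<le> m z * N h" using min[of z] \<mu> by (intro mult_mono) auto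
    then show ?case unfolding h mult by (simp add: m_def)
  qed
  have pow: "N (f ^ n) = N f ^ n" for f n
    by (induction n) (use const[of 1] in \<open>simp_all add: mult one_pCons\<close>)
  have step: "m (z + w) = \<mu>" if "m z = \<mu>" "cmod w < \<mu>" for z w
  proof -
    \<comment> \<open>X - (z + w) divides (X - z)^(n+1) - w^(n+1), whose value is at most
      \<mu>^(n+1) + |w|^(n+1). The cofactor is monic of degree n and hence has value at least
      \<mu>^n. Dividing leaves an error that vanishes as n grows, because |w| < \<mu>.\<close>
    have le: "m (z + w) \<le> \<mu> + \<mu> * (cmod w / \<mu>) ^ Suc n" for n
    proof -
      define b where "b = [:-z, 1:]"
      define g where "g = b ^ Suc n - [:w:] ^ Suc n"
      have "[:w:] ^ k = [:w ^ k:]" for k by (induction k) (simp_all add: one_pCons)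
      then have gw: "g = b ^ Suc n + [:- (w ^ Suc n):]" by (simp add: g_def)
      have db: "degree (b ^ Suc n) = Suc n" "lead_coeff (b ^ Suc n) = 1"
        by (simp only: b_def degree_linear_power) (simp only: lead_coeff_power b_def, simp)
      have dg: "degree g = Suc n"
        unfolding gw by (subst degree_add_eq_left) (use db in simp_all)
      have lg: "lead_coeff g = 1"
        unfolding dg using db by (simp add: gw del: power_Suc)
      have "b - [:w:] dvd g" unfolding g_def power_diff_sumr2 by simp
      moreover have bw: "b - [:w:] = [:- (z + w), 1:]" by (simp add: b_def)
      ultimately obtain h where h: "g = [:- (z + w), 1:] * h" by (auto simp: dvd_def)
      have "\<mu> ^ n \<le> N h" by (rule monic) (use monic_cofactor[OF h] dg lg in blast)+
      then have "m (z + w) * \<mu> ^ n \<le> N g"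
        unfolding h mult m_def[symmetric] by (rule mult_left_mono) (rule nn)
      also have "\<dots> \<le> \<mu> ^ Suc n + cmod w ^ Suc n"
        unfolding gw using add[of "b ^ Suc n" "[:- (w ^ Suc n):]"] that(1)
        by (simp only: pow const norm_minus_cancel norm_power b_def m_def)
      also have "\<dots> = (\<mu> + \<mu> * (cmod w / \<mu>) ^ Suc n) * \<mu> ^ n"
        using \<mu> by (simp add: field_simps)
      finally show ?thesis using \<mu> by (simp add: mult_right_le_imp_le)
    qed
    have "(\<lambda>n. \<mu> + \<mu> * (cmod w / \<mu>) ^ Suc n) \<longlonglongrightarrow> \<mu> + \<mu> * 0"
      by (intro tendsto_intros LIMSEQ_Suc LIMSEQ_power_zero) (use that \<mu> in auto)
    then have "m (z + w) \<le> \<mu>" using le by (intro LIMSEQ_le_const) auto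
    then show ?thesis using min by (simp add: antisym)
  qed
  \<comment> \<open>Any point is reached from z0 by finitely many equal steps shorter than
    \<mu>.\<close>
  have all: "m (z0 + of_nat k * w) = \<mu>" if "cmod w < \<mu>" for k w
  proof (induction k)
    case (Suc k)
    then show ?case using step[OF Suc that] by (simp add: algebra_simps)
  qed (simp add: \<mu>_def)
  have bd: "m (z0 + w) = \<mu>" for w
  proof -
    obtain k :: nat where k: "cmod w / \<mu> < real k" using reals_Archimedean2 by blast
    then have "k > 0" using \<mu> by (metis divide_nonneg_pos norm_ge_zero not_less of_nat_0 of_nat_0_less_iff order_le_less_trans)
    then have "cmod (w / of_nat k) < \<mu>"
      using k \<mu> by (simp add: norm_divide field_simps)
    from all[OF this, of k] show ?thesis using \<open>k > 0\<close> by simp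
  qed
  \<comment> \<open>At the point of modulus r coercivity would give r \<le> \<mu> +
    \<open>m 0\<close>, and the summand 1 makes this false.\<close>
  define r where "r = \<mu> + m 0 + cmod z0 + 1"
  have "r \<le> cmod (of_real r)" by simp
  also have "\<dots> \<le> \<mu> + m 0"
    using m0[of "z0 + (of_real r - z0)"] unfolding bd by (simp del: norm_of_real)
  finally show False using norm_ge_zero[of z0] by (simp add: r_def)
qed

section \<open>Elementary C*-algebra identities\<close>

context cstar_algebra
begin

lemmas aclosed = vclosed mult_closed star_closed

lemma mult_zero_left [simp]: "a \<in> carrier A \<Longrightarrow> \<zero>v \<boxtimes> a = \<zero>v"
  using mult_scale_left[of a a 0] by (simp add: mult_closed)

lemma mult_zero_right [simp]: "a \<in> carrier A \<Longrightarrow> a \<boxtimes> \<zero>v = \<zero>v"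
  using mult_scale_right[of a a 0] by (simp add: mult_closed)

lemma star_zero [simp]: "astar A \<zero>v = \<zero>v"
  using star_scale[of "\<zero>v" 0] by (simp add: zero_closed star_closed)

lemma star_minus:
  "\<lbrakk>a \<in> carrier A; b \<in> carrier A\<rbrakk> \<Longrightarrow> astar A (vminus A a b) = vminus A (astar A a) (astar A b)"
  by (simp add: vminus_def star_add star_scale aclosed)

lemma mult_minus_right:
  "\<lbrakk>a \<in> carrier A; b \<in> carrier A; c \<in> carrier A\<rbrakk> \<Longrightarrow> a \<boxtimes> vminus A b c = vminus A (a \<boxtimes> b) (a \<boxtimes> c)"
  by (simp add: vminus_def mult_add_right mult_scale_right aclosed)

lemma mult_minus_left:
  "\<lbrakk>a \<in> carrier A; b \<in> carrier A; c \<in> carrier A\<rbrakk> \<Longrightarrow> vminus A b c \<boxtimes> a = vminus A (b \<boxtimes> a) (c \<boxtimes> a)"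
  by (simp add: vminus_def mult_add_left mult_scale_left aclosed)

lemma norm_star [simp]:
  assumes "a \<in> carrier A" shows "vnorm A (astar A a) = vnorm A a"
proof -
  have le: "vnorm A b \<le> vnorm A (astar A b)" if b: "b \<in> carrier A" for b
  proof (cases "vnorm A b = 0")
    case True
    then show ?thesis using norm_nonneg[OF star_closed[OF b]] by simp
  next
    case False
    have "vnorm A b * vnorm A b \<le> vnorm A (astar A b) * vnorm A b"
      using norm_mult[OF star_closed[OF b] b] cstar_identity[OF b] by (simp add: power2_eq_square)
    then show ?thesis using False norm_nonneg[OF b] by simp
  qed
  show ?thesis
    using le[OF assms] le[OF star_closed[OF assms]] by (simp add: star_star assms)
qed

end

section \<open>Minimal power-multiplicative seminorms\<close>

context abelian_cstar_algebra
begin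

lemma mult_left_comm:
  "\<lbrakk>a \<in> carrier A; b \<in> carrier A; c \<in> carrier A\<rbrakk> \<Longrightarrow> a \<boxtimes> (b \<boxtimes> c) = b \<boxtimes> (a \<boxtimes> c)"
  by (metis mult_assoc mult_comm)

lemmas mult_ac = mult_assoc mult_comm mult_left_comm

text \<open>With b = a*a commutativity identifies the adjoint of a a times a a with b*b, and
  repeated use of the C*-identity turns the square of the left side into the fourth power of the
  norm of a. This is the only input that makes the norm a power-multiplicative seminorm.\<close>

lemma norm_square:
  assumes a: "a \<in> carrier A" shows "vnorm A (a \<boxtimes> a) = (vnorm A a)\<^sup>2"
proof -
  let ?b = "astar A a \<boxtimes> a"
  have "(vnorm A (a \<boxtimes> a))\<^sup>2 = vnorm A (astar A (a \<boxtimes> a) \<boxtimes> (a \<boxtimes> a))"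
    by (simp add: cstar_identity aclosed a)
  also have "astar A (a \<boxtimes> a) \<boxtimes> (a \<boxtimes> a) = astar A ?b \<boxtimes> ?b"
    by (simp add: star_mult star_star mult_ac aclosed a)
  also have "vnorm A \<dots> = ((vnorm A a)\<^sup>2)\<^sup>2"
    using cstar_identity[of ?b] cstar_identity[of a] a by (simp add: aclosed)
  finally show ?thesis
    by (rule power2_eq_imp_eq) (simp_all add: norm_nonneg aclosed a)
qed

text \<open>The value 0 off the carrier makes pointwise comparison over the whole type the same as
  comparison on the carrier.\<close>

definition power_mult_seminorm :: "('a \<Rightarrow> real) \<Rightarrow> bool" where
  "power_mult_seminorm p \<longleftrightarrow>
     (\<forall>a. a \<notin> carrier A \<longrightarrow> p a = 0) \<and>
     (\<forall>a\<in>carrier A. 0 \<le> p a \<and> p a \<le> vnorm A a \<and> p (a \<boxtimes> a) = (p a)\<^sup>2) \<and>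
     (\<forall>a\<in>carrier A. \<forall>b\<in>carrier A. p (a \<boxplus> b) \<le> p a + p b \<and> p (a \<boxtimes> b) \<le> p a * p b) \<and>
     (\<forall>c. \<forall>a\<in>carrier A. p (c \<boxdot> a) = cmod c * p a)"

text \<open>The element f^n a. The factor a is part of the definition because f^0 has no meaning
  without a unit.\<close>

definition mpow :: "'a \<Rightarrow> nat \<Rightarrow> 'a \<Rightarrow> 'a" where
  "mpow f n a = ((\<lambda>b. f \<boxtimes> b) ^^ n) a"

lemma mpow_simps [simp]: "mpow f 0 a = a" "mpow f (Suc n) a = f \<boxtimes> mpow f n a"
  by (simp_all add: mpow_def)

lemma mpow_closed: "\<lbrakk>f \<in> carrier A; a \<in> carrier A\<rbrakk> \<Longrightarrow> mpow f n a \<in> carrier A"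
  by (induction n) (simp_all add: aclosed)

lemma mpow_add:
  "\<lbrakk>f \<in> carrier A; a \<in> carrier A; b \<in> carrier A\<rbrakk> \<Longrightarrow> mpow f n (a \<boxplus> b) = mpow f n a \<boxplus> mpow f n b"
  by (induction n) (simp_all add: mult_add_right mpow_closed)

lemma mpow_scale:
  "\<lbrakk>f \<in> carrier A; a \<in> carrier A\<rbrakk> \<Longrightarrow> mpow f n (c \<boxdot> a) = c \<boxdot> mpow f n a"
  by (induction n) (simp_all add: mult_scale_right mpow_closed)

lemma mpow_mult:
  "\<lbrakk>f \<in> carrier A; a \<in> carrier A; b \<in> carrier A\<rbrakk> \<Longrightarrow> mpow f n (a \<boxtimes> b) = a \<boxtimes> mpow f n b"
  by (induction n) (simp_all add: mult_left_comm mpow_closed)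

lemma mpow_mult_mpow:
  "\<lbrakk>f \<in> carrier A; a \<in> carrier A; b \<in> carrier A\<rbrakk>
     \<Longrightarrow> mpow f n a \<boxtimes> mpow f m b = mpow f (n + m) (a \<boxtimes> b)"
  by (induction n) (simp_all add: mult_assoc mpow_mult mpow_closed)

text \<open>The new seminorm is q(a) = lim p(f^n a) / p(f)^n, a decreasing limit. Multiplication by
  f shifts the sequence by one index, so f becomes multiplicative for q. An element that was already
  multiplicative for p stays so, and the value at f does not drop.\<close>

lemma seminorm_localize:
  assumes p: "power_mult_seminorm p" and f: "f \<in> carrier A" and pf: "p f > 0"
  obtains q where "power_mult_seminorm q" "\<And>a. q a \<le> p a"
    "\<And>a. a \<in> carrier A \<Longrightarrow> q (f \<boxtimes> a) = p f * q a"
    "\<And>g c. \<lbrakk>g \<in> carrier A; \<And>a. a \<in> carrier A \<Longrightarrow> p (g \<boxtimes> a) = c * p a\<rbrakk>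
       \<Longrightarrow> \<forall>a\<in>carrier A. q (g \<boxtimes> a) = c * q a"
    "q f = p f"
proof -
  have p1: "a \<notin> carrier A \<Longrightarrow> p a = 0"
    and p2: "a \<in> carrier A \<Longrightarrow> 0 \<le> p a" "a \<in> carrier A \<Longrightarrow> p a \<le> vnorm A a"
      "a \<in> carrier A \<Longrightarrow> p (a \<boxtimes> a) = (p a)\<^sup>2"
    and p3: "\<lbrakk>a \<in> carrier A; b \<in> carrier A\<rbrakk> \<Longrightarrow> p (a \<boxplus> b) \<le> p a + p b"
      "\<lbrakk>a \<in> carrier A; b \<in> carrier A\<rbrakk> \<Longrightarrow> p (a \<boxtimes> b) \<le> p a * p b"
    and p4: "a \<in> carrier A \<Longrightarrow> p (c \<boxdot> a) = cmod c * p a" for a b c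
    using p unfolding power_mult_seminorm_def by blast+
  define r where "r a n = (if a \<in> carrier A then p (mpow f n a) / p f ^ n else 0)" for a n
  have dec: "decseq (r a)" for a
  proof (rule decseq_SucI)
    fix n
    show "r a (Suc n) \<le> r a n"
      using p3(2)[OF f mpow_closed[OF f]] pf by (simp add: r_def field_simps)
  qed
  have r0: "0 \<le> r a n" for a n
    using pf p2(1)[OF mpow_closed[OF f]] by (simp add: r_def)
  have "\<exists>L. r a \<longlonglongrightarrow> L \<and> (\<forall>n. L \<le> r a n)" for a
    using decseq_convergent[OF dec, of 0 a] r0 by metis
  then obtain q where q: "\<And>a. r a \<longlonglongrightarrow> q a" and qle: "\<And>a n. q a \<le> r a n" by metis
  have qp: "q a \<le> p a" for a using qle[of a 0] by (cases "a \<in> carrier A") (simp_all add: r_def p1)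
  have q0: "0 \<le> q a" for a using LIMSEQ_le_const[OF q, of 0] r0 by blast
  \<comment> \<open>Products of two terms of index n have index 2n, since f^n a times f^n b is
    f^(2n) a b.\<close>
  have double: "(\<lambda>n. r a (n + n)) \<longlonglongrightarrow> q a" for a
    using LIMSEQ_subseq_LIMSEQ[OF q[of a], of "\<lambda>n. n + n"] by (simp add: strict_mono_def o_def)
  have pms: "power_mult_seminorm q"
    unfolding power_mult_seminorm_def
  proof (intro conjI allI ballI impI)
    fix a assume "a \<notin> carrier A"
    then have "r a = (\<lambda>_. 0)" by (simp add: r_def fun_eq_iff)
    then show "q a = 0" using q[of a] by (simp add: LIMSEQ_const_iff)
  next
    fix a assume a: "a \<in> carrier A"
    show "0 \<le> q a" by (rule q0)
    show "q a \<le> vnorm A a" using qp[of a] p2(2)[OF a] by simp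
    have "r (a \<boxtimes> a) (n + n) = (r a n)\<^sup>2" for n
      using a f by (simp add: r_def aclosed power_divide power_add power2_eq_square
          p2(3)[unfolded power2_eq_square] flip: mpow_mult_mpow)
        (simp add: p2(3) mpow_closed power2_eq_square)
    then have "(\<lambda>n. (r a n)\<^sup>2) \<longlonglongrightarrow> q (a \<boxtimes> a)" using double[of "a \<boxtimes> a"] by simp
    moreover have "(\<lambda>n. (r a n)\<^sup>2) \<longlonglongrightarrow> (q a)\<^sup>2" by (intro tendsto_intros q)
    ultimately show "q (a \<boxtimes> a) = (q a)\<^sup>2" using LIMSEQ_unique by blast
    fix c :: complex
    have "(\<lambda>n. cmod c * r a n) \<longlonglongrightarrow> q (c \<boxdot> a)"
    proof -
      have "r (c \<boxdot> a) = (\<lambda>n. cmod c * r a n)"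
        using a f by (simp add: r_def mpow_scale p4 mpow_closed aclosed fun_eq_iff)
      then show ?thesis using q[of "c \<boxdot> a"] by simp
    qed
    moreover have "(\<lambda>n. cmod c * r a n) \<longlonglongrightarrow> cmod c * q a" by (intro tendsto_intros q)
    ultimately show "q (c \<boxdot> a) = cmod c * q a" using LIMSEQ_unique by blast
  next
    fix a b assume ab: "a \<in> carrier A" "b \<in> carrier A"
    have "r (a \<boxplus> b) n \<le> r a n + r b n" for n
      using p3(1)[OF mpow_closed[OF f] mpow_closed[OF f], of a b n n] pf ab f
      by (simp add: r_def mpow_add aclosed flip: add_divide_distrib) (simp add: divide_right_mono)
    then show "q (a \<boxplus> b) \<le> q a + q b"
      using tendsto_add[OF q[of a] q[of b]] q[of "a \<boxplus> b"] by (intro LIMSEQ_le) auto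
    have "r (a \<boxtimes> b) (n + n) \<le> r a n * r b n" for n
      using p3(2)[OF mpow_closed[OF f] mpow_closed[OF f], of a b n n] pf ab f
      by (simp add: r_def aclosed power_add divide_right_mono mpow_mult_mpow)
    then show "q (a \<boxtimes> b) \<le> q a * q b"
      using tendsto_mult[OF q[of a] q[of b]] double[of "a \<boxtimes> b"] by (intro LIMSEQ_le) auto
  qed
  have fm: "q (f \<boxtimes> a) = p f * q a" if a: "a \<in> carrier A" for a
  proof -
    have "r (f \<boxtimes> a) = (\<lambda>n. p f * r a (Suc n))"
      using a f pf by (simp add: r_def mpow_mult aclosed fun_eq_iff)
    then have "(\<lambda>n. p f * r a (Suc n)) \<longlonglongrightarrow> q (f \<boxtimes> a)" using q[of "f \<boxtimes> a"] by simp
    moreover have "(\<lambda>n. p f * r a (Suc n)) \<longlonglongrightarrow> p f * q a" by (intro tendsto_intros LIMSEQ_Suc q)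
    ultimately show ?thesis using LIMSEQ_unique by blast
  qed
  have gm: "q (g \<boxtimes> a) = c * q a"
    if g: "g \<in> carrier A" and pg: "\<And>a. a \<in> carrier A \<Longrightarrow> p (g \<boxtimes> a) = c * p a" and a: "a \<in> carrier A" for g c a
  proof -
    have "r (g \<boxtimes> a) = (\<lambda>n. c * r a n)"
      using a g f by (simp add: r_def mpow_mult aclosed pg mpow_closed fun_eq_iff)
    then have "(\<lambda>n. c * r a n) \<longlonglongrightarrow> q (g \<boxtimes> a)" using q[of "g \<boxtimes> a"] by simp
    moreover have "(\<lambda>n. c * r a n) \<longlonglongrightarrow> c * q a" by (intro tendsto_intros q)
    ultimately show ?thesis using LIMSEQ_unique by blast
  qed
  \<comment> \<open>Repeated squaring gives p(f^(2^k)) = p(f)^(2^k), so the decreasing sequence for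
    a = f returns to p(f) at every index 2^k - 1. The index is lower by one because
    \<open>mpow f n f\<close> is f^(n+1).\<close>
  have qf: "q f = p f"
  proof (rule ccontr)
    assume "q f \<noteq> p f"
    then have lt: "q f < p f" using qp[of f] by simp
    have pw: "p (mpow f (2 ^ k - 1) f) = p f ^ (2 ^ k)" for k
    proof (induction k)
      case (Suc k)
      have e: "Suc ((2 ^ k - 1) + (2 ^ k - 1)) = 2 ^ Suc k - (1::nat)"
        unfolding power_Suc using zero_less_power[of "2::nat" k] by linarith
      have "mpow f (2 ^ k - 1) f \<boxtimes> mpow f (2 ^ k - 1) f = mpow f (2 ^ Suc k - 1) f"
        unfolding mpow_mult_mpow[OF f f f] e[symmetric] mpow_mult[OF f f f] by simp
      then show ?case
        using p2(3)[OF mpow_closed[OF f f, of "2 ^ k - 1"]] Suc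
        by (simp add: mult.commute flip: power_mult)
    qed simp
    have rk: "r f (2 ^ k - 1) = p f" for k
    proof -
      have "p f ^ (2 ^ k) = p f * p f ^ (2 ^ k - 1)"
        by (metis power_Suc Suc_diff_1 zero_less_numeral zero_less_power)
      then show ?thesis using pf f unfolding r_def pw by simp
    qed
    obtain n where n: "r f n < p f"
      using order_tendstoD(2)[OF q lt] by (auto simp: eventually_sequentially)
    have "n \<le> 2 ^ n - 1" using less_exp[of n] by linarith
    then have "r f (2 ^ n - 1) \<le> r f n" using dec by (rule decseqD[rotated])
    then show False using rk[of n] n by simp
  qed
  show thesis by (rule that[of q]) (use pms qp fm gm qf in blast)+
qed

text \<open>Zorn's lemma gives a minimal p, and localizing p at f must return p itself, which makes
  f multiplicative. For this the localization q has to stay in the family. The condition p(a0 a) =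
  p(a) in \<open>S\<close> ensures it: q(f a0) is both p(f) q(a0) and q(f) = p(f), hence q(a0) =
  1.\<close>

lemma exists_multiplicative_seminorm:
  assumes a0: "a0 \<in> carrier A" and n0: "vnorm A a0 = 1"
  obtains p where "power_mult_seminorm p" "p a0 = 1"
    "\<And>a b. \<lbrakk>a \<in> carrier A; b \<in> carrier A\<rbrakk> \<Longrightarrow> p (a \<boxtimes> b) = p a * p b"
proof -
  define S where "S = {p. power_mult_seminorm p \<and> p a0 = 1 \<and> (\<forall>a\<in>carrier A. p (a0 \<boxtimes> a) = p a)}"
  \<comment> \<open>The order is reversed, so that the maximal element of Zorn's lemma is a minimal
    seminorm and chains are bounded by their pointwise infima.\<close>
  define P where "P p q \<longleftrightarrow> (\<forall>a. q a \<le> p a)" for p q :: "'a \<Rightarrow> real"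
  have "power_mult_seminorm (\<lambda>a. if a \<in> carrier A then vnorm A a else 0)"
    unfolding power_mult_seminorm_def
    by (simp add: norm_nonneg norm_square norm_triangle norm_mult norm_scale aclosed)
  \<comment> \<open>The norm itself need not satisfy p(a0 a) = p(a), but its localization at a0
    does, because a0 has norm 1.\<close>
  from this a0 obtain p0 where
    "power_mult_seminorm p0" "p0 a0 = 1" "\<And>a. a \<in> carrier A \<Longrightarrow> p0 (a0 \<boxtimes> a) = p0 a"
  proof (rule seminorm_localize)
  qed (use a0 n0 in auto)
  then have S0: "p0 \<in> S" by (simp add: S_def)
  have "\<exists>m\<in>S. \<forall>a\<in>S. P m a \<longrightarrow> a = m"
  proof (rule predicate_Zorn)
    show "partial_order_on S (relation_of P S)"
      by (rule partial_order_on_relation_ofI) (auto simp: P_def fun_eq_iff intro: order_trans antisym)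
    fix C assume C: "C \<in> Chains (relation_of P S)"
    show "\<exists>u\<in>S. \<forall>a\<in>C. P a u"
    proof (cases "C = {}")
      case True
      then show ?thesis using S0 by auto
    next
      case False
      have CS: "C \<subseteq> S" using C by (auto simp: Chains_def relation_of_def)
      have lin: "P p q \<or> P q p" if "p \<in> C" "q \<in> C" for p q
        using C that by (auto simp: Chains_def relation_of_def)
      have nn: "0 \<le> p a" if "p \<in> C" for p a
        using CS that unfolding S_def power_mult_seminorm_def by (cases "a \<in> carrier A") auto
      have pmsC: "power_mult_seminorm p" if "p \<in> C" for p using CS that by (auto simp: S_def)
      define q where "q a = (INF p\<in>C. p a)" for a
      have bdd: "bdd_below ((\<lambda>p. p a) ` C)" for a
        using nn by (intro bdd_belowI2[where m=0]) auto
      have q_le: "q a \<le> p a" if "p \<in> C" for p a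
        unfolding q_def using that bdd by (rule cINF_lower[rotated])
      have q_ge: "x \<le> q a" if "\<And>p. p \<in> C \<Longrightarrow> x \<le> p a" for x a
        unfolding q_def using that False by (intro cINF_greatest) auto
      have q_lt: "\<exists>p\<in>C. p a < x" if "q a < x" for x a
        using that unfolding q_def by (subst (asm) cINF_less_iff) (use False bdd in auto)
      have q_nn: "0 \<le> q a" for a by (rule q_ge) (rule nn)
      \<comment> \<open>The chain is totally ordered, so one member can be close to the infimum at
        two elements at once.\<close>
      have both: "\<exists>p\<in>C. p a < x \<and> p b < y" if lt: "q a < x" "q b < y" for a b x y
      proof -
        obtain p1 where "p1 \<in> C" "p1 a < x" using q_lt lt by blast
        moreover obtain p2 where "p2 \<in> C" "p2 b < y" using q_lt lt by blast
        ultimately show ?thesis using lin[of p1 p2] unfolding P_def by (meson le_less_trans)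
      qed
      have pms: "power_mult_seminorm q"
        unfolding power_mult_seminorm_def
      proof (intro conjI allI ballI impI)
        fix a assume "a \<notin> carrier A"
        then have "p a = 0" if "p \<in> C" for p
          using pmsC[OF that] by (simp add: power_mult_seminorm_def)
        then have "q a \<le> 0" using q_le[of _ a] False by force
        then show "q a = 0" using q_nn[of a] by simp
      next
        fix a assume a: "a \<in> carrier A"
        show "0 \<le> q a" by (rule q_nn)
        obtain p where p: "p \<in> C" using False by blast
        show "q a \<le> vnorm A a"
          using q_le[OF p, of a] pmsC[OF p] a unfolding power_mult_seminorm_def by force
        have sq: "p (a \<boxtimes> a) = (p a)\<^sup>2" if "p \<in> C" for p
          using pmsC[OF that] a by (simp add: power_mult_seminorm_def)
        show "q (a \<boxtimes> a) = (q a)\<^sup>2"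
        proof (rule antisym)
          show "(q a)\<^sup>2 \<le> q (a \<boxtimes> a)"
            by (rule q_ge) (simp add: sq power_mono q_le q_nn)
          have "sqrt (q (a \<boxtimes> a)) \<le> q a"
          proof (rule q_ge)
            fix p assume "p \<in> C"
            then show "sqrt (q (a \<boxtimes> a)) \<le> p a"
              using q_le[of p "a \<boxtimes> a"] sq[of p] nn[of p a] by (simp add: real_sqrt_le_iff real_le_lsqrt)
          qed
          then have "(sqrt (q (a \<boxtimes> a)))\<^sup>2 \<le> (q a)\<^sup>2" by (intro power_mono) (simp_all add: q_nn)
          then show "q (a \<boxtimes> a) \<le> (q a)\<^sup>2" by (simp add: q_nn)
        qed
        fix c :: complex
        have sc: "p (c \<boxdot> a) = cmod c * p a" if "p \<in> C" for p
          using pmsC[OF that] a by (simp add: power_mult_seminorm_def)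
        show "q (c \<boxdot> a) = cmod c * q a"
        proof (cases "c = 0")
          case True
          then have "q (c \<boxdot> a) \<le> 0" using sc q_le[of _ "c \<boxdot> a"] \<open>C \<noteq> {}\<close> by force
          then show ?thesis using q_nn[of "c \<boxdot> a"] True by simp
        next
          case False
          show ?thesis
          proof (rule antisym)
            show "cmod c * q a \<le> q (c \<boxdot> a)"
              by (rule q_ge) (simp add: sc q_le mult_left_mono)
            have "q (c \<boxdot> a) / cmod c \<le> q a"
            proof (rule q_ge)
              fix p assume "p \<in> C"
              then show "q (c \<boxdot> a) / cmod c \<le> p a"
                using q_le[of p "c \<boxdot> a"] sc[of p] False by (simp add: field_simps)
            qed
            then show "q (c \<boxdot> a) \<le> cmod c * q a" using False by (simp add: field_simps)
          qed
        qed
      next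
        fix a b assume ab: "a \<in> carrier A" "b \<in> carrier A"
        have tri: "p (a \<boxplus> b) \<le> p a + p b" and sub: "p (a \<boxtimes> b) \<le> p a * p b" if "p \<in> C" for p
          using pmsC[OF that] ab by (simp_all add: power_mult_seminorm_def)
        show "q (a \<boxplus> b) \<le> q a + q b"
        proof (rule field_le_epsilon)
          fix e :: real assume "e > 0"
          then obtain p where "p \<in> C" "p a < q a + e / 2" "p b < q b + e / 2"
            using both[of a "q a + e / 2" b "q b + e / 2"] by auto
          then show "q (a \<boxplus> b) \<le> q a + q b + e" using tri[of p] q_le[of p "a \<boxplus> b"] by simp
        qed
        have *: "q (a \<boxtimes> b) \<le> (q a + e) * (q b + e)" if e: "e > 0" for e
        proof -
          obtain p where "p \<in> C" "p a < q a + e" "p b < q b + e"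
            using both[of a "q a + e" b "q b + e"] e by auto
          then show ?thesis
            using sub[of p] q_le[of p "a \<boxtimes> b"] mult_mono[of "p a" "q a + e" "p b" "q b + e"]
              nn[of p] q_nn[of a] e by auto
        qed
        have "((\<lambda>e. (q a + e) * (q b + e)) \<longlongrightarrow> (q a + 0) * (q b + 0)) (at_right 0)"
          by (intro tendsto_intros)
        then show "q (a \<boxtimes> b) \<le> q a * q b"
          using * by (intro tendsto_lowerbound[of _ _ "at_right 0"])
            (auto simp: eventually_at_right_less eventually_at_filter)
      qed
      obtain p where "p \<in> C" using False by blast
      have C1: "p a0 = 1" and Ca: "a \<in> carrier A \<Longrightarrow> p (a0 \<boxtimes> a) = p a" if "p \<in> C" for p a
        using CS that by (auto simp: S_def)
      have "q a0 = 1"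
      proof (rule order_antisym)
        show "q a0 \<le> 1" using q_le[OF \<open>p \<in> C\<close>, of a0] C1[OF \<open>p \<in> C\<close>] by simp
        show "1 \<le> q a0" by (rule q_ge, subst C1) auto
      qed
      moreover have "q (a0 \<boxtimes> a) = q a" if "a \<in> carrier A" for a
        unfolding q_def using Ca that by (intro INF_cong) auto
      ultimately have "q \<in> S" using pms by (simp add: S_def)
      then show ?thesis using q_le by (auto simp: P_def)
    qed
  qed
  then obtain p where pS: "p \<in> S" and pmin: "\<And>q. \<lbrakk>q \<in> S; \<And>a. q a \<le> p a\<rbrakk> \<Longrightarrow> q = p"
    unfolding P_def by blast
  have pms: "power_mult_seminorm p" and p1: "p a0 = 1"
    and pa: "\<And>a. a \<in> carrier A \<Longrightarrow> p (a0 \<boxtimes> a) = p a" using pS by (auto simp: S_def)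
  have "p (f \<boxtimes> a) = p f * p a" if f: "f \<in> carrier A" and a: "a \<in> carrier A" for f a
  proof (cases "p f > 0")
    case True
    obtain q where q: "power_mult_seminorm q" "\<And>a. q a \<le> p a"
      "\<And>a. a \<in> carrier A \<Longrightarrow> q (f \<boxtimes> a) = p f * q a"
      "\<And>g c. \<lbrakk>g \<in> carrier A; \<And>a. a \<in> carrier A \<Longrightarrow> p (g \<boxtimes> a) = c * p a\<rbrakk>
         \<Longrightarrow> \<forall>a\<in>carrier A. q (g \<boxtimes> a) = c * q a"
      "q f = p f"
      by (rule seminorm_localize[OF pms f True]) blast
    have qa: "q (a0 \<boxtimes> a) = q a" if "a \<in> carrier A" for a
      using q(4)[OF a0, of 1] pa that by simp
    have "q a0 = 1"
      using q(3)[OF a0] qa[OF f] q(5) True mult_comm[OF f a0] by simp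
    then have "q \<in> S" using q(1) qa by (simp add: S_def)
    then have "q = p" using q(2) by (rule pmin)
    then show ?thesis using q(3)[OF a] by simp
  next
    case False
    then have "p f = 0" using pms f unfolding power_mult_seminorm_def by force
    moreover have "0 \<le> p (f \<boxtimes> a)" "p (f \<boxtimes> a) \<le> p f * p a"
      using pms f a unfolding power_mult_seminorm_def by (auto simp: aclosed)
    ultimately show ?thesis by simp
  qed
  then show thesis using that pms p1 by blast
qed

end

section \<open>Characters\<close>

text \<open>The *-homomorphisms to the complex numbers, including zero. The zero functional is the
  point at infinity; without it the set would in general fail to be closed under pointwise
  limits.\<close>

definition chars0 :: "('a, 'm) cstar_scheme \<Rightarrow> ('a \<Rightarrow> complex) set" where
  "chars0 A = {x. (\<forall>a. a \<notin> carrier A \<longrightarrow> x a = 0) \<and>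
     (\<forall>a\<in>carrier A. \<forall>b\<in>carrier A. x (a \<boxplus>\<^bsub>A\<^esub> b) = x a + x b \<and> x (a \<boxtimes>\<^bsub>A\<^esub> b) = x a * x b) \<and>
     (\<forall>c. \<forall>a\<in>carrier A. x (c \<boxdot>\<^bsub>A\<^esub> a) = c * x a) \<and>
     (\<forall>a\<in>carrier A. x (astar A a) = cnj (x a))}"

definition chars :: "('a, 'm) cstar_scheme \<Rightarrow> ('a \<Rightarrow> complex) set" where
  "chars A = chars0 A - {\<lambda>_. 0}"

lemma chars0D:
  assumes "x \<in> chars0 A"
  shows "a \<notin> carrier A \<Longrightarrow> x a = 0"
    and "\<lbrakk>a \<in> carrier A; b \<in> carrier A\<rbrakk> \<Longrightarrow> x (a \<boxplus>\<^bsub>A\<^esub> b) = x a + x b"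
    and "\<lbrakk>a \<in> carrier A; b \<in> carrier A\<rbrakk> \<Longrightarrow> x (a \<boxtimes>\<^bsub>A\<^esub> b) = x a * x b"
    and "a \<in> carrier A \<Longrightarrow> x (c \<boxdot>\<^bsub>A\<^esub> a) = c * x a"
    and "a \<in> carrier A \<Longrightarrow> x (astar A a) = cnj (x a)"
  using assms by (auto simp: chars0_def)

lemma chars_subset: "x \<in> chars A \<Longrightarrow> x \<in> chars0 A"
  by (simp add: chars_def)

context cstar_algebra
begin

lemma char_zero: "x \<in> chars0 A \<Longrightarrow> x \<zero>v = 0"
  using chars0D(4)[of x A "\<zero>v" 0] by (simp add: zero_closed)

lemma char_minus:
  "\<lbrakk>x \<in> chars0 A; a \<in> carrier A; b \<in> carrier A\<rbrakk> \<Longrightarrow> x (vminus A a b) = x a - x b"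
  by (simp add: vminus_def chars0D aclosed)

lemmas char_simps = chars0D(2-5) char_zero char_minus

lemma self_adjoint_re: "a \<in> carrier A \<Longrightarrow> astar A (a \<boxplus> astar A a) = a \<boxplus> astar A a"
  by (simp add: aclosed star_add star_star add_comm)

lemma self_adjoint_im:
  "a \<in> carrier A \<Longrightarrow> astar A (\<i> \<boxdot> vminus A a (astar A a)) = \<i> \<boxdot> vminus A a (astar A a)"
  by (simp add: aclosed star_add star_scale star_star vminus_def scale_add_right add_comm flip: scale_scale)

lemma zero_char: "(\<lambda>_. 0) \<in> chars0 A"
  by (simp add: chars0_def)

lemma chars_unit:
  \<comment> \<open>The element u serves as a unit at the single point x.\<close>
  assumes "x \<in> chars A" obtains u where "u \<in> carrier A" "x u = 1"
proof -
  have x: "x \<in> chars0 A" using assms by (rule chars_subset)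
  obtain a where a: "x a \<noteq> 0" using assms by (force simp: chars_def fun_eq_iff)
  then have "a \<in> carrier A" using chars0D(1)[OF x] by metis
  then show thesis using that[of "(1 / x a) \<boxdot> a"] a x by (simp add: aclosed chars0D)
qed

text \<open>If \<open>\<bar>x(a)\<bar> > \<parallel>a\<parallel>\<close>, then \<open>x(b) = 1\<close> for a multiple \<open>b\<close> of \<open>a\<close> with \<open>\<parallel>b\<parallel> < 1\<close>, and \<open>c = b + bc\<close> has a
  solution, on which \<open>x\<close> gives the contradiction \<open>x(c) = 1 + x(c)\<close>.\<close>

lemma char_bound:
  assumes x: "x \<in> chars0 A" and a: "a \<in> carrier A"
  shows "cmod (x a) \<le> vnorm A a"
proof (rule ccontr)
  assume *: "\<not> ?thesis"
  then have xa: "cmod (x a) > 0" using norm_nonneg[OF a] by linarith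
  define b where "b = (1 / x a) \<boxdot> a"
  have b: "b \<in> carrier A" by (simp add: b_def aclosed a)
  have xb: "x b = 1" using xa x a by (simp add: b_def chars0D)
  have nb: "vnorm A b < 1" using * xa a by (simp add: b_def norm_scale norm_divide field_simps)
  interpret M: Metric_space "carrier A" "vdist A" by (rule metric)
  obtain c where c: "c \<in> carrier A" "b \<boxplus> b \<boxtimes> c = c"
  proof (rule M.Banach_fixedpoint_thm[of "\<lambda>c. b \<boxplus> b \<boxtimes> c" "vnorm A b"])
    show "M.mcomplete" by (rule complete)
    show "carrier A \<noteq> {}" using a by blast
    show "(\<lambda>c. b \<boxplus> b \<boxtimes> c) \<in> carrier A \<rightarrow> carrier A" by (simp add: aclosed b)
    show "vdist A (b \<boxplus> b \<boxtimes> c) (b \<boxplus> b \<boxtimes> d) \<le> vnorm A b * vdist A c d"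
      if "c \<in> carrier A" "d \<in> carrier A" for c d
      using that b norm_mult[of b "vminus A c d"]
      by (simp add: vdist_def aclosed add_minus_add mult_minus_right add_zero_left)
  qed (use nb in auto)
  have "x (b \<boxplus> b \<boxtimes> c) = 1 + x c" using x b c(1) xb by (simp add: chars0D aclosed)
  then show False using c(2) by simp
qed

end

section \<open>From multiplicative seminorms to characters\<close>

context abelian_cstar_algebra
begin

text \<open>Horner's scheme for q(a) u: the constant coefficient c contributes c u instead of a
  multiple of the missing unit.\<close>

definition poly_app :: "'a \<Rightarrow> 'a \<Rightarrow> complex poly \<Rightarrow> 'a" where
  "poly_app u a q = foldr (\<lambda>c e. c \<boxdot> u \<boxplus> a \<boxtimes> e) (coeffs q) \<zero>v"

lemma poly_app_0 [simp]: "poly_app u a 0 = \<zero>v"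
  by (simp add: poly_app_def)

lemma poly_app_pCons [simp]:
  "\<lbrakk>u \<in> carrier A; a \<in> carrier A\<rbrakk> \<Longrightarrow> poly_app u a (pCons c q) = c \<boxdot> u \<boxplus> a \<boxtimes> poly_app u a q"
  by (cases "c = 0 \<and> q = 0") (auto simp: poly_app_def coeffs_pCons_eq_cCons cCons_def add_zero zero_closed)

context
  fixes u a assumes u: "u \<in> carrier A" and a: "a \<in> carrier A"
begin

lemma poly_app_closed: "poly_app u a q \<in> carrier A"
  by (induction q) (simp_all add: u a aclosed)

lemmas poly_app_closeds = poly_app_closed u a aclosed

lemma poly_app_add: "poly_app u a (p + q) = poly_app u a p \<boxplus> poly_app u a q"
proof (induction p arbitrary: q)
  case (pCons c p)
  then show ?case
    by (cases q) (simp add: scale_add_left mult_add_right poly_app_closeds add_assoc add_left_comm)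
qed (simp add: add_zero_left poly_app_closeds)

lemma poly_app_smult: "poly_app u a (smult c p) = c \<boxdot> poly_app u a p"
  by (induction p) (simp_all add: scale_add_right scale_scale mult_scale_right poly_app_closeds)

text \<open>The product of p(a) u and q(a) u contains u twice, which accounts for the factor u on
  the left.\<close>

lemma poly_app_mult: "u \<boxtimes> poly_app u a (p * q) = poly_app u a p \<boxtimes> poly_app u a q"
proof (induction p)
  case (pCons c p)
  have "u \<boxtimes> poly_app u a (pCons c p * q)
      = c \<boxdot> (u \<boxtimes> poly_app u a q) \<boxplus> a \<boxtimes> (u \<boxtimes> poly_app u a (p * q))"
    by (simp add: poly_app_add poly_app_smult mult_add_right mult_scale_right poly_app_closeds add_zero_left mult_left_comm)
  then show ?case unfolding pCons
    by (simp add: u a mult_add_left mult_scale_left mult_assoc poly_app_closeds)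
qed (simp add: poly_app_closeds)

end

text \<open>For fixed a the map sending q to p(q(a) u) is a multiplicative seminorm on polynomials,
  normalised on constants since p(u) = 1. Its zero X - z gives p(a u - z u) = 0, and this z is the
  value x(a). Uniqueness of z makes x linear and multiplicative, and the modulus of x is p.\<close>

lemma exists_char_norm_one:
  assumes u: "u \<in> carrier A" and nu: "vnorm A u = 1"
  obtains x where "x \<in> chars0 A" "cmod (x u) = 1"
proof -
  obtain p where p: "power_mult_seminorm p" and pu: "p u = 1"
    and pm: "\<And>a b. \<lbrakk>a \<in> carrier A; b \<in> carrier A\<rbrakk> \<Longrightarrow> p (a \<boxtimes> b) = p a * p b"
    using exists_multiplicative_seminorm[OF u nu] by blast
  have p0: "a \<in> carrier A \<Longrightarrow> 0 \<le> p a" and pn: "a \<in> carrier A \<Longrightarrow> p a \<le> vnorm A a"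
    and pt: "\<lbrakk>a \<in> carrier A; b \<in> carrier A\<rbrakk> \<Longrightarrow> p (a \<boxplus> b) \<le> p a + p b"
    and ps: "a \<in> carrier A \<Longrightarrow> p (c \<boxdot> a) = cmod c * p a" for a b c
    using p unfolding power_mult_seminorm_def by blast+
  have pdiff: "p b \<le> p c + p (vminus A b c)" if "b \<in> carrier A" "c \<in> carrier A" for b c
    using pt[of c "vminus A b c"] that by (simp add: add_minus_cancel' aclosed)
  have psym: "p (vminus A b c) = p (vminus A c b)" if "b \<in> carrier A" "c \<in> carrier A" for b c
    using that by (subst minus_commute) (simp_all add: ps aclosed)
  have "\<exists>z. p (vminus A (a \<boxtimes> u) (z \<boxdot> u)) = 0" if a: "a \<in> carrier A" for a
  proof -
    define N where "N q = p (poly_app u a q)" for q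
    note poly_app_closeds' = poly_app_closed[OF u a] u a aclosed
    have "\<exists>z. N [:-z, 1:] = 0"
    proof (rule multiplicative_seminorm_poly_point)
      fix f g
      have "p (u \<boxtimes> poly_app u a (f * g)) = N f * N g"
        by (simp add: N_def poly_app_mult[OF u a] pm poly_app_closeds')
      then show "N (f * g) = N f * N g" by (simp add: N_def pm poly_app_closeds' pu)
      show "N (f + g) \<le> N f + N g" by (simp add: N_def poly_app_add[OF u a] pt poly_app_closeds')
      show "N [:c:] = cmod c" for c by (simp add: N_def u a add_zero aclosed ps pu)
    qed
    then obtain z where z: "N [:-z, 1:] = 0" by blast
    have "poly_app u a [:-z, 1:] = vminus A (a \<boxtimes> u) (z \<boxdot> u)"
      using u a by (simp add: add_zero aclosed scale_one vminus_def add_comm flip: scale_scale)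
    then show ?thesis using z by (auto simp: N_def)
  qed
  then obtain x where x: "\<And>a. a \<in> carrier A \<Longrightarrow> p (vminus A (a \<boxtimes> u) (x a \<boxdot> u)) = 0" by metis
  have x_eq: "x a = z" if a: "a \<in> carrier A" and z: "p (vminus A (a \<boxtimes> u) (z \<boxdot> u)) = 0" for a z
  proof -
    have "vminus A (x a \<boxdot> u) (a \<boxtimes> u) \<boxplus> vminus A (a \<boxtimes> u) (z \<boxdot> u) = (x a - z) \<boxdot> u"
      using u a scale_add_left[of u "x a" "-z"]
      by (simp add: minus_add_minus aclosed) (simp add: vminus_def flip: scale_scale)
    then have "cmod (x a - z) * p u \<le> 0"
      using pt[of "vminus A (x a \<boxdot> u) (a \<boxtimes> u)" "vminus A (a \<boxtimes> u) (z \<boxdot> u)"] x[OF a] z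
        psym[of "x a \<boxdot> u" "a \<boxtimes> u"] a u by (simp add: aclosed ps)
    then show ?thesis using pu by simp
  qed
  have px: "cmod (x a) = p a" if a: "a \<in> carrier A" for a
    using pdiff[of "a \<boxtimes> u" "x a \<boxdot> u"] pdiff[of "x a \<boxdot> u" "a \<boxtimes> u"] psym[of "x a \<boxdot> u" "a \<boxtimes> u"]
      x[OF a] a u pu by (simp add: aclosed pm ps)
  have xadd: "x (a \<boxplus> b) = x a + x b" if ab: "a \<in> carrier A" "b \<in> carrier A" for a b
  proof (rule x_eq)
    have "vminus A ((a \<boxplus> b) \<boxtimes> u) ((x a + x b) \<boxdot> u)
        = vminus A (a \<boxtimes> u) (x a \<boxdot> u) \<boxplus> vminus A (b \<boxtimes> u) (x b \<boxdot> u)"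
      using ab u by (simp add: mult_add_left scale_add_left add_minus_add aclosed)
    then show "p (vminus A ((a \<boxplus> b) \<boxtimes> u) ((x a + x b) \<boxdot> u)) = 0"
      using pt[of "vminus A (a \<boxtimes> u) (x a \<boxdot> u)" "vminus A (b \<boxtimes> u) (x b \<boxdot> u)"] x ab u
        p0[of "vminus A (a \<boxtimes> u) (x a \<boxdot> u) \<boxplus> vminus A (b \<boxtimes> u) (x b \<boxdot> u)"]
      by (simp add: aclosed)
  qed (use ab in \<open>simp add: aclosed\<close>)
  have xscale: "x (c \<boxdot> a) = c * x a" if a: "a \<in> carrier A" for a c
  proof (rule x_eq)
    have "vminus A ((c \<boxdot> a) \<boxtimes> u) ((c * x a) \<boxdot> u) = c \<boxdot> vminus A (a \<boxtimes> u) (x a \<boxdot> u)"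
      using a u by (simp add: mult_scale_left scale_scale scale_minus aclosed)
    then show "p (vminus A ((c \<boxdot> a) \<boxtimes> u) ((c * x a) \<boxdot> u)) = 0"
      using x[OF a] a u by (simp add: ps aclosed)
  qed (use a in \<open>simp add: aclosed\<close>)
  have xmult: "x (a \<boxtimes> b) = x a * x b" if ab: "a \<in> carrier A" "b \<in> carrier A" for a b
  proof (rule x_eq)
    have "a \<boxtimes> vminus A (b \<boxtimes> u) (x b \<boxdot> u) \<boxplus> x b \<boxdot> vminus A (a \<boxtimes> u) (x a \<boxdot> u)
        = vminus A (a \<boxtimes> b \<boxtimes> u) (x b \<boxdot> (a \<boxtimes> u)) \<boxplus> vminus A (x b \<boxdot> (a \<boxtimes> u)) ((x a * x b) \<boxdot> u)"
      using ab u by (simp add: mult_minus_right scale_minus mult_assoc mult_scale_right aclosed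
          mult.commute[of "x a"] flip: scale_scale)
    also have "\<dots> = vminus A (a \<boxtimes> b \<boxtimes> u) ((x a * x b) \<boxdot> u)"
      using ab u by (simp add: minus_add_minus aclosed)
    finally show "p (vminus A ((a \<boxtimes> b) \<boxtimes> u) ((x a * x b) \<boxdot> u)) = 0"
      using pt[of "a \<boxtimes> vminus A (b \<boxtimes> u) (x b \<boxdot> u)" "x b \<boxdot> vminus A (a \<boxtimes> u) (x a \<boxdot> u)"] x ab u
        p0[of "vminus A (a \<boxtimes> b \<boxtimes> u) ((x a * x b) \<boxdot> u)"]
      by (simp add: aclosed pm ps)
  qed (use ab in \<open>simp add: aclosed\<close>)
  have xu: "cmod (x u) = 1" using px[OF u] pu by simp
  \<comment> \<open>Arens' argument without a unit: with w = h u + i s u one has w*w = h h k + s^2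
    k, where k = u*u has norm 1. Hence |x(h) + i s|^2 is at most \<open>vnorm A h\<close> squared
    plus s^2 for every real s; the term of the left side linear in s then forces the imaginary part
    of x(h) to vanish.\<close>
  have real: "Im (x h) = 0" if h: "h \<in> carrier A" and hs: "astar A h = h" for h
  proof -
    have bound: "(cmod (x h + \<i> * of_real s))\<^sup>2 \<le> (vnorm A h)\<^sup>2 + s\<^sup>2" for s :: real
    proof -
      define c where "c = \<i> * of_real s"
      define w where "w = h \<boxtimes> u \<boxplus> c \<boxdot> u"
      define k where "k = astar A u \<boxtimes> u"
      have k: "k \<in> carrier A" "vnorm A k = 1" using cstar_identity[OF u] u nu by (simp_all add: k_def aclosed)
      have w: "w \<in> carrier A" by (simp add: w_def aclosed h u)
      have ws: "astar A w = h \<boxtimes> astar A u \<boxplus> (- c) \<boxdot> astar A u"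
        using h u hs by (simp add: w_def star_add star_mult star_scale c_def aclosed mult_comm)
      have cc: "c * c = - of_real (s\<^sup>2)" by (simp add: c_def power2_eq_square complex_eq_iff)
      have "astar A w \<boxtimes> w = (h \<boxtimes> (h \<boxtimes> k) \<boxplus> c \<boxdot> (h \<boxtimes> k)) \<boxplus> ((- c) \<boxdot> (h \<boxtimes> k) \<boxplus> (- c * c) \<boxdot> k)"
        unfolding ws unfolding w_def k_def using h u
        by (simp add: mult_add_left mult_add_right mult_scale_left mult_scale_right mult_assoc aclosed
            scale_add_right mult_left_comm add_assoc add_left_comm flip: scale_scale)
      also have "\<dots> = h \<boxtimes> (h \<boxtimes> k) \<boxplus> ((c + - c) \<boxdot> (h \<boxtimes> k) \<boxplus> (- c * c) \<boxdot> k)"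
        using h k by (subst scale_add_left) (simp_all add: add_assoc aclosed)
      also have "\<dots> = h \<boxtimes> (h \<boxtimes> k) \<boxplus> of_real (s\<^sup>2) \<boxdot> k"
        using h k by (simp add: add_zero_left aclosed cc)
      finally have "(vnorm A w)\<^sup>2 \<le> vnorm A (h \<boxtimes> (h \<boxtimes> k)) + s\<^sup>2"
        using norm_triangle[of "h \<boxtimes> (h \<boxtimes> k)" "of_real (s\<^sup>2) \<boxdot> k"] cstar_identity[OF w] h k
        by (simp add: aclosed norm_scale norm_power)
      also have "vnorm A (h \<boxtimes> (h \<boxtimes> k)) \<le> (vnorm A h)\<^sup>2"
        using norm_mult[of h "h \<boxtimes> k"] mult_left_mono[OF norm_mult[of h k], of "vnorm A h"] h k
        by (simp add: aclosed norm_nonneg power2_eq_square)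
      finally have 1: "(vnorm A w)\<^sup>2 \<le> (vnorm A h)\<^sup>2 + s\<^sup>2" by simp
      have "x w = (x h + c) * x u" using h u by (simp add: w_def xadd xmult xscale aclosed distrib_right)
      then have "cmod (x h + c) = p w" using px[OF w] xu by (simp add: Real_Vector_Spaces.norm_mult)
      then have "cmod (x h + c) \<le> vnorm A w" using pn[OF w] by simp
      then have "(cmod (x h + c))\<^sup>2 \<le> (vnorm A w)\<^sup>2" by (intro power_mono) auto
      then show ?thesis using 1 by (simp add: c_def)
    qed
    have lin: "2 * Im (x h) * s \<le> (vnorm A h)\<^sup>2" for s
    proof -
      have "(cmod (x h + \<i> * of_real s))\<^sup>2 = (Re (x h))\<^sup>2 + (Im (x h) + s)\<^sup>2"
        by (simp add: cmod_power2)
      also have "\<dots> = (Re (x h))\<^sup>2 + (Im (x h))\<^sup>2 + 2 * Im (x h) * s + s\<^sup>2"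
        by (simp add: power2_eq_square algebra_simps)
      finally show ?thesis
        using bound[of s] zero_le_power2[of "Re (x h)"] zero_le_power2[of "Im (x h)"] by linarith
    qed
    show ?thesis
    proof (rule ccontr)
      assume "Im (x h) \<noteq> 0"
      \<comment> \<open>This s makes the left side of \<open>lin\<close> exceed the right side by
        exactly 1.\<close>
      then show False using lin[of "((vnorm A h)\<^sup>2 + 1) / (2 * Im (x h))"] by simp
    qed
  qed
  have xstar: "x (astar A a) = cnj (x a)" if a: "a \<in> carrier A" for a
  proof -
    have "Im (x (a \<boxplus> astar A a)) = 0"
      by (rule real) (simp_all add: aclosed a self_adjoint_re)
    moreover have "Im (x (\<i> \<boxdot> vminus A a (astar A a))) = 0"
      by (rule real) (simp_all add: aclosed a self_adjoint_im)
    moreover have "x (vminus A a (astar A a)) = x a - x (astar A a)"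
      using a by (simp add: vminus_def xadd xscale aclosed)
    ultimately show ?thesis using a by (simp add: xadd xscale aclosed complex_eq_iff)
  qed
  define y where "y a = (if a \<in> carrier A then x a else 0)" for a
  have "y \<in> chars0 A"
    by (simp add: chars0_def y_def xadd xmult xscale xstar aclosed)
  then show thesis using that[of y] xu u by (simp add: y_def)
qed

lemma exists_char_norm:
  assumes a: "a \<in> carrier A"
  obtains x where "x \<in> chars0 A" "cmod (x a) = vnorm A a"
proof (cases "vnorm A a = 0")
  case True
  then show thesis using that[OF zero_char] by simp
next
  case False
  then have n: "vnorm A a > 0" using norm_nonneg[OF a] by linarith
  define u where "u = of_real (1 / vnorm A a) \<boxdot> a"
  have "u \<in> carrier A" "vnorm A u = 1" using n a by (simp_all add: u_def aclosed norm_scale norm_divide)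
  then obtain x where x: "x \<in> chars0 A" "cmod (x u) = 1" by (rule exists_char_norm_one)
  then have "cmod (x a) = vnorm A a" using n a by (simp add: u_def chars0D norm_divide field_simps)
  then show thesis using that x by blast
qed

lemma eq_by_chars:
  assumes "a \<in> carrier A" "b \<in> carrier A" "\<And>x. x \<in> chars A \<Longrightarrow> x a = x b"
  shows "a = b"
proof -
  obtain x where x: "x \<in> chars0 A" "cmod (x (vminus A a b)) = vnorm A (vminus A a b)"
    using exists_char_norm[of "vminus A a b"] assms by (auto simp: aclosed)
  have "x a = x b" using assms(3)[of x] x(1) by (cases "x = (\<lambda>_. 0)") (auto simp: chars_def)
  then have "vnorm A (vminus A a b) = 0" using x assms by (simp add: char_minus)
  then show ?thesis using assms by (simp add: norm_eq_zero aclosed minus_eq_zero)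
qed

lemma norm_le_by_chars:
  assumes "a \<in> carrier A" "0 \<le> r" "\<And>x. x \<in> chars A \<Longrightarrow> cmod (x a) \<le> r"
  shows "vnorm A a \<le> r"
proof -
  obtain x where x: "x \<in> chars0 A" "cmod (x a) = vnorm A a"
    using exists_char_norm[OF assms(1)] by blast
  then show ?thesis using assms(2) assms(3)[of x] by (cases "x = (\<lambda>_. 0)") (auto simp: chars_def)
qed

end

section \<open>The Gelfand transform\<close>

lemma open_coordinate_vimage: "open U \<Longrightarrow> open ((\<lambda>h::'a \<Rightarrow> 'b::topological_space. h a) -` U)"
  by (intro open_vimage continuous_on_product_coordinates)

text \<open>Functions carry the topology of pointwise convergence, and a coordinate at which two
  functions differ separates them. The three instances provide closed points and disjoint
  neighbourhoods for characters.\<close>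

instance "fun" :: (type, t0_space) t0_space
proof
  fix f g :: "'a \<Rightarrow> 'b" assume "f \<noteq> g"
  then obtain a where "f a \<noteq> g a" by blast
  from t0_space_class.t0_space[OF this] obtain U where "open U" "(f a \<in> U) \<noteq> (g a \<in> U)"
    by blast
  then show "\<exists>U. open U \<and> \<not> (f \<in> U \<longleftrightarrow> g \<in> U)"
    using open_coordinate_vimage[of U a] by (metis vimage_eq)
qed

instance "fun" :: (type, t1_space) t1_space
proof
  fix f g :: "'a \<Rightarrow> 'b" assume "f \<noteq> g"
  then obtain a where "f a \<noteq> g a" by blast
  from t1_space_class.t1_space[OF this] obtain U where "open U" "f a \<in> U" "g a \<notin> U"
    by blast
  then show "\<exists>U. open U \<and> f \<in> U \<and> g \<notin> U"
    using open_coordinate_vimage[of U a] by (metis vimage_eq)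
qed

instance "fun" :: (type, t2_space) t2_space
proof
  fix f g :: "'a \<Rightarrow> 'b" assume "f \<noteq> g"
  then obtain a where "f a \<noteq> g a" by blast
  from hausdorff[OF this] obtain U V where "open U" "open V" "f a \<in> U" "g a \<in> V" "U \<inter> V = {}"
    by blast
  then show "\<exists>U V. open U \<and> open V \<and> f \<in> U \<and> g \<in> V \<and> U \<inter> V = {}"
    using open_coordinate_vimage[of U a] open_coordinate_vimage[of V a]
    by (intro exI[of _ "(\<lambda>h. h a) -` U"] exI[of _ "(\<lambda>h. h a) -` V"]) auto
qed
lemma continuous_on_eval: "continuous_on S (\<lambda>x::'a \<Rightarrow> 'b::topological_space. x a)"
  by (rule continuous_on_subset[OF continuous_on_product_coordinates]) simp

text \<open>Every ordered pair gets its own disjoint neighbourhoods. \<open>U y\<close> meets both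
  requirements on each pair, as its first and as its second component, so that any two of these sets
  fall into disjoint sets.\<close>

lemma finite_separation:
  fixes F :: "'a::t2_space set"
  assumes "finite F"
  obtains U where "\<And>y. y \<in> F \<Longrightarrow> open (U y) \<and> y \<in> U y"
    "\<And>y z. \<lbrakk>y \<in> F; z \<in> F; y \<noteq> z\<rbrakk> \<Longrightarrow> U y \<inter> U z = {}"
proof -
  have "\<forall>y z :: 'a. \<exists>P Q. y \<noteq> z \<longrightarrow> open P \<and> open Q \<and> y \<in> P \<and> z \<in> Q \<and> P \<inter> Q = {}"
  proof (intro allI)
    fix y z :: 'a
    show "\<exists>P Q. y \<noteq> z \<longrightarrow> open P \<and> open Q \<and> y \<in> P \<and> z \<in> Q \<and> P \<inter> Q = {}"
      by (cases "y = z") (use hausdorff[of y z] in simp_all)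
  qed
  then obtain P Q where V: "\<And>y z :: 'a. y \<noteq> z \<Longrightarrow> open (P y z) \<and> open (Q y z) \<and> y \<in> P y z \<and> z \<in> Q y z \<and>
      P y z \<inter> Q y z = {}"
    by metis
  define U where "U y = (\<Inter>z\<in>F - {y}. P y z \<inter> Q z y)" for y
  show thesis
  proof
    fix y assume "y \<in> F"
    show "open (U y) \<and> y \<in> U y"
    proof -
      have "open (P y z \<inter> Q z y) \<and> y \<in> P y z \<inter> Q z y" if "z \<in> F - {y}" for z
        using V[of y z] V[of z y] that by (auto intro: open_Int)
      then show ?thesis unfolding U_def using assms by (intro conjI open_INT) blast+
    qed
  next
    fix y z assume "y \<in> F" "z \<in> F" "y \<noteq> z"
    then have "U y \<subseteq> P y z" "U z \<subseteq> Q y z" by (auto simp: U_def)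
    then show "U y \<inter> U z = {}" using V[OF \<open>y \<noteq> z\<close>] by blast
  qed
qed

section \<open>Closed ideals and sets of characters\<close>

definition kernel :: "('a, 'm) cstar_scheme \<Rightarrow> ('a \<Rightarrow> complex) set \<Rightarrow> 'a set" where
  "kernel A Y = {a \<in> carrier A. \<forall>x\<in>Y. x a = 0}"

text \<open>The hull of I. Its members will be the characters of the quotient by I.\<close>

definition zeros :: "('a, 'm) cstar_scheme \<Rightarrow> 'a set \<Rightarrow> ('a \<Rightarrow> complex) set" where
  "zeros A I = {x \<in> chars A. \<forall>a\<in>I. x a = 0}"

context complex_normed_space
begin

lemma closed_subspaceD:
  assumes "closed_subspace V M"
  shows "M \<subseteq> carrier V" "\<zero>v \<in> M" "\<lbrakk>x \<in> M; y \<in> M\<rbrakk> \<Longrightarrow> x \<boxplus> y \<in> M" "x \<in> M \<Longrightarrow> c \<boxdot> x \<in> M"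
    "\<lbrakk>x \<in> M; y \<in> M\<rbrakk> \<Longrightarrow> vminus V x y \<in> M"
    "\<lbrakk>range f \<subseteq> M; l \<in> carrier V; converges f l\<rbrakk> \<Longrightarrow> l \<in> M"
  using assms by (auto simp: closed_subspace_def closedin_sequential vminus_def)

lemma closed_subspaceI:
  assumes "M \<subseteq> carrier V" "\<zero>v \<in> M" "\<And>x y. \<lbrakk>x \<in> M; y \<in> M\<rbrakk> \<Longrightarrow> x \<boxplus> y \<in> M"
    "\<And>c x. x \<in> M \<Longrightarrow> c \<boxdot> x \<in> M"
    "\<And>f l. \<lbrakk>range f \<subseteq> M; l \<in> carrier V; converges f l\<rbrakk> \<Longrightarrow> l \<in> M"
  shows "closed_subspace V M"
  using assms by (auto simp: closed_subspace_def closedin_sequential)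

lemma closed_subspace_approx:
  assumes M: "closed_subspace V M" and x: "x \<in> carrier V"
    and ap: "\<And>e. e > 0 \<Longrightarrow> \<exists>y\<in>M. vnorm V (vminus V x y) \<le> e"
  shows "x \<in> M"
proof -
  have "\<exists>y\<in>M. vnorm V (vminus V x y) \<le> 1 / Suc n" for n by (rule ap) simp
  then obtain f where f: "\<And>n. f n \<in> M" "\<And>n. vnorm V (vminus V x (f n)) \<le> 1 / Suc n" by metis
  have fc: "f n \<in> carrier V" for n using f(1) closed_subspaceD(1)[OF M] by blast
  have "converges f x"
    unfolding converges_def
  proof (rule tendsto_sandwich[OF _ _ tendsto_const LIMSEQ_Suc[OF lim_1_over_n]])
    show "\<forall>\<^sub>F n in sequentially. 0 \<le> vnorm V (vminus V (f n) x)"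
      using fc x by (simp add: norm_nonneg minus_closed)
    show "\<forall>\<^sub>F n in sequentially. vnorm V (vminus V (f n) x) \<le> 1 / of_nat (Suc n)"
      using f(2) fc x norm_minus_commute by (intro always_eventually allI) (metis of_nat_Suc)
  qed
  then show ?thesis using closed_subspaceD(6)[OF M _ x, of f] f(1) by blast
qed

end

context cstar_algebra
begin

lemma closed_idealD:
  assumes "closed_ideal A I"
  shows "closed_subspace A I" "I \<subseteq> carrier A" "\<zero>v \<in> I"
    "\<lbrakk>x \<in> I; y \<in> I\<rbrakk> \<Longrightarrow> x \<boxplus> y \<in> I" "x \<in> I \<Longrightarrow> c \<boxdot> x \<in> I" "\<lbrakk>x \<in> I; y \<in> I\<rbrakk> \<Longrightarrow> vminus A x y \<in> I"
    "\<lbrakk>a \<in> carrier A; x \<in> I\<rbrakk> \<Longrightarrow> a \<boxtimes> x \<in> I" "\<lbrakk>a \<in> carrier A; x \<in> I\<rbrakk> \<Longrightarrow> x \<boxtimes> a \<in> I"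
  using assms closed_subspaceD by (auto simp: closed_ideal_def)

lemma closed_ideal_carrier: "closed_ideal A (carrier A)"
  unfolding closed_ideal_def by (auto intro!: closed_subspaceI simp: aclosed)

lemma kernel_closed_ideal:
  assumes "Y \<subseteq> chars0 A" shows "closed_ideal A (kernel A Y)"
proof -
  note Y = subsetD[OF assms]
  have "closed_subspace A (kernel A Y)"
  proof (rule closed_subspaceI)
    fix f l assume f: "range f \<subseteq> kernel A Y" and l: "l \<in> carrier A" and c: "converges f l"
    have fc: "f n \<in> carrier A" for n using f by (auto simp: kernel_def)
    have "x l = 0" if x: "x \<in> Y" for x
    proof -
      have "cmod (x l) \<le> vnorm A (vminus A (f n) l)" for n
      proof -
        have "x (f n) = 0" using f x by (auto simp: kernel_def)
        then show ?thesis
          using char_bound[OF Y[OF x], of "vminus A (f n) l"] fc[of n] l x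
          by (simp add: char_minus Y aclosed)
      qed
      then have "cmod (x l) \<le> 0" using c unfolding converges_def by (intro LIMSEQ_le_const) auto
      then show ?thesis by simp
    qed
    then show "l \<in> kernel A Y" using l by (simp add: kernel_def)
  qed (auto simp: kernel_def char_simps Y aclosed)
  then show ?thesis
    by (auto simp: closed_ideal_def kernel_def char_simps Y aclosed)
qed

end

section \<open>The algebra as functions vanishing at infinity\<close>

context abelian_cstar_algebra
begin

text \<open>By \<open>char_bound\<close> the set lies in the product of the discs of radius
  \<open>vnorm A a\<close>, which is compact by Tychonoff. Each defining equation involves finitely
  many coordinates and is therefore a closed condition.\<close>

lemma compact_chars0: "compact (chars0 A)"
proof -
  let ?B = "PiE UNIV (\<lambda>a. cball 0 (if a \<in> carrier A then vnorm A a else 0) :: complex set)"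
  have "compactin (product_topology (\<lambda>_. euclidean) UNIV) ?B"
    unfolding compactin_PiE by (auto simp: compactin_euclidean_iff)
  then have B: "compact ?B" by (simp add: euclidean_product_topology compactin_euclidean_iff)
  have sub: "chars0 A \<subseteq> ?B" using char_bound chars0D(1) by fastforce
  have eq: "chars0 A = (\<Inter>a\<in>-carrier A. {x. x a = 0}) \<inter>
      (\<Inter>a\<in>carrier A. \<Inter>b\<in>carrier A. {x. x (a \<boxplus> b) = x a + x b}) \<inter>
      (\<Inter>a\<in>carrier A. \<Inter>b\<in>carrier A. {x. x (a \<boxtimes> b) = x a * x b}) \<inter>
      (\<Inter>c. \<Inter>a\<in>carrier A. {x. x (c \<boxdot> a) = c * x a}) \<inter>
      (\<Inter>a\<in>carrier A. {x. x (astar A a) = cnj (x a)})"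
    by (auto simp: chars0_def)
  have "closed (chars0 A)"
    unfolding eq
    by (intro closed_Int closed_INT ballI closed_Collect_eq continuous_intros continuous_on_eval)
  then show ?thesis using compact_Int_closed[OF B] sub by (metis inf.absorb2)
qed

lemma self_adjoint_char_real:
  "\<lbrakk>x \<in> chars0 A; a \<in> carrier A; astar A a = a\<rbrakk> \<Longrightarrow> of_real (Re (x a)) = x a"
  using chars0D(5)[of x A a] by (simp add: complex_eq_iff)

text \<open>The norm is bounded by the supremum over the characters, so uniform approximants of f
  form a Cauchy sequence in the algebra, and their limit represents f.\<close>

lemma gelfand_limit:
  assumes ap: "\<And>e. e > 0 \<Longrightarrow> \<exists>a\<in>carrier A. \<forall>x\<in>chars0 A. cmod (x a - f x) \<le> e"
  shows "\<exists>a\<in>carrier A. \<forall>x\<in>chars0 A. x a = f x"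
proof -
  have "\<exists>a\<in>carrier A. \<forall>x\<in>chars0 A. cmod (x a - f x) \<le> 1 / Suc n" for n by (rule ap) simp
  then obtain s where s: "\<And>n. s n \<in> carrier A" 
    and sf: "\<And>n x. x \<in> chars0 A \<Longrightarrow> cmod (x (s n) - f x) \<le> 1 / Suc n" by metis
  have lim: "(\<lambda>n. 1 / real (Suc n)) \<longlonglongrightarrow> 0" by (rule LIMSEQ_Suc[OF lim_1_over_n])
  have "cauchy_seq s"
    unfolding cauchy_seq_def
  proof (intro allI impI)
    fix e :: real assume "e > 0"
    then obtain N where N: "\<And>n. n \<ge> N \<Longrightarrow> 1 / real (Suc n) < e / 2"
      using order_tendstoD(2)[OF lim, of "e / 2"] by (auto simp: eventually_sequentially)
    have "vnorm A (vminus A (s m) (s n)) < e" if "m \<ge> N" "n \<ge> N" for m n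
    proof -
      have "vnorm A (vminus A (s m) (s n)) \<le> 1 / real (Suc m) + 1 / real (Suc n)"
      proof (rule norm_le_by_chars)
        fix x assume "x \<in> chars A"
        then have x: "x \<in> chars0 A" by (rule chars_subset)
        have "cmod (x (s m) - x (s n)) \<le> cmod (x (s m) - f x) + cmod (x (s n) - f x)"
          by (metis norm_minus_commute norm_triangle_sub add.commute diff_add_cancel norm_triangle_ineq4 diff_diff_eq2)
        then show "cmod (x (vminus A (s m) (s n))) \<le> 1 / real (Suc m) + 1 / real (Suc n)"
          using sf[OF x, of m] sf[OF x, of n] x s by (simp add: char_minus)
      qed (simp_all add: aclosed s)
      then show ?thesis using N[OF that(1)] N[OF that(2)] by simp
    qed
    then show "\<exists>N. \<forall>m\<ge>N. \<forall>n\<ge>N. vnorm A (vminus A (s m) (s n)) < e" by blast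
  qed
  then obtain a where a: "a \<in> carrier A" "converges s a"
    using complete s unfolding mcomplete_iff by blast
  have "x a = f x" if x: "x \<in> chars0 A" for x
  proof -
    have "(\<lambda>n. x (s n) - x a) \<longlonglongrightarrow> 0"
    proof (rule Lim_null_comparison[OF always_eventually a(2)[unfolded converges_def]], rule allI)
      show "cmod (x (s n) - x a) \<le> vnorm A (vminus A (s n) a)" for n
        using char_bound[OF x, of "vminus A (s n) a"] s a x by (simp add: char_minus aclosed)
    qed
    moreover have "(\<lambda>n. x (s n) - f x) \<longlonglongrightarrow> 0"
      by (rule Lim_null_comparison[OF always_eventually lim]) (use sf[OF x] in blast)
    ultimately have "(\<lambda>n. (x (s n) - f x) - (x (s n) - x a)) \<longlonglongrightarrow> 0 - 0" by (rule tendsto_diff[rotated])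
    then show ?thesis by (simp add: LIMSEQ_const_iff)
  qed
  then show ?thesis using a by blast
qed

text \<open>Stone-Weierstrass needs constants, which the algebra may lack. They are adjoined to the
  real parts of self-adjoint elements and dropped at the end: since f vanishes at the zero
  character, the constant of a close approximant is small.\<close>

lemma gelfand_surj_real:
  fixes f :: "('a \<Rightarrow> complex) \<Rightarrow> real"
  assumes cont: "continuous_on (chars0 A) f" and f0: "f (\<lambda>_. 0) = 0"
  shows "\<exists>a\<in>carrier A. \<forall>x\<in>chars0 A. x a = of_real (f x)"
proof (rule gelfand_limit)
  define R where "R = {g. \<exists>a c. a \<in> carrier A \<and> astar A a = a \<and> (\<forall>x\<in>chars0 A. g x = Re (x a) + c)}"
  interpret function_ring_on R "chars0 A"
  proof
    show "compact (chars0 A)" by (rule compact_chars0)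
    show "continuous_on (chars0 A) g" if gR: "g \<in> R" for g
    proof -
      obtain a c where "\<forall>x\<in>chars0 A. g x = Re (x a) + c" using gR unfolding R_def by blast
      moreover have "continuous_on (chars0 A) (\<lambda>x. Re (x a) + c)"
        by (intro continuous_intros continuous_on_eval)
      ultimately show ?thesis by (metis (no_types, lifting) continuous_on_cong)
    qed
    show "(\<lambda>_. c) \<in> R" for c
      unfolding R_def by (auto intro!: exI[of _ "\<zero>v"] exI[of _ c] simp: aclosed char_zero)
    show "\<exists>f\<in>R. f x \<noteq> f y" if xy: "x \<in> chars0 A" "y \<in> chars0 A" "x \<noteq> y" for x y
    proof -
      obtain a where a: "x a \<noteq> y a" using xy(3) by blast
      then have ac: "a \<in> carrier A" using chars0D(1) xy by metis
      have R: "(\<lambda>x. Re (x h)) \<in> R" if "h \<in> carrier A" "astar A h = h" for h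
        unfolding R_def using that by (auto intro!: exI[of _ h] exI[of _ 0])
      have "(\<lambda>x. Re (x (a \<boxplus> astar A a))) \<in> R"
        by (rule R) (simp_all add: aclosed ac self_adjoint_re)
      moreover have "(\<lambda>x. Re (x (\<i> \<boxdot> vminus A a (astar A a)))) \<in> R"
        by (rule R) (simp_all add: aclosed ac self_adjoint_im)
      moreover have "Re (x a) \<noteq> Re (y a) \<or> Im (x a) \<noteq> Im (y a)" using a complex_eq_iff by blast
      ultimately show ?thesis using xy ac by (fastforce simp: char_simps aclosed)
    qed
    fix g h assume "g \<in> R" "h \<in> R"
    then obtain a c b d where a: "a \<in> carrier A" "astar A a = a" "\<And>x. x \<in> chars0 A \<Longrightarrow> g x = Re (x a) + c"
      and b: "b \<in> carrier A" "astar A b = b" "\<And>x. x \<in> chars0 A \<Longrightarrow> h x = Re (x b) + d"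
      unfolding R_def by blast
    show "(\<lambda>x. g x + h x) \<in> R"
      unfolding R_def using a b
      by (auto intro!: exI[of _ "a \<boxplus> b"] exI[of _ "c + d"] simp: char_simps aclosed star_add)
    \<comment> \<open>The product of a + c and b + d splits into this element and the constant c
      d.\<close>
    define e where "e = a \<boxtimes> b \<boxplus> (of_real d \<boxdot> a \<boxplus> of_real c \<boxdot> b)"
    have e: "e \<in> carrier A" "astar A e = e"
      using a b by (simp_all add: e_def aclosed star_add star_mult star_scale mult_comm)
    moreover have "g x * h x = Re (x e) + c * d" if x: "x \<in> chars0 A" for x
    proof -
      have "Im (x a) = 0" "Im (x b) = 0"
        using self_adjoint_char_real[OF x] a b by (metis Im_complex_of_real)+
      then show ?thesis using x a b by (simp add: e_def char_simps aclosed algebra_simps)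
    qed
    ultimately show "(\<lambda>x. g x * h x) \<in> R" unfolding R_def by blast
  qed
  fix e :: real assume "e > 0"
  then obtain g where g: "g \<in> R" "\<And>x. x \<in> chars0 A \<Longrightarrow> \<bar>f x - g x\<bar> < e / 2"
    using Stone_Weierstrass_basic[OF cont, of "e / 2"] by auto
  then obtain a c where a: "a \<in> carrier A" "astar A a = a" "\<And>x. x \<in> chars0 A \<Longrightarrow> g x = Re (x a) + c"
    unfolding R_def by blast
  \<comment> \<open>At the zero character the approximant equals c and f equals 0. Discarding c
    therefore costs at most e / 2.\<close>
  have c: "\<bar>c\<bar> < e / 2" using g(2)[OF zero_char] a(3)[OF zero_char] f0 by simp
  have "cmod (x a - of_real (f x)) \<le> e" if x: "x \<in> chars0 A" for x
  proof -
    have "x a - of_real (f x) = of_real (Re (x a) - f x)"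
      using self_adjoint_char_real[OF x a(1,2)] by simp
    moreover have "\<bar>Re (x a) - f x\<bar> \<le> e" using g(2)[OF x] a(3)[OF x] c by linarith
    ultimately show ?thesis by (simp only: norm_of_real)
  qed
  then show "\<exists>a\<in>carrier A. \<forall>x\<in>chars0 A. cmod (x a - of_real (f x)) \<le> e" using a by blast
qed

lemma gelfand_surj:
  assumes cont: "continuous_on (chars0 A) f" and f0: "f (\<lambda>_. 0) = 0"
  obtains a where "a \<in> carrier A" "\<And>x. x \<in> chars0 A \<Longrightarrow> x a = f x"
proof -
  obtain a where a: "a \<in> carrier A" "\<forall>x\<in>chars0 A. x a = of_real (Re (f x))"
    using gelfand_surj_real[of "\<lambda>x. Re (f x)"] cont f0 by (auto intro: continuous_intros)
  obtain b where b: "b \<in> carrier A" "\<forall>x\<in>chars0 A. x b = of_real (Im (f x))"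
    using gelfand_surj_real[of "\<lambda>x. Im (f x)"] cont f0 by (auto intro: continuous_intros)
  show thesis
    by (rule that[of "a \<boxplus> \<i> \<boxdot> b"]) (use a b in \<open>simp_all add: aclosed char_simps complex_eq_iff\<close>)
qed

text \<open>The point at infinity is put into the closed set on which Urysohn's function vanishes.
  The function thus vanishes at the zero character and comes from an element of the algebra.\<close>

lemma char_urysohn:
  assumes x0: "x0 \<in> chars A" and U: "open U" "x0 \<in> U"
  obtains a where "a \<in> carrier A" "x0 a = 1" "\<And>x. \<lbrakk>x \<in> chars0 A; x \<notin> U\<rbrakk> \<Longrightarrow> x a = 0"
    "\<And>x. x \<in> chars0 A \<Longrightarrow> \<exists>r. 0 \<le> r \<and> r \<le> 1 \<and> x a = of_real r"
proof -
  have x0': "x0 \<in> chars0 A" "x0 \<noteq> (\<lambda>_. 0)" using x0 by (auto simp: chars_def)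
  let ?X = "top_of_set (chars0 A)"
  have "compact_space ?X" using compact_chars0 by (simp add: compact_space_subtopology compactin_euclidean_iff)
  moreover have "Hausdorff_space ?X"
    by (intro Hausdorff_space_subtopology) (simp add: Hausdorff_space_def disjnt_def, metis hausdorff)
  ultimately have "normal_space ?X" using compact_Hausdorff_or_regular_imp_normal_space by blast
  moreover have "closedin ?X (chars0 A \<inter> (- U \<union> {\<lambda>_. 0}))"
    using U by (intro closedin_closed_Int closed_Un) auto
  moreover have "closedin ?X {x0}" using closedin_closed_Int[of "{x0}" "chars0 A"] x0' by auto
  moreover have "disjnt (chars0 A \<inter> (- U \<union> {\<lambda>_. 0})) {x0}" using U x0' by (auto simp: disjnt_def)
  ultimately obtain f where f: "continuous_map ?X (top_of_set {0..1::real}) f"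
    "f ` (chars0 A \<inter> (- U \<union> {\<lambda>_. 0})) \<subseteq> {0}" "f ` {x0} \<subseteq> {1}"
    using Urysohn_lemma[of ?X _ _ 0 1] by (metis zero_le_one)
  then have fc: "continuous_on (chars0 A) f" and f01: "\<And>x. x \<in> chars0 A \<Longrightarrow> 0 \<le> f x \<and> f x \<le> 1"
    by (auto simp: continuous_map_in_subtopology)
  have "f (\<lambda>_. 0) = 0" using f(2) zero_char by auto
  then obtain a where a: "a \<in> carrier A" "\<And>x. x \<in> chars0 A \<Longrightarrow> x a = of_real (f x)"
    using gelfand_surj_real[OF fc] by blast
  show thesis
  proof (rule that[OF a(1)])
    show "x0 a = 1" using a(2)[OF x0'(1)] f(3) by simp
    show "x a = 0" if "x \<in> chars0 A" "x \<notin> U" for x using a(2)[OF that(1)] f(2) that by auto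
    show "\<exists>r. 0 \<le> r \<and> r \<le> 1 \<and> x a = of_real r" if "x \<in> chars0 A" for x
      using a(2)[OF that] f01[OF that] by blast
  qed
qed

text \<open>The set K where |x(a)| \<ge> e is compact and avoids the hull of I. Finitely many
  members of I give a non-negative s in I with s \<ge> \<delta> > 0 on K. Dividing a by max(s,
  \<delta>) and multiplying back by s changes nothing on K and elsewhere only shrinks values of
  modulus below e, so a is a limit of elements of I.\<close>

lemma nullstellensatz:
  assumes I: "closed_ideal A I" and a: "a \<in> carrier A" and van: "\<And>x. x \<in> zeros A I \<Longrightarrow> x a = 0"
  shows "a \<in> I"
proof (rule closed_subspace_approx[OF closed_idealD(1)[OF I] a])
  fix e :: real assume e: "e > 0"
  define K where "K = chars0 A \<inter> {x. e \<le> cmod (x a)}"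
  have "compact K"
    unfolding K_def
    by (intro compact_Int_closed compact_chars0 closed_Collect_le continuous_intros continuous_on_eval)
  have "\<exists>g\<in>I. x g \<noteq> 0" if x: "x \<in> K" for x
  proof -
    have "x a \<noteq> 0" "x \<in> chars0 A" using x e by (auto simp: K_def)
    then have "x \<in> chars A" by (auto simp: chars_def)
    then show ?thesis using van[of x] \<open>x a \<noteq> 0\<close> unfolding zeros_def by blast
  qed
  then have cov: "K \<subseteq> (\<Union>g\<in>I. {x. x g \<noteq> 0})" by blast
  have opn: "open {x::'a \<Rightarrow> complex. x g \<noteq> 0}" for g
    by (intro open_Collect_neq continuous_on_eval continuous_intros)
  obtain D where D: "D \<subseteq> I" "finite D" "K \<subseteq> (\<Union>g\<in>D. {x. x g \<noteq> 0})"
    by (rule compactE_image[OF \<open>compact K\<close> opn cov]) blast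
  \<comment> \<open>The finite subcover is condensed into the single element s, the sum of the
    products g*g. It is positive wherever some g does not vanish.\<close>
  have "\<exists>s\<in>I. \<forall>x\<in>chars0 A. x s = of_real (\<Sum>g\<in>D. (cmod (x g))\<^sup>2)" using D(2,1)
  proof (induction D rule: finite_induct)
    case empty
    then show ?case using closed_idealD(3)[OF I] char_zero by auto
  next
    case (insert g D)
    then obtain s where s: "s \<in> I" "\<forall>x\<in>chars0 A. x s = of_real (\<Sum>g\<in>D. (cmod (x g))\<^sup>2)" by blast
    have g: "g \<in> I" "g \<in> carrier A" "s \<in> carrier A" using insert s closed_idealD(2)[OF I] by auto
    have "x (astar A g \<boxtimes> g \<boxplus> s) = of_real (\<Sum>g\<in>insert g D. (cmod (x g))\<^sup>2)" if x: "x \<in> chars0 A" for x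
      using x s(2) g insert.hyps complex_norm_square[of "x g"]
      by (simp add: char_simps aclosed mult.commute)
    moreover have "astar A g \<boxtimes> g \<boxplus> s \<in> I"
      using g s by (intro closed_idealD[OF I]) (simp_all add: aclosed)
    ultimately show ?case by blast
  qed
  then obtain s where s: "s \<in> I" "\<And>x. x \<in> chars0 A \<Longrightarrow> x s = of_real (\<Sum>g\<in>D. (cmod (x g))\<^sup>2)" by blast
  have sc: "s \<in> carrier A" using s closed_idealD(2)[OF I] by blast
  have s0: "0 \<le> Re (x s)" "of_real (Re (x s)) = x s" if "x \<in> chars0 A" for x
    using s(2)[OF that] by (simp_all add: sum_nonneg)
  have sK: "0 < Re (x s)" if x: "x \<in> K" for x
  proof -
    obtain g where "g \<in> D" "x g \<noteq> 0" using D(3) x by blast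
    then have "0 < (\<Sum>g\<in>D. (cmod (x g))\<^sup>2)" using D(2) by (intro sum_pos2[of _ g]) auto
    then show ?thesis using s(2)[of x] x by (simp add: K_def)
  qed
  obtain \<delta> where \<delta>: "\<delta> > 0" "\<And>x. x \<in> K \<Longrightarrow> \<delta> \<le> Re (x s)"
  proof (cases "K = {}")
    case True
    then show ?thesis using that[of 1] by auto
  next
    case False
    obtain x1 where x1: "x1 \<in> K" "\<forall>x\<in>K. Re (x1 s) \<le> Re (x s)"
      using continuous_attains_inf[OF \<open>compact K\<close> False continuous_on_Re[OF continuous_on_eval]] by blast
    then show ?thesis using that[of "Re (x1 s)"] sK by blast
  qed
  define f where "f x = x a / of_real (max (Re (x s)) \<delta>)" for x :: "'a \<Rightarrow> complex"
  have mx: "max (Re (x s)) \<delta> > 0" for x using \<delta>(1) by linarith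
  have "complex_of_real (max (Re (x s)) \<delta>) \<noteq> 0" for x
    using mx[of x] by (metis of_real_eq_0_iff less_irrefl)
  then have "continuous_on (chars0 A) f"
    unfolding f_def by (intro continuous_intros continuous_on_eval) blast
  then obtain b where b: "b \<in> carrier A" "\<And>x. x \<in> chars0 A \<Longrightarrow> x b = f x"
    using gelfand_surj[of f] by (auto simp: f_def)
  have "vnorm A (vminus A a (s \<boxtimes> b)) \<le> e"
  proof (rule norm_le_by_chars)
    fix x assume "x \<in> chars A"
    then have x: "x \<in> chars0 A" by (rule chars_subset)
    define r where "r = Re (x s) / max (Re (x s)) \<delta>"
    have r: "0 \<le> r" "r \<le> 1" using s0[OF x] mx[of x] by (simp_all add: r_def)
    have "x (s \<boxtimes> b) = x a * of_real r"
      using x sc b(1) b(2)[OF x] s0(2)[OF x] by (simp add: char_simps f_def r_def)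
    then have "x (vminus A a (s \<boxtimes> b)) = x a * of_real (1 - r)"
      using x a sc b(1) by (simp add: char_minus aclosed algebra_simps)
    then have eq: "cmod (x (vminus A a (s \<boxtimes> b))) = cmod (x a) * (1 - r)"
      using r by (simp only: Real_Vector_Spaces.norm_mult norm_of_real)
    show "cmod (x (vminus A a (s \<boxtimes> b))) \<le> e"
    proof (cases "x \<in> K")
      case True
      then have "r = 1" using \<delta> sK by (fastforce simp: r_def max_def)
      then show ?thesis using eq e by simp
    next
      case False
      then have "cmod (x a) \<le> e" using x by (simp add: K_def)
      then show ?thesis using eq e r mult_mono[of "cmod (x a)" e "1 - r" 1] by simp
    qed
  qed (use a sc b e in \<open>simp_all add: aclosed\<close>)
  then show "\<exists>y\<in>I. vnorm A (vminus A a y) \<le> e" using closed_idealD(8)[OF I b(1) s(1)] by blast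
qed

text \<open>Vanishing on the hull is stable under conjugation, and it characterises membership in a
  closed ideal.\<close>

lemma closed_ideal_star:
  assumes I: "closed_ideal A I" and a: "a \<in> I" shows "astar A a \<in> I"
proof (rule nullstellensatz[OF I])
  have ac: "a \<in> carrier A" using closed_idealD(2)[OF I] a by blast
  then show "astar A a \<in> carrier A" by (rule star_closed)
  show "x (astar A a) = 0" if "x \<in> zeros A I" for x
    using that a ac chars0D(5)[of x A a] by (simp add: zeros_def chars_subset)
qed

lemma kernel_zeros:
  assumes I: "closed_ideal A I" shows "kernel A (zeros A I) = I"
proof
  show "kernel A (zeros A I) \<subseteq> I" using nullstellensatz[OF I] by (simp add: kernel_def subset_iff)
  show "I \<subseteq> kernel A (zeros A I)" using closed_idealD(2)[OF I] by (auto simp: kernel_def zeros_def)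
qed

lemma closedin_zeros: "closedin (top_of_set (chars A)) (zeros A I)"
proof -
  have "zeros A I = chars A \<inter> (\<Inter>a\<in>I. {x. x a = 0})" by (auto simp: zeros_def)
  then show ?thesis
    by (auto intro!: closedin_closed_Int closed_INT closed_Collect_eq continuous_intros continuous_on_eval)
qed

text \<open>A character outside a closed set is separated from it by an element that takes the value
  1 there and vanishes on the set.\<close>

lemma zeros_kernel:
  assumes "closedin (top_of_set (chars A)) Y" shows "zeros A (kernel A Y) = Y"
proof
  have Y: "Y \<subseteq> chars A" using closedin_subset[OF assms] by simp
  then show "Y \<subseteq> zeros A (kernel A Y)" by (auto simp: zeros_def kernel_def)
  show "zeros A (kernel A Y) \<subseteq> Y"
  proof
    fix x assume x: "x \<in> zeros A (kernel A Y)"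
    then have xc: "x \<in> chars A" by (simp add: zeros_def)
    obtain T where T: "closed T" "Y = chars A \<inter> T" using assms by (auto simp: closedin_closed)
    show "x \<in> Y"
    proof (rule ccontr)
      assume "x \<notin> Y"
      then have "x \<in> - T" "open (- T)" using T xc by auto
      obtain a where a: "a \<in> carrier A" "x a = 1" "\<And>x. \<lbrakk>x \<in> chars0 A; x \<notin> - T\<rbrakk> \<Longrightarrow> x a = 0"
        by (rule char_urysohn[OF xc \<open>open (- T)\<close> \<open>x \<in> - T\<close>]) blast
      have "y a = 0" if "y \<in> Y" for y using a(3)[of y] that T by (auto simp: chars_subset)
      then have "a \<in> kernel A Y" using a(1) by (simp add: kernel_def)
      then have "x a = 0" using x by (simp add: zeros_def)
      then show False using a(2) by simp
    qed
  qed
qed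

lemma closure_of_chars:
  assumes "D \<subseteq> chars A"
  shows "top_of_set (chars A) closure_of D = zeros A (kernel A D)"
proof (rule closure_of_unique)
  show "D \<subseteq> zeros A (kernel A D)" using assms by (auto simp: zeros_def kernel_def)
  show "closedin (top_of_set (chars A)) (zeros A (kernel A D))" by (rule closedin_zeros)
  fix T assume T: "D \<subseteq> T" "closedin (top_of_set (chars A)) T"
  have "zeros A (kernel A D) \<subseteq> zeros A (kernel A T)" using T(1) by (auto simp: zeros_def kernel_def)
  then show "zeros A (kernel A D) \<subseteq> T" using zeros_kernel[OF T(2)] by simp
qed

end

section \<open>The spectrum of an abelian C*-algebra\<close>

definition rep_char :: "('a, 'm) cstar_scheme \<Rightarrow> 'a rep \<Rightarrow> ('a \<Rightarrow> complex) \<Rightarrow> bool" where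
  "rep_char A \<rho> x \<longleftrightarrow> x \<in> chars A \<and>
     (\<forall>a\<in>carrier A. \<forall>\<xi>\<in>carrier (fst \<rho>). snd \<rho> a \<xi> = x a \<boxdot>\<^bsub>fst \<rho>\<^esub> \<xi>)"

definition rep_class :: "('a, 'm) cstar_scheme \<Rightarrow> ('a \<Rightarrow> complex) \<Rightarrow> 'a rep set" where
  "rep_class A x = {\<rho>. irreducible_rep A \<rho> \<and> rep_char A \<rho> x}"

lemma representationD:
  assumes "representation A (H, \<pi>)"
  shows "hilbert_space H"
    and "b \<in> carrier A \<Longrightarrow> bounded_linear_map H H (\<pi> b)"
    and "\<lbrakk>b \<in> carrier A; \<eta> \<in> carrier H\<rbrakk> \<Longrightarrow> \<pi> b \<eta> \<in> carrier H"
    and "\<lbrakk>b \<in> carrier A; \<eta> \<in> carrier H; \<zeta> \<in> carrier H\<rbrakk>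
      \<Longrightarrow> \<pi> b (\<eta> \<boxplus>\<^bsub>H\<^esub> \<zeta>) = \<pi> b \<eta> \<boxplus>\<^bsub>H\<^esub> \<pi> b \<zeta>"
    and "\<lbrakk>b \<in> carrier A; \<eta> \<in> carrier H\<rbrakk> \<Longrightarrow> \<pi> b (k \<boxdot>\<^bsub>H\<^esub> \<eta>) = k \<boxdot>\<^bsub>H\<^esub> \<pi> b \<eta>"
    and "\<lbrakk>b \<in> carrier A; c \<in> carrier A; \<eta> \<in> carrier H\<rbrakk> \<Longrightarrow> \<pi> (b \<boxtimes>\<^bsub>A\<^esub> c) \<eta> = \<pi> b (\<pi> c \<eta>)"
    and "\<lbrakk>b \<in> carrier A; c \<in> carrier A; \<eta> \<in> carrier H\<rbrakk>
      \<Longrightarrow> \<pi> (b \<boxplus>\<^bsub>A\<^esub> c) \<eta> = \<pi> b \<eta> \<boxplus>\<^bsub>H\<^esub> \<pi> c \<eta>"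
    and "\<lbrakk>b \<in> carrier A; \<eta> \<in> carrier H\<rbrakk> \<Longrightarrow> \<pi> (k \<boxdot>\<^bsub>A\<^esub> b) \<eta> = k \<boxdot>\<^bsub>H\<^esub> \<pi> b \<eta>"
    and "\<lbrakk>b \<in> carrier A; \<eta> \<in> carrier H; \<zeta> \<in> carrier H\<rbrakk>
      \<Longrightarrow> hinner H (\<pi> b \<eta>) \<zeta> = hinner H \<eta> (\<pi> (astar A b) \<zeta>)"
  using assms by (auto simp: representation_def bounded_linear_map_def linear_map_def Pi_iff)

section \<open>Irreducible representations are one-dimensional\<close>

context hilbert_space
begin

lemma inner_add_right:
  "\<lbrakk>x \<in> carrier H; y \<in> carrier H; z \<in> carrier H\<rbrakk> \<Longrightarrow> hinner H z (x \<boxplus> y) = hinner H z x + hinner H z y"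
  using inner_commute[of "x \<boxplus> y" z] inner_commute[of x z] inner_commute[of y z] inner_add[of x y z]
  by (simp add: vclosed)

lemma inner_scale_right:
  "\<lbrakk>x \<in> carrier H; z \<in> carrier H\<rbrakk> \<Longrightarrow> hinner H z (c \<boxdot> x) = cnj c * hinner H z x"
  using inner_commute[of "c \<boxdot> x" z] inner_commute[of x z] inner_scale[of x z c] by (simp add: vclosed)

end

context complex_banach_space
begin

text \<open>Scalar multiples of v differ in norm by |c - d| times the norm of v, so a convergent
  sequence on the line has Cauchy coefficients. Irreducibility can then be applied to lines.\<close>

lemma line_closed_subspace:
  assumes v: "v \<in> carrier V"
  shows "closed_subspace V ((\<lambda>c. c \<boxdot> v) ` UNIV)"
proof (cases "v = \<zero>v")
  case True
  then have eq: "(\<lambda>c. c \<boxdot> v) ` UNIV = {\<zero>v}" by auto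
  show ?thesis unfolding eq
  proof (rule closed_subspaceI)
    fix f l assume f: "range f \<subseteq> {\<zero>v}" "l \<in> carrier V" "converges f l"
    then have "f = (\<lambda>_. \<zero>v)" by auto
    then have "vnorm V (vminus V \<zero>v l) = 0" using f(3) by (simp add: converges_def LIMSEQ_const_iff)
    then show "l \<in> {\<zero>v}" using f(2) by (simp add: norm_eq_zero vclosed minus_eq_zero)
  qed (auto simp: vclosed add_zero)
next
  case False
  then have nv: "vnorm V v > 0" using norm_nonneg[OF v] norm_eq_zero[OF v] by linarith
  have diff: "vminus V (c \<boxdot> v) (d \<boxdot> v) = (c - d) \<boxdot> v" for c d
    using scale_add_left[OF v, of c "-d"] scale_scale[OF v, of "-1" d] by (simp add: vminus_def)
  show ?thesis
  proof (rule closed_subspaceI)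
    fix f l assume f: "range f \<subseteq> (\<lambda>c. c \<boxdot> v) ` UNIV" and l: "l \<in> carrier V" and conv: "converges f l"
    then have "\<forall>n. \<exists>c. f n = c \<boxdot> v" by blast
    then obtain c where c: "\<And>n. f n = c n \<boxdot> v" by metis
    have fc: "f n \<in> carrier V" for n by (simp add: c vclosed v)
    have "Cauchy c"
    proof (rule metric_CauchyI)
      fix e :: real assume "e > 0"
      then have pos: "e * vnorm V v / 2 > 0" using nv by simp
      obtain N where N: "\<And>n. n \<ge> N \<Longrightarrow> vnorm V (vminus V (f n) l) < e * vnorm V v / 2"
        using order_tendstoD(2)[OF conv[unfolded converges_def] pos] unfolding eventually_sequentially by blast
      have "dist (c m) (c n) < e" if "m \<ge> N" "n \<ge> N" for m n
      proof -
        have "vnorm V (vminus V (f m) (f n)) < e * vnorm V v"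
          using norm_minus_triangle[OF fc l fc, of m n] N[OF that(1)] N[OF that(2)]
            norm_minus_commute[OF l fc, of n] by linarith
        then show ?thesis using nv by (simp add: c diff norm_scale v dist_norm)
      qed
      then show "\<exists>M. \<forall>m\<ge>M. \<forall>n\<ge>M. dist (c m) (c n) < e" by blast
    qed
    then obtain d where d: "c \<longlonglongrightarrow> d" using Cauchy_convergent convergent_def by blast
    have "vnorm V (vminus V l (d \<boxdot> v)) \<le> 0 + 0 * vnorm V v"
    proof (rule LIMSEQ_le_const)
      show "(\<lambda>n. vnorm V (vminus V (f n) l) + cmod (c n - d) * vnorm V v) \<longlonglongrightarrow> 0 + 0 * vnorm V v"
        using conv d unfolding converges_def
        by (intro tendsto_intros tendsto_norm_zero LIM_zero)
      have "vnorm V (vminus V l (d \<boxdot> v)) \<le> vnorm V (vminus V (f n) l) + cmod (c n - d) * vnorm V v" for n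
        using norm_minus_triangle[OF l fc, of "d \<boxdot> v" n] norm_minus_commute[OF l fc, of n] v
        by (simp add: vclosed c diff norm_scale)
      then show "\<exists>N. \<forall>n\<ge>N. vnorm V (vminus V l (d \<boxdot> v))
          \<le> vnorm V (vminus V (f n) l) + cmod (c n - d) * vnorm V v" by blast
    qed
    then have "l = d \<boxdot> v"
      using norm_nonneg[of "vminus V l (d \<boxdot> v)"] norm_eq_zero[of "vminus V l (d \<boxdot> v)"] l v
      by (simp add: vclosed minus_eq_zero)
    then show "l \<in> (\<lambda>c. c \<boxdot> v) ` UNIV" by blast
  next
    show "\<zero>v \<in> (\<lambda>c. c \<boxdot> v) ` UNIV" using image_eqI[of "\<zero>v" "\<lambda>c. c \<boxdot> v" 0 UNIV] v by simp
  qed (auto simp: vclosed v simp flip: scale_add_left scale_scale)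
qed

end

context abelian_cstar_algebra
begin

text \<open>With r the norm of a, the element r^2 v*v minus the square of the modulus of a v equals
  w*w for w = sqrt(r^2 - |a|^2) v. The factor v makes w vanish at infinity, so that w exists in the
  algebra. For this reason the estimate is stated on vectors \<pi>(v)\<xi>.\<close>

lemma rep_contractive:
  assumes rep: "representation A (H, \<pi>)" and a: "a \<in> carrier A" and v: "v \<in> carrier A" and \<xi>: "\<xi> \<in> carrier H"
  shows "vnorm H (\<pi> a (\<pi> v \<xi>)) \<le> vnorm A a * vnorm H (\<pi> v \<xi>)"
proof -
  interpret H: hilbert_space H using rep by (simp add: representation_def)
  note cl = representationD(3)[OF rep] and ladd = representationD(4)[OF rep] and lscl = representationD(5)[OF rep]
    and mul = representationD(6)[OF rep] and add = representationD(7)[OF rep] and scl = representationD(8)[OF rep]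
    and adj = representationD(9)[OF rep]
  have sq: "hinner H \<xi> (\<pi> (astar A b \<boxtimes> b) \<xi>) = of_real ((vnorm H (\<pi> b \<xi>))\<^sup>2)" if "b \<in> carrier A" for b
    using that \<xi> by (simp add: mul adj[symmetric] cl aclosed H.inner_self)
  define r where "r = vnorm A a"
  have r: "0 \<le> r" by (simp add: r_def norm_nonneg a)
  define f where "f x = of_real (sqrt \<bar>r\<^sup>2 - (cmod (x a))\<^sup>2\<bar>) * x v" for x :: "'a \<Rightarrow> complex"
  have "continuous_on (chars0 A) f"
    unfolding f_def by (intro continuous_intros continuous_on_eval)
  then obtain w where w: "w \<in> carrier A" "\<And>x. x \<in> chars0 A \<Longrightarrow> x w = f x"
    using gelfand_surj[of f] by (auto simp: f_def)
  have "astar A w \<boxtimes> w \<boxplus> astar A (a \<boxtimes> v) \<boxtimes> (a \<boxtimes> v) = of_real (r\<^sup>2) \<boxdot> (astar A v \<boxtimes> v)"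
  proof (rule eq_by_chars)
    fix x assume "x \<in> chars A"
    then have x: "x \<in> chars0 A" by (rule chars_subset)
    have "cmod (x a) \<le> r" using char_bound[OF x a] by (simp add: r_def)
    then have "(cmod (x a))\<^sup>2 \<le> r\<^sup>2" by (intro power_mono) auto
    then have "sqrt \<bar>r\<^sup>2 - (cmod (x a))\<^sup>2\<bar> * sqrt \<bar>r\<^sup>2 - (cmod (x a))\<^sup>2\<bar> = r\<^sup>2 - (cmod (x a))\<^sup>2" by simp
    then have "cnj (f x) * f x = of_real (r\<^sup>2 - (cmod (x a))\<^sup>2) * (cnj (x v) * x v)"
      unfolding f_def by (simp add: mult.assoc mult.left_commute flip: of_real_mult)
    also have "\<dots> = of_real (r\<^sup>2) * (cnj (x v) * x v) - (cnj (x a) * x a) * (cnj (x v) * x v)"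
      using complex_norm_square[of "x a"] by (simp add: algebra_simps)
    finally show "x (astar A w \<boxtimes> w \<boxplus> astar A (a \<boxtimes> v) \<boxtimes> (a \<boxtimes> v)) = x (of_real (r\<^sup>2) \<boxdot> (astar A v \<boxtimes> v))"
      using x a v w(1) w(2)[OF x] by (simp add: char_simps aclosed algebra_simps)
  qed (use a v w in \<open>simp_all add: aclosed\<close>)
  then have "hinner H \<xi> (\<pi> (astar A w \<boxtimes> w \<boxplus> astar A (a \<boxtimes> v) \<boxtimes> (a \<boxtimes> v)) \<xi>)
      = hinner H \<xi> (\<pi> (of_real (r\<^sup>2) \<boxdot> (astar A v \<boxtimes> v)) \<xi>)" by simp
  then have "hinner H \<xi> (\<pi> (astar A w \<boxtimes> w) \<xi>) + hinner H \<xi> (\<pi> (astar A (a \<boxtimes> v) \<boxtimes> (a \<boxtimes> v)) \<xi>)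
      = of_real (r\<^sup>2) * hinner H \<xi> (\<pi> (astar A v \<boxtimes> v) \<xi>)"
    using a v w(1) \<xi> by (simp add: add scl cl aclosed H.inner_add_right H.inner_scale_right)
  then have "(vnorm H (\<pi> w \<xi>))\<^sup>2 + (vnorm H (\<pi> (a \<boxtimes> v) \<xi>))\<^sup>2 = r\<^sup>2 * (vnorm H (\<pi> v \<xi>))\<^sup>2"
    using a v w(1) by (simp only: sq aclosed of_real_add[symmetric] of_real_mult[symmetric] of_real_eq_iff)
  then have "(vnorm H (\<pi> (a \<boxtimes> v) \<xi>))\<^sup>2 \<le> (r * vnorm H (\<pi> v \<xi>))\<^sup>2"
    using zero_le_power2[of "vnorm H (\<pi> w \<xi>)"] unfolding power_mult_distrib by linarith
  then have "vnorm H (\<pi> (a \<boxtimes> v) \<xi>) \<le> r * vnorm H (\<pi> v \<xi>)"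
    by (rule power2_le_imp_le) (simp add: r H.norm_nonneg cl v \<xi>)
  then show ?thesis by (simp add: mul a v \<xi> r_def)
qed

lemma rep_kernel_closed_ideal:
  assumes rep: "representation A (H, \<pi>)" shows "closed_ideal A (rep_kernel A (H, \<pi>))"
proof -
  interpret H: hilbert_space H using rep by (simp add: representation_def)
  note cl = representationD(3)[OF rep] and ladd = representationD(4)[OF rep] and lscl = representationD(5)[OF rep]
    and mul = representationD(6)[OF rep] and add = representationD(7)[OF rep] and scl = representationD(8)[OF rep]
    and adj = representationD(9)[OF rep]
  have lin0: "\<pi> b \<zero>v\<^bsub>H\<^esub> = \<zero>v\<^bsub>H\<^esub>" if "b \<in> carrier A" for b
    using lscl[OF that H.zero_closed, of 0] cl[OF that H.zero_closed] H.zero_closed by simp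
  have inner0: "hinner H \<eta> \<zero>v\<^bsub>H\<^esub> = 0" if "\<eta> \<in> carrier H" for \<eta>
    using H.inner_commute[OF H.zero_closed that] H.inner_scale[OF H.zero_closed that, of 0] H.zero_closed by simp
  let ?J = "rep_kernel A (H, \<pi>)"
  have JC: "?J \<subseteq> carrier A" by (auto simp: rep_kernel_def)
  have "closed_subspace A ?J"
  proof (rule closed_subspaceI)
    have "\<pi> \<zero>v \<xi> = \<zero>v\<^bsub>H\<^esub>" if "\<xi> \<in> carrier H" for \<xi>
      using scl[OF zero_closed that, of 0] cl[OF zero_closed that] zero_closed by simp
    then show "\<zero>v \<in> ?J" by (simp add: rep_kernel_def zero_closed)
    fix f l assume f: "range f \<subseteq> ?J" and l: "l \<in> carrier A" and conv: "converges f l"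
    have fc: "f n \<in> carrier A" for n using f JC by blast
    have 1: "\<pi> l (\<pi> v \<xi>) = \<zero>v\<^bsub>H\<^esub>" if v: "v \<in> carrier A" and \<xi>: "\<xi> \<in> carrier H" for v \<xi>
    proof -
      have "vnorm H (\<pi> l (\<pi> v \<xi>)) \<le> vnorm A (vminus A (f n) l) * vnorm H (\<pi> v \<xi>)" for n
      proof -
        have "\<pi> (f n) (\<pi> v \<xi>) = \<zero>v\<^bsub>H\<^esub>" using f cl[OF v \<xi>] by (auto simp: rep_kernel_def)
        then have "\<pi> (vminus A l (f n)) (\<pi> v \<xi>) = \<pi> l (\<pi> v \<xi>)"
          using cl[OF v \<xi>] l fc by (simp add: vminus_def add scl aclosed H.add_zero cl)
        then show ?thesis
          using rep_contractive[OF rep minus_closed[OF l fc] v \<xi>] norm_minus_commute[OF l fc] by metis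
      qed
      moreover have "(\<lambda>n. vnorm A (vminus A (f n) l) * vnorm H (\<pi> v \<xi>)) \<longlonglongrightarrow> 0 * vnorm H (\<pi> v \<xi>)"
        using conv unfolding converges_def by (intro tendsto_intros)
      ultimately have "vnorm H (\<pi> l (\<pi> v \<xi>)) \<le> 0" by (intro LIMSEQ_le_const) auto
      then show ?thesis
        using H.norm_nonneg[of "\<pi> l (\<pi> v \<xi>)"] H.norm_eq_zero[of "\<pi> l (\<pi> v \<xi>)"] v l \<xi> cl by simp
    qed
    have "\<pi> l \<xi> = \<zero>v\<^bsub>H\<^esub>" if \<xi>: "\<xi> \<in> carrier H" for \<xi>
    proof -
      have "\<pi> (astar A l) (\<pi> l \<xi>) = \<pi> l (\<pi> (astar A l) \<xi>)"
        using l \<xi> by (metis mul mult_comm star_closed)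
      then have "hinner H (\<pi> l \<xi>) (\<pi> l \<xi>) = 0"
        using 1[OF star_closed[OF l] \<xi>] l \<xi> by (simp add: adj cl inner0)
      then show ?thesis using H.inner_self[of "\<pi> l \<xi>"] H.norm_eq_zero cl[OF l \<xi>] by simp
    qed
    then show "l \<in> ?J" using l by (simp add: rep_kernel_def)
  qed (auto simp: rep_kernel_def add scl aclosed H.add_zero H.zero_closed)
  moreover have "a \<boxtimes> b \<in> ?J" if "a \<in> carrier A" "b \<in> ?J" for a b
    using that lin0 by (auto simp: rep_kernel_def mul aclosed)
  moreover have "b \<boxtimes> a = a \<boxtimes> b" if "a \<in> carrier A" "b \<in> ?J" for a b
    using that JC mult_comm by blast
  ultimately show ?thesis by (simp add: closed_ideal_def)
qed

text \<open>By commutativity the null space of each \<pi>(b) is invariant, so \<pi>(b) is zero or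
  injective. The kernel J then behaves like a prime ideal, which leaves exactly one character in its
  hull.\<close>

lemma irreducible_rep_char:
  assumes irr: "irreducible_rep A (H, \<pi>)"
  obtains x where "rep_char A (H, \<pi>) x"
proof -
  have rep: "representation A (H, \<pi>)" using irr by (simp add: irreducible_rep_def)
  interpret H: hilbert_space H using rep by (simp add: representation_def)
  note blm = representationD(2)[OF rep]
  note cl = representationD(3)[OF rep] and ladd = representationD(4)[OF rep] and lscl = representationD(5)[OF rep]
    and mul = representationD(6)[OF rep] and add = representationD(7)[OF rep] and scl = representationD(8)[OF rep]
    and adj = representationD(9)[OF rep]
  have lminus: "\<pi> b (vminus H \<eta> \<zeta>) = vminus H (\<pi> b \<eta>) (\<pi> b \<zeta>)"
    if "b \<in> carrier A" "\<eta> \<in> carrier H" "\<zeta> \<in> carrier H" for b \<eta> \<zeta>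
    using that by (simp add: vminus_def ladd lscl H.vclosed)
  have rminus: "\<pi> (vminus A b c) \<eta> = vminus H (\<pi> b \<eta>) (\<pi> c \<eta>)"
    if "b \<in> carrier A" "c \<in> carrier A" "\<eta> \<in> carrier H" for b c \<eta>
    using that by (simp add: vminus_def add scl aclosed)
  have lin0: "\<pi> b \<zero>v\<^bsub>H\<^esub> = \<zero>v\<^bsub>H\<^esub>" if "b \<in> carrier A" for b
    using lscl[OF that H.zero_closed, of 0] cl[OF that H.zero_closed] H.zero_closed by simp
  define J where "J = rep_kernel A (H, \<pi>)"
  have J: "closed_ideal A J" unfolding J_def by (rule rep_kernel_closed_ideal[OF rep])
  have JI: "b \<in> J \<longleftrightarrow> b \<in> carrier A \<and> (\<forall>\<eta>\<in>carrier H. \<pi> b \<eta> = \<zero>v\<^bsub>H\<^esub>)" for b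
    by (auto simp: J_def rep_kernel_def)
  have JC: "J \<noteq> carrier A" using irr JI by (force simp: irreducible_rep_def)
  have null: "b \<in> J \<or> (\<forall>\<eta>\<in>carrier H. \<pi> b \<eta> = \<zero>v\<^bsub>H\<^esub> \<longrightarrow> \<eta> = \<zero>v\<^bsub>H\<^esub>)" if b: "b \<in> carrier A" for b
  proof -
    define M where "M = {\<eta> \<in> carrier H. \<pi> b \<eta> = \<zero>v\<^bsub>H\<^esub>}"
    obtain K where K: "\<And>\<eta>. \<eta> \<in> carrier H \<Longrightarrow> vnorm H (\<pi> b \<eta>) \<le> K * vnorm H \<eta>"
      using blm[OF b] by (auto simp: bounded_linear_map_def)
    have "closed_subspace H M"
    proof (rule H.closed_subspaceI)
      fix f l assume f: "range f \<subseteq> M" and l: "l \<in> carrier H" and conv: "H.converges f l"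
      have fc: "f n \<in> carrier H" and f0: "\<pi> b (f n) = \<zero>v\<^bsub>H\<^esub>" for n using f by (auto simp: M_def)
      have "vnorm H (\<pi> b l) \<le> K * vnorm H (vminus H (f n) l)" for n
        using K[OF H.minus_closed[OF l fc], of n] H.norm_minus_commute[OF l fc] f0 fc l b
        by (simp add: lminus cl)
      moreover have "(\<lambda>n. K * vnorm H (vminus H (f n) l)) \<longlonglongrightarrow> K * 0"
        using conv unfolding H.converges_def by (intro tendsto_intros)
      ultimately have "vnorm H (\<pi> b l) \<le> 0" by (intro LIMSEQ_le_const) auto
      then have "\<pi> b l = \<zero>v\<^bsub>H\<^esub>"
        using H.norm_nonneg[OF cl[OF b l]] H.norm_eq_zero[OF cl[OF b l]] by simp
      then show "l \<in> M" using l by (simp add: M_def)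
    qed (auto simp: M_def ladd lscl b H.vclosed H.add_zero lin0)
    moreover have "\<pi> a ` M \<subseteq> M" if a: "a \<in> carrier A" for a
    proof -
      have "\<pi> b (\<pi> a \<eta>) = \<pi> a (\<pi> b \<eta>)" if "\<eta> \<in> carrier H" for \<eta>
        using a b that by (metis mul mult_comm)
      then show ?thesis using a by (auto simp: M_def cl lin0)
    qed
    ultimately have "M = {\<zero>v\<^bsub>H\<^esub>} \<or> M = carrier H" using irr by (simp add: irreducible_rep_def)
    then show ?thesis using b by (auto simp: JI M_def)
  qed
  have "zeros A J \<noteq> {}" using nullstellensatz[OF J] JC closed_idealD(2)[OF J] by blast
  then obtain x where x: "x \<in> zeros A J" by blast
  have xc: "x \<in> chars A" and x0: "x \<in> chars0 A" using x chars_subset by (auto simp: zeros_def)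
  \<comment> \<open>Two characters in the hull would give b and c outside J with b c = 0, although
    \<pi>(b) and \<pi>(c) are both injective.\<close>
  have uniq: "y = x" if y: "y \<in> zeros A J" for y
  proof (rule ccontr)
    assume "y \<noteq> x"
    from hausdorff[OF this] obtain U W
      where UW: "open U" "open W" "y \<in> U" "x \<in> W" "U \<inter> W = {}" by blast
    have yc: "y \<in> chars A" using y by (simp add: zeros_def)
    obtain b where b: "b \<in> carrier A" "y b = 1" "\<And>z. \<lbrakk>z \<in> chars0 A; z \<notin> U\<rbrakk> \<Longrightarrow> z b = 0"
      by (rule char_urysohn[OF yc UW(1,3)]) blast
    obtain c where c: "c \<in> carrier A" "x c = 1" "\<And>z. \<lbrakk>z \<in> chars0 A; z \<notin> W\<rbrakk> \<Longrightarrow> z c = 0"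
      by (rule char_urysohn[OF xc UW(2,4)]) blast
    have bc: "b \<boxtimes> c = \<zero>v"
    proof (rule eq_by_chars)
      fix z assume "z \<in> chars A"
      then have z: "z \<in> chars0 A" by (rule chars_subset)
      show "z (b \<boxtimes> c) = z \<zero>v"
        using b(1) c(1) b(3)[OF z] c(3)[OF z] z UW(5) by (cases "z \<in> U") (auto simp: char_simps)
    qed (use b c in \<open>simp_all add: aclosed\<close>)
    have "b \<notin> J" "c \<notin> J" using b(2) c(2) x y by (auto simp: zeros_def)
    then obtain \<eta> where \<eta>: "\<eta> \<in> carrier H" "\<pi> c \<eta> \<noteq> \<zero>v\<^bsub>H\<^esub>" using c(1) JI by blast
    have "\<pi> b (\<pi> c \<eta>) = \<zero>v\<^bsub>H\<^esub>"
      using mul[OF b(1) c(1) \<eta>(1)] closed_idealD(3)[OF J] \<eta>(1) unfolding bc JI by simp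
    then show False using null[OF b(1)] \<open>b \<notin> J\<close> \<eta> cl[OF c(1) \<eta>(1)] by blast
  qed
  have inJ: "a \<in> J" if "a \<in> carrier A" "x a = 0" for a
    using that uniq by (intro nullstellensatz[OF J]) auto
  obtain u where u: "u \<in> carrier A" "x u = 1" using chars_unit[OF xc] .
  have "u \<notin> J" using x u(2) by (auto simp: zeros_def)
  \<comment> \<open>The element u u - u lies in J, so \<pi>(u) annihilates \<pi>(u)\<eta> - \<eta>;
    since \<pi>(u) is injective, u acts as the identity.\<close>
  have \<pi>u: "\<pi> u \<eta> = \<eta>" if \<eta>: "\<eta> \<in> carrier H" for \<eta>
  proof -
    have "vminus A (u \<boxtimes> u) u \<in> J" using u x0 by (intro inJ) (simp_all add: aclosed char_simps)
    then have "\<pi> u (vminus H (\<pi> u \<eta>) \<eta>) = \<zero>v\<^bsub>H\<^esub>"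
      using \<eta> u(1) by (simp add: JI lminus rminus mul cl aclosed)
    then have "vminus H (\<pi> u \<eta>) \<eta> = \<zero>v\<^bsub>H\<^esub>"
      using null[OF u(1)] \<open>u \<notin> J\<close> \<eta> cl[OF u(1) \<eta>] by (simp add: H.vclosed)
    then show ?thesis using \<eta> cl[OF u(1) \<eta>] by (simp add: H.minus_eq_zero)
  qed
  have "\<pi> a \<eta> = x a \<boxdot>\<^bsub>H\<^esub> \<eta>" if a: "a \<in> carrier A" and \<eta>: "\<eta> \<in> carrier H" for a \<eta>
  proof -
    have "vminus A a (x a \<boxdot> u) \<in> J" using a u x0 by (intro inJ) (simp_all add: aclosed char_simps)
    then have "vminus H (\<pi> a \<eta>) (x a \<boxdot>\<^bsub>H\<^esub> \<eta>) = \<zero>v\<^bsub>H\<^esub>"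
      using \<eta> u(1) a by (simp add: JI rminus scl \<pi>u aclosed)
    then show ?thesis using \<eta> a cl[OF a \<eta>] by (simp add: H.minus_eq_zero H.vclosed)
  qed
  then show thesis using that[of x] xc by (simp add: rep_char_def)
qed

lemma rep_char_unique:
  assumes irr: "irreducible_rep A \<rho>" and xy: "rep_char A \<rho> x" "rep_char A \<rho> y"
  shows "x = y"
proof
  fix a
  obtain H \<pi> where \<rho>: "\<rho> = (H, \<pi>)" by fastforce
  have rep: "representation A (H, \<pi>)" using irr by (simp add: irreducible_rep_def \<rho>)
  interpret H: hilbert_space H using rep by (simp add: representation_def)
  obtain b \<xi> where \<xi>: "b \<in> carrier A" "\<xi> \<in> carrier H" "\<pi> b \<xi> \<noteq> \<zero>v\<^bsub>H\<^esub>"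
    using irr by (auto simp: irreducible_rep_def \<rho>)
  then have "\<xi> \<noteq> \<zero>v\<^bsub>H\<^esub>" using xy(1) by (auto simp: rep_char_def \<rho>)
  show "x a = y a"
  proof (cases "a \<in> carrier A")
    case True
    then have "x a \<boxdot>\<^bsub>H\<^esub> \<xi> = y a \<boxdot>\<^bsub>H\<^esub> \<xi>" using xy \<xi> by (simp add: rep_char_def \<rho>)
    then have "(x a + - y a) \<boxdot>\<^bsub>H\<^esub> \<xi> = \<zero>v\<^bsub>H\<^esub>"
      using \<xi>(2) H.scale_add_left[OF \<xi>(2), of "x a" "- y a"] H.add_neg[of "y a \<boxdot>\<^bsub>H\<^esub> \<xi>"]
        H.scale_scale[OF \<xi>(2), of "-1" "y a"] by (simp add: H.vclosed)
    then have "cmod (x a - y a) * vnorm H \<xi> = 0" using H.norm_scale[OF \<xi>(2), of "x a - y a"] by simp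
    then show ?thesis using \<open>\<xi> \<noteq> _\<close> \<xi>(2) by (simp add: H.norm_eq_zero)
  next
    case False
    then show ?thesis using xy chars0D(1)[OF chars_subset] by (metis rep_char_def)
  qed
qed

text \<open>The algebra acts by scalars, so every line is invariant, and a line spanned by a
  non-zero vector must be the whole space.\<close>

lemma irreducible_rep_line:
  assumes irr: "irreducible_rep A (H, \<pi>)" and x: "rep_char A (H, \<pi>) x"
  obtains \<xi> where "\<xi> \<in> carrier H" "vnorm H \<xi> = 1" "\<And>\<eta>. \<eta> \<in> carrier H \<Longrightarrow> \<eta> = hinner H \<eta> \<xi> \<boxdot>\<^bsub>H\<^esub> \<xi>"
proof -
  have rep: "representation A (H, \<pi>)" using irr by (simp add: irreducible_rep_def)
  interpret H: hilbert_space H using rep by (simp add: representation_def)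
  obtain b \<zeta> where \<zeta>: "b \<in> carrier A" "\<zeta> \<in> carrier H" "\<pi> b \<zeta> \<noteq> \<zero>v\<^bsub>H\<^esub>"
    using irr by (auto simp: irreducible_rep_def)
  then have "\<zeta> \<noteq> \<zero>v\<^bsub>H\<^esub>" using x by (auto simp: rep_char_def)
  then have n: "vnorm H \<zeta> > 0" using H.norm_nonneg[OF \<zeta>(2)] H.norm_eq_zero[OF \<zeta>(2)] by linarith
  define \<xi> where "\<xi> = of_real (1 / vnorm H \<zeta>) \<boxdot>\<^bsub>H\<^esub> \<zeta>"
  have \<xi>: "\<xi> \<in> carrier H" "vnorm H \<xi> = 1"
    using n \<zeta>(2) by (simp_all add: \<xi>_def H.vclosed H.norm_scale norm_divide)
  let ?M = "(\<lambda>c. c \<boxdot>\<^bsub>H\<^esub> \<xi>) ` UNIV"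
  have "\<pi> a ` ?M \<subseteq> ?M" if "a \<in> carrier A" for a
    using x that \<xi> by (auto simp: rep_char_def H.vclosed simp flip: H.scale_scale)
  then have "?M = {\<zero>v\<^bsub>H\<^esub>} \<or> ?M = carrier H"
    using irr H.line_closed_subspace[OF \<xi>(1)] by (simp add: irreducible_rep_def)
  moreover have "\<xi> \<in> ?M" using H.scale_one[OF \<xi>(1)] by (metis rangeI)
  moreover have "\<xi> \<noteq> \<zero>v\<^bsub>H\<^esub>" using \<xi> by auto
  ultimately have M: "?M = carrier H" by blast
  have "\<eta> = hinner H \<eta> \<xi> \<boxdot>\<^bsub>H\<^esub> \<xi>" if \<eta>: "\<eta> \<in> carrier H" for \<eta>
  proof -
    obtain c where "\<eta> = c \<boxdot>\<^bsub>H\<^esub> \<xi>" using \<eta> M by blast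
    then show ?thesis using \<xi> H.inner_scale[of \<xi> \<xi> c] H.inner_self[of \<xi>] by simp
  qed
  then show thesis using that \<xi> by blast
qed

end

text \<open>A Hilbert space has to live on the element type of A, so the line spanned by u inside A
  is used. As x(u) = 1, the map x identifies this line with the complex numbers and supplies norm
  and inner product.\<close>

definition line_rep :: "('a, 'm) cstar_scheme \<Rightarrow> ('a \<Rightarrow> complex) \<Rightarrow> 'a \<Rightarrow> 'a rep" where
  "line_rep A x u =
     (\<lparr>carrier = range (\<lambda>c. c \<boxdot>\<^bsub>A\<^esub> u), vadd = vadd A, vzero = vzero A, vscale = vscale A,
       vnorm = (\<lambda>h. cmod (x h)), hinner = (\<lambda>h k. x h * cnj (x k))\<rparr>, \<lambda>a h. x a \<boxdot>\<^bsub>A\<^esub> h)"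

context abelian_cstar_algebra
begin

lemma line_rep_irreducible:
  assumes x: "x \<in> chars A" and u: "u \<in> carrier A" "x u = 1"
  shows "irreducible_rep A (line_rep A x u)" "rep_char A (line_rep A x u) x"
proof -
  have x0: "x \<in> chars0 A" using x by (rule chars_subset)
  obtain H \<pi> where H\<pi>: "line_rep A x u = (H, \<pi>)" by fastforce
  then have H: "carrier H = range (\<lambda>c. c \<boxdot> u)" "vadd H = vadd A" "vzero H = vzero A" "vscale H = vscale A"
    "vnorm H = (\<lambda>h. cmod (x h))" "hinner H = (\<lambda>h k. x h * cnj (x k))" and \<pi>: "\<pi> = (\<lambda>a h. x a \<boxdot> h)"
    by (auto simp: line_rep_def)
  have HA: "h \<in> carrier A" "h = x h \<boxdot> u" if "h \<in> carrier H" for h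
    using that u x0 by (auto simp: H aclosed char_simps)
  have Hsub: "c \<boxdot> u \<in> carrier H" for c by (auto simp: H)
  have Hx: "x (c \<boxdot> u) = c" for c using u x0 by (simp add: char_simps)
  have Hadd: "h \<boxplus> k \<in> carrier H" if "h \<in> carrier H" "k \<in> carrier H" for h k
    using that u by (auto simp: H simp flip: scale_add_left)
  have Hscl: "c \<boxdot> h \<in> carrier H" if "h \<in> carrier H" for h c
    using that u by (auto simp: H simp flip: scale_scale)
  have Hzero: "\<zero>v \<in> carrier H" using Hsub[of 0] u by simp
  have vm: "vminus H = vminus A" by (simp add: vminus_def fun_eq_iff H)
  interpret H: complex_normed_space H
  proof
    show "\<exists>y\<in>carrier H. h \<boxplus>\<^bsub>H\<^esub> y = \<zero>v\<^bsub>H\<^esub>" if "h \<in> carrier H" for h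
      using Hscl[OF that, of "-1"] add_neg[OF HA(1)[OF that]] by (auto simp: H(2,3))
    show "vnorm H h = 0 \<longleftrightarrow> h = \<zero>v\<^bsub>H\<^esub>" if "h \<in> carrier H" for h
      using HA[OF that] u x0 by (auto simp: H(3,5) char_simps)
    show "vnorm H (h \<boxplus>\<^bsub>H\<^esub> k) \<le> vnorm H h + vnorm H k" if "h \<in> carrier H" "k \<in> carrier H" for h k
      using HA[OF that(1)] HA[OF that(2)] x0 by (simp add: H(2,5) char_simps norm_triangle_ineq)
    show "vnorm H (c \<boxdot>\<^bsub>H\<^esub> h) = cmod c * vnorm H h" if "h \<in> carrier H" for c h
      using HA[OF that] x0 by (simp add: H(4,5) char_simps Real_Vector_Spaces.norm_mult)
  qed (simp_all add: H(2-4) Hadd Hscl Hzero HA(1) add_assoc add_comm add_left_comm add_zero scale_add_right scale_add_left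
      scale_scale scale_one)
  have "Metric_space.mcomplete (carrier H) (vdist H)"
    unfolding H.mcomplete_iff
  proof (intro allI impI, elim conjE)
    fix f assume f: "range f \<subseteq> carrier H" and cau: "H.cauchy_seq f"
    have fH: "f n \<in> carrier H" for n using f by blast
    have "Cauchy (\<lambda>n. x (f n))"
    proof (rule metric_CauchyI)
      fix e :: real assume "e > 0"
      then obtain N where N: "\<forall>m\<ge>N. \<forall>n\<ge>N. vnorm H (vminus H (f m) (f n)) < e"
        using cau unfolding H.cauchy_seq_def by blast
      have "dist (x (f m)) (x (f n)) = vnorm H (vminus H (f m) (f n))" for m n
        using HA(1)[OF fH] x0 by (simp add: vm H(5) char_simps dist_norm)
      then show "\<exists>M. \<forall>m\<ge>M. \<forall>n\<ge>M. dist (x (f m)) (x (f n)) < e" using N by auto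
    qed
    then obtain c where c: "(\<lambda>n. x (f n)) \<longlonglongrightarrow> c" using Cauchy_convergent convergent_def by blast
    have "vnorm H (vminus H (f n) (c \<boxdot> u)) = cmod (x (f n) - c)" for n
      using HA(1)[OF fH] x0 u by (simp add: vm H(5) char_simps aclosed)
    then have "H.converges f (c \<boxdot> u)"
      unfolding H.converges_def using c by (simp add: tendsto_norm_zero LIM_zero)
    then show "\<exists>l\<in>carrier H. H.converges f l" using Hsub by blast
  qed
  then have ban: "complex_banach_space H" by unfold_locales
  have hil: "hilbert_space H"
  proof (intro hilbert_space.intro ban hilbert_space_axioms.intro)
    show "hinner H h h = complex_of_real ((vnorm H h)\<^sup>2)" for h
      using complex_norm_square[of "x h"] by (simp add: H(5,6))
  qed (use HA(1) x0 in \<open>simp_all add: H(2-6) char_simps algebra_simps\<close>)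
  have blm: "bounded_linear_map H H (\<pi> a)" if "a \<in> carrier A" for a
  proof -
    have "vnorm H (\<pi> a h) \<le> cmod (x a) * vnorm H h" if "h \<in> carrier H" for h
      using HA(1)[OF that] x0 by (simp add: \<pi> H(5) char_simps Real_Vector_Spaces.norm_mult)
    moreover have "linear_map H H (\<pi> a)"
      unfolding linear_map_def using HA(1)
      by (auto simp: \<pi> H(2-4) Hscl scale_add_right mult.commute simp flip: scale_scale)
    ultimately show ?thesis unfolding bounded_linear_map_def by blast
  qed
  have rep: "representation A (H, \<pi>)"
    unfolding representation_def
    using HA(1) hil blm x0
    by (auto simp: \<pi> H(2-6) char_simps scale_add_left scale_scale Hscl)
  show rc: "rep_char A (line_rep A x u) x" unfolding H\<pi> by (simp add: rep_char_def x \<pi> H(4))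
  have "\<pi> u u \<noteq> \<zero>v\<^bsub>H\<^esub>" "u \<in> carrier H"
    using u Hsub[of 1] x0 by (auto simp: \<pi> H(3) scale_one char_zero)
  moreover have "M = {\<zero>v\<^bsub>H\<^esub>} \<or> M = carrier H" if M: "closed_subspace H M" for M
  proof (cases "M \<subseteq> {\<zero>v\<^bsub>H\<^esub>}")
    case True
    then show ?thesis using H.closed_subspaceD(2)[OF M] by blast
  next
    case False
    then obtain h where h: "h \<in> M" "h \<noteq> \<zero>v" by (auto simp: H(3))
    have hH: "h \<in> carrier H" using h H.closed_subspaceD(1)[OF M] by blast
    have "x h \<noteq> 0" using HA(2)[OF hH] h(2) u by (metis scale_zero_left)
    have "c \<boxdot> u \<in> M" for c
    proof -
      have "(c / x h) \<boxdot>\<^bsub>H\<^esub> h = (c / x h * x h) \<boxdot> u"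
        using HA(2)[OF hH] u by (simp only: H(4) scale_scale)
      then show ?thesis using \<open>x h \<noteq> 0\<close> H.closed_subspaceD(4)[OF M h(1), of "c / x h"] by simp
    qed
    then have "carrier H \<subseteq> M" by (auto simp: H(1))
    then show ?thesis using H.closed_subspaceD(1)[OF M] by blast
  qed
  ultimately show "irreducible_rep A (line_rep A x u)"
    unfolding H\<pi> using rep u by (auto simp: irreducible_rep_def)
qed

text \<open>An intertwiner carries the scalar x(a) to the scalar y(a) on a one-dimensional space.
  Conversely, matching unit vectors of the two lines is unitary and intertwines as soon as the
  scalars agree.\<close>

lemma unitarily_equivalent_iff:
  assumes irr: "irreducible_rep A \<rho>" "irreducible_rep A \<sigma>" and xy: "rep_char A \<rho> x" "rep_char A \<sigma> y"
  shows "unitarily_equivalent A \<rho> \<sigma> \<longleftrightarrow> x = y"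
proof -
  obtain H \<pi> K \<tau> where \<rho>\<sigma>: "\<rho> = (H, \<pi>)" "\<sigma> = (K, \<tau>)" by fastforce
  have rep: "representation A (H, \<pi>)" "representation A (K, \<tau>)"
    using irr by (simp_all add: irreducible_rep_def \<rho>\<sigma>)
  interpret H: hilbert_space H using rep(1) by (simp add: representation_def)
  interpret K: hilbert_space K using rep(2) by (simp add: representation_def)
  obtain \<xi> where \<xi>: "\<xi> \<in> carrier H" "vnorm H \<xi> = 1" "\<And>v. v \<in> carrier H \<Longrightarrow> v = hinner H v \<xi> \<boxdot>\<^bsub>H\<^esub> \<xi>"
    using irreducible_rep_line irr(1) xy(1) unfolding \<rho>\<sigma> by blast
  obtain \<eta> where \<eta>: "\<eta> \<in> carrier K" "vnorm K \<eta> = 1" "\<And>v. v \<in> carrier K \<Longrightarrow> v = hinner K v \<eta> \<boxdot>\<^bsub>K\<^esub> \<eta>"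
    using irreducible_rep_line irr(2) xy(2) unfolding \<rho>\<sigma> by blast
  have x: "\<pi> a v = x a \<boxdot>\<^bsub>H\<^esub> v" if "a \<in> carrier A" "v \<in> carrier H" for a v
    using xy(1) that by (simp add: rep_char_def \<rho>\<sigma>)
  have y: "\<tau> a v = y a \<boxdot>\<^bsub>K\<^esub> v" if "a \<in> carrier A" "v \<in> carrier K" for a v
    using xy(2) that by (simp add: rep_char_def \<rho>\<sigma>)
  show ?thesis
  proof
    assume "unitarily_equivalent A \<rho> \<sigma>"
    then obtain U where U: "linear_map H K U" "bij_betw U (carrier H) (carrier K)"
      and Ua: "\<And>a v. \<lbrakk>a \<in> carrier A; v \<in> carrier H\<rbrakk> \<Longrightarrow> U (\<pi> a v) = \<tau> a (U v)"
      by (auto simp: unitarily_equivalent_def \<rho>\<sigma>)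
    have Uc: "U v \<in> carrier K" if "v \<in> carrier H" for v using U(2) that by (auto simp: bij_betw_def)
    have Us: "U (c \<boxdot>\<^bsub>H\<^esub> v) = c \<boxdot>\<^bsub>K\<^esub> U v" if "v \<in> carrier H" for v c
      using U(1) that by (simp add: linear_map_def)
    obtain v where v: "v \<in> carrier H" "U v = \<eta>" using U(2) \<eta>(1) unfolding bij_betw_def by (metis imageE)
    show "x = y"
    proof
      fix a
      show "x a = y a"
      proof (cases "a \<in> carrier A")
        case True
        have "x a \<boxdot>\<^bsub>K\<^esub> \<eta> = y a \<boxdot>\<^bsub>K\<^esub> \<eta>" using Ua[OF True v(1)] v \<eta>(1) True by (simp add: x y Us)
        then have "hinner K (x a \<boxdot>\<^bsub>K\<^esub> \<eta>) \<eta> = hinner K (y a \<boxdot>\<^bsub>K\<^esub> \<eta>) \<eta>" by simp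
        then show ?thesis using \<eta>(1,2) by (simp add: K.inner_scale K.inner_self)
      next
        case False
        then show ?thesis using xy chars0D(1)[OF chars_subset] by (metis rep_char_def)
      qed
    qed
  next
    assume "x = y"
    define U where "U v = hinner H v \<xi> \<boxdot>\<^bsub>K\<^esub> \<eta>" for v
    have Uc: "U v \<in> carrier K" for v by (simp add: U_def \<eta> K.vclosed)
    have lin: "linear_map H K U"
      unfolding linear_map_def using \<xi>(1) \<eta>(1)
      by (auto simp: Uc) (simp_all add: U_def H.inner_add H.inner_scale K.scale_add_left K.scale_scale)
    have inn: "hinner K (U v) (U w) = hinner H v w" if "v \<in> carrier H" "w \<in> carrier H" for v w
    proof -
      have "hinner H v w = hinner H (hinner H v \<xi> \<boxdot>\<^bsub>H\<^esub> \<xi>) (hinner H w \<xi> \<boxdot>\<^bsub>H\<^esub> \<xi>)"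
        using \<xi>(3)[OF that(1)] \<xi>(3)[OF that(2)] by simp
      then show ?thesis
        using \<xi>(1,2) \<eta>(1,2)
        by (simp add: U_def H.inner_scale H.inner_scale_right K.inner_scale K.inner_scale_right
            H.inner_self K.inner_self H.vclosed K.vclosed)
    qed
    have "bij_betw U (carrier H) (carrier K)"
      unfolding bij_betw_def
    proof
      show "inj_on U (carrier H)"
      proof (rule inj_onI)
        fix v w assume vw: "v \<in> carrier H" "w \<in> carrier H" "U v = U w"
        then have "hinner K (U v) \<eta> = hinner K (U w) \<eta>" by simp
        then have "hinner H v \<xi> = hinner H w \<xi>" using \<eta>(1,2) by (simp add: U_def K.inner_scale K.inner_self)
        then show "v = w" using \<xi>(3)[OF vw(1)] \<xi>(3)[OF vw(2)] by simp
      qed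
      have "w \<in> U ` carrier H" if w: "w \<in> carrier K" for w
      proof -
        have "U (hinner K w \<eta> \<boxdot>\<^bsub>H\<^esub> \<xi>) = w"
          using \<eta>(3)[OF w] \<xi>(1,2) by (simp add: U_def H.inner_scale H.inner_self)
        then show ?thesis using \<xi>(1) by (metis H.scale_closed image_eqI)
      qed
      then show "U ` carrier H = carrier K" using Uc by blast
    qed
    moreover have "U (\<pi> a v) = \<tau> a (U v)" if "a \<in> carrier A" "v \<in> carrier H" for a v
      using that \<xi>(1) \<eta>(1) \<open>x = y\<close> by (simp add: x y Uc) (simp add: U_def H.inner_scale K.scale_scale)
    ultimately show "unitarily_equivalent A \<rho> \<sigma>"
      using lin inn by (auto simp: unitarily_equivalent_def \<rho>\<sigma>)
  qed
qed

section \<open>Characters as points of the spectrum\<close>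

lemma irreducible_in_rep_class:
  assumes "irreducible_rep A \<rho>" shows "\<exists>x\<in>chars A. \<rho> \<in> rep_class A x"
proof -
  obtain x where "rep_char A \<rho> x" using irreducible_rep_char[of "fst \<rho>" "snd \<rho>"] assms by auto
  then show ?thesis using assms by (auto simp: rep_class_def rep_char_def)
qed

lemma rep_class_nonempty:
  assumes x: "x \<in> chars A" shows "rep_class A x \<noteq> {}"
proof -
  obtain u where u: "u \<in> carrier A" "x u = 1" using chars_unit[OF x] .
  have "line_rep A x u \<in> rep_class A x" using line_rep_irreducible[OF x u] by (simp add: rep_class_def)
  then show ?thesis by blast
qed

lemma unitary_equivalence_Image:
  assumes "\<rho> \<in> rep_class A x" shows "unitary_equivalence A `` {\<rho>} = rep_class A x"
proof -
  have "\<sigma> \<in> rep_class A x" if \<sigma>: "irreducible_rep A \<sigma>" "unitarily_equivalent A \<rho> \<sigma>" for \<sigma>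
  proof -
    obtain y where "rep_char A \<sigma> y" using irreducible_in_rep_class[OF \<sigma>(1)] by (auto simp: rep_class_def)
    then show ?thesis using \<sigma> assms unitarily_equivalent_iff[of \<rho> \<sigma> x y] by (simp add: rep_class_def)
  qed
  moreover have "unitarily_equivalent A \<rho> \<sigma>" if "\<sigma> \<in> rep_class A x" for \<sigma>
    using that assms unitarily_equivalent_iff[of \<rho> \<sigma> x x] by (simp add: rep_class_def)
  ultimately show ?thesis using assms by (auto simp: unitary_equivalence_def rep_class_def)
qed

lemma spectrum_eq: "spectrum A = rep_class A ` chars A"
proof
  show "spectrum A \<subseteq> rep_class A ` chars A"
  proof
    fix c assume "c \<in> spectrum A"
    then obtain \<rho> where \<rho>: "irreducible_rep A \<rho>" "c = unitary_equivalence A `` {\<rho>}"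
      by (auto simp: spectrum_def quotient_def)
    then obtain x where "x \<in> chars A" "\<rho> \<in> rep_class A x" using irreducible_in_rep_class by blast
    then show "c \<in> rep_class A ` chars A" using \<rho>(2) unitary_equivalence_Image by blast
  qed
  show "rep_class A ` chars A \<subseteq> spectrum A"
  proof clarify
    fix x assume "x \<in> chars A"
    then obtain \<rho> where \<rho>: "\<rho> \<in> rep_class A x" using rep_class_nonempty by blast
    have "unitary_equivalence A `` {\<rho>} \<in> spectrum A"
      unfolding spectrum_def by (rule quotientI) (use \<rho> in \<open>simp add: rep_class_def\<close>)
    then show "rep_class A x \<in> spectrum A" using unitary_equivalence_Image[OF \<rho>] by simp
  qed
qed

lemma inj_rep_class: "inj_on (rep_class A) (chars A)"
proof (rule inj_onI)
  fix x y assume "x \<in> chars A" "y \<in> chars A" and eq: "rep_class A x = rep_class A y"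
  then obtain \<rho> where \<rho>: "\<rho> \<in> rep_class A x" using rep_class_nonempty by blast
  then have "\<rho> \<in> rep_class A y" using eq by simp
  then show "x = y" using \<rho> rep_char_unique[of \<rho> x y] by (simp add: rep_class_def)
qed

lemma rep_kernel_eq:
  assumes "\<rho> \<in> rep_class A x" shows "rep_kernel A \<rho> = kernel A {x}"
proof -
  obtain H \<pi> where \<rho>: "\<rho> = (H, \<pi>)" by fastforce
  have irr: "irreducible_rep A (H, \<pi>)" and x: "rep_char A (H, \<pi>) x"
    using assms by (auto simp: rep_class_def \<rho>)
  then interpret H: hilbert_space H by (simp add: irreducible_rep_def representation_def)
  obtain \<xi> where \<xi>: "\<xi> \<in> carrier H" "vnorm H \<xi> = 1" using irreducible_rep_line[OF irr x] by blast
  have "(\<forall>v\<in>carrier H. \<pi> a v = \<zero>v\<^bsub>H\<^esub>) \<longleftrightarrow> x a = 0" if a: "a \<in> carrier A" for a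
  proof
    assume "\<forall>v\<in>carrier H. \<pi> a v = \<zero>v\<^bsub>H\<^esub>"
    then have "x a \<boxdot>\<^bsub>H\<^esub> \<xi> = \<zero>v\<^bsub>H\<^esub>" using \<xi> x a by (simp add: rep_char_def)
    then show "x a = 0" using H.norm_scale[OF \<xi>(1), of "x a"] \<xi>(2) by simp
  next
    assume "x a = 0"
    then show "\<forall>v\<in>carrier H. \<pi> a v = \<zero>v\<^bsub>H\<^esub>" using x a by (simp add: rep_char_def)
  qed
  then show ?thesis by (auto simp: rep_kernel_def kernel_def \<rho>)
qed

lemma class_kernel_eq:
  assumes "x \<in> chars A" shows "class_kernel A (rep_class A x) = kernel A {x}"
proof -
  have "class_kernel A (rep_class A x) = (\<Inter>\<rho>\<in>rep_class A x. kernel A {x})"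
    unfolding class_kernel_def by (intro INF_cong refl) (rule rep_kernel_eq)
  then show ?thesis using rep_class_nonempty[OF assms] by simp
qed

lemma prim_eq: "prim A = (\<lambda>x. kernel A {x}) ` chars A"
proof
  show "prim A \<subseteq> (\<lambda>x. kernel A {x}) ` chars A"
  proof
    fix P assume "P \<in> prim A"
    then obtain \<rho> where \<rho>: "irreducible_rep A \<rho>" "P = rep_kernel A \<rho>" by (auto simp: prim_def)
    then obtain x where "x \<in> chars A" "\<rho> \<in> rep_class A x" using irreducible_in_rep_class by blast
    then show "P \<in> (\<lambda>x. kernel A {x}) ` chars A" using \<rho>(2) rep_kernel_eq by blast
  qed
  show "(\<lambda>x. kernel A {x}) ` chars A \<subseteq> prim A"
  proof clarify
    fix x assume "x \<in> chars A"
    then obtain \<rho> where \<rho>: "\<rho> \<in> rep_class A x" using rep_class_nonempty by blast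
    then have "irreducible_rep A \<rho>" by (simp add: rep_class_def)
    then show "kernel A {x} \<in> prim A" unfolding prim_def rep_kernel_eq[OF \<rho>, symmetric] by blast
  qed
qed

lemma inj_kernel: "inj_on (\<lambda>x. kernel A {x}) (chars A)"
proof (rule inj_onI)
  fix x y assume xy: "x \<in> chars A" "y \<in> chars A" "kernel A {x} = kernel A {y}"
  have "closedin (top_of_set (chars A)) {z}" if "z \<in> chars A" for z
    using closedin_closed_Int[of "{z}" "chars A"] that by simp
  then have "{x} = {y}" using zeros_kernel xy by metis
  then show "x = y" by simp
qed

text \<open>The generating set given by J corresponds to the complement of \<open>zeros A J\<close>.
  By \<open>zeros_kernel\<close> every open set of characters has this form, so the generators
  already make up the whole topology; injectivity of the map to kernels handles
  intersections.\<close>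

lemma openin_prim_topology:
  "openin (prim_topology A) W \<longleftrightarrow> (\<exists>U. openin (top_of_set (chars A)) U \<and> W = (\<lambda>x. kernel A {x}) ` U)"
proof -
  let ?X = "top_of_set (chars A)" and ?\<kappa> = "\<lambda>x. kernel A {x}"
  let ?B = "{{P \<in> prim A. \<not> J \<subseteq> P} |J. closed_ideal A J}"
  have basis: "{P \<in> prim A. \<not> J \<subseteq> P} = ?\<kappa> ` (chars A - zeros A J)" if "closed_ideal A J" for J
    using closed_idealD(2)[OF that] unfolding prim_eq by (auto simp: zeros_def kernel_def subset_iff)
  have sub: "U \<subseteq> chars A" if "openin ?X U" for U using openin_subset[OF that] by simp
  show ?thesis
    unfolding prim_topology_def openin_topology_generated_by_iff
  proof
    assume "generate_topology_on ?B W"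
    then show "\<exists>U. openin ?X U \<and> W = ?\<kappa> ` U"
    proof induction
      case Empty
      then show ?case by (intro exI[of _ "{}"]) simp
    next
      case (Int a b)
      then obtain U V where "openin ?X U" "a = ?\<kappa> ` U" "openin ?X V" "b = ?\<kappa> ` V" by blast
      then show ?case
        using inj_on_image_Int[OF inj_kernel sub sub] by (intro exI[of _ "U \<inter> V"]) auto
    next
      case (UN K)
      then obtain f where f: "\<And>k. k \<in> K \<Longrightarrow> openin ?X (f k) \<and> k = ?\<kappa> ` f k" by metis
      have "(\<Union>k\<in>K. k) = (\<Union>k\<in>K. ?\<kappa> ` f k)" by (rule SUP_cong) (use f in blast)+
      then have "\<Union>K = ?\<kappa> ` (\<Union>k\<in>K. f k)" by (simp add: image_UN)
      then show ?case using f by (intro exI[of _ "\<Union>k\<in>K. f k"]) auto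
    next
      case (Basis s)
      then obtain J where J: "closed_ideal A J" "s = {P \<in> prim A. \<not> J \<subseteq> P}" by blast
      have "openin ?X (chars A - zeros A J)"
        using closedin_zeros by (simp add: closedin_def double_diff)
      then show ?case using basis[OF J(1)] J(2) by blast
    qed
  next
    assume "\<exists>U. openin ?X U \<and> W = ?\<kappa> ` U"
    then obtain U where U: "openin ?X U" "W = ?\<kappa> ` U" by blast
    have "closedin ?X (chars A - U)" using U(1) openin_closedin_eq by fastforce
    then have "zeros A (kernel A (chars A - U)) = chars A - U" by (rule zeros_kernel)
    then have "chars A - zeros A (kernel A (chars A - U)) = U" using sub[OF U(1)] by blast
    moreover have cl: "closed_ideal A (kernel A (chars A - U))"
      using kernel_closed_ideal chars_subset by (metis DiffD1 subsetI)
    ultimately have "W = {P \<in> prim A. \<not> kernel A (chars A - U) \<subseteq> P}"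
      using basis[OF cl] U(2) by simp
    then show "generate_topology_on ?B W" using cl by (intro generate_topology_on.Basis) blast
  qed
qed

lemma openin_spectrum_topology:
  "openin (spectrum_topology A) W \<longleftrightarrow> (\<exists>U. openin (top_of_set (chars A)) U \<and> W = rep_class A ` U)"
proof -
  have eq: "class_kernel A -` ((\<lambda>x. kernel A {x}) ` U) \<inter> spectrum A = rep_class A ` U" if U: "U \<subseteq> chars A" for U
  proof -
    have iff: "kernel A {x} \<in> (\<lambda>x. kernel A {x}) ` U \<longleftrightarrow> x \<in> U" if "x \<in> chars A" for x
      by (rule inj_on_image_mem_iff[OF inj_kernel that U])
    have "rep_class A x \<in> class_kernel A -` ((\<lambda>x. kernel A {x}) ` U) \<longleftrightarrow> x \<in> U" if "x \<in> chars A" for x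
      using iff[OF that] class_kernel_eq[OF that] by simp
    then show ?thesis unfolding spectrum_eq using U by blast
  qed
  show ?thesis
    unfolding spectrum_topology_def openin_pullback_topology openin_prim_topology
  proof
    assume "\<exists>V. (\<exists>U. openin (top_of_set (chars A)) U \<and> V = (\<lambda>x. kernel A {x}) ` U)
      \<and> W = class_kernel A -` V \<inter> spectrum A"
    then obtain U where U: "openin (top_of_set (chars A)) U"
      "W = class_kernel A -` ((\<lambda>x. kernel A {x}) ` U) \<inter> spectrum A" by blast
    then have "W = rep_class A ` U" using eq[of U] openin_subset[OF U(1)] by simp
    then show "\<exists>U. openin (top_of_set (chars A)) U \<and> W = rep_class A ` U" using U(1) by blast
  next
    assume "\<exists>U. openin (top_of_set (chars A)) U \<and> W = rep_class A ` U"
    then obtain U where U: "openin (top_of_set (chars A)) U" "W = rep_class A ` U" by blast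
    then have "W = class_kernel A -` ((\<lambda>x. kernel A {x}) ` U) \<inter> spectrum A"
      using eq[of U] openin_subset[OF U(1)] by simp
    then show "\<exists>V. (\<exists>U. openin (top_of_set (chars A)) U \<and> V = (\<lambda>x. kernel A {x}) ` U)
      \<and> W = class_kernel A -` V \<inter> spectrum A"
      using U(1) by blast
  qed
qed

text \<open>Closures and closed sets in the spectrum may henceforth be computed with characters and
  the topology of pointwise convergence.\<close>

lemma homeomorphic_rep_class: "homeomorphic_map (top_of_set (chars A)) (spectrum_topology A) (rep_class A)"
proof -
  let ?X = "top_of_set (chars A)"
  have ts: "topspace (spectrum_topology A) = spectrum A"
  proof
    show "topspace (spectrum_topology A) \<subseteq> spectrum A"
    proof -
      obtain U where "openin ?X U" "topspace (spectrum_topology A) = rep_class A ` U"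
        using openin_topspace[of "spectrum_topology A"] unfolding openin_spectrum_topology by blast
      then show ?thesis using openin_subset[of ?X U] by (auto simp: spectrum_eq)
    qed
    have "openin (spectrum_topology A) (spectrum A)"
      unfolding openin_spectrum_topology spectrum_eq by (intro exI[of _ "chars A"]) simp
    then show "spectrum A \<subseteq> topspace (spectrum_topology A)" by (rule openin_subset)
  qed
  have "openin ?X {x \<in> chars A. rep_class A x \<in> U} \<longleftrightarrow> openin (spectrum_topology A) U"
    if U: "U \<subseteq> rep_class A ` chars A" for U
  proof
    have "U = rep_class A ` {x \<in> chars A. rep_class A x \<in> U}" using U by auto
    then show "openin ?X {x \<in> chars A. rep_class A x \<in> U} \<Longrightarrow> openin (spectrum_topology A) U"
      unfolding openin_spectrum_topology by blast
    assume "openin (spectrum_topology A) U"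
    then obtain V where V: "openin ?X V" "U = rep_class A ` V" unfolding openin_spectrum_topology by blast
    then have "V \<subseteq> chars A" using openin_subset by fastforce
    then have "{x \<in> chars A. rep_class A x \<in> U} = V"
      using V(2) inj_rep_class by (auto simp: inj_on_def subset_iff)
    then show "openin ?X {x \<in> chars A. rep_class A x \<in> U}" using V(1) by simp
  qed
  then show ?thesis
    unfolding homeomorphic_map_def quotient_map_def using inj_rep_class by (simp add: ts spectrum_eq)
qed

lemma spectrum_topology_closure_of:
  assumes "D \<subseteq> chars A"
  shows "spectrum_topology A closure_of (rep_class A ` D) = rep_class A ` zeros A (kernel A D)"
  using homeomorphic_map_closure_of[OF homeomorphic_rep_class] closure_of_chars[OF assms] assms by simp

end

section \<open>Quotients\<close>

context cstar_algebra
begin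

context
  fixes I assumes I: "closed_ideal A I"
begin

lemmas Iclosed = closed_idealD(3-8)[OF I]

lemma ideal_in_carrier: "a \<in> I \<Longrightarrow> a \<in> carrier A"
  using closed_idealD(2)[OF I] by blast

lemma mem_coset: "a \<in> carrier A \<Longrightarrow> b \<in> coset A I a \<longleftrightarrow> b \<in> carrier A \<and> vminus A b a \<in> I"
proof
  assume a: "a \<in> carrier A" and "b \<in> coset A I a"
  then obtain i where i: "i \<in> I" "b = a \<boxplus> i" by (auto simp: coset_def)
  then have "vminus A b a = i" using a ideal_in_carrier add_comm add_minus_cancel by metis
  then show "b \<in> carrier A \<and> vminus A b a \<in> I" using i a ideal_in_carrier by (simp add: aclosed)
next
  assume a: "a \<in> carrier A" and b: "b \<in> carrier A \<and> vminus A b a \<in> I"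
  then show "b \<in> coset A I a" unfolding coset_def using add_minus_cancel'[of a b] by (metis image_eqI)
qed

lemma self_mem_coset: "a \<in> carrier A \<Longrightarrow> a \<in> coset A I a"
  by (simp add: mem_coset Iclosed)

lemma coset_eq_iff:
  assumes a: "a \<in> carrier A" and b: "b \<in> carrier A"
  shows "coset A I a = coset A I b \<longleftrightarrow> vminus A a b \<in> I"
proof
  assume "coset A I a = coset A I b"
  then show "vminus A a b \<in> I" using self_mem_coset[OF a] mem_coset[OF b] by blast
next
  assume ab: "vminus A a b \<in> I"
  have "vminus A b a \<in> I" using Iclosed(3)[OF ab, of "-1"] minus_commute[OF b a] by simp
  then have "c \<in> coset A I a \<longleftrightarrow> c \<in> coset A I b" for c
    using Iclosed(2)[OF _ ab, of "vminus A c a"] Iclosed(2)[of "vminus A c b" "vminus A b a"]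
      minus_add_minus[of c a b] minus_add_minus[of c b a] a b by (auto simp: mem_coset)
  then show "coset A I a = coset A I b" by blast
qed

lemma coset_repr: "\<lbrakk>a \<in> carrier A; x \<in> coset A I a\<rbrakk> \<Longrightarrow> x \<in> carrier A \<and> coset A I x = coset A I a"
  by (simp add: mem_coset coset_eq_iff)

lemma quotient_carrier: "X \<in> carrier (quotient_algebra A I) \<longleftrightarrow> (\<exists>a\<in>carrier A. X = coset A I a)"
  by (auto simp: quotient_algebra_def)

lemma quotient_zero: "vzero (quotient_algebra A I) = coset A I \<zero>v"
proof -
  have "coset A I \<zero>v = I" using mem_coset[OF zero_closed] ideal_in_carrier by (auto simp: aclosed)
  then show ?thesis by (simp add: quotient_algebra_def)
qed

lemma Union_coset_const:
  assumes "a \<in> X" "\<And>x. x \<in> X \<Longrightarrow> f x = S" shows "(\<Union>x\<in>X. f x) = S"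
  using assms by blast

lemma Union_coset_const2:
  assumes "a \<in> X" "b \<in> Y" "\<And>x y. \<lbrakk>x \<in> X; y \<in> Y\<rbrakk> \<Longrightarrow> f x y = S"
  shows "(\<Union>x\<in>X. \<Union>y\<in>Y. f x y) = S"
  using assms by blast

lemma quotient_add:
  assumes a: "a \<in> carrier A" and b: "b \<in> carrier A"
  shows "vadd (quotient_algebra A I) (coset A I a) (coset A I b) = coset A I (a \<boxplus> b)"
proof -
  have eq: "coset A I (x \<boxplus> y) = coset A I (a \<boxplus> b)" if "x \<in> coset A I a" "y \<in> coset A I b" for x y
    using that a b Iclosed(2) by (simp add: coset_eq_iff mem_coset aclosed add_minus_add)
  have "vadd (quotient_algebra A I) (coset A I a) (coset A I b)
      = (\<Union>x\<in>coset A I a. \<Union>y\<in>coset A I b. coset A I (x \<boxplus> y))"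
    by (simp add: quotient_algebra_def)
  also have "\<dots> = coset A I (a \<boxplus> b)"
    by (rule Union_coset_const2[OF self_mem_coset[OF a] self_mem_coset[OF b] eq])
  finally show ?thesis .
qed

lemma quotient_mult:
  assumes a: "a \<in> carrier A" and b: "b \<in> carrier A"
  shows "amult (quotient_algebra A I) (coset A I a) (coset A I b) = coset A I (a \<boxtimes> b)"
proof -
  have eq: "coset A I (x \<boxtimes> y) = coset A I (a \<boxtimes> b)" if "x \<in> coset A I a" "y \<in> coset A I b" for x y
  proof -
    have xy: "x \<in> carrier A" "y \<in> carrier A" "vminus A x a \<in> I" "vminus A y b \<in> I"
      using that a b by (simp_all add: mem_coset)
    have "vminus A (x \<boxtimes> y) (a \<boxtimes> b) = vminus A x a \<boxtimes> y \<boxplus> a \<boxtimes> vminus A y b"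
      using xy a b by (simp add: mult_minus_left mult_minus_right aclosed minus_add_minus)
    then show ?thesis using xy a b Iclosed by (simp add: coset_eq_iff aclosed)
  qed
  have "amult (quotient_algebra A I) (coset A I a) (coset A I b)
      = (\<Union>x\<in>coset A I a. \<Union>y\<in>coset A I b. coset A I (x \<boxtimes> y))"
    by (simp add: quotient_algebra_def)
  also have "\<dots> = coset A I (a \<boxtimes> b)"
    by (rule Union_coset_const2[OF self_mem_coset[OF a] self_mem_coset[OF b] eq])
  finally show ?thesis .
qed

lemma quotient_scale:
  assumes a: "a \<in> carrier A"
  shows "vscale (quotient_algebra A I) c (coset A I a) = coset A I (c \<boxdot> a)"
proof -
  have eq: "coset A I (c \<boxdot> x) = coset A I (c \<boxdot> a)" if "x \<in> coset A I a" for x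
    using that a Iclosed(3) by (simp add: coset_eq_iff mem_coset aclosed flip: scale_minus)
  have "vscale (quotient_algebra A I) c (coset A I a) = (\<Union>x\<in>coset A I a. coset A I (c \<boxdot> x))"
    by (simp add: quotient_algebra_def)
  also have "\<dots> = coset A I (c \<boxdot> a)" by (rule Union_coset_const[OF self_mem_coset[OF a] eq])
  finally show ?thesis .
qed

lemma quotient_norm_le: 
  assumes a: "a \<in> carrier A" shows "vnorm (quotient_algebra A I) (coset A I a) \<le> vnorm A a"
  unfolding quotient_algebra_def using self_mem_coset[OF a] a mem_coset norm_nonneg
  by (auto intro!: cINF_lower bdd_belowI2[where m=0])

lemma quotient_norm_greatest: 
  assumes a: "a \<in> carrier A" and le: "\<And>b. \<lbrakk>b \<in> carrier A; coset A I b = coset A I a\<rbrakk> \<Longrightarrow> r \<le> vnorm A b"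
  shows "r \<le> vnorm (quotient_algebra A I) (coset A I a)"
proof -
  have "r \<le> (INF x\<in>coset A I a. vnorm A x)"
    by (rule cINF_greatest) (use self_mem_coset[OF a] coset_repr[OF a] le in blast)+
  then show ?thesis by (simp add: quotient_algebra_def)
qed

end

end

text \<open>The choice of representative is harmless only when x annihilates I; off the carrier the
  value is 0, as required of members of \<open>chars0\<close>.\<close>

definition quotient_char :: "('a, 'm) cstar_scheme \<Rightarrow> 'a set \<Rightarrow> ('a \<Rightarrow> complex) \<Rightarrow> 'a set \<Rightarrow> complex" where
  "quotient_char A I x X = (if X \<in> carrier (quotient_algebra A I) then x (SOME a. a \<in> X) else 0)"

section \<open>The quotient C*-algebra and its characters\<close>

context abelian_cstar_algebra
begin

context
  fixes I assumes I: "closed_ideal A I"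
begin

abbreviation (input) "Q \<equiv> quotient_algebra A I"
abbreviation (input) "cs \<equiv> coset A I"

lemma quotient_star:
  assumes a: "a \<in> carrier A" shows "astar Q (cs a) = cs (astar A a)"
proof -
  have eq: "cs (astar A x) = cs (astar A a)" if "x \<in> cs a" for x
  proof -
    have x: "x \<in> carrier A" "vminus A x a \<in> I" using that a by (simp_all add: mem_coset[OF I])
    then show ?thesis using a closed_ideal_star[OF I x(2)] by (simp add: coset_eq_iff[OF I] aclosed star_minus)
  qed
  have "astar Q (cs a) = (\<Union>x\<in>cs a. cs (astar A x))" by (simp add: quotient_algebra_def)
  also have "\<dots> = cs (astar A a)" by (rule Union_coset_const[OF I self_mem_coset[OF I a] eq])
  finally show ?thesis .
qed

lemma zeros_coset:
  assumes x: "x \<in> zeros A I" and ab: "a \<in> carrier A" "b \<in> carrier A" "cs a = cs b"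
  shows "x a = x b"
proof -
  have "vminus A a b \<in> I" using coset_eq_iff[OF I ab(1,2)] ab(3) by simp
  then have "x (vminus A a b) = 0" using x by (simp add: zeros_def)
  then show ?thesis using char_minus[of x a b] x ab chars_subset[of x A] by (simp add: zeros_def)
qed

lemma coset_eq_by_zeros:
  assumes "a \<in> carrier A" "b \<in> carrier A" "\<And>x. x \<in> zeros A I \<Longrightarrow> x a = x b"
  shows "cs a = cs b"
  unfolding coset_eq_iff[OF I assms(1,2)]
proof (rule nullstellensatz[OF I])
  show "vminus A a b \<in> carrier A" using assms by (simp add: aclosed)
  show "x (vminus A a b) = 0" if "x \<in> zeros A I" for x
    using assms that chars_subset[of x A] by (simp add: char_minus zeros_def)
qed

lemma zeros_le_quotient_norm:
  assumes x: "x \<in> zeros A I" and a: "a \<in> carrier A" shows "cmod (x a) \<le> vnorm Q (cs a)"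
proof (rule quotient_norm_greatest[OF I a])
  fix b assume b: "b \<in> carrier A" "cs b = cs a"
  then show "cmod (x a) \<le> vnorm A b"
    using zeros_coset[OF x b(1) a] char_bound[of x b] x chars_subset[of x A] by (simp add: zeros_def)
qed

text \<open>The values of \<open>a\<close> are cut off at modulus \<open>r\<close>, which does not change \<open>a\<close> on \<open>zeros A I\<close>.\<close>

lemma quotient_norm_lift:
  assumes a: "a \<in> carrier A" and r: "0 \<le> r" and le: "\<And>x. x \<in> zeros A I \<Longrightarrow> cmod (x a) \<le> r"
  obtains b where "b \<in> carrier A" "cs b = cs a" "vnorm A b \<le> r"
\<comment> \<open>For r = 0 the cut-off factor r / max(r, |x(a)|) would be undefined where x(a) =
  0.\<close>
proof (cases "r = 0")
  case True
  have "cs \<zero>v = cs a"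
  proof (rule coset_eq_by_zeros)
    show "x \<zero>v = x a" if "x \<in> zeros A I" for x
      using le[OF that] True that char_zero[of x] chars_subset[of x A] by (simp add: zeros_def)
  qed (simp_all add: a aclosed)
  then show thesis using that[of "\<zero>v"] r by (simp add: aclosed)
next
  case False
  define f where "f x = x a * of_real (r / max r (cmod (x a)))" for x :: "'a \<Rightarrow> complex"
  have "max r (cmod (x a)) \<noteq> 0" for x :: "'a \<Rightarrow> complex" using r False by linarith
  then have "continuous_on (chars0 A) f"
    unfolding f_def by (intro continuous_intros continuous_on_eval) blast
  then obtain b where b: "b \<in> carrier A" "\<And>x. x \<in> chars0 A \<Longrightarrow> x b = f x"
    using gelfand_surj[of f] by (auto simp: f_def)
  have "cs b = cs a"
  proof (rule coset_eq_by_zeros)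
    fix x assume x: "x \<in> zeros A I"
    then have "x \<in> chars0 A" by (simp add: zeros_def chars_subset)
    then show "x b = x a" using le[OF x] b(2)[of x] False by (simp add: f_def max_absorb1)
  qed (use a b in simp_all)
  moreover have "vnorm A b \<le> r"
  proof (rule norm_le_by_chars)
    fix x assume "x \<in> chars A"
    then have "cmod (x b) = cmod (x a) * (r / max r (cmod (x a)))"
      using b(2)[of x] r by (simp add: chars_subset f_def Real_Vector_Spaces.norm_mult norm_divide)
    also have "\<dots> \<le> r" using r False by (simp add: field_simps max_def mult_left_mono)
    finally show "cmod (x b) \<le> r" .
  qed (use b r in simp_all)
  ultimately show thesis using that b by blast
qed

text \<open>Together with \<open>zeros_le_quotient_norm\<close> this identifies the quotient norm
  with the supremum over the hull of I. The norm axioms and the C*-identity of the quotient are then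
  pointwise statements.\<close>

lemma quotient_norm_le_zeros:
  assumes "a \<in> carrier A" "0 \<le> r" "\<And>x. x \<in> zeros A I \<Longrightarrow> cmod (x a) \<le> r"
  shows "vnorm Q (cs a) \<le> r"
proof -
  obtain b where "b \<in> carrier A" "cs b = cs a" "vnorm A b \<le> r"
    by (rule quotient_norm_lift[of a r]) (use assms in blast)+
  then show ?thesis using quotient_norm_le[OF I, of b] by simp
qed

lemma quotient_norm_nonneg: "a \<in> carrier A \<Longrightarrow> 0 \<le> vnorm Q (cs a)"
  using norm_nonneg by (intro quotient_norm_greatest[OF I])

lemmas quotient_ops = quotient_add[OF I] quotient_mult[OF I] quotient_scale[OF I] quotient_star quotient_zero[OF I]

lemma quotient_minus: "\<lbrakk>a \<in> carrier A; b \<in> carrier A\<rbrakk> \<Longrightarrow> vminus Q (cs a) (cs b) = cs (vminus A a b)"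
  by (simp add: vminus_def quotient_ops aclosed)

lemma coset_in_quotient: "a \<in> carrier A \<Longrightarrow> cs a \<in> carrier Q"
  using quotient_carrier[OF I] by blast

lemma quotient_cosetE: assumes "X \<in> carrier Q" obtains a where "a \<in> carrier A" "X = cs a"
  using assms quotient_carrier[OF I] by blast

lemma zeros_char0: "x \<in> zeros A I \<Longrightarrow> x \<in> chars0 A"
  by (simp add: zeros_def chars_subset)

lemma quotient_normed: "complex_normed_space Q"
proof
  fix X Y Z c d
  show "\<zero>v\<^bsub>Q\<^esub> \<in> carrier Q" by (simp add: quotient_ops coset_in_quotient aclosed)
  {
    assume "X \<in> carrier Q"
    then obtain a where a: "a \<in> carrier A" "X = cs a" by (rule quotient_cosetE)
    show "c \<boxdot>\<^bsub>Q\<^esub> X \<in> carrier Q" "X \<boxplus>\<^bsub>Q\<^esub> \<zero>v\<^bsub>Q\<^esub> = X" "1 \<boxdot>\<^bsub>Q\<^esub> X = X"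
      "(c + d) \<boxdot>\<^bsub>Q\<^esub> X = c \<boxdot>\<^bsub>Q\<^esub> X \<boxplus>\<^bsub>Q\<^esub> d \<boxdot>\<^bsub>Q\<^esub> X" "(c * d) \<boxdot>\<^bsub>Q\<^esub> X = c \<boxdot>\<^bsub>Q\<^esub> d \<boxdot>\<^bsub>Q\<^esub> X"
      using a by (simp_all add: quotient_ops coset_in_quotient aclosed add_zero scale_one scale_add_left scale_scale)
    have "X \<boxplus>\<^bsub>Q\<^esub> cs ((-1) \<boxdot> a) = \<zero>v\<^bsub>Q\<^esub>" using a by (simp add: quotient_ops aclosed add_neg)
    then show "\<exists>Y\<in>carrier Q. X \<boxplus>\<^bsub>Q\<^esub> Y = \<zero>v\<^bsub>Q\<^esub>" using coset_in_quotient[OF scale_closed[OF a(1), of "-1"]] by blast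
    show "vnorm Q X = 0 \<longleftrightarrow> X = \<zero>v\<^bsub>Q\<^esub>"
    proof
      assume 0: "vnorm Q X = 0"
      have "cs a = cs \<zero>v"
      proof (rule coset_eq_by_zeros)
        show "x a = x \<zero>v" if "x \<in> zeros A I" for x
          using zeros_le_quotient_norm[OF that a(1)] 0 a char_zero[OF zeros_char0[OF that]] by simp
      qed (simp_all add: a aclosed)
      then show "X = \<zero>v\<^bsub>Q\<^esub>" using a by (simp add: quotient_ops)
    next
      assume "X = \<zero>v\<^bsub>Q\<^esub>"
      then show "vnorm Q X = 0"
        using quotient_norm_le[OF I zero_closed] quotient_norm_nonneg[OF zero_closed] by (simp add: quotient_ops)
    qed
    have le: "vnorm Q (cs (c \<boxdot> b)) \<le> cmod c * vnorm Q (cs b)" if "b \<in> carrier A" for b c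
      using that zeros_char0
      by (intro quotient_norm_le_zeros)
        (simp_all add: aclosed quotient_norm_nonneg char_simps Real_Vector_Spaces.norm_mult
          mult_left_mono zeros_le_quotient_norm)
    have "cmod c * vnorm Q (cs a) \<le> vnorm Q (cs (c \<boxdot> a))"
    proof (cases "c = 0")
      case True
      then show ?thesis using quotient_norm_nonneg[of "c \<boxdot> a"] a by (simp add: aclosed)
    next
      case False
      then have "(1 / c) \<boxdot> (c \<boxdot> a) = a" using a by (simp add: scale_one flip: scale_scale)
      then show ?thesis using le[of "c \<boxdot> a" "1 / c"] a False by (simp add: aclosed norm_divide field_simps)
    qed
    then show "vnorm Q (c \<boxdot>\<^bsub>Q\<^esub> X) = cmod c * vnorm Q X" using le[OF a(1), of c] a by (simp add: quotient_ops)
    assume "Y \<in> carrier Q"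
    then obtain b where b: "b \<in> carrier A" "Y = cs b" by (rule quotient_cosetE)
    show "X \<boxplus>\<^bsub>Q\<^esub> Y \<in> carrier Q" "X \<boxplus>\<^bsub>Q\<^esub> Y = Y \<boxplus>\<^bsub>Q\<^esub> X"
      "c \<boxdot>\<^bsub>Q\<^esub> (X \<boxplus>\<^bsub>Q\<^esub> Y) = c \<boxdot>\<^bsub>Q\<^esub> X \<boxplus>\<^bsub>Q\<^esub> c \<boxdot>\<^bsub>Q\<^esub> Y"
      using a b by (simp_all add: quotient_ops coset_in_quotient aclosed scale_add_right add_comm)
    have "cmod (x (a \<boxplus> b)) \<le> vnorm Q (cs a) + vnorm Q (cs b)" if x: "x \<in> zeros A I" for x
      using norm_triangle_ineq[of "x a" "x b"] zeros_le_quotient_norm[OF x a(1)]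
        zeros_le_quotient_norm[OF x b(1)] zeros_char0[OF x] a b by (simp add: char_simps)
    then show "vnorm Q (X \<boxplus>\<^bsub>Q\<^esub> Y) \<le> vnorm Q X + vnorm Q Y"
      using a b quotient_norm_nonneg by (simp add: quotient_ops) (intro quotient_norm_le_zeros; simp add: aclosed)
    assume "Z \<in> carrier Q"
    then obtain c where "c \<in> carrier A" "Z = cs c" by (rule quotient_cosetE)
    then show "(X \<boxplus>\<^bsub>Q\<^esub> Y) \<boxplus>\<^bsub>Q\<^esub> Z = X \<boxplus>\<^bsub>Q\<^esub> (Y \<boxplus>\<^bsub>Q\<^esub> Z)"
      using a b by (simp add: quotient_ops aclosed add_assoc)
  }
qed

text \<open>A rapidly convergent subsequence is lifted to \<open>A\<close> term by term with the same distances.\<close>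

lemma quotient_banach: "complex_banach_space Q"
proof -
  interpret Q: complex_normed_space Q by (rule quotient_normed)
  have "Metric_space.mcomplete (carrier Q) (vdist Q)"
    unfolding Q.mcomplete_iff
  proof (intro allI impI, elim conjE)
    fix F assume F: "range F \<subseteq> carrier Q" and cau: "Q.cauchy_seq F"
    have FQ: "F n \<in> carrier Q" for n using F by blast
    have "\<forall>k. \<exists>N. \<forall>m\<ge>N. \<forall>n\<ge>N. vnorm Q (vminus Q (F m) (F n)) < (1/2) ^ k"
      using cau by (simp add: Q.cauchy_seq_def)
    then obtain N where N: "\<And>k m n. \<lbrakk>m \<ge> N k; n \<ge> N k\<rbrakk> \<Longrightarrow> vnorm Q (vminus Q (F m) (F n)) < (1/2) ^ k" by metis
    \<comment> \<open>Partial sums of the indices N give a monotone sequence that still dominates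
      each N k.\<close>
    define s where "s k = (\<Sum>j\<le>k. N j)" for k
    have sN: "N k \<le> s k" "s k \<le> s (Suc k)" for k unfolding s_def by (auto intro: member_le_sum)
    have "\<exists>g. \<forall>k. (g k \<in> carrier A \<and> cs (g k) = F (s k)) \<and> vnorm A (vminus A (g (Suc k)) (g k)) \<le> (1/2) ^ k"
    proof (rule dependent_nat_choice)
      show "\<exists>a. a \<in> carrier A \<and> cs a = F (s 0)" using quotient_cosetE[OF FQ] by metis
      fix a k assume a: "a \<in> carrier A \<and> cs a = F (s k)"
      obtain b where b: "b \<in> carrier A" "F (s (Suc k)) = cs b" using quotient_cosetE[OF FQ] by blast
      have "vnorm Q (cs (vminus A b a)) \<le> (1/2) ^ k"
        using N[of k "s (Suc k)" "s k"] sN[of k] a b by (simp add: quotient_minus[symmetric])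
      then have "cmod (x (vminus A b a)) \<le> (1/2) ^ k" if "x \<in> zeros A I" for x
        using zeros_le_quotient_norm[OF that, of "vminus A b a"] a b by (simp add: aclosed)
      then obtain d where d: "d \<in> carrier A" "cs d = cs (vminus A b a)" "vnorm A d \<le> (1/2) ^ k"
        using quotient_norm_lift[of "vminus A b a" "(1/2) ^ k"] a b by (auto simp: aclosed)
      have "cs (a \<boxplus> d) = cs (a \<boxplus> vminus A b a)"
        using a b d quotient_add[OF I] by (metis minus_closed)
      also have "\<dots> = F (s (Suc k))" using a b by (simp add: add_minus_cancel')
      finally have "cs (a \<boxplus> d) = F (s (Suc k))" .
      moreover have "vminus A (a \<boxplus> d) a = d" using a d add_comm add_minus_cancel by metis
      ultimately show "\<exists>c. (c \<in> carrier A \<and> cs c = F (s (Suc k))) \<and> vnorm A (vminus A c a) \<le> (1/2) ^ k"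
        using a d by (intro exI[of _ "a \<boxplus> d"]) (simp add: aclosed)
    qed
    then obtain g where g: "\<And>k. g k \<in> carrier A" "\<And>k. cs (g k) = F (s k)"
      and gd: "\<And>k. vnorm A (vminus A (g (Suc k)) (g k)) \<le> (1/2) ^ k" by blast
    \<comment> \<open>The right side is the exact value of the geometric sum of (1/2)^j from j = n
      to n + m - 1; the subtracted term lets the induction close.\<close>
    have gdist: "vnorm A (vminus A (g (n + m)) (g n)) \<le> 2 * (1/2) ^ n - 2 * (1/2) ^ (n + m)" for n m
    proof (induction m)
      case 0
      then show ?case using g by simp
    next
      case (Suc m)
      then show ?case
        using norm_minus_triangle[OF g(1)[of "n + Suc m"] g(1)[of "n + m"] g(1)[of n]] gd[of "n + m"] by simp
    qed
    have gle: "vnorm A (vminus A (g m) (g n)) \<le> 2 * (1/2) ^ n" if "n \<le> m" for m n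
    proof -
      have "vnorm A (vminus A (g m) (g n)) \<le> 2 * (1/2) ^ n - 2 * (1/2) ^ m" using gdist[of n "m - n"] that by simp
      moreover have "0 \<le> (1/2::real) ^ m" by simp
      ultimately show ?thesis by linarith
    qed
    have lim: "(\<lambda>n. 2 * (1/2::real) ^ n) \<longlonglongrightarrow> 2 * 0" by (intro tendsto_intros LIMSEQ_power_zero) simp
    have "cauchy_seq g"
      unfolding cauchy_seq_def
    proof (intro allI impI)
      fix e :: real assume "e > 0"
      then have "\<forall>\<^sub>F n in sequentially. 2 * (1/2::real) ^ n < e" using order_tendstoD(2)[OF lim] by simp
      then obtain M where M: "\<And>n. n \<ge> M \<Longrightarrow> 2 * (1/2::real) ^ n < e" unfolding eventually_sequentially by blast
      have "vnorm A (vminus A (g m) (g n)) < e" if "m \<ge> M" "n \<ge> M" for m n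
        using gle[of m n] gle[of n m] M[OF that(1)] M[OF that(2)] norm_minus_commute[OF g(1) g(1), of m n]
        by (cases "m \<le> n") auto
      then show "\<exists>M. \<forall>m\<ge>M. \<forall>n\<ge>M. vnorm A (vminus A (g m) (g n)) < e" by blast
    qed
    then obtain a where a: "a \<in> carrier A" "converges g a" using complete g unfolding mcomplete_iff by blast
    have bound: "vnorm Q (vminus Q (F n) (cs a)) \<le> (1/2) ^ k + vnorm A (vminus A (g k) a)" if "n \<ge> N k" for n k
    proof -
      have "vnorm Q (vminus Q (F (s k)) (cs a)) \<le> vnorm A (vminus A (g k) a)"
        using quotient_norm_le[OF I, of "vminus A (g k) a"] g a by (simp add: quotient_minus aclosed flip: g(2))
      then show ?thesis
        using Q.norm_minus_triangle[OF FQ[of n] FQ[of "s k"] coset_in_quotient[OF a(1)]] N[OF that sN(1)] by linarith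
    qed
    have "(\<lambda>k. (1/2) ^ k + vnorm A (vminus A (g k) a)) \<longlonglongrightarrow> 0 + 0"
      using a(2) unfolding converges_def by (intro tendsto_intros LIMSEQ_power_zero) auto
    then have lim2: "(\<lambda>k. (1/2) ^ k + vnorm A (vminus A (g k) a)) \<longlonglongrightarrow> 0" by simp
    have "Q.converges F (cs a)"
      unfolding Q.converges_def
    proof (rule LIMSEQ_I)
      fix e :: real assume "e > 0"
      then have "\<forall>\<^sub>F k in sequentially. (1/2) ^ k + vnorm A (vminus A (g k) a) < e"
        using order_tendstoD(2)[OF lim2] by simp
      then obtain k where k: "(1/2) ^ k + vnorm A (vminus A (g k) a) < e" unfolding eventually_sequentially by blast
      have "norm (vnorm Q (vminus Q (F n) (cs a)) - 0) < e" if "n \<ge> N k" for n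
        using bound[OF that] k Q.norm_nonneg[OF Q.minus_closed[OF FQ coset_in_quotient[OF a(1)]], of n] by simp
      then show "\<exists>M. \<forall>n\<ge>M. norm (vnorm Q (vminus Q (F n) (cs a)) - 0) < e" by blast
    qed
    then show "\<exists>l\<in>carrier Q. Q.converges F l" using coset_in_quotient[OF a(1)] by blast
  qed
  then show ?thesis by unfold_locales
qed

theorem quotient_abelian: "abelian_cstar_algebra Q"
proof (intro abelian_cstar_algebra.intro cstar_algebra.intro quotient_banach cstar_algebra_axioms.intro
    abelian_cstar_algebra_axioms.intro)
  fix X Y Z k
  {
    assume "X \<in> carrier Q"
    then obtain a where a: "a \<in> carrier A" "X = cs a" by (rule quotient_cosetE)
    show "astar Q X \<in> carrier Q" "astar Q (astar Q X) = X" "astar Q (k \<boxdot>\<^bsub>Q\<^esub> X) = cnj k \<boxdot>\<^bsub>Q\<^esub> astar Q X"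
      using a by (simp_all add: quotient_ops coset_in_quotient aclosed star_star star_scale)
    show "vnorm Q (astar Q X \<boxtimes>\<^bsub>Q\<^esub> X) = (vnorm Q X)\<^sup>2"
    proof (rule antisym)
      show "vnorm Q (astar Q X \<boxtimes>\<^bsub>Q\<^esub> X) \<le> (vnorm Q X)\<^sup>2"
        using a zeros_char0 zeros_le_quotient_norm[OF _ a(1)]
        by (simp add: quotient_ops aclosed, intro quotient_norm_le_zeros)
          (simp_all add: aclosed char_simps Real_Vector_Spaces.norm_mult power2_eq_square mult_mono quotient_norm_nonneg)
      have n0: "0 \<le> vnorm Q (cs (astar A a \<boxtimes> a))" using a by (simp add: quotient_norm_nonneg aclosed)
      have "vnorm Q (cs a) \<le> sqrt (vnorm Q (cs (astar A a \<boxtimes> a)))"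
      proof (rule quotient_norm_le_zeros[OF a(1)])
        fix x assume x: "x \<in> zeros A I"
        have "(cmod (x a))\<^sup>2 \<le> vnorm Q (cs (astar A a \<boxtimes> a))"
          using zeros_le_quotient_norm[OF x, of "astar A a \<boxtimes> a"] zeros_char0[OF x] a
          by (simp add: aclosed char_simps Real_Vector_Spaces.norm_mult power2_eq_square)
        then show "cmod (x a) \<le> sqrt (vnorm Q (cs (astar A a \<boxtimes> a)))" by (rule real_le_rsqrt)
      qed (use n0 in simp)
      then have "(vnorm Q (cs a))\<^sup>2 \<le> (sqrt (vnorm Q (cs (astar A a \<boxtimes> a))))\<^sup>2"
        by (intro power_mono quotient_norm_nonneg a)
      then show "(vnorm Q X)\<^sup>2 \<le> vnorm Q (astar Q X \<boxtimes>\<^bsub>Q\<^esub> X)" using a n0 by (simp add: quotient_ops aclosed)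
    qed
    assume "Y \<in> carrier Q"
    then obtain b where b: "b \<in> carrier A" "Y = cs b" by (rule quotient_cosetE)
    show "X \<boxtimes>\<^bsub>Q\<^esub> Y \<in> carrier Q" "X \<boxtimes>\<^bsub>Q\<^esub> Y = Y \<boxtimes>\<^bsub>Q\<^esub> X"
      "(k \<boxdot>\<^bsub>Q\<^esub> X) \<boxtimes>\<^bsub>Q\<^esub> Y = k \<boxdot>\<^bsub>Q\<^esub> (X \<boxtimes>\<^bsub>Q\<^esub> Y)" "X \<boxtimes>\<^bsub>Q\<^esub> (k \<boxdot>\<^bsub>Q\<^esub> Y) = k \<boxdot>\<^bsub>Q\<^esub> (X \<boxtimes>\<^bsub>Q\<^esub> Y)"
      "astar Q (X \<boxplus>\<^bsub>Q\<^esub> Y) = astar Q X \<boxplus>\<^bsub>Q\<^esub> astar Q Y"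
      "astar Q (X \<boxtimes>\<^bsub>Q\<^esub> Y) = astar Q Y \<boxtimes>\<^bsub>Q\<^esub> astar Q X"
      using a b by (simp_all add: quotient_ops coset_in_quotient aclosed mult_comm mult_scale_left mult_scale_right star_add star_mult)
    have "cmod (x (a \<boxtimes> b)) \<le> vnorm Q (cs a) * vnorm Q (cs b)" if x: "x \<in> zeros A I" for x
      using zeros_le_quotient_norm[OF x a(1)] zeros_le_quotient_norm[OF x b(1)] zeros_char0[OF x] a b
      by (simp add: char_simps Real_Vector_Spaces.norm_mult mult_mono quotient_norm_nonneg)
    then show "vnorm Q (X \<boxtimes>\<^bsub>Q\<^esub> Y) \<le> vnorm Q X * vnorm Q Y"
      using a b quotient_norm_nonneg by (simp add: quotient_ops) (intro quotient_norm_le_zeros; simp add: aclosed)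
    assume "Z \<in> carrier Q"
    then obtain c where c: "c \<in> carrier A" "Z = cs c" by (rule quotient_cosetE)
    show "(X \<boxtimes>\<^bsub>Q\<^esub> Y) \<boxtimes>\<^bsub>Q\<^esub> Z = X \<boxtimes>\<^bsub>Q\<^esub> (Y \<boxtimes>\<^bsub>Q\<^esub> Z)"
      "(X \<boxplus>\<^bsub>Q\<^esub> Y) \<boxtimes>\<^bsub>Q\<^esub> Z = (X \<boxtimes>\<^bsub>Q\<^esub> Z) \<boxplus>\<^bsub>Q\<^esub> (Y \<boxtimes>\<^bsub>Q\<^esub> Z)"
      "X \<boxtimes>\<^bsub>Q\<^esub> (Y \<boxplus>\<^bsub>Q\<^esub> Z) = (X \<boxtimes>\<^bsub>Q\<^esub> Y) \<boxplus>\<^bsub>Q\<^esub> (X \<boxtimes>\<^bsub>Q\<^esub> Z)"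
      using a b c by (simp_all add: quotient_ops aclosed mult_assoc mult_add_left mult_add_right)
  }
qed

lemma quotient_char_coset:
  assumes "x \<in> zeros A I" "a \<in> carrier A" shows "quotient_char A I x (cs a) = x a"
proof -
  have "(SOME b. b \<in> cs a) \<in> cs a" using self_mem_coset[OF I assms(2)] by (rule someI)
  then show ?thesis
    using coset_repr[OF I assms(2)] zeros_coset[OF assms(1) _ assms(2)] coset_in_quotient[OF assms(2)]
    by (simp add: quotient_char_def)
qed

lemma chars_quotient: "chars Q = quotient_char A I ` zeros A I"
proof
  show "quotient_char A I ` zeros A I \<subseteq> chars Q"
  proof clarify
    fix x assume x: "x \<in> zeros A I"
    obtain u where u: "u \<in> carrier A" "x u = 1" using chars_unit[of x] x by (auto simp: zeros_def)
    have "quotient_char A I x \<in> chars0 Q"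
      unfolding chars0_def
      using zeros_char0[OF x] x
      by (auto elim!: quotient_cosetE simp: quotient_ops quotient_char_coset char_simps aclosed) (simp add: quotient_char_def)
    moreover have "quotient_char A I x \<noteq> (\<lambda>_. 0)"
      using quotient_char_coset[OF x u(1)] u(2) by (metis zero_neq_one)
    ultimately show "quotient_char A I x \<in> chars Q" by (simp add: chars_def)
  qed
  show "chars Q \<subseteq> quotient_char A I ` zeros A I"
  proof
    fix z assume z: "z \<in> chars Q"
    then have z0: "z \<in> chars0 Q" by (rule chars_subset)
    interpret Q: abelian_cstar_algebra Q by (rule quotient_abelian)
    define x where "x a = (if a \<in> carrier A then z (cs a) else 0)" for a
    have "x \<in> chars0 A"
      using z0 by (auto simp: chars0_def x_def aclosed coset_in_quotient simp flip: quotient_ops)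
    moreover have "x \<noteq> (\<lambda>_. 0)"
    proof -
      obtain X where X: "X \<in> carrier Q" "z X = 1" using Q.chars_unit[OF z] .
      obtain a where "a \<in> carrier A" "X = cs a" using quotient_cosetE[OF X(1)] .
      then have "x a = 1" using X(2) by (simp add: x_def)
      then show ?thesis by (metis zero_neq_one)
    qed
    moreover have "x a = 0" if a: "a \<in> I" for a
    proof -
      have "cs a = vzero Q" using ideal_in_carrier[OF I a] a by (simp add: quotient_ops coset_eq_iff[OF I] aclosed)
      then show ?thesis using Q.char_zero[OF z0] by (simp add: x_def)
    qed
    ultimately have x: "x \<in> zeros A I" by (simp add: zeros_def chars_def)
    have "z X = quotient_char A I x X" for X
    proof (cases "X \<in> carrier Q")
      case True
      then show ?thesis using quotient_char_coset[OF x] by (auto elim!: quotient_cosetE simp: x_def)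
    next
      case False
      then show ?thesis using chars0D(1)[OF z0] by (simp add: quotient_char_def)
    qed
    then show "z \<in> quotient_char A I ` zeros A I" using x by blast
  qed
qed

end

end

section \<open>Actions on abelian C*-algebras\<close>

definition char_action ::
  "('a, 'm) cstar_scheme \<Rightarrow> ('g, 'n) monoid_scheme \<Rightarrow> ('g \<Rightarrow> 'a \<Rightarrow> 'a) \<Rightarrow> 'g \<Rightarrow> ('a \<Rightarrow> complex) \<Rightarrow> 'a \<Rightarrow> complex" where
  "char_action A G \<alpha> t x = (\<lambda>a. if a \<in> carrier A then x (\<alpha> (inv\<^bsub>G\<^esub> t) a) else 0)"

definition moved_chars ::
  "('a, 'm) cstar_scheme \<Rightarrow> ('g, 'n) monoid_scheme \<Rightarrow> ('g \<Rightarrow> 'a \<Rightarrow> 'a) \<Rightarrow> 'g \<Rightarrow> ('a \<Rightarrow> complex) set" where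
  "moved_chars A G \<alpha> t = {x \<in> chars A. char_action A G \<alpha> t x \<noteq> x}"

definition free_chars ::
  "('a, 'm) cstar_scheme \<Rightarrow> ('g, 'n) monoid_scheme \<Rightarrow> ('g \<Rightarrow> 'a \<Rightarrow> 'a) \<Rightarrow> ('a \<Rightarrow> complex) set" where
  "free_chars A G \<alpha> = {x \<in> chars A. \<forall>t\<in>carrier G - {\<one>\<^bsub>G\<^esub>}. char_action A G \<alpha> t x \<noteq> x}"

definition dense_chars :: "('a, 'm) cstar_scheme \<Rightarrow> ('a \<Rightarrow> complex) set \<Rightarrow> bool" where
  "dense_chars A D \<longleftrightarrow> (\<forall>b\<in>carrier A. (\<forall>x\<in>D. x b = 0) \<longrightarrow> b = \<zero>v\<^bsub>A\<^esub>)"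

context abelian_cstar_algebra
begin

lemma dense_chars_iff:
  assumes D: "D \<subseteq> chars A"
  shows "dense_chars A D \<longleftrightarrow> zeros A (kernel A D) = chars A"
proof
  assume "dense_chars A D"
  then have "b = \<zero>v" if "b \<in> kernel A D" for b using that by (simp add: dense_chars_def kernel_def)
  then show "zeros A (kernel A D) = chars A"
    using char_zero chars_subset by (force simp: zeros_def)
next
  assume eq: "zeros A (kernel A D) = chars A"
  show "dense_chars A D"
    unfolding dense_chars_def
  proof (intro ballI impI)
    fix b assume b: "b \<in> carrier A" "\<forall>x\<in>D. x b = 0"
    then have "b \<in> kernel A D" by (simp add: kernel_def)
    then have "x b = 0" if "x \<in> chars A" for x using eq that by (auto simp: zeros_def)
    then show "b = \<zero>v" using b by (intro eq_by_chars) (simp_all add: aclosed char_zero chars_subset)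
  qed
qed

end

section \<open>Group actions on characters and on the spectrum\<close>

locale abelian_system = cstar_dynamical_system A G \<alpha> + abelian_cstar_algebra A
  for A :: "('a, 'm) cstar_scheme" (structure) and G :: "('g, 'n) monoid_scheme" and \<alpha>
begin

abbreviation "act \<equiv> char_action A G \<alpha>"

lemma aut:
  assumes t: "t \<in> carrier G"
  shows "a \<in> carrier A \<Longrightarrow> \<alpha> t a \<in> carrier A"
    and "\<lbrakk>a \<in> carrier A; b \<in> carrier A\<rbrakk> \<Longrightarrow> \<alpha> t (a \<boxplus> b) = \<alpha> t a \<boxplus> \<alpha> t b"
    and "a \<in> carrier A \<Longrightarrow> \<alpha> t (c \<boxdot> a) = c \<boxdot> \<alpha> t a"
    and "\<lbrakk>a \<in> carrier A; b \<in> carrier A\<rbrakk> \<Longrightarrow> \<alpha> t (a \<boxtimes> b) = \<alpha> t a \<boxtimes> \<alpha> t b"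
    and "a \<in> carrier A \<Longrightarrow> \<alpha> t (astar A a) = astar A (\<alpha> t a)"
  using action_aut[OF t] by (auto simp: star_automorphism_def linear_map_def Pi_iff)

lemma action_inv:
  assumes "t \<in> carrier G" "a \<in> carrier A"
  shows "\<alpha> t (\<alpha> (inv\<^bsub>G\<^esub> t) a) = a" "\<alpha> (inv\<^bsub>G\<^esub> t) (\<alpha> t a) = a"
  using action_mult[of t "inv\<^bsub>G\<^esub> t" a] action_mult[of "inv\<^bsub>G\<^esub> t" t a] assms by (simp_all add: action_one)

lemma act_apply: "a \<in> carrier A \<Longrightarrow> act t x a = x (\<alpha> (inv\<^bsub>G\<^esub> t) a)"
  by (simp add: char_action_def)

lemma act_chars0: "\<lbrakk>t \<in> carrier G; x \<in> chars0 A\<rbrakk> \<Longrightarrow> act t x \<in> chars0 A"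
  unfolding chars0_def[of A] by (simp add: char_action_def aut aclosed)

lemma act_one: "x \<in> chars0 A \<Longrightarrow> act \<one>\<^bsub>G\<^esub> x = x"
  using chars0D(1)[of x A] by (auto simp: char_action_def action_one fun_eq_iff)

lemma act_mult:
  assumes "s \<in> carrier G" "t \<in> carrier G"
  shows "act (s \<otimes>\<^bsub>G\<^esub> t) x = act s (act t x)"
  using assms by (auto simp: char_action_def inv_mult_group action_mult aut fun_eq_iff)

lemma act_inv:
  assumes "t \<in> carrier G" "x \<in> chars0 A"
  shows "act t (act (inv\<^bsub>G\<^esub> t) x) = x" "act (inv\<^bsub>G\<^esub> t) (act t x) = x"
  using act_mult[of t "inv\<^bsub>G\<^esub> t" x] act_mult[of "inv\<^bsub>G\<^esub> t" t x] assms by (simp_all add: act_one)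

lemma act_chars:
  assumes t: "t \<in> carrier G" and x: "x \<in> chars A" shows "act t x \<in> chars A"
proof -
  obtain u where u: "u \<in> carrier A" "x u = 1" using chars_unit[OF x] .
  have "act t x (\<alpha> t u) = 1" using u t by (simp add: act_apply aut action_inv)
  then have "act t x \<noteq> (\<lambda>_. 0)" by (metis zero_neq_one)
  then show ?thesis using act_chars0[OF t chars_subset[OF x]] by (simp add: chars_def)
qed

text \<open>Automorphisms only permute characters, and the norm is determined by characters; the
  inverse gives the other inequality.\<close>

lemma aut_isometric:
  assumes t: "t \<in> carrier G" and a: "a \<in> carrier A" shows "vnorm A (\<alpha> t a) = vnorm A a"
proof -
  have le: "vnorm A (\<alpha> s b) \<le> vnorm A b" if s: "s \<in> carrier G" and b: "b \<in> carrier A" for s b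
  proof (rule norm_le_by_chars)
    fix x assume x: "x \<in> chars A"
    show "cmod (x (\<alpha> s b)) \<le> vnorm A b"
      using char_bound[OF act_chars0[OF inv_closed[OF s] chars_subset[OF x]] b] s b by (simp add: act_apply)
  qed (use s b in \<open>simp_all add: aut norm_nonneg\<close>)
  show ?thesis
    using le[OF t a] le[OF inv_closed[OF t] aut(1)[OF t a]] action_inv(2)[OF t a] by simp
qed

text \<open>Precomposition with the inverse automorphism keeps the Hilbert space and its invariant
  subspaces and replaces the scalar x(a) by the value of the translated character.\<close>

lemma spectrum_action_rep_class:
  assumes t: "t \<in> carrier G" and x: "x \<in> chars A"
  shows "spectrum_action A G \<alpha> t (rep_class A x) = rep_class A (act t x)"
proof -
  let ?s = "\<lambda>(H, \<pi>). (H, \<lambda>a. \<pi> (\<alpha> (inv\<^bsub>G\<^esub> t) a))"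
  have it: "inv\<^bsub>G\<^esub> t \<in> carrier G" using t by simp
  have shift: "?s \<rho> \<in> rep_class A (act t x)" if "\<rho> \<in> rep_class A x" for \<rho>
  proof -
    obtain H \<pi> where \<rho>: "\<rho> = (H, \<pi>)" by fastforce
    have irr: "irreducible_rep A (H, \<pi>)" and rc: "rep_char A (H, \<pi>) x"
      using that by (simp_all add: rep_class_def \<rho>)
    have "representation A (H, \<lambda>a. \<pi> (\<alpha> (inv\<^bsub>G\<^esub> t) a))"
      using irr aut[OF it] unfolding irreducible_rep_def representation_def by (simp add: aclosed)
    moreover have "\<exists>a\<in>carrier A. \<exists>\<xi>\<in>carrier H. \<pi> (\<alpha> (inv\<^bsub>G\<^esub> t) a) \<xi> \<noteq> \<zero>v\<^bsub>H\<^esub>"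
    proof -
      obtain a \<xi> where "a \<in> carrier A" "\<xi> \<in> carrier H" "\<pi> a \<xi> \<noteq> \<zero>v\<^bsub>H\<^esub>"
        using irr by (auto simp: irreducible_rep_def)
      then show ?thesis using aut(1)[OF t] action_inv(2)[OF t] by metis
    qed
    moreover have "M = {\<zero>v\<^bsub>H\<^esub>} \<or> M = carrier H"
      if "closed_subspace H M" "\<forall>a\<in>carrier A. \<pi> (\<alpha> (inv\<^bsub>G\<^esub> t) a) ` M \<subseteq> M" for M
    proof -
      have "\<pi> a ` M \<subseteq> M" if "a \<in> carrier A" for a
        using \<open>\<forall>a\<in>carrier A. _\<close> that aut(1)[OF t] action_inv(2)[OF t] by metis
      then show ?thesis using irr that(1) by (simp add: irreducible_rep_def)
    qed
    ultimately have "irreducible_rep A (H, \<lambda>a. \<pi> (\<alpha> (inv\<^bsub>G\<^esub> t) a))" by (simp add: irreducible_rep_def)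
    moreover have "rep_char A (H, \<lambda>a. \<pi> (\<alpha> (inv\<^bsub>G\<^esub> t) a)) (act t x)"
      using rc act_chars[OF t x] it by (simp add: rep_char_def act_apply aut)
    ultimately show ?thesis by (simp add: rep_class_def \<rho>)
  qed
  obtain \<rho> where \<rho>: "\<rho> \<in> rep_class A x" using rep_class_nonempty[OF x] by blast
  have "spectrum_action A G \<alpha> t (rep_class A x) = (\<Union>\<sigma>\<in>?s ` rep_class A x. unitary_equivalence A `` {\<sigma>})"
    unfolding spectrum_action_def by blast
  also have "\<dots> = (\<Union>\<sigma>\<in>?s ` rep_class A x. rep_class A (act t x))"
  proof (intro SUP_cong refl)
    fix \<sigma> assume "\<sigma> \<in> ?s ` rep_class A x"
    then obtain \<tau> where "\<tau> \<in> rep_class A x" "\<sigma> = ?s \<tau>" by blast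
    then show "unitary_equivalence A `` {\<sigma>} = rep_class A (act t x)"
      using unitary_equivalence_Image[OF shift] by blast
  qed
  also have "\<dots> = rep_class A (act t x)" using \<rho> by blast
  finally show ?thesis .
qed

lemma spectrum_action_fixed_iff:
  assumes "t \<in> carrier G" "x \<in> chars A"
  shows "spectrum_action A G \<alpha> t (rep_class A x) = rep_class A x \<longleftrightarrow> act t x = x"
  using spectrum_action_rep_class[OF assms] inj_on_eq_iff[OF inj_rep_class act_chars[OF assms] assms(2)] by simp

lemma topologically_free_iff:
  "topologically_free A G \<alpha> \<longleftrightarrow>
    (\<forall>F. finite F \<and> F \<subseteq> carrier G - {\<one>\<^bsub>G\<^esub>} \<longrightarrow> dense_chars A (chars A \<inter> (\<Inter>t\<in>F. moved_chars A G \<alpha> t)))"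
proof -
  have key: "spectrum_topology A closure_of
          (spectrum A \<inter> (\<Inter>t\<in>F. {x \<in> spectrum A. spectrum_action A G \<alpha> t x \<noteq> x})) = spectrum A \<longleftrightarrow>
        dense_chars A (chars A \<inter> (\<Inter>t\<in>F. moved_chars A G \<alpha> t))" if F: "F \<subseteq> carrier G - {\<one>\<^bsub>G\<^esub>}" for F
  proof -
    let ?D = "chars A \<inter> (\<Inter>t\<in>F. moved_chars A G \<alpha> t)"
    define S where "S = (\<Inter>t\<in>F. {x \<in> spectrum A. spectrum_action A G \<alpha> t x \<noteq> x})"
    define M where "M = (\<Inter>t\<in>F. moved_chars A G \<alpha> t)"
    have iff: "rep_class A x \<in> S \<longleftrightarrow> x \<in> M" if x: "x \<in> chars A" for x
    proof -
      have "spectrum_action A G \<alpha> t (rep_class A x) \<noteq> rep_class A x \<longleftrightarrow> act t x \<noteq> x" if "t \<in> F" for t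
        using that F x spectrum_action_fixed_iff[of t x] by blast
      moreover have "rep_class A x \<in> spectrum A" using x by (simp add: spectrum_eq)
      ultimately show ?thesis using x by (auto simp: moved_chars_def S_def M_def)
    qed
    have "rep_class A ` chars A \<inter> S = rep_class A ` (chars A \<inter> M)" using iff by blast
    then have eq: "spectrum A \<inter> (\<Inter>t\<in>F. {x \<in> spectrum A. spectrum_action A G \<alpha> t x \<noteq> x}) = rep_class A ` ?D"
      unfolding spectrum_eq S_def M_def .
    have D: "?D \<subseteq> chars A" by blast
    have sub: "zeros A (kernel A ?D) \<subseteq> chars A" by (auto simp: zeros_def)
    have "rep_class A ` zeros A (kernel A ?D) = rep_class A ` chars A \<longleftrightarrow> zeros A (kernel A ?D) = chars A"
      by (rule inj_on_image_eq_iff[OF inj_rep_class sub subset_refl])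
    then show ?thesis unfolding eq spectrum_topology_closure_of[OF D] dense_chars_iff[OF D] unfolding spectrum_eq .
  qed
  show ?thesis
    unfolding topologically_free_def
    by (intro all_cong1 imp_cong refl) (erule conjE, erule key)
qed

lemma zeros_invariant:
  assumes "closed_ideal A I" "invariant G \<alpha> I" "t \<in> carrier G" "x \<in> zeros A I"
  shows "act t x \<in> zeros A I"
proof -
  have "act t x a = 0" if "a \<in> I" for a
  proof -
    have "\<alpha> (inv\<^bsub>G\<^esub> t) a \<in> I" using assms(2,3) that by (auto simp: invariant_def)
    then show ?thesis using assms(4) ideal_in_carrier[OF assms(1) that] by (simp add: act_apply zeros_def)
  qed
  then show ?thesis using assms act_chars by (simp add: zeros_def)
qed

lemma kernel_invariant:
  assumes Y: "Y \<subseteq> chars0 A" and inv: "\<And>t x. \<lbrakk>t \<in> carrier G; x \<in> Y\<rbrakk> \<Longrightarrow> act t x \<in> Y"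
  shows "invariant G \<alpha> (kernel A Y)"
  unfolding invariant_def
proof clarify
  fix t a assume t: "t \<in> carrier G" and a: "a \<in> kernel A Y"
  have "x (\<alpha> t a) = 0" if x: "x \<in> Y" for x
    using inv[OF inv_closed[OF t] x] a t by (force simp: kernel_def act_apply)
  then show "\<alpha> t a \<in> kernel A Y" using a t by (simp add: kernel_def aut)
qed

text \<open>Closed invariant subsets of the spectrum are the hulls of the closed invariant ideals.
  Free points are dense in the hull of I exactly when the kernel of the free points in it is no
  larger than I.\<close>

lemma essentially_free_iff:
  "essentially_free (spectrum_topology A) G (spectrum_action A G \<alpha>) \<longleftrightarrow>
    (\<forall>I. closed_ideal A I \<and> invariant G \<alpha> I \<longrightarrow>
      (\<forall>b\<in>carrier A. (\<forall>x\<in>zeros A I \<inter> free_chars A G \<alpha>. x b = 0) \<longrightarrow> b \<in> I))"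
proof -
  let ?X = "spectrum_topology A" and ?s = "spectrum_action A G \<alpha>"
  have hom: "homeomorphic_map (top_of_set (chars A)) ?X (rep_class A)" by (rule homeomorphic_rep_class)
  have main: "subtopology ?X (rep_class A ` zeros A I) closure_of
        {y \<in> rep_class A ` zeros A I. {t \<in> carrier G. ?s t y = y} = {\<one>\<^bsub>G\<^esub>}} = rep_class A ` zeros A I \<longleftrightarrow>
      (\<forall>b\<in>carrier A. (\<forall>x\<in>zeros A I \<inter> free_chars A G \<alpha>. x b = 0) \<longrightarrow> b \<in> I)"
    if I: "closed_ideal A I" for I
  proof -
    let ?Z = "zeros A I"
    let ?D = "?Z \<inter> free_chars A G \<alpha>"
    have Z: "?Z \<subseteq> chars A" by (auto simp: zeros_def)
    have "{t \<in> carrier G. ?s t (rep_class A x) = rep_class A x} = {\<one>\<^bsub>G\<^esub>} \<longleftrightarrow> x \<in> free_chars A G \<alpha>"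
      if x: "x \<in> chars A" for x
    proof -
      have "{t \<in> carrier G. ?s t (rep_class A x) = rep_class A x} = {t \<in> carrier G. act t x = x}"
        using spectrum_action_fixed_iff[OF _ x] by blast
      then show ?thesis using act_one[OF chars_subset[OF x]] x by (auto simp: free_chars_def)
    qed
    then have eq: "{y \<in> rep_class A ` ?Z. {t \<in> carrier G. ?s t y = y} = {\<one>\<^bsub>G\<^esub>}} = rep_class A ` ?D"
      using Z by (auto simp: subset_iff)
    have D: "?D \<subseteq> chars A" using Z by blast
    have cl: "subtopology ?X (rep_class A ` ?Z) closure_of (rep_class A ` ?D)
        = rep_class A ` ?Z \<inter> rep_class A ` zeros A (kernel A ?D)"
      unfolding closure_of_subtopology
      by (subst Int_absorb1) (auto simp: spectrum_topology_closure_of[OF D])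
    have sub: "zeros A (kernel A ?D) \<subseteq> chars A" by (auto simp: zeros_def)
    have "rep_class A ` ?Z \<inter> rep_class A ` zeros A (kernel A ?D) = rep_class A ` ?Z
        \<longleftrightarrow> rep_class A ` ?Z \<subseteq> rep_class A ` zeros A (kernel A ?D)" by blast
    also have "\<dots> \<longleftrightarrow> ?Z \<subseteq> zeros A (kernel A ?D)"
      by (rule inj_on_image_subset_iff[OF inj_rep_class Z sub])
    also have "\<dots> \<longleftrightarrow> kernel A ?D \<subseteq> I"
    proof
      assume "?Z \<subseteq> zeros A (kernel A ?D)"
      then have "kernel A (zeros A (kernel A ?D)) \<subseteq> kernel A ?Z" by (auto simp: kernel_def)
      then have "kernel A (zeros A (kernel A ?D)) \<subseteq> I" using kernel_zeros[OF I] by simp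
      moreover have "kernel A ?D \<subseteq> kernel A (zeros A (kernel A ?D))" by (auto simp: kernel_def zeros_def)
      ultimately show "kernel A ?D \<subseteq> I" by blast
    qed (auto simp: zeros_def)
    also have "\<dots> \<longleftrightarrow> (\<forall>b\<in>carrier A. (\<forall>x\<in>?D. x b = 0) \<longrightarrow> b \<in> I)" by (auto simp: kernel_def)
    finally show ?thesis unfolding eq cl .
  qed
  have inv_iff: "invariant G ?s (rep_class A ` zeros A I) \<longleftrightarrow> invariant G \<alpha> I" if I: "closed_ideal A I" for I
  proof
    assume inv: "invariant G ?s (rep_class A ` zeros A I)"
    have "act t x \<in> zeros A I" if "t \<in> carrier G" "x \<in> zeros A I" for t x
    proof -
      have xc: "x \<in> chars A" using that by (simp add: zeros_def)
      have "?s t (rep_class A x) \<in> rep_class A ` zeros A I"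
        using inv that unfolding invariant_def by blast
      then have "rep_class A (act t x) \<in> rep_class A ` zeros A I"
        unfolding spectrum_action_rep_class[OF that(1) xc] .
      then show ?thesis
        using inj_on_image_mem_iff[OF inj_rep_class act_chars[OF that(1) xc], of "zeros A I"]
        by (auto simp: zeros_def)
    qed
    then have "invariant G \<alpha> (kernel A (zeros A I))"
      by (intro kernel_invariant) (use zeros_char0[OF I] in blast)+
    then show "invariant G \<alpha> I" using kernel_zeros[OF I] by simp
  next
    assume inv: "invariant G \<alpha> I"
    have "?s t (rep_class A x) \<in> rep_class A ` zeros A I" if "t \<in> carrier G" "x \<in> zeros A I" for t x
      using zeros_invariant[OF I inv that] spectrum_action_rep_class[of t x] that by (auto simp: zeros_def)
    then show "invariant G ?s (rep_class A ` zeros A I)" by (auto simp: invariant_def)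
  qed
  have closed_iff: "closedin ?X Y \<longleftrightarrow> (\<exists>I. closed_ideal A I \<and> Y = rep_class A ` zeros A I)" for Y
  proof
    assume Y: "closedin ?X Y"
    have img: "rep_class A ` chars A = topspace ?X" using homeomorphic_imp_surjective_map[OF hom] by simp
    define Z where "Z = {x \<in> chars A. rep_class A x \<in> Y}"
    have "Y \<subseteq> rep_class A ` chars A" using closedin_subset[OF Y] img by simp
    then have YZ: "Y = rep_class A ` Z" unfolding Z_def by blast
    have "closedin (top_of_set (chars A)) Z"
      using YZ homeomorphic_map_closedness[OF hom, of Z] Y by (auto simp: Z_def)
    then have "zeros A (kernel A Z) = Z" by (rule zeros_kernel)
    moreover have "closed_ideal A (kernel A Z)"
      by (rule kernel_closed_ideal) (auto simp: Z_def chars_subset)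
    ultimately show "\<exists>I. closed_ideal A I \<and> Y = rep_class A ` zeros A I" using YZ by metis
  next
    assume "\<exists>I. closed_ideal A I \<and> Y = rep_class A ` zeros A I"
    then obtain I where I: "Y = rep_class A ` zeros A I" by blast
    then show "closedin ?X Y"
      using homeomorphic_map_closedness[OF hom, of "zeros A I"] closedin_zeros[of I] by (auto simp: zeros_def)
  qed
  show ?thesis
    unfolding essentially_free_def
  proof (intro iffI allI impI; elim conjE)
    fix I
    assume I: "closed_ideal A I" and inv: "invariant G \<alpha> I"
      and *: "\<forall>Y. closedin ?X Y \<and> invariant G ?s Y \<longrightarrow>
        subtopology ?X Y closure_of {y \<in> Y. {t \<in> carrier G. ?s t y = y} = {\<one>\<^bsub>G\<^esub>}} = Y"
    have cl: "closedin ?X (rep_class A ` zeros A I)" unfolding closed_iff by (rule exI[of _ I]) (simp add: I)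
    have "invariant G ?s (rep_class A ` zeros A I)" using inv_iff[OF I] inv by simp
    with cl show "\<forall>b\<in>carrier A. (\<forall>x\<in>zeros A I \<inter> free_chars A G \<alpha>. x b = 0) \<longrightarrow> b \<in> I"
      using * by (intro iffD1[OF main[OF I]]) simp
  next
    fix Y
    assume *: "\<forall>I. closed_ideal A I \<and> invariant G \<alpha> I \<longrightarrow>
        (\<forall>b\<in>carrier A. (\<forall>x\<in>zeros A I \<inter> free_chars A G \<alpha>. x b = 0) \<longrightarrow> b \<in> I)"
      and cl: "closedin ?X Y" and inv: "invariant G ?s Y"
    obtain I where I: "closed_ideal A I" "Y = rep_class A ` zeros A I"
      using iffD1[OF closed_iff cl] by (elim exE conjE)
    have "invariant G \<alpha> I" using inv inv_iff[OF I(1)] I(2) by simp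
    then have "\<forall>b\<in>carrier A. (\<forall>x\<in>zeros A I \<inter> free_chars A G \<alpha>. x b = 0) \<longrightarrow> b \<in> I"
      using * I(1) by simp
    then show "subtopology ?X Y closure_of {y \<in> Y. {t \<in> carrier G. ?s t y = y} = {\<one>\<^bsub>G\<^esub>}} = Y"
      unfolding I(2) by (rule iffD2[OF main[OF I(1)]])
  qed
qed

section \<open>The quotient of a dynamical system\<close>

context
  fixes I assumes I: "closed_ideal A I" and inv: "invariant G \<alpha> I"
begin

lemma quotient_action_coset:
  assumes t: "t \<in> carrier G" and a: "a \<in> carrier A"
  shows "quotient_action \<alpha> t (coset A I a) = coset A I (\<alpha> t a)"
proof -
  have sub: "\<alpha> s i \<in> I" if "s \<in> carrier G" "i \<in> I" for s i using inv that by (auto simp: invariant_def)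
  \<comment> \<open>Invariance is assumed as an inclusion only; applying it to the inverse of t
    turns it into equality, which the image of a coset requires.\<close>
  have "I \<subseteq> \<alpha> t ` I"
  proof
    fix i assume i: "i \<in> I"
    then have "\<alpha> t (\<alpha> (inv\<^bsub>G\<^esub> t) i) = i" using action_inv(1)[OF t] ideal_in_carrier[OF I] by blast
    then show "i \<in> \<alpha> t ` I" using sub[OF inv_closed[OF t] i] by (metis imageI)
  qed
  then have "\<alpha> t ` I = I" using sub[OF t] by blast
  have "quotient_action \<alpha> t (coset A I a) = (\<lambda>i. \<alpha> t a \<boxplus> \<alpha> t i) ` I"
    unfolding quotient_action_def coset_def image_image
    by (rule image_cong) (simp_all add: aut[OF t] a ideal_in_carrier[OF I])
  also have "\<dots> = coset A I (\<alpha> t a)" unfolding coset_def by (metis \<open>\<alpha> t ` I = I\<close> image_image)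
  finally show ?thesis .
qed

theorem quotient_system: "abelian_system (quotient_algebra A I) G (quotient_action \<alpha>)"
proof -
  let ?Q = "quotient_algebra A I"
  interpret Q: abelian_cstar_algebra ?Q by (rule quotient_abelian[OF I])
  note quotient_ops = quotient_add[OF I] quotient_mult[OF I] quotient_scale[OF I] quotient_star[OF I]
  note E = quotient_cosetE[OF I] and C = coset_in_quotient[OF I]
  have aut_t: "star_automorphism ?Q (quotient_action \<alpha> t)" if t: "t \<in> carrier G" for t
  proof -
    have it: "inv\<^bsub>G\<^esub> t \<in> carrier G" using t by simp
    note qa = quotient_action_coset[OF t]
    have cl: "quotient_action \<alpha> t X \<in> carrier ?Q" if "X \<in> carrier ?Q" for X
      using E[OF that] qa C aut(1)[OF t] by metis
    have i1: "quotient_action \<alpha> t (quotient_action \<alpha> (inv\<^bsub>G\<^esub> t) X) = X"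
      and i2: "quotient_action \<alpha> (inv\<^bsub>G\<^esub> t) (quotient_action \<alpha> t X) = X" if X: "X \<in> carrier ?Q" for X
    proof -
      obtain a where "a \<in> carrier A" "X = coset A I a" using E[OF X] .
      then show "quotient_action \<alpha> t (quotient_action \<alpha> (inv\<^bsub>G\<^esub> t) X) = X"
        "quotient_action \<alpha> (inv\<^bsub>G\<^esub> t) (quotient_action \<alpha> t X) = X"
        using t it by (simp_all add: quotient_action_coset aut action_inv)
    qed
    have cl': "quotient_action \<alpha> (inv\<^bsub>G\<^esub> t) X \<in> carrier ?Q" if "X \<in> carrier ?Q" for X
      using E[OF that] quotient_action_coset[OF it] C aut(1)[OF it] by metis
    have "bij_betw (quotient_action \<alpha> t) (carrier ?Q) (carrier ?Q)"
      by (rule bij_betw_byWitness[where f' = "quotient_action \<alpha> (inv\<^bsub>G\<^esub> t)"]) (use i1 i2 cl cl' in auto)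
    moreover have "linear_map ?Q ?Q (quotient_action \<alpha> t)"
      unfolding linear_map_def using cl
      by (auto elim!: E) (simp_all add: quotient_ops qa aut[OF t] aclosed)
    moreover have "quotient_action \<alpha> t (X \<boxtimes>\<^bsub>?Q\<^esub> Y) = quotient_action \<alpha> t X \<boxtimes>\<^bsub>?Q\<^esub> quotient_action \<alpha> t Y"
      if "X \<in> carrier ?Q" "Y \<in> carrier ?Q" for X Y
      using that by (auto elim!: E simp: quotient_ops qa aut[OF t] aclosed)
    moreover have "quotient_action \<alpha> t (astar ?Q X) = astar ?Q (quotient_action \<alpha> t X)"
      if "X \<in> carrier ?Q" for X
      using that by (auto elim!: E simp: quotient_ops qa aut[OF t] aclosed)
    ultimately show ?thesis by (simp add: star_automorphism_def)
  qed
  show ?thesis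
  proof (intro abelian_system.intro cstar_dynamical_system.intro cstar_dynamical_system_axioms.intro)
    show "cstar_algebra ?Q" "abelian_cstar_algebra ?Q" by unfold_locales
    show "group G" by unfold_locales
    show "quotient_action \<alpha> \<one>\<^bsub>G\<^esub> X = X" if "X \<in> carrier ?Q" for X
      using that by (auto elim!: E simp: quotient_action_coset action_one)
    show "quotient_action \<alpha> (s \<otimes>\<^bsub>G\<^esub> t) X = quotient_action \<alpha> s (quotient_action \<alpha> t X)"
      if "s \<in> carrier G" "t \<in> carrier G" "X \<in> carrier ?Q" for s t X
      using that by (auto elim!: E simp: quotient_action_coset action_mult aut)
  qed (rule aut_t)
qed

lemma char_action_quotient_char:
  assumes t: "t \<in> carrier G" and x: "x \<in> zeros A I"
  shows "char_action (quotient_algebra A I) G (quotient_action \<alpha>) t (quotient_char A I x)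
    = quotient_char A I (act t x)"
proof
  fix X
  show "char_action (quotient_algebra A I) G (quotient_action \<alpha>) t (quotient_char A I x) X
    = quotient_char A I (act t x) X"
  proof (cases "X \<in> carrier (quotient_algebra A I)")
    case True
    obtain a where "a \<in> carrier A" "X = coset A I a" using quotient_cosetE[OF I True] .
    then show ?thesis
      using True t x zeros_invariant[OF I inv t x]
      by (simp add: char_action_def quotient_action_coset quotient_char_coset[OF I] aut)
  next
    case False
    then show ?thesis by (simp add: char_action_def quotient_char_def)
  qed
qed

text \<open>The characters of the quotient are, equivariantly, those in the hull of I, so they have
  the same isotropy as in A. This connects essential freeness, stated inside the spectrum of A, with
  the properties of the quotient systems.\<close>

lemma free_dense_quotient_iff:
  "dense_chars (quotient_algebra A I) (free_chars (quotient_algebra A I) G (quotient_action \<alpha>)) \<longleftrightarrow>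
    (\<forall>b\<in>carrier A. (\<forall>x\<in>zeros A I \<inter> free_chars A G \<alpha>. x b = 0) \<longrightarrow> b \<in> I)"
proof -
  let ?Q = "quotient_algebra A I"
  have inj: "quotient_char A I x = quotient_char A I y \<longleftrightarrow> x = y" if x: "x \<in> zeros A I" and y: "y \<in> zeros A I" for x y
  proof
    assume eq: "quotient_char A I x = quotient_char A I y"
    have "x a = y a" for a
    proof (cases "a \<in> carrier A")
      case True
      then show ?thesis using eq quotient_char_coset[OF I x True] quotient_char_coset[OF I y True] by simp
    next
      case False
      then show ?thesis using x y chars0D(1)[OF zeros_char0[OF I]] by metis
    qed
    then show "x = y" by blast
  qed simp
  have "quotient_char A I x \<in> free_chars ?Q G (quotient_action \<alpha>) \<longleftrightarrow> x \<in> free_chars A G \<alpha>"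
    if x: "x \<in> zeros A I" for x
    using x inj[OF zeros_invariant[OF I inv _ x] x] chars_quotient[OF I]
    by (auto simp: free_chars_def char_action_quotient_char zeros_def)
  then have fr: "free_chars ?Q G (quotient_action \<alpha>) = quotient_char A I ` (zeros A I \<inter> free_chars A G \<alpha>)"
    using chars_quotient[OF I] by (auto simp: free_chars_def)
  have "dense_chars ?Q D \<longleftrightarrow> (\<forall>b\<in>carrier A. (\<forall>z\<in>D. z (coset A I b) = 0) \<longrightarrow> coset A I b = \<zero>v\<^bsub>?Q\<^esub>)" for D
    unfolding dense_chars_def using quotient_carrier[OF I] by auto
  moreover have "coset A I b = \<zero>v\<^bsub>?Q\<^esub> \<longleftrightarrow> b \<in> I" if "b \<in> carrier A" for b
    using that by (simp add: quotient_zero[OF I] coset_eq_iff[OF I] aclosed)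
  ultimately show ?thesis unfolding fr using quotient_char_coset[OF I] by auto
qed

end

end

section \<open>Bounded sequences\<close>

lemma linf_simps [simp]:
  "vadd (linf A) f g n = f n \<boxplus>\<^bsub>A\<^esub> g n" "vzero (linf A) n = \<zero>v\<^bsub>A\<^esub>" "vscale (linf A) c f n = c \<boxdot>\<^bsub>A\<^esub> f n"
  "amult (linf A) f g n = f n \<boxtimes>\<^bsub>A\<^esub> g n" "astar (linf A) f n = astar A (f n)"
  by (simp_all add: linf_def)

lemma linf_minus [simp]: "vminus (linf A) f g n = vminus A (f n) (g n)"
  by (simp add: vminus_def)

lemma linf_carrier: "f \<in> carrier (linf A) \<longleftrightarrow> (\<forall>n. f n \<in> carrier A) \<and> (\<exists>K. \<forall>n. vnorm A (f n) \<le> K)"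
  by (auto simp: linf_def bdd_above_def)

lemma linf_norm_upper: "f \<in> carrier (linf A) \<Longrightarrow> vnorm A (f n) \<le> vnorm (linf A) f"
  by (auto simp: linf_def intro!: cSUP_upper)

lemma linf_norm_least: "(\<And>n. vnorm A (f n) \<le> r) \<Longrightarrow> vnorm (linf A) f \<le> r"
  by (auto simp: linf_def intro!: cSUP_least)

context abelian_cstar_algebra
begin

lemma linf_mem: "f \<in> carrier (linf A) \<Longrightarrow> f n \<in> carrier A"
  by (simp add: linf_carrier)

lemma linfI: "\<lbrakk>\<And>n. f n \<in> carrier A; \<And>n. vnorm A (f n) \<le> K\<rbrakk> \<Longrightarrow> f \<in> carrier (linf A)"
  by (auto simp: linf_carrier)

lemma linf_closed:
  assumes f: "f \<in> carrier (linf A)" and g: "g \<in> carrier (linf A)"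
  shows "f \<boxplus>\<^bsub>linf A\<^esub> g \<in> carrier (linf A)" "f \<boxtimes>\<^bsub>linf A\<^esub> g \<in> carrier (linf A)"
    "c \<boxdot>\<^bsub>linf A\<^esub> f \<in> carrier (linf A)" "astar (linf A) f \<in> carrier (linf A)"
proof -
  note m = linf_mem[OF f] linf_mem[OF g]
  show "f \<boxplus>\<^bsub>linf A\<^esub> g \<in> carrier (linf A)"
  proof (rule linfI[where K = "vnorm (linf A) f + vnorm (linf A) g"])
    show "vnorm A ((f \<boxplus>\<^bsub>linf A\<^esub> g) n) \<le> vnorm (linf A) f + vnorm (linf A) g" for n
      using norm_triangle[OF m, of n n] linf_norm_upper[OF f, of n] linf_norm_upper[OF g, of n] by simp
  qed (simp add: m aclosed)
  show "f \<boxtimes>\<^bsub>linf A\<^esub> g \<in> carrier (linf A)"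
  proof (rule linfI[where K = "vnorm (linf A) f * vnorm (linf A) g"])
    show "vnorm A ((f \<boxtimes>\<^bsub>linf A\<^esub> g) n) \<le> vnorm (linf A) f * vnorm (linf A) g" for n
      using norm_mult[OF m, of n n] norm_nonneg[OF m(1)] norm_nonneg[OF m(2)]
        mult_mono[OF linf_norm_upper[OF f, of n] linf_norm_upper[OF g, of n]]
        order_trans[OF norm_nonneg[OF m(1)] linf_norm_upper[OF f]] by (simp add: order_trans)
  qed (simp add: m aclosed)
  show "c \<boxdot>\<^bsub>linf A\<^esub> f \<in> carrier (linf A)"
    by (rule linfI[where K = "cmod c * vnorm (linf A) f"])
      (simp_all add: m aclosed norm_scale mult_left_mono linf_norm_upper[OF f])
  show "astar (linf A) f \<in> carrier (linf A)"
    by (rule linfI[where K = "vnorm (linf A) f"]) (simp_all add: m aclosed linf_norm_upper[OF f])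
qed

lemma linf_norm_nonneg: "f \<in> carrier (linf A) \<Longrightarrow> 0 \<le> vnorm (linf A) f"
  using order_trans[OF norm_nonneg linf_norm_upper] linf_mem by blast

lemma linf_normed: "complex_normed_space (linf A)"
proof
  show "\<zero>v\<^bsub>linf A\<^esub> \<in> carrier (linf A)" by (rule linfI[where K = 0]) (simp_all add: aclosed)
  fix f g h c d
  {
    assume f: "f \<in> carrier (linf A)"
    note fm = linf_mem[OF f]
    show "c \<boxdot>\<^bsub>linf A\<^esub> f \<in> carrier (linf A)" by (rule linf_closed(3)[OF f f])
    show "f \<boxplus>\<^bsub>linf A\<^esub> \<zero>v\<^bsub>linf A\<^esub> = f" "1 \<boxdot>\<^bsub>linf A\<^esub> f = f"
      "(c + d) \<boxdot>\<^bsub>linf A\<^esub> f = c \<boxdot>\<^bsub>linf A\<^esub> f \<boxplus>\<^bsub>linf A\<^esub> d \<boxdot>\<^bsub>linf A\<^esub> f"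
      "(c * d) \<boxdot>\<^bsub>linf A\<^esub> f = c \<boxdot>\<^bsub>linf A\<^esub> d \<boxdot>\<^bsub>linf A\<^esub> f"
      by (simp_all add: fun_eq_iff fm add_zero scale_one scale_add_left scale_scale)
    have "f \<boxplus>\<^bsub>linf A\<^esub> (-1) \<boxdot>\<^bsub>linf A\<^esub> f = \<zero>v\<^bsub>linf A\<^esub>" by (simp add: fun_eq_iff fm add_neg)
    then show "\<exists>g\<in>carrier (linf A). f \<boxplus>\<^bsub>linf A\<^esub> g = \<zero>v\<^bsub>linf A\<^esub>" using linf_closed(3)[OF f f] by blast
    show "vnorm (linf A) f = 0 \<longleftrightarrow> f = \<zero>v\<^bsub>linf A\<^esub>"
    proof
      assume 0: "vnorm (linf A) f = 0"
      have "vnorm A (f n) = 0" for n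
        using linf_norm_upper[OF f, of n] norm_nonneg[OF fm, of n] 0 by simp
      then show "f = \<zero>v\<^bsub>linf A\<^esub>" by (simp add: fun_eq_iff norm_eq_zero[OF fm])
    next
      assume "f = \<zero>v\<^bsub>linf A\<^esub>"
      then show "vnorm (linf A) f = 0" using linf_norm_nonneg[OF f] linf_norm_least[of A f 0] by simp
    qed
    have le: "vnorm (linf A) (c \<boxdot>\<^bsub>linf A\<^esub> g) \<le> cmod c * vnorm (linf A) g" if g: "g \<in> carrier (linf A)" for c g
      by (rule linf_norm_least) (simp add: norm_scale linf_mem[OF g] mult_left_mono linf_norm_upper[OF g])
    have "cmod c * vnorm (linf A) f \<le> vnorm (linf A) (c \<boxdot>\<^bsub>linf A\<^esub> f)"
    proof (cases "c = 0")
      case True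
      then show ?thesis using linf_norm_nonneg[OF linf_closed(3)[OF f f]] by simp
    next
      case False
      have "(1 / c) \<boxdot>\<^bsub>linf A\<^esub> c \<boxdot>\<^bsub>linf A\<^esub> f = f"
        using False by (simp add: fun_eq_iff fm scale_one flip: scale_scale)
      then show ?thesis using le[OF linf_closed(3)[OF f f], of "1 / c" c] False
        by (simp add: norm_divide field_simps)
    qed
    then show "vnorm (linf A) (c \<boxdot>\<^bsub>linf A\<^esub> f) = cmod c * vnorm (linf A) f" using le[OF f, of c] by simp
    assume g: "g \<in> carrier (linf A)"
    note gm = linf_mem[OF g]
    show "f \<boxplus>\<^bsub>linf A\<^esub> g \<in> carrier (linf A)" by (rule linf_closed(1)[OF f g])
    show "f \<boxplus>\<^bsub>linf A\<^esub> g = g \<boxplus>\<^bsub>linf A\<^esub> f" using add_comm[OF fm gm] by (simp add: fun_eq_iff)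
    show "c \<boxdot>\<^bsub>linf A\<^esub> (f \<boxplus>\<^bsub>linf A\<^esub> g) = c \<boxdot>\<^bsub>linf A\<^esub> f \<boxplus>\<^bsub>linf A\<^esub> c \<boxdot>\<^bsub>linf A\<^esub> g"
      by (simp add: fun_eq_iff fm gm scale_add_right)
    show "vnorm (linf A) (f \<boxplus>\<^bsub>linf A\<^esub> g) \<le> vnorm (linf A) f + vnorm (linf A) g"
    proof (rule linf_norm_least)
      show "vnorm A ((f \<boxplus>\<^bsub>linf A\<^esub> g) n) \<le> vnorm (linf A) f + vnorm (linf A) g" for n
        using norm_triangle[OF fm gm, of n n] linf_norm_upper[OF f, of n] linf_norm_upper[OF g, of n] by simp
    qed
    assume h: "h \<in> carrier (linf A)"
    show "(f \<boxplus>\<^bsub>linf A\<^esub> g) \<boxplus>\<^bsub>linf A\<^esub> h = f \<boxplus>\<^bsub>linf A\<^esub> (g \<boxplus>\<^bsub>linf A\<^esub> h)"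
      by (simp add: fun_eq_iff fm gm linf_mem[OF h] add_assoc)
  }
qed

lemma linf_banach: "complex_banach_space (linf A)"
proof -
  interpret L: complex_normed_space "linf A" by (rule linf_normed)
  have "Metric_space.mcomplete (carrier (linf A)) (vdist (linf A))"
    unfolding L.mcomplete_iff
  proof (intro allI impI, elim conjE)
    fix F assume F: "range F \<subseteq> carrier (linf A)" and cau: "L.cauchy_seq F"
    have FL: "F k \<in> carrier (linf A)" for k using F by blast
    note Fm = linf_mem[OF FL]
    have diff: "vnorm A (vminus A (F i n) (F j n)) \<le> vnorm (linf A) (vminus (linf A) (F i) (F j))" for i j n
      using linf_norm_upper[OF L.minus_closed[OF FL FL], of i j n] by simp
    have "cauchy_seq (\<lambda>k. F k n)" for n
      unfolding cauchy_seq_def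
    proof (intro allI impI)
      fix e :: real assume "e > 0"
      then obtain N where "\<forall>i\<ge>N. \<forall>j\<ge>N. vnorm (linf A) (vminus (linf A) (F i) (F j)) < e"
        using cau unfolding L.cauchy_seq_def by blast
      then show "\<exists>N. \<forall>i\<ge>N. \<forall>j\<ge>N. vnorm A (vminus A (F i n) (F j n)) < e" using diff le_less_trans by blast
    qed
    moreover have "range (\<lambda>k. F k n) \<subseteq> carrier A" for n using Fm by blast
    ultimately have "\<exists>l. l \<in> carrier A \<and> converges (\<lambda>k. F k n) l" for n
      using complete[unfolded mcomplete_iff, rule_format, of "\<lambda>k. F k n"] by blast
    then have "\<exists>l. \<forall>n. l n \<in> carrier A \<and> converges (\<lambda>k. F k n) (l n)" by (intro choice allI)
    then obtain l where l: "\<And>n. l n \<in> carrier A" "\<And>n. converges (\<lambda>k. F k n) (l n)" by blast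
    have close: "vnorm A (vminus A (F i n) (l n)) \<le> e"
      if N: "\<forall>i\<ge>N. \<forall>j\<ge>N. vnorm (linf A) (vminus (linf A) (F i) (F j)) < e" and i: "i \<ge> N" for N e i n
    proof -
      have "vnorm A (vminus A (F i n) (l n)) \<le> e + 0"
      proof (rule LIMSEQ_le_const)
        show "(\<lambda>j. e + vnorm A (vminus A (F j n) (l n))) \<longlonglongrightarrow> e + 0"
          using l(2)[of n] unfolding converges_def by (intro tendsto_intros)
        have "vnorm A (vminus A (F i n) (l n)) \<le> e + vnorm A (vminus A (F j n) (l n))" if "j \<ge> N" for j
          using norm_minus_triangle[OF Fm[of i n] Fm[of j n] l(1)[of n]] diff[of i n j]
            N[rule_format, OF i that] by linarith
        then show "\<exists>N. \<forall>j\<ge>N. vnorm A (vminus A (F i n) (l n)) \<le> e + vnorm A (vminus A (F j n) (l n))" by blast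
      qed
      then show ?thesis by simp
    qed
    obtain N where N: "\<forall>i\<ge>N. \<forall>j\<ge>N. vnorm (linf A) (vminus (linf A) (F i) (F j)) < 1"
      using cau unfolding L.cauchy_seq_def by (meson zero_less_one)
    have lL: "l \<in> carrier (linf A)"
    proof (rule linfI[where K = "vnorm (linf A) (F N) + 1"])
      show "vnorm A (l n) \<le> vnorm (linf A) (F N) + 1" for n
        using close[OF N order_refl, of n] norm_le_norm_minus[OF l(1)[of n] Fm[of N n]]
          norm_minus_commute[OF l(1)[of n] Fm[of N n]] linf_norm_upper[OF FL, of N n] by linarith
    qed (rule l(1))
    have "L.converges F l"
      unfolding L.converges_def
    proof (rule LIMSEQ_I)
      fix e :: real assume "e > 0"
      then obtain N where N: "\<forall>i\<ge>N. \<forall>j\<ge>N. vnorm (linf A) (vminus (linf A) (F i) (F j)) < e / 2"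
        using cau unfolding L.cauchy_seq_def by (meson half_gt_zero)
      have half: "vnorm (linf A) (vminus (linf A) (F i) l) \<le> e / 2" if "i \<ge> N" for i
        using close[OF N that] by (intro linf_norm_least) simp
      have "norm (vnorm (linf A) (vminus (linf A) (F i) l) - 0) < e" if "i \<ge> N" for i
        using half[OF that] \<open>e > 0\<close> L.norm_nonneg[OF L.minus_closed[OF FL lL], of i] by simp
      then show "\<exists>M. \<forall>i\<ge>M. norm (vnorm (linf A) (vminus (linf A) (F i) l) - 0) < e" by blast
    qed
    then show "\<exists>l\<in>carrier (linf A). L.converges F l" using lL by blast
  qed
  then show ?thesis using linf_normed by (simp add: complex_banach_space_def complex_banach_space_axioms_def)
qed

lemma linf_abelian: "abelian_cstar_algebra (linf A)"
proof (intro abelian_cstar_algebra.intro cstar_algebra.intro linf_banach cstar_algebra_axioms.intro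
    abelian_cstar_algebra_axioms.intro)
  fix f g h k
  {
    assume f: "f \<in> carrier (linf A)"
    note fm = linf_mem[OF f]
    show "astar (linf A) f \<in> carrier (linf A)" by (rule linf_closed(4)[OF f f])
    show "astar (linf A) (astar (linf A) f) = f"
      "astar (linf A) (k \<boxdot>\<^bsub>linf A\<^esub> f) = cnj k \<boxdot>\<^bsub>linf A\<^esub> astar (linf A) f"
      by (simp_all add: fun_eq_iff fm star_star star_scale)
    have sf: "astar (linf A) f \<boxtimes>\<^bsub>linf A\<^esub> f \<in> carrier (linf A)"
      by (intro linf_closed(2) f linf_closed(4)[OF f f])
    show "vnorm (linf A) (astar (linf A) f \<boxtimes>\<^bsub>linf A\<^esub> f) = (vnorm (linf A) f)\<^sup>2"
    proof (rule antisym)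
      show "vnorm (linf A) (astar (linf A) f \<boxtimes>\<^bsub>linf A\<^esub> f) \<le> (vnorm (linf A) f)\<^sup>2"
        by (rule linf_norm_least) (simp add: cstar_identity fm power_mono linf_norm_upper[OF f] norm_nonneg)
      have "vnorm (linf A) f \<le> sqrt (vnorm (linf A) (astar (linf A) f \<boxtimes>\<^bsub>linf A\<^esub> f))"
      proof (rule linf_norm_least, rule real_le_rsqrt)
        show "(vnorm A (f n))\<^sup>2 \<le> vnorm (linf A) (astar (linf A) f \<boxtimes>\<^bsub>linf A\<^esub> f)" for n
          using linf_norm_upper[OF sf, of n] by (simp add: cstar_identity fm)
      qed
      then have "(vnorm (linf A) f)\<^sup>2 \<le> (sqrt (vnorm (linf A) (astar (linf A) f \<boxtimes>\<^bsub>linf A\<^esub> f)))\<^sup>2"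
        by (intro power_mono linf_norm_nonneg f)
      then show "(vnorm (linf A) f)\<^sup>2 \<le> vnorm (linf A) (astar (linf A) f \<boxtimes>\<^bsub>linf A\<^esub> f)"
        using linf_norm_nonneg[OF sf] by simp
    qed
    assume g: "g \<in> carrier (linf A)"
    note gm = linf_mem[OF g]
    show "f \<boxtimes>\<^bsub>linf A\<^esub> g \<in> carrier (linf A)" by (rule linf_closed(2)[OF f g])
    show "f \<boxtimes>\<^bsub>linf A\<^esub> g = g \<boxtimes>\<^bsub>linf A\<^esub> f" using mult_comm[OF fm gm] by (simp add: fun_eq_iff)
    show "(k \<boxdot>\<^bsub>linf A\<^esub> f) \<boxtimes>\<^bsub>linf A\<^esub> g = k \<boxdot>\<^bsub>linf A\<^esub> (f \<boxtimes>\<^bsub>linf A\<^esub> g)"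
      "f \<boxtimes>\<^bsub>linf A\<^esub> (k \<boxdot>\<^bsub>linf A\<^esub> g) = k \<boxdot>\<^bsub>linf A\<^esub> (f \<boxtimes>\<^bsub>linf A\<^esub> g)"
      "astar (linf A) (f \<boxplus>\<^bsub>linf A\<^esub> g) = astar (linf A) f \<boxplus>\<^bsub>linf A\<^esub> astar (linf A) g"
      "astar (linf A) (f \<boxtimes>\<^bsub>linf A\<^esub> g) = astar (linf A) g \<boxtimes>\<^bsub>linf A\<^esub> astar (linf A) f"
      by (simp_all add: fun_eq_iff fm gm mult_scale_left mult_scale_right star_add star_mult)
    show "vnorm (linf A) (f \<boxtimes>\<^bsub>linf A\<^esub> g) \<le> vnorm (linf A) f * vnorm (linf A) g"
    proof (rule linf_norm_least)
      fix n
      have "vnorm A (f n \<boxtimes> g n) \<le> vnorm A (f n) * vnorm A (g n)" by (rule norm_mult[OF fm gm])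
      also have "\<dots> \<le> vnorm (linf A) f * vnorm (linf A) g"
        by (intro mult_mono linf_norm_upper f g linf_norm_nonneg norm_nonneg gm)
      finally show "vnorm A ((f \<boxtimes>\<^bsub>linf A\<^esub> g) n) \<le> vnorm (linf A) f * vnorm (linf A) g" by simp
    qed
    assume h: "h \<in> carrier (linf A)"
    note hm = linf_mem[OF h]
    show "(f \<boxtimes>\<^bsub>linf A\<^esub> g) \<boxtimes>\<^bsub>linf A\<^esub> h = f \<boxtimes>\<^bsub>linf A\<^esub> (g \<boxtimes>\<^bsub>linf A\<^esub> h)"
      "(f \<boxplus>\<^bsub>linf A\<^esub> g) \<boxtimes>\<^bsub>linf A\<^esub> h = (f \<boxtimes>\<^bsub>linf A\<^esub> h) \<boxplus>\<^bsub>linf A\<^esub> (g \<boxtimes>\<^bsub>linf A\<^esub> h)"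
      "f \<boxtimes>\<^bsub>linf A\<^esub> (g \<boxplus>\<^bsub>linf A\<^esub> h) = (f \<boxtimes>\<^bsub>linf A\<^esub> g) \<boxplus>\<^bsub>linf A\<^esub> (f \<boxtimes>\<^bsub>linf A\<^esub> h)"
      by (simp_all add: fun_eq_iff fm gm hm mult_assoc mult_add_left mult_add_right)
  }
qed

lemma c0_closed_ideal: "closed_ideal (linf A) (c0_ideal A)"
proof -
  interpret L: abelian_cstar_algebra "linf A" by (rule linf_abelian)
  have mem: "f \<in> c0_ideal A \<longleftrightarrow> f \<in> carrier (linf A) \<and> (\<lambda>n. vnorm A (f n)) \<longlonglongrightarrow> 0" for f
    by (simp add: c0_ideal_def)
  have "closed_subspace (linf A) (c0_ideal A)"
  proof (rule L.closed_subspaceI)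
    show "c0_ideal A \<subseteq> carrier (linf A)" by (auto simp: mem)
    show "\<zero>v\<^bsub>linf A\<^esub> \<in> c0_ideal A" by (simp add: mem L.zero_closed)
    show "f \<boxplus>\<^bsub>linf A\<^esub> g \<in> c0_ideal A" if f: "f \<in> c0_ideal A" and g: "g \<in> c0_ideal A" for f g
    proof -
      have fg: "f \<in> carrier (linf A)" "g \<in> carrier (linf A)" using f g by (simp_all add: mem)
      have "(\<lambda>n. vnorm A (f n) + vnorm A (g n)) \<longlonglongrightarrow> 0 + 0" using f g by (intro tendsto_add) (simp_all add: mem)
      then have lim: "(\<lambda>n. vnorm A (f n) + vnorm A (g n)) \<longlonglongrightarrow> 0" by simp
      have "(\<lambda>n. vnorm A (f n \<boxplus> g n)) \<longlonglongrightarrow> 0"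
        by (rule Lim_null_comparison[OF always_eventually lim])
          (simp add: norm_triangle norm_nonneg linf_mem[OF fg(1)] linf_mem[OF fg(2)] aclosed)
      then show ?thesis using fg by (simp add: mem L.add_closed)
    qed
    show "c \<boxdot>\<^bsub>linf A\<^esub> f \<in> c0_ideal A" if f: "f \<in> c0_ideal A" for c f
    proof -
      have fl: "f \<in> carrier (linf A)" using f by (simp add: mem)
      have "(\<lambda>n. cmod c * vnorm A (f n)) \<longlonglongrightarrow> cmod c * 0" using f by (intro tendsto_intros) (simp add: mem)
      then show ?thesis using fl by (simp add: mem L.scale_closed norm_scale linf_mem[OF fl])
    qed
    fix F l assume F: "range F \<subseteq> c0_ideal A" and l: "l \<in> carrier (linf A)" and conv: "L.converges F l"
    have FL: "F k \<in> carrier (linf A)" "(\<lambda>n. vnorm A (F k n)) \<longlonglongrightarrow> 0" for k using F mem by blast+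
    have "(\<lambda>n. vnorm A (l n)) \<longlonglongrightarrow> 0"
    proof (rule LIMSEQ_I)
      fix e :: real assume e: "e > 0"
      obtain k where k: "vnorm (linf A) (vminus (linf A) (F k) l) < e / 2"
        using order_tendstoD(2)[OF conv[unfolded L.converges_def], of "e / 2"] e
        unfolding eventually_sequentially by auto
      obtain N where N: "\<And>n. n \<ge> N \<Longrightarrow> vnorm A (F k n) < e / 2"
        using order_tendstoD(2)[OF FL(2)[of k], of "e / 2"] e unfolding eventually_sequentially by auto
      have "norm (vnorm A (l n) - 0) < e" if "n \<ge> N" for n
        using norm_le_norm_minus[OF linf_mem[OF l] linf_mem[OF FL(1)], of n k n]
          norm_minus_commute[OF linf_mem[OF l] linf_mem[OF FL(1)], of n k n]
          linf_norm_upper[OF L.minus_closed[OF FL(1) l], of k n] k N[OF that] norm_nonneg[OF linf_mem[OF l], of n]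
        by simp
      then show "\<exists>N. \<forall>n\<ge>N. norm (vnorm A (l n) - 0) < e" by blast
    qed
    then show "l \<in> c0_ideal A" using l by (simp add: mem)
  qed
  moreover have "f \<boxtimes>\<^bsub>linf A\<^esub> g \<in> c0_ideal A" if f: "f \<in> carrier (linf A)" and g: "g \<in> c0_ideal A" for f g
  proof -
    have gl: "g \<in> carrier (linf A)" using g by (simp add: mem)
    have "(\<lambda>n. vnorm (linf A) f * vnorm A (g n)) \<longlonglongrightarrow> vnorm (linf A) f * 0"
      using g by (intro tendsto_intros) (simp add: mem)
    then have lim: "(\<lambda>n. vnorm (linf A) f * vnorm A (g n)) \<longlonglongrightarrow> 0" by simp
    have "vnorm A (f n \<boxtimes> g n) \<le> vnorm (linf A) f * vnorm A (g n)" for n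
      using norm_mult[OF linf_mem[OF f] linf_mem[OF gl], of n n]
        mult_right_mono[OF linf_norm_upper[OF f, of n] norm_nonneg[OF linf_mem[OF gl], of n]] by linarith
    then have "(\<lambda>n. vnorm A (f n \<boxtimes> g n)) \<longlonglongrightarrow> 0"
      by (intro Lim_null_comparison[OF always_eventually lim])
        (simp add: norm_nonneg linf_mem[OF f] linf_mem[OF gl] aclosed)
    then show ?thesis using f gl by (simp add: mem L.mult_closed)
  qed
  moreover have "g \<boxtimes>\<^bsub>linf A\<^esub> f = f \<boxtimes>\<^bsub>linf A\<^esub> g" if "f \<in> carrier (linf A)" "g \<in> c0_ideal A" for f g
    using that L.mult_comm by (simp add: mem)
  ultimately show ?thesis by (simp add: closed_ideal_def)
qed

lemma linf_const: "b \<in> carrier A \<Longrightarrow> (\<lambda>n. b) \<in> carrier (linf A)"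
  by (rule linfI[where K = "vnorm A b"]) simp_all

end

section \<open>The action on the sequence algebra\<close>

context abelian_system
begin

lemma linf_system: "abelian_system (linf A) G (linf_action \<alpha>)"
proof (intro abelian_system.intro cstar_dynamical_system.intro cstar_dynamical_system_axioms.intro)
  interpret L: abelian_cstar_algebra "linf A" by (rule linf_abelian)
  show "cstar_algebra (linf A)" "abelian_cstar_algebra (linf A)" by unfold_locales
  show "group G" by unfold_locales
  have cl: "linf_action \<alpha> t f \<in> carrier (linf A)" if "t \<in> carrier G" "f \<in> carrier (linf A)" for t f
    by (rule linfI[where K = "vnorm (linf A) f"])
      (simp_all add: linf_action_def that aut linf_mem aut_isometric linf_norm_upper)
  show "linf_action \<alpha> \<one>\<^bsub>G\<^esub> f = f" if "f \<in> carrier (linf A)" for f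
    by (simp add: linf_action_def fun_eq_iff action_one linf_mem[OF that])
  show "linf_action \<alpha> (s \<otimes>\<^bsub>G\<^esub> t) f = linf_action \<alpha> s (linf_action \<alpha> t f)"
    if "s \<in> carrier G" "t \<in> carrier G" "f \<in> carrier (linf A)" for s t f
    using that by (simp add: linf_action_def fun_eq_iff action_mult linf_mem[OF that(3)])
  fix t assume t: "t \<in> carrier G"
  have it: "inv\<^bsub>G\<^esub> t \<in> carrier G" using t by simp
  have "bij_betw (linf_action \<alpha> t) (carrier (linf A)) (carrier (linf A))"
    by (rule bij_betw_byWitness[where f' = "linf_action \<alpha> (inv\<^bsub>G\<^esub> t)"])
      (use cl[OF t] cl[OF it] in \<open>auto simp: linf_action_def fun_eq_iff action_inv[OF t] linf_mem\<close>)
  then show "star_automorphism (linf A) (linf_action \<alpha> t)"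
    unfolding star_automorphism_def linear_map_def using cl[OF t]
    by (auto simp: linf_action_def fun_eq_iff aut[OF t] linf_mem)
qed

lemma c0_invariant: "invariant G (linf_action \<alpha>) (c0_ideal A)"
proof -
  interpret L: abelian_system "linf A" G "linf_action \<alpha>" by (rule linf_system)
  have "linf_action \<alpha> t f \<in> c0_ideal A" if t: "t \<in> carrier G" and f: "f \<in> c0_ideal A" for t f
  proof -
    have fl: "f \<in> carrier (linf A)" using f by (simp add: c0_ideal_def)
    then show ?thesis using f t L.aut(1)[OF t fl]
      by (simp add: c0_ideal_def linf_action_def aut_isometric linf_mem)
  qed
  then show ?thesis by (auto simp: invariant_def)
qed

text \<open>The sequence algebra is itself a quotient of an abelian system by an invariant closed
  ideal, so everything proved for abelian systems applies to it and to its dual.\<close>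

lemma B_infty_system: "abelian_system (B_infty A) G (B_infty_action \<alpha>)"
  unfolding B_infty_def B_infty_action_def
  by (rule abelian_system.quotient_system[OF linf_system c0_closed_ideal c0_invariant])

end

section \<open>Ultrafilters\<close>

definition ultra :: "'a filter \<Rightarrow> bool" where
  "ultra U \<longleftrightarrow> U \<noteq> bot \<and> (\<forall>P. eventually P U \<or> eventually (\<lambda>x. \<not> P x) U)"

text \<open>Zorn's lemma, with the infimum of a chain of proper filters as bound, gives a minimal
  proper filter below F. Restricting it to a set that it does not exclude must return the same
  filter, so the set belongs to it.\<close>

lemma exists_ultra:
  fixes F :: "'a filter"
  assumes F: "F \<noteq> bot"
  obtains U where "ultra U" "U \<le> F"
proof -
  let ?S = "{U. U \<noteq> bot \<and> U \<le> F}"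
  have "\<exists>m\<in>?S. \<forall>U\<in>?S. U \<le> m \<longrightarrow> U = m"
  proof (rule predicate_Zorn)
    show "partial_order_on ?S (relation_of (\<lambda>x y. y \<le> x) ?S)"
      by (rule partial_order_on_relation_ofI) auto
    fix C assume C: "C \<in> Chains (relation_of (\<lambda>x y. y \<le> x) ?S)"
    show "\<exists>u\<in>?S. \<forall>a\<in>C. u \<le> a"
    proof (cases "C = {}")
      case True
      then show ?thesis using F by auto
    next
      case False
      have CS: "C \<subseteq> ?S" and lin: "\<And>a b. \<lbrakk>a \<in> C; b \<in> C\<rbrakk> \<Longrightarrow> a \<le> b \<or> b \<le> a"
        using C by (auto simp: Chains_def relation_of_def)
      have "eventually P (Inf C) \<longleftrightarrow> (\<exists>b\<in>C. eventually P b)" for P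
      proof (rule eventually_Inf_base[OF False])
        fix a b assume ab: "a \<in> C" "b \<in> C"
        then show "\<exists>x\<in>C. x \<le> inf a b" using lin[OF ab] by (metis inf.absorb1 inf.absorb2 order_refl)
      qed
      then have "Inf C \<noteq> bot" using CS by (auto simp: trivial_limit_def)
      moreover have "Inf C \<le> F"
      proof -
        obtain a where "a \<in> C" using False by blast
        then show ?thesis using CS Inf_lower[of a C] by auto
      qed
      ultimately show ?thesis by (auto intro: Inf_lower)
    qed
  qed
  then obtain U where U: "U \<noteq> bot" "U \<le> F" and min: "\<And>V. \<lbrakk>V \<noteq> bot; V \<le> F; V \<le> U\<rbrakk> \<Longrightarrow> V = U" by auto
  have "eventually P U \<or> eventually (\<lambda>x. \<not> P x) U" for P
  proof (rule disjCI)
    assume n: "\<not> eventually (\<lambda>x. \<not> P x) U"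
    let ?V = "inf U (principal {x. P x})"
    have ev: "eventually Q ?V \<longleftrightarrow> eventually (\<lambda>x. P x \<longrightarrow> Q x) U" for Q
      by (simp add: eventually_inf_principal)
    have "?V \<noteq> bot" using n ev[of "\<lambda>_. False"] by (simp add: trivial_limit_def)
    moreover have "?V \<le> F" using U(2) by (rule le_infI1)
    ultimately have "?V = U" by (intro min) simp_all
    then show "eventually P U" using ev[of P] by simp
  qed
  then show thesis using that U unfolding ultra_def by blast
qed

text \<open>Compactness of a disc provides a cluster point, and an ultrafilter converges to each of
  its cluster points.\<close>

lemma ultra_limit:
  fixes f :: "'a \<Rightarrow> complex"
  assumes U: "ultra U" and bd: "eventually (\<lambda>x. cmod (f x) \<le> C) U"
  shows "(f \<longlongrightarrow> Lim U f) U"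
proof -
  have "filtermap f U \<noteq> bot" using U by (simp add: ultra_def filtermap_bot_iff)
  moreover have "eventually (\<lambda>z. z \<in> cball 0 C) (filtermap f U)" using bd by (simp add: eventually_filtermap)
  ultimately obtain l where l: "inf (nhds l) (filtermap f U) \<noteq> bot"
    using compact_filter[of "cball 0 C :: complex set"] by auto
  have "(f \<longlongrightarrow> l) U"
  proof (rule topological_tendstoI)
    fix S assume S: "open S" "l \<in> S"
    show "eventually (\<lambda>x. f x \<in> S) U"
    proof (rule ccontr)
      assume "\<not> eventually (\<lambda>x. f x \<in> S) U"
      then have "eventually (\<lambda>z. z \<notin> S) (filtermap f U)" using U by (auto simp: ultra_def eventually_filtermap)
      moreover have "eventually (\<lambda>z. z \<in> S) (nhds l)" using S by (rule eventually_nhds_in_open)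
      ultimately have "eventually (\<lambda>_. False) (inf (nhds l) (filtermap f U))"
        unfolding eventually_inf by blast
      then show False using l by (simp add: trivial_limit_def)
    qed
  qed
  then show ?thesis using U tendsto_Lim[of U f l] by (simp add: ultra_def)
qed

section \<open>Functionals\<close>

lemma dual_iff:
  "\<phi> \<in> carrier (dual V) \<longleftrightarrow> \<phi> \<in> extensional (carrier V) \<and>
    (\<forall>x\<in>carrier V. \<forall>y\<in>carrier V. \<phi> (x \<boxplus>\<^bsub>V\<^esub> y) = \<phi> x + \<phi> y) \<and>
    (\<forall>c. \<forall>x\<in>carrier V. \<phi> (c \<boxdot>\<^bsub>V\<^esub> x) = c * \<phi> x) \<and>
    (\<exists>K. \<forall>x\<in>carrier V. cmod (\<phi> x) \<le> K * vnorm V x)"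
  by (auto simp: dual_def bounded_linear_map_def linear_map_def complex_space_def)

text \<open>In contrast to members of \<open>dual\<close>, these need not be extensional and carry
  an explicit bound, so that compositions such as b \<mapsto> \<psi>(a b) can be handled without
  restricting them to the carrier.\<close>

definition bounded_functional :: "('a, 'm) normed_scheme \<Rightarrow> ('a \<Rightarrow> complex) \<Rightarrow> real \<Rightarrow> bool" where
  "bounded_functional V \<psi> C \<longleftrightarrow> 0 \<le> C \<and>
    (\<forall>x\<in>carrier V. \<forall>y\<in>carrier V. \<psi> (x \<boxplus>\<^bsub>V\<^esub> y) = \<psi> x + \<psi> y) \<and>
    (\<forall>c. \<forall>x\<in>carrier V. \<psi> (c \<boxdot>\<^bsub>V\<^esub> x) = c * \<psi> x) \<and>
    (\<forall>x\<in>carrier V. cmod (\<psi> x) \<le> C * vnorm V x)"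

lemma bounded_functionalD:
  assumes "bounded_functional V \<psi> C"
  shows "0 \<le> C" "\<lbrakk>x \<in> carrier V; y \<in> carrier V\<rbrakk> \<Longrightarrow> \<psi> (x \<boxplus>\<^bsub>V\<^esub> y) = \<psi> x + \<psi> y"
    "x \<in> carrier V \<Longrightarrow> \<psi> (c \<boxdot>\<^bsub>V\<^esub> x) = c * \<psi> x" "x \<in> carrier V \<Longrightarrow> cmod (\<psi> x) \<le> C * vnorm V x"
  using assms by (auto simp: bounded_functional_def)

context complex_normed_space
begin

lemma bounded_functional_minus:
  "\<lbrakk>bounded_functional V \<psi> C; x \<in> carrier V; y \<in> carrier V\<rbrakk> \<Longrightarrow> \<psi> (vminus V x y) = \<psi> x - \<psi> y"
  by (simp add: vminus_def bounded_functionalD vclosed)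

lemma bounded_functional_add:
  assumes "bounded_functional V \<psi> C" "bounded_functional V \<theta> D"
  shows "bounded_functional V (\<lambda>x. \<psi> x + \<theta> x) (C + D)"
proof -
  have "cmod (\<psi> x + \<theta> x) \<le> (C + D) * vnorm V x" if "x \<in> carrier V" for x
    using bounded_functionalD(4)[OF assms(1) that] bounded_functionalD(4)[OF assms(2) that]
      norm_triangle_ineq[of "\<psi> x" "\<theta> x"] by (simp add: distrib_right)
  then show ?thesis
    using bounded_functionalD(1-3)[OF assms(1)] bounded_functionalD(1-3)[OF assms(2)]
    by (simp add: bounded_functional_def algebra_simps)
qed

lemma bounded_functional_scale:
  assumes "bounded_functional V \<psi> C" shows "bounded_functional V (\<lambda>x. c * \<psi> x) (cmod c * C)"
proof -
  have "cmod (c * \<psi> x) \<le> cmod c * C * vnorm V x" if "x \<in> carrier V" for x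
    using mult_left_mono[OF bounded_functionalD(4)[OF assms that] norm_ge_zero[of c]] by (simp add: Real_Vector_Spaces.norm_mult mult.assoc)
  then show ?thesis using bounded_functionalD(1-3)[OF assms] by (simp add: bounded_functional_def algebra_simps)
qed

lemma bounded_functional_zero: "bounded_functional V (\<lambda>x. 0) 0"
  by (simp add: bounded_functional_def)

lemma dual_bounded_functional:
  assumes \<phi>: "\<phi> \<in> carrier (dual V)" shows "bounded_functional V \<phi> (vnorm (dual V) \<phi>)"
proof -
  have lin: "\<And>x y. \<lbrakk>x \<in> carrier V; y \<in> carrier V\<rbrakk> \<Longrightarrow> \<phi> (x \<boxplus> y) = \<phi> x + \<phi> y"
    "\<And>c x. x \<in> carrier V \<Longrightarrow> \<phi> (c \<boxdot> x) = c * \<phi> x" using \<phi> by (auto simp: dual_iff)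
  obtain K where K: "\<And>x. x \<in> carrier V \<Longrightarrow> cmod (\<phi> x) \<le> K * vnorm V x" using \<phi> unfolding dual_iff by blast
  have norm_eq: "vnorm (dual V) \<phi> = (SUP x\<in>{x \<in> carrier V. vnorm V x \<le> 1}. cmod (\<phi> x))"
    by (simp add: dual_def opnorm_def complex_space_def)
  have bdd: "bdd_above ((\<lambda>x. cmod (\<phi> x)) ` {x \<in> carrier V. vnorm V x \<le> 1})"
  proof (rule bdd_aboveI2)
    fix x assume "x \<in> {x \<in> carrier V. vnorm V x \<le> 1}"
    then have x: "x \<in> carrier V" "vnorm V x \<le> 1" by auto
    have "K * vnorm V x \<le> \<bar>K\<bar> * 1"
      using x norm_nonneg[OF x(1)] by (intro mult_mono) auto
    then show "cmod (\<phi> x) \<le> \<bar>K\<bar>" using K[OF x(1)] by simp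
  qed
  have unit: "cmod (\<phi> x) \<le> vnorm (dual V) \<phi>" if "x \<in> carrier V" "vnorm V x \<le> 1" for x
    unfolding norm_eq by (rule cSUP_upper2[OF bdd, of x]) (use that in auto)
  have \<phi>0: "\<phi> \<zero>v = 0" using lin(2)[OF zero_closed, of 0] zero_closed by simp
  have nn: "0 \<le> vnorm (dual V) \<phi>" using unit[OF zero_closed] \<phi>0 by simp
  have "cmod (\<phi> x) \<le> vnorm (dual V) \<phi> * vnorm V x" if x: "x \<in> carrier V" for x
  proof (cases "vnorm V x = 0")
    case True
    then have "x = \<zero>v" using norm_eq_zero[OF x] by simp
    then show ?thesis using \<phi>0 by simp
  next
    case False
    then have n: "vnorm V x > 0" using norm_nonneg[OF x] by linarith
    have "cmod (\<phi> (of_real (1 / vnorm V x) \<boxdot> x)) \<le> vnorm (dual V) \<phi>"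
      using x n by (intro unit) (simp_all add: vclosed norm_scale norm_divide)
    then show ?thesis using n by (simp add: lin(2)[OF x] Real_Vector_Spaces.norm_mult norm_divide field_simps)
  qed
  then show ?thesis using lin nn by (simp add: bounded_functional_def)
qed

lemma bounded_functional_dual: "bounded_functional V \<psi> C \<Longrightarrow> (\<lambda>x\<in>carrier V. \<psi> x) \<in> carrier (dual V)"
  unfolding dual_iff bounded_functional_def by (auto simp: vclosed)

end

context abelian_cstar_algebra
begin

lemma char_bounded_functional: "x \<in> chars0 A \<Longrightarrow> bounded_functional A x 1"
  by (simp add: bounded_functional_def char_simps char_bound)

lemma bounded_functional_mult:
  assumes \<psi>: "bounded_functional A \<psi> C" and a: "a \<in> carrier A"
  shows "bounded_functional A (\<lambda>b. \<psi> (a \<boxtimes> b)) (C * vnorm A a)"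
proof -
  have "cmod (\<psi> (a \<boxtimes> b)) \<le> C * vnorm A a * vnorm A b" if b: "b \<in> carrier A" for b
    using bounded_functionalD(4)[OF \<psi> mult_closed[OF a b]]
      mult_left_mono[OF norm_mult[OF a b] bounded_functionalD(1)[OF \<psi>]] by (simp add: mult.assoc)
  then show ?thesis
    using a bounded_functionalD(1-3)[OF \<psi>]
    by (simp add: bounded_functional_def mult_add_right mult_scale_right aclosed norm_nonneg)
qed

lemma bounded_functional_star:
  assumes \<psi>: "bounded_functional A \<psi> C"
  shows "bounded_functional A (\<lambda>b. cnj (\<psi> (astar A b))) C"
proof -
  have "cmod (\<psi> (astar A b)) \<le> C * vnorm A b" if b: "b \<in> carrier A" for b
    using bounded_functionalD(4)[OF \<psi> star_closed[OF b]] b by simp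
  then show ?thesis
    using bounded_functionalD(1-3)[OF \<psi>] by (simp add: bounded_functional_def star_add star_scale aclosed)
qed

section \<open>Point masses\<close>

text \<open>Elements of norm at most 1 that peak at y and are supported in V: as V shrinks, they
  approximate the indicator function of the point y.\<close>

definition bumps :: "('a \<Rightarrow> complex) \<Rightarrow> ('a \<Rightarrow> complex) set \<Rightarrow> 'a set" where
  "bumps y V = {e \<in> carrier A. astar A e = e \<and> y e = 1 \<and>
     (\<forall>x\<in>chars0 A. cmod (x e) \<le> 1 \<and> (x \<notin> V \<longrightarrow> x e = 0))}"

definition bump_filter :: "('a \<Rightarrow> complex) \<Rightarrow> 'a filter" where
  "bump_filter y = (INF V\<in>{V. open V \<and> y \<in> V}. principal (bumps y V))"

text \<open>Refining to an ultrafilter makes every bounded functional converge. Existence of the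
  limit thus comes from compactness rather than from a representing measure.\<close>

definition bump_ultra :: "('a \<Rightarrow> complex) \<Rightarrow> 'a filter" where
  "bump_ultra y = (SOME U. ultra U \<and> U \<le> bump_filter y)"

text \<open>The value \<open>\<mu>{y}\<close> if \<open>\<psi>\<close> is integration against the measure \<open>\<mu>\<close>.\<close>

definition atom :: "('a \<Rightarrow> complex) \<Rightarrow> ('a \<Rightarrow> complex) \<Rightarrow> complex" where
  "atom y \<psi> = Lim (bump_ultra y) \<psi>"

lemma bumps_nonempty:
  assumes y: "y \<in> chars A" and V: "open V" "y \<in> V" shows "bumps y V \<noteq> {}"
proof -
  obtain a where a: "a \<in> carrier A" "y a = 1" "\<And>x. \<lbrakk>x \<in> chars0 A; x \<notin> V\<rbrakk> \<Longrightarrow> x a = 0"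
    "\<And>x. x \<in> chars0 A \<Longrightarrow> \<exists>r. 0 \<le> r \<and> r \<le> 1 \<and> x a = of_real r"
    by (rule char_urysohn[OF y V]) blast
  have "astar A a = a"
  proof (rule eq_by_chars)
    fix x assume "x \<in> chars A"
    then have x: "x \<in> chars0 A" by (rule chars_subset)
    then show "x (astar A a) = x a" using a(4)[OF x] a(1) by (auto simp: char_simps)
  qed (use a in \<open>simp_all add: aclosed\<close>)
  moreover have "cmod (x a) \<le> 1" if "x \<in> chars0 A" for x using a(4)[OF that] by auto
  ultimately have "a \<in> bumps y V" using a by (simp add: bumps_def)
  then show ?thesis by blast
qed

lemma bump_norm: "e \<in> bumps y V \<Longrightarrow> vnorm A e \<le> 1"
  by (rule norm_le_by_chars) (simp_all add: bumps_def chars_subset)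

lemma eventually_bump_filter:
  "y \<in> chars A \<Longrightarrow> eventually P (bump_filter y) \<longleftrightarrow> (\<exists>V. open V \<and> y \<in> V \<and> (\<forall>e\<in>bumps y V. P e))"
  unfolding bump_filter_def
proof (subst eventually_INF_base)
  show "{V. open V \<and> y \<in> V} \<noteq> {}" by auto
  fix V W assume "V \<in> {V. open V \<and> y \<in> V}" "W \<in> {V. open V \<and> y \<in> V}"
  moreover have "bumps y (V \<inter> W) \<subseteq> bumps y V \<inter> bumps y W" by (auto simp: bumps_def)
  ultimately show "\<exists>x\<in>{V. open V \<and> y \<in> V}.
      principal (bumps y x) \<le> inf (principal (bumps y V)) (principal (bumps y W))"
    by (intro bexI[of _ "V \<inter> W"]) auto
qed (auto simp: eventually_principal)

lemma bump_ultra: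
  assumes y: "y \<in> chars A" shows "ultra (bump_ultra y)" "bump_ultra y \<le> bump_filter y"
proof -
  have "bump_filter y \<noteq> bot"
    using bumps_nonempty[OF y] eventually_bump_filter[OF y, of "\<lambda>_. False"] by (auto simp: trivial_limit_def)
  then have "\<exists>U. ultra U \<and> U \<le> bump_filter y" using exists_ultra by blast
  then have "ultra (bump_ultra y) \<and> bump_ultra y \<le> bump_filter y" unfolding bump_ultra_def by (rule someI_ex)
  then show "ultra (bump_ultra y)" "bump_ultra y \<le> bump_filter y" by auto
qed

lemma bump_nontrivial: "y \<in> chars A \<Longrightarrow> bump_ultra y \<noteq> bot"
  using bump_ultra(1) by (simp add: ultra_def)

lemma eventually_bump:
  assumes "y \<in> chars A" "open V" "y \<in> V" "\<And>e. e \<in> bumps y V \<Longrightarrow> P e"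
  shows "eventually P (bump_ultra y)"
  using bump_ultra(2)[OF assms(1)] eventually_bump_filter[OF assms(1)] assms(2-4) unfolding le_filter_def by blast

lemma eventually_carrier: "y \<in> chars A \<Longrightarrow> eventually (\<lambda>e. e \<in> carrier A) (bump_ultra y)"
  by (rule eventually_bump[of y UNIV]) (auto simp: bumps_def)

lemma atom_tendsto:
  assumes y: "y \<in> chars A" and \<psi>: "bounded_functional A \<psi> C"
  shows "(\<psi> \<longlongrightarrow> atom y \<psi>) (bump_ultra y)"
  unfolding atom_def
proof (rule ultra_limit[OF bump_ultra(1)[OF y]], rule eventually_bump[OF y open_UNIV UNIV_I])
  fix e assume e: "e \<in> bumps y UNIV"
  then have ec: "e \<in> carrier A" by (simp add: bumps_def)
  show "cmod (\<psi> e) \<le> C"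
    using bounded_functionalD(4)[OF \<psi> ec] mult_left_mono[OF bump_norm[OF e] bounded_functionalD(1)[OF \<psi>]] by simp
qed

lemma atom_eqI: "\<lbrakk>y \<in> chars A; (\<psi> \<longlongrightarrow> l) (bump_ultra y)\<rbrakk> \<Longrightarrow> atom y \<psi> = l"
  unfolding atom_def using bump_nontrivial by (rule tendsto_Lim) 

lemma atom_cong:
  assumes y: "y \<in> chars A" and eq: "\<And>b. b \<in> carrier A \<Longrightarrow> \<psi> b = \<theta> b"
  shows "atom y \<psi> = atom y \<theta>"
proof -
  have "eventually (\<lambda>e. \<psi> e = \<theta> e) (bump_ultra y)"
    using eventually_carrier[OF y] by (rule eventually_mono) (rule eq)
  then have "(\<psi> \<longlongrightarrow> l) (bump_ultra y) \<longleftrightarrow> (\<theta> \<longlongrightarrow> l) (bump_ultra y)" for l by (rule tendsto_cong)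
  then show ?thesis unfolding atom_def Topological_Spaces.Lim_def by simp
qed

lemma atom_add:
  assumes "y \<in> chars A" "bounded_functional A \<psi> C" "bounded_functional A \<theta> D"
  shows "atom y (\<lambda>b. \<psi> b + \<theta> b) = atom y \<psi> + atom y \<theta>"
  using assms by (intro atom_eqI tendsto_add atom_tendsto)

lemma atom_scale:
  assumes "y \<in> chars A" "bounded_functional A \<psi> C"
  shows "atom y (\<lambda>b. c * \<psi> b) = c * atom y \<psi>"
  using assms by (intro atom_eqI tendsto_mult_left atom_tendsto)

lemma atom_star:
  assumes y: "y \<in> chars A" and \<psi>: "bounded_functional A \<psi> C"
  shows "atom y (\<lambda>b. cnj (\<psi> (astar A b))) = cnj (atom y \<psi>)"
proof (rule atom_eqI[OF y])
  have "((\<lambda>b. cnj (\<psi> b)) \<longlongrightarrow> cnj (atom y \<psi>)) (bump_ultra y)" by (intro tendsto_intros atom_tendsto[OF y \<psi>])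
  moreover have "eventually (\<lambda>b. cnj (\<psi> b) = cnj (\<psi> (astar A b))) (bump_ultra y)"
    by (rule eventually_bump[OF y open_UNIV UNIV_I]) (simp add: bumps_def)
  ultimately show "((\<lambda>b. cnj (\<psi> (astar A b))) \<longlongrightarrow> cnj (atom y \<psi>)) (bump_ultra y)"
    by (rule Lim_transform_eventually)
qed

lemma atom_char:
  assumes y: "y \<in> chars A" and z: "z \<in> chars A"
  shows "atom y z = (if z = y then 1 else 0)"
proof (cases "z = y")
  case True
  have "eventually (\<lambda>e. 1 = z e) (bump_ultra y)"
    by (rule eventually_bump[OF y open_UNIV UNIV_I]) (simp add: bumps_def True)
  then have "(z \<longlongrightarrow> 1) (bump_ultra y)" by (rule Lim_transform_eventually[OF tendsto_const])
  then show ?thesis using atom_eqI[OF y] True by simp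
next
  case False
  then have "y \<in> - {z}" "open (- {z})" by (auto simp: open_Compl)
  then have "eventually (\<lambda>e. 0 = z e) (bump_ultra y)"
    by (intro eventually_bump[OF y]) (auto simp: bumps_def chars_subset[OF z])
  then have "(z \<longlongrightarrow> 0) (bump_ultra y)" by (rule Lim_transform_eventually[OF tendsto_const])
  then show ?thesis using atom_eqI[OF y] False by simp
qed

text \<open>If e is supported where a differs from y(a) by less than \<delta>, then a e differs in
  norm from y(a) e by at most \<delta>. In the limit a acts as the scalar y(a).\<close>

lemma atom_mult:
  assumes y: "y \<in> chars A" and \<psi>: "bounded_functional A \<psi> C" and a: "a \<in> carrier A"
  shows "atom y (\<lambda>b. \<psi> (a \<boxtimes> b)) = y a * atom y \<psi>"
proof -
  have "((\<lambda>b. \<psi> (a \<boxtimes> b) - y a * \<psi> b) \<longlongrightarrow> 0) (bump_ultra y)"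
  proof (rule tendstoI)
    fix \<epsilon> :: real assume \<epsilon>: "\<epsilon> > 0"
    have C: "0 \<le> C" by (rule bounded_functionalD(1)[OF \<psi>])
    \<comment> \<open>The summand 1 keeps the denominator positive when C = 0 and makes C \<delta>
      strictly smaller than \<epsilon>.\<close>
    define \<delta> where "\<delta> = \<epsilon> / (C + 1)"
    have \<delta>: "\<delta> > 0" "C * \<delta> < \<epsilon>" using \<epsilon> C by (simp_all add: \<delta>_def field_simps)
    let ?V = "{x. cmod (x a - y a) < \<delta>}"
    have V: "open ?V" "y \<in> ?V"
      using \<delta>(1) by (auto intro!: open_Collect_less continuous_intros continuous_on_eval)
    show "eventually (\<lambda>b. dist (\<psi> (a \<boxtimes> b) - y a * \<psi> b) 0 < \<epsilon>) (bump_ultra y)"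
    proof (rule eventually_bump[OF y V])
      fix e assume e: "e \<in> bumps y ?V"
      then have ec: "e \<in> carrier A" by (simp add: bumps_def)
      have "vnorm A (vminus A (a \<boxtimes> e) (y a \<boxdot> e)) \<le> \<delta>"
      proof (rule norm_le_by_chars)
        fix x assume "x \<in> chars A"
        then have x: "x \<in> chars0 A" by (rule chars_subset)
        have eq: "cmod (x (vminus A (a \<boxtimes> e) (y a \<boxdot> e))) = cmod (x a - y a) * cmod (x e)"
          using x a ec by (simp add: char_simps aclosed flip: left_diff_distrib Real_Vector_Spaces.norm_mult)
        show "cmod (x (vminus A (a \<boxtimes> e) (y a \<boxdot> e))) \<le> \<delta>"
        proof (cases "x \<in> ?V")
          case True
          then show ?thesis
            unfolding eq using mult_mono[of "cmod (x a - y a)" \<delta> "cmod (x e)" 1] e x \<delta>(1) by (simp add: bumps_def)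
        next
          case False
          then have "x e = 0" using e x by (simp add: bumps_def)
          then show ?thesis unfolding eq using \<delta>(1) by simp
        qed
      qed (use a ec \<delta> in \<open>simp_all add: aclosed\<close>)
      then have "C * vnorm A (vminus A (a \<boxtimes> e) (y a \<boxdot> e)) \<le> C * \<delta>" using C by (rule mult_left_mono)
      moreover have "\<psi> (a \<boxtimes> e) - y a * \<psi> e = \<psi> (vminus A (a \<boxtimes> e) (y a \<boxdot> e))"
        using a ec bounded_functionalD(3)[OF \<psi>] by (simp add: bounded_functional_minus[OF \<psi>] aclosed)
      ultimately show "dist (\<psi> (a \<boxtimes> e) - y a * \<psi> e) 0 < \<epsilon>"
        using bounded_functionalD(4)[OF \<psi>, of "vminus A (a \<boxtimes> e) (y a \<boxdot> e)"] a ec \<delta>(2) by (simp add: aclosed)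
    qed
  qed
  from tendsto_add[OF this tendsto_mult_left[OF atom_tendsto[OF y \<psi>], of "y a"]]
  show ?thesis by (intro atom_eqI[OF y]) simp
qed

text \<open>Bumps with disjoint supports, multiplied by unimodular phases, add up to an element s of
  norm at most 1. With the right phases \<psi>(s) is the sum of the moduli of \<psi> at the bumps,
  so this sum cannot exceed C.\<close>

lemma atom_sum_bound:
  assumes F: "finite F" "F \<subseteq> chars A" and \<psi>: "bounded_functional A \<psi> C"
  shows "(\<Sum>y\<in>F. cmod (atom y \<psi>)) \<le> C"
proof (rule field_le_epsilon)
  fix \<epsilon> :: real assume \<epsilon>: "\<epsilon> > 0"
  obtain U where U: "\<And>y. y \<in> F \<Longrightarrow> open (U y) \<and> y \<in> U y"
    and disj: "\<And>y z. \<lbrakk>y \<in> F; z \<in> F; y \<noteq> z\<rbrakk> \<Longrightarrow> U y \<inter> U z = {}" by (rule finite_separation[OF F(1)]) blast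
  define \<delta> where "\<delta> = \<epsilon> / (real (card F) + 1)"
  have \<delta>: "\<delta> > 0" "real (card F) * \<delta> \<le> \<epsilon>" using \<epsilon> by (simp_all add: \<delta>_def field_simps)
  have "\<exists>e. e \<in> bumps y (U y) \<and> dist (\<psi> e) (atom y \<psi>) < \<delta>" if y: "y \<in> F" for y
  proof -
    have yc: "y \<in> chars A" using F(2) y by blast
    have "open (U y)" "y \<in> U y" using U[OF y] by auto
    then have "eventually (\<lambda>e. e \<in> bumps y (U y)) (bump_ultra y)" by (rule eventually_bump[OF yc]) simp
    moreover have "eventually (\<lambda>e. dist (\<psi> e) (atom y \<psi>) < \<delta>) (bump_ultra y)"
      using atom_tendsto[OF yc \<psi>] \<delta>(1) by (rule tendstoD)
    ultimately have "eventually (\<lambda>e. e \<in> bumps y (U y) \<and> dist (\<psi> e) (atom y \<psi>) < \<delta>) (bump_ultra y)"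
      by (rule eventually_conj)
    then show ?thesis using bump_nontrivial[OF yc] eventually_happens' by blast
  qed
  then obtain e where e: "\<And>y. y \<in> F \<Longrightarrow> e y \<in> bumps y (U y)"
    and ed: "\<And>y. y \<in> F \<Longrightarrow> dist (\<psi> (e y)) (atom y \<psi>) < \<delta>" by metis
  have ec: "e y \<in> carrier A" if "y \<in> F" for y using e[OF that] by (simp add: bumps_def)
  \<comment> \<open>The phase that makes c(y) \<psi>(e(y)) equal to the modulus; it is set to 0
    where no phase exists.\<close>
  define c where "c y = (if \<psi> (e y) = 0 then 0 else of_real (cmod (\<psi> (e y))) / \<psi> (e y))" for y
  have c: "c y * \<psi> (e y) = of_real (cmod (\<psi> (e y)))" "cmod (c y) \<le> 1" for y
    by (simp_all add: c_def norm_divide)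
  have ex: "\<exists>s\<in>carrier A. (\<forall>x\<in>chars0 A. x s = (\<Sum>y\<in>E. c y * x (e y))) \<and> \<psi> s = (\<Sum>y\<in>E. c y * \<psi> (e y))"
    if "finite E" "E \<subseteq> F" for E
    using that
  proof (induction E rule: finite_induct)
    case empty
    have "\<psi> \<zero>v = 0" using bounded_functionalD(3)[OF \<psi> zero_closed, of 0] zero_closed by simp
    then show ?case by (intro bexI[of _ "\<zero>v"]) (simp_all add: char_zero aclosed)
  next
    case (insert y E)
    then obtain s where s: "s \<in> carrier A" "\<And>x. x \<in> chars0 A \<Longrightarrow> x s = (\<Sum>y\<in>E. c y * x (e y))"
      "\<psi> s = (\<Sum>y\<in>E. c y * \<psi> (e y))" by blast
    have ey: "e y \<in> carrier A" using ec insert.prems by simp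
    show ?case
    proof (intro bexI[of _ "c y \<boxdot> e y \<boxplus> s"] conjI ballI)
      show "x (c y \<boxdot> e y \<boxplus> s) = (\<Sum>y\<in>insert y E. c y * x (e y))" if "x \<in> chars0 A" for x
        using that s(1) s(2)[OF that] ey insert.hyps by (simp add: char_simps aclosed)
      show "\<psi> (c y \<boxdot> e y \<boxplus> s) = (\<Sum>y\<in>insert y E. c y * \<psi> (e y))"
        using s(1,3) ey insert.hyps bounded_functionalD(2,3)[OF \<psi>] by (simp add: aclosed)
    qed (use s(1) ey in \<open>simp add: aclosed\<close>)
  qed
  from ex[OF F(1) subset_refl] obtain s where s': "s \<in> carrier A"
    "\<forall>x\<in>chars0 A. x s = (\<Sum>y\<in>F. c y * x (e y))" "\<psi> s = (\<Sum>y\<in>F. c y * \<psi> (e y))"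
    by (elim bexE conjE)
  note s = s'(1) s'(2)[rule_format] s'(3)
  have "vnorm A s \<le> 1"
  proof (rule norm_le_by_chars[OF s(1)])
    fix x assume "x \<in> chars A"
    then have x: "x \<in> chars0 A" by (rule chars_subset)
    show "cmod (x s) \<le> 1"
    proof (cases "\<exists>y\<in>F. x \<in> U y")
      case True
      then obtain y where y: "y \<in> F" "x \<in> U y" by blast
      have "x (e z) = 0" if "z \<in> F - {y}" for z
      proof -
        have "x \<notin> U z" using disj[of y z] y that by blast
        then show ?thesis using e[of z] that x by (simp add: bumps_def)
      qed
      then have "(\<Sum>z\<in>F - {y}. c z * x (e z)) = 0" by (intro sum.neutral ballI) simp
      then have "x s = c y * x (e y)" using s(2)[OF x] sum.remove[OF F(1) y(1), of "\<lambda>z. c z * x (e z)"] by simp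
      moreover have "cmod (x (e y)) \<le> 1" using e[OF y(1)] x by (simp add: bumps_def)
      ultimately show ?thesis using mult_mono[OF c(2)[of y], of "cmod (x (e y))" 1] by (simp add: Real_Vector_Spaces.norm_mult)
    next
      case False
      have "x (e z) = 0" if "z \<in> F" for z using e[OF that] False that x by (auto simp: bumps_def)
      then show ?thesis using s(2)[OF x] by simp
    qed
  qed simp
  have "(\<Sum>y\<in>F. cmod (\<psi> (e y))) = Re (\<psi> s)" unfolding s(3) by (simp add: c(1))
  also have "\<dots> \<le> cmod (\<psi> s)" by (rule complex_Re_le_cmod)
  also have "\<dots> \<le> C"
    using bounded_functionalD(4)[OF \<psi> s(1)] mult_left_mono[OF \<open>vnorm A s \<le> 1\<close> bounded_functionalD(1)[OF \<psi>]] by simp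
  finally have 1: "(\<Sum>y\<in>F. cmod (\<psi> (e y))) \<le> C" .
  have "(\<Sum>y\<in>F. cmod (atom y \<psi>)) \<le> (\<Sum>y\<in>F. cmod (\<psi> (e y)) + \<delta>)"
  proof (rule sum_mono)
    fix y assume "y \<in> F"
    then show "cmod (atom y \<psi>) \<le> cmod (\<psi> (e y)) + \<delta>"
      using ed[of y] norm_triangle_ineq2[of "atom y \<psi>" "\<psi> (e y)"] by (simp add: dist_norm Real_Vector_Spaces.norm_minus_commute)
  qed
  also have "\<dots> \<le> C + \<epsilon>" using 1 \<delta>(2) by (simp add: sum.distrib)
  finally show "(\<Sum>y\<in>F. cmod (atom y \<psi>)) \<le> C + \<epsilon>" .
qed

text \<open>In terms of measures this is the part of the mass of \<psi> carried by the single points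
  of S. As a function of \<psi> it acts as the sum of the point projections over S in the
  bidual.\<close>

definition point_sum :: "('a \<Rightarrow> complex) set \<Rightarrow> ('a \<Rightarrow> complex) \<Rightarrow> complex" where
  "point_sum S \<psi> = infsum (\<lambda>y. atom y \<psi>) S"

context
  fixes S assumes S: "S \<subseteq> chars A"
begin

lemma atom_abs_summable:
  assumes "bounded_functional A \<psi> C" shows "(\<lambda>y. cmod (atom y \<psi>)) summable_on S"
  using atom_sum_bound[OF _ _ assms] S
  by (intro nonneg_bdd_above_summable_on bdd_aboveI2[where M = C]) auto

lemma atom_summable: "bounded_functional A \<psi> C \<Longrightarrow> (\<lambda>y. atom y \<psi>) summable_on S"
  by (rule abs_summable_summable[OF atom_abs_summable])

lemma point_sum_bound:
  assumes "bounded_functional A \<psi> C" shows "cmod (point_sum S \<psi>) \<le> C"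
proof -
  have "cmod (point_sum S \<psi>) \<le> infsum (\<lambda>y. cmod (atom y \<psi>)) S"
    unfolding point_sum_def by (rule norm_infsum_bound[OF atom_abs_summable[OF assms]])
  also have "\<dots> \<le> C"
    by (rule infsum_le_finite_sums[OF atom_abs_summable[OF assms]]) (use atom_sum_bound[OF _ _ assms] S in auto)
  finally show ?thesis .
qed

lemma point_sum_cong: "(\<And>b. b \<in> carrier A \<Longrightarrow> \<psi> b = \<theta> b) \<Longrightarrow> point_sum S \<psi> = point_sum S \<theta>"
  unfolding point_sum_def using S by (intro infsum_cong atom_cong) auto

lemma point_sum_add:
  assumes "bounded_functional A \<psi> C" "bounded_functional A \<theta> D"
  shows "point_sum S (\<lambda>b. \<psi> b + \<theta> b) = point_sum S \<psi> + point_sum S \<theta>"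
proof -
  have "point_sum S (\<lambda>b. \<psi> b + \<theta> b) = infsum (\<lambda>y. atom y \<psi> + atom y \<theta>) S"
    unfolding point_sum_def using S assms by (intro infsum_cong atom_add) auto
  then show ?thesis using assms by (simp add: point_sum_def infsum_add atom_summable)
qed

lemma point_sum_scale:
  assumes "bounded_functional A \<psi> C" shows "point_sum S (\<lambda>b. c * \<psi> b) = c * point_sum S \<psi>"
proof -
  have "point_sum S (\<lambda>b. c * \<psi> b) = infsum (\<lambda>y. c * atom y \<psi>) S"
    unfolding point_sum_def using S assms by (intro infsum_cong atom_scale) auto
  then show ?thesis by (simp add: point_sum_def infsum_cmult_right')
qed

lemma point_sum_star:
  assumes "bounded_functional A \<psi> C" shows "point_sum S (\<lambda>b. cnj (\<psi> (astar A b))) = cnj (point_sum S \<psi>)"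
proof -
  have "point_sum S (\<lambda>b. cnj (\<psi> (astar A b))) = infsum (\<lambda>y. cnj (atom y \<psi>)) S"
    unfolding point_sum_def using S assms by (intro infsum_cong atom_star) auto
  then show ?thesis by (simp add: point_sum_def)
qed

text \<open>A character is a unit point mass, so the sum sees it only at its own point.\<close>

lemma point_sum_char:
  assumes z: "z \<in> chars A" shows "point_sum S z = (if z \<in> S then 1 else 0)"
proof -
  have "infsum (\<lambda>y. atom y z) S = infsum (\<lambda>y. 1) (S \<inter> {z})"
    by (rule infsum_cong_neutral) (use S z atom_char in auto)
  then show ?thesis by (simp add: point_sum_def)
qed

text \<open>The point masses are norm continuous, so they pass through absolutely convergent series.\<close>

lemma point_sum_series:
  assumes w: "(\<lambda>y. cmod (w y)) summable_on T" and x: "\<And>y. y \<in> T \<Longrightarrow> x y \<in> chars0 A"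
  shows "point_sum S (\<lambda>a. infsum (\<lambda>y. w y * x y a) T) = infsum (\<lambda>y. w y * point_sum S (x y)) T"
proof -
  define W where "W = infsum (\<lambda>y. cmod (w y)) T"
  have summ: "(\<lambda>y. cmod (w y * x y a)) summable_on T" if a: "a \<in> carrier A" for a
  proof (rule summable_on_comparison_test[OF summable_on_cmult_left[OF w, of "vnorm A a"]])
    show "cmod (w y * x y a) \<le> cmod (w y) * vnorm A a" if "y \<in> T" for y
      using char_bound[OF x[OF that] a] by (simp add: Real_Vector_Spaces.norm_mult mult_left_mono)
  qed simp
  have summ': "(\<lambda>y. w y * x y a) summable_on E" if a: "a \<in> carrier A" and E: "E \<subseteq> T" for a E
    using abs_summable_summable[OF summ[OF a]] E by (rule summable_on_subset_banach)
  \<comment> \<open>The bound is needed for arbitrary subsets E, because it will be applied to tails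
    of the series.\<close>
  have bf: "bounded_functional A (\<lambda>a. infsum (\<lambda>y. w y * x y a) E) (infsum (\<lambda>y. cmod (w y)) E)"
    if E: "E \<subseteq> T" for E
    unfolding bounded_functional_def
  proof (intro conjI ballI allI)
    have wE: "(\<lambda>y. cmod (w y)) summable_on E" using w E by (rule summable_on_subset_banach)
    show "0 \<le> infsum (\<lambda>y. cmod (w y)) E" by (rule infsum_nonneg) simp
    fix a assume a: "a \<in> carrier A"
    have "cmod (infsum (\<lambda>y. w y * x y a) E) \<le> infsum (\<lambda>y. cmod (w y * x y a)) E"
      by (rule norm_infsum_bound[OF summable_on_subset_banach[OF summ[OF a] E]])
    also have "\<dots> \<le> infsum (\<lambda>y. cmod (w y) * vnorm A a) E"
    proof (rule infsum_mono[OF summable_on_subset_banach[OF summ[OF a] E] summable_on_cmult_left[OF wE]])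
      show "cmod (w y * x y a) \<le> cmod (w y) * vnorm A a" if "y \<in> E" for y
        using char_bound[OF x a, of y] that E by (auto simp: Real_Vector_Spaces.norm_mult intro!: mult_left_mono)
    qed
    finally show "cmod (infsum (\<lambda>y. w y * x y a) E) \<le> infsum (\<lambda>y. cmod (w y)) E * vnorm A a"
      by (simp add: infsum_cmult_left')
    show "infsum (\<lambda>y. w y * x y (c \<boxdot> a)) E = c * infsum (\<lambda>y. w y * x y a) E" for c
    proof -
      have "infsum (\<lambda>y. w y * x y (c \<boxdot> a)) E = infsum (\<lambda>y. c * (w y * x y a)) E"
        using a x E by (intro infsum_cong) (auto simp: chars0D subset_iff)
      then show ?thesis by (simp add: infsum_cmult_right')
    qed
    fix b assume b: "b \<in> carrier A"
    have "infsum (\<lambda>y. w y * x y (a \<boxplus> b)) E = infsum (\<lambda>y. w y * x y a + w y * x y b) E"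
      using a b x E by (intro infsum_cong) (auto simp: chars0D subset_iff distrib_left)
    then show "infsum (\<lambda>y. w y * x y (a \<boxplus> b)) E = infsum (\<lambda>y. w y * x y a) E + infsum (\<lambda>y. w y * x y b) E"
      using infsum_add[OF summ'[OF a E] summ'[OF b E]] by simp
  qed
  let ?\<Psi> = "\<lambda>E a. infsum (\<lambda>y. w y * x y a) E"
  have fin: "point_sum S (?\<Psi> F) = (\<Sum>y\<in>F. w y * point_sum S (x y))" if "finite F" "F \<subseteq> T" for F
    using that
  proof (induction F rule: finite_induct)
    case empty
    then show ?case using point_sum_scale[OF bounded_functional_zero, of 0] by simp
  next
    case (insert z F)
    have "point_sum S (?\<Psi> (insert z F)) = point_sum S (\<lambda>a. w z * x z a + ?\<Psi> F a)"
      using insert.hyps by (intro point_sum_cong) simp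
    also have "\<dots> = w z * point_sum S (x z) + point_sum S (?\<Psi> F)"
      using insert.prems x char_bounded_functional[of "x z"]
      by (subst point_sum_add[OF bounded_functional_scale bf]) (auto simp: point_sum_scale)
    finally show ?case using insert by simp
  qed
  have W: "((\<lambda>y. cmod (w y)) has_sum W) T" unfolding W_def using w by (rule has_sum_infsum)
  \<comment> \<open>The remainder is the value of \<open>point_sum\<close> on the tail of the
    series. By \<open>point_sum_bound\<close> it is at most the tail of the summable weights, which
    tends to 0.\<close>
  have err: "cmod ((\<Sum>y\<in>F. w y * point_sum S (x y)) - point_sum S (?\<Psi> T)) \<le> W - (\<Sum>y\<in>F. cmod (w y))"
    if F: "finite F" "F \<subseteq> T" for F
  proof -
    have split: "?\<Psi> T a = ?\<Psi> F a + ?\<Psi> (T - F) a" if a: "a \<in> carrier A" for a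
      using infsum_Un_disjoint[OF summ'[OF a F(2)] summ'[OF a Diff_subset], of F] F(2)
      by (simp add: Un_absorb1)
    have "point_sum S (?\<Psi> T) = point_sum S (\<lambda>a. ?\<Psi> F a + ?\<Psi> (T - F) a)" by (rule point_sum_cong) (rule split)
    also have "\<dots> = point_sum S (?\<Psi> F) + point_sum S (?\<Psi> (T - F))"
      by (rule point_sum_add[OF bf[OF F(2)] bf[OF Diff_subset]])
    finally have "cmod ((\<Sum>y\<in>F. w y * point_sum S (x y)) - point_sum S (?\<Psi> T)) = cmod (point_sum S (?\<Psi> (T - F)))"
      using fin[OF F] by simp
    also have "\<dots> \<le> infsum (\<lambda>y. cmod (w y)) (T - F)" by (rule point_sum_bound[OF bf[OF Diff_subset]])
    also have "\<dots> = W - (\<Sum>y\<in>F. cmod (w y))"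
      unfolding W_def using infsum_Diff[OF w _ F(2)] F(1) by simp
    finally show ?thesis .
  qed
  have "((\<lambda>y. w y * point_sum S (x y)) has_sum point_sum S (?\<Psi> T)) T"
    unfolding has_sum_def
  proof (rule LIM_zero_cancel, rule Lim_null_comparison)
    show "\<forall>\<^sub>F F in finite_subsets_at_top T.
        cmod ((\<Sum>y\<in>F. w y * point_sum S (x y)) - point_sum S (?\<Psi> T)) \<le> W - (\<Sum>y\<in>F. cmod (w y))"
      using err by (intro eventually_finite_subsets_at_top_weakI)
    show "((\<lambda>F. W - (\<Sum>y\<in>F. cmod (w y))) \<longlongrightarrow> 0) (finite_subsets_at_top T)"
      using tendsto_diff[OF tendsto_const W[unfolded has_sum_def], of W] by simp
  qed
  then show ?thesis by (rule infsumI[symmetric])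
qed

end

end

section \<open>The Rokhlin* property\<close>

context complex_normed_space
begin

lemma dual_norm_le:
  assumes \<phi>: "\<phi> \<in> carrier (dual V)" and C: "0 \<le> C" and le: "\<And>x. x \<in> carrier V \<Longrightarrow> cmod (\<phi> x) \<le> C * vnorm V x"
  shows "vnorm (dual V) \<phi> \<le> C"
proof -
  have "(SUP x\<in>{x \<in> carrier V. vnorm V x \<le> 1}. cmod (\<phi> x)) \<le> C"
  proof (rule cSUP_least)
    show "{x \<in> carrier V. vnorm V x \<le> 1} \<noteq> {}" using zero_closed by auto
    fix x assume "x \<in> {x \<in> carrier V. vnorm V x \<le> 1}"
    then show "cmod (\<phi> x) \<le> C" using le[of x] mult_left_mono[OF _ C, of "vnorm V x" 1] by auto
  qed
  then show ?thesis by (simp add: dual_def opnorm_def complex_space_def)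
qed

lemma bidualD:
  assumes "\<Phi> \<in> carrier (dual (dual V))"
  shows "\<lbrakk>\<phi> \<in> carrier (dual V); \<theta> \<in> carrier (dual V)\<rbrakk> \<Longrightarrow> \<Phi> (\<lambda>x\<in>carrier V. \<phi> x + \<theta> x) = \<Phi> \<phi> + \<Phi> \<theta>"
    and "\<phi> \<in> carrier (dual V) \<Longrightarrow> \<Phi> (\<lambda>x\<in>carrier V. c * \<phi> x) = c * \<Phi> \<phi>"
    and "\<exists>K\<ge>0. \<forall>\<phi>\<in>carrier (dual V). cmod (\<Phi> \<phi>) \<le> K * vnorm (dual V) \<phi>"
proof -
  have v: "vadd (dual V) \<phi> \<theta> = (\<lambda>x\<in>carrier V. \<phi> x + \<theta> x)" "vscale (dual V) c \<phi> = (\<lambda>x\<in>carrier V. c * \<phi> x)" for \<phi> \<theta> c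
    by (simp_all add: dual_def)
  have D: "(\<forall>\<phi>\<in>carrier (dual V). \<forall>\<theta>\<in>carrier (dual V). \<Phi> (\<lambda>x\<in>carrier V. \<phi> x + \<theta> x) = \<Phi> \<phi> + \<Phi> \<theta>) \<and>
      (\<forall>c. \<forall>\<phi>\<in>carrier (dual V). \<Phi> (\<lambda>x\<in>carrier V. c * \<phi> x) = c * \<Phi> \<phi>)"
    and "\<exists>K. \<forall>\<phi>\<in>carrier (dual V). cmod (\<Phi> \<phi>) \<le> K * vnorm (dual V) \<phi>"
    using assms unfolding dual_iff[of \<Phi> "dual V"] v by blast+
  then obtain K where K: "\<And>\<phi>. \<phi> \<in> carrier (dual V) \<Longrightarrow> cmod (\<Phi> \<phi>) \<le> K * vnorm (dual V) \<phi>" by blast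
  have "cmod (\<Phi> \<phi>) \<le> \<bar>K\<bar> * vnorm (dual V) \<phi>" if "\<phi> \<in> carrier (dual V)" for \<phi>
    using order_trans[OF K[OF that] mult_right_mono[OF abs_ge_self]]
      bounded_functionalD(1)[OF dual_bounded_functional[OF that]] by blast
  then show "\<exists>K\<ge>0. \<forall>\<phi>\<in>carrier (dual V). cmod (\<Phi> \<phi>) \<le> K * vnorm (dual V) \<phi>"
    by (intro exI[of _ "\<bar>K\<bar>"]) simp
  show "\<lbrakk>\<phi> \<in> carrier (dual V); \<theta> \<in> carrier (dual V)\<rbrakk> \<Longrightarrow> \<Phi> (\<lambda>x\<in>carrier V. \<phi> x + \<theta> x) = \<Phi> \<phi> + \<Phi> \<theta>"
    "\<phi> \<in> carrier (dual V) \<Longrightarrow> \<Phi> (\<lambda>x\<in>carrier V. c * \<phi> x) = c * \<Phi> \<phi>"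
    using D by blast+
qed

lemma bidualI:
  assumes "\<Phi> \<in> extensional (carrier (dual V))"
    and "\<And>\<phi> \<theta>. \<lbrakk>\<phi> \<in> carrier (dual V); \<theta> \<in> carrier (dual V)\<rbrakk> \<Longrightarrow> \<Phi> (\<lambda>x\<in>carrier V. \<phi> x + \<theta> x) = \<Phi> \<phi> + \<Phi> \<theta>"
    and "\<And>\<phi> c. \<phi> \<in> carrier (dual V) \<Longrightarrow> \<Phi> (\<lambda>x\<in>carrier V. c * \<phi> x) = c * \<Phi> \<phi>"
    and "\<And>\<phi>. \<phi> \<in> carrier (dual V) \<Longrightarrow> cmod (\<Phi> \<phi>) \<le> K * vnorm (dual V) \<phi>"
  shows "\<Phi> \<in> carrier (dual (dual V))"
proof -
  have v: "vadd (dual V) \<phi> \<theta> = (\<lambda>x\<in>carrier V. \<phi> x + \<theta> x)" "vscale (dual V) c \<phi> = (\<lambda>x\<in>carrier V. c * \<phi> x)" for \<phi> \<theta> c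
    by (simp_all add: dual_def)
  show ?thesis unfolding dual_iff[of \<Phi> "dual V"] v using assms by (intro conjI ballI allI exI[of _ K]) blast+
qed

end

section \<open>The Arens product and the action on the bidual\<close>

context abelian_cstar_algebra
begin

lemma dual_mult:
  assumes \<phi>: "\<phi> \<in> carrier (dual A)" and a: "a \<in> carrier A"
  shows "(\<lambda>b\<in>carrier A. \<phi> (a \<boxtimes> b)) \<in> carrier (dual A)"
    "vnorm (dual A) (\<lambda>b\<in>carrier A. \<phi> (a \<boxtimes> b)) \<le> vnorm (dual A) \<phi> * vnorm A a"
proof -
  have bf: "bounded_functional A (\<lambda>b. \<phi> (a \<boxtimes> b)) (vnorm (dual A) \<phi> * vnorm A a)"
    by (rule bounded_functional_mult[OF dual_bounded_functional[OF \<phi>] a])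
  show 1: "(\<lambda>b\<in>carrier A. \<phi> (a \<boxtimes> b)) \<in> carrier (dual A)" by (rule bounded_functional_dual[OF bf])
  show "vnorm (dual A) (\<lambda>b\<in>carrier A. \<phi> (a \<boxtimes> b)) \<le> vnorm (dual A) \<phi> * vnorm A a"
    by (rule dual_norm_le[OF 1 bounded_functionalD(1)[OF bf]]) (simp add: bounded_functionalD(4)[OF bf])
qed

text \<open>The outer factor of an Arens product is evaluated at this functional. Members of the
  bidual are meaningful only on the dual, so membership has to be known before any product is
  computed.\<close>

lemma arens_inner_dual:
  assumes \<Psi>: "\<Psi> \<in> carrier (dual (dual A))" and \<phi>: "\<phi> \<in> carrier (dual A)"
  shows "(\<lambda>a\<in>carrier A. \<Psi> (\<lambda>b\<in>carrier A. \<phi> (a \<boxtimes> b))) \<in> carrier (dual A)"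
proof -
  note bf = dual_bounded_functional[OF \<phi>]
  obtain K where K: "K \<ge> 0" "\<And>\<phi>. \<phi> \<in> carrier (dual A) \<Longrightarrow> cmod (\<Psi> \<phi>) \<le> K * vnorm (dual A) \<phi>"
    using bidualD(3)[OF \<Psi>] by blast
  have add: "\<Psi> (\<lambda>b\<in>carrier A. \<phi> ((x \<boxplus> y) \<boxtimes> b)) = \<Psi> (\<lambda>b\<in>carrier A. \<phi> (x \<boxtimes> b)) + \<Psi> (\<lambda>b\<in>carrier A. \<phi> (y \<boxtimes> b))"
    if "x \<in> carrier A" "y \<in> carrier A" for x y
  proof -
    have "(\<lambda>b\<in>carrier A. \<phi> ((x \<boxplus> y) \<boxtimes> b))
        = (\<lambda>b\<in>carrier A. (\<lambda>b\<in>carrier A. \<phi> (x \<boxtimes> b)) b + (\<lambda>b\<in>carrier A. \<phi> (y \<boxtimes> b)) b)"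
      using that by (intro restrict_ext) (simp add: mult_add_left bounded_functionalD(2)[OF bf] aclosed)
    then show ?thesis using bidualD(1)[OF \<Psi> dual_mult(1)[OF \<phi> that(1)] dual_mult(1)[OF \<phi> that(2)]] by simp
  qed
  have scl: "\<Psi> (\<lambda>b\<in>carrier A. \<phi> ((c \<boxdot> x) \<boxtimes> b)) = c * \<Psi> (\<lambda>b\<in>carrier A. \<phi> (x \<boxtimes> b))" if "x \<in> carrier A" for x c
  proof -
    have "(\<lambda>b\<in>carrier A. \<phi> ((c \<boxdot> x) \<boxtimes> b)) = (\<lambda>b\<in>carrier A. c * (\<lambda>b\<in>carrier A. \<phi> (x \<boxtimes> b)) b)"
      using that by (intro restrict_ext) (simp add: mult_scale_left bounded_functionalD(3)[OF bf] aclosed)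
    then show ?thesis using bidualD(2)[OF \<Psi> dual_mult(1)[OF \<phi> that]] by simp
  qed
  have bound: "cmod (\<Psi> (\<lambda>b\<in>carrier A. \<phi> (x \<boxtimes> b))) \<le> K * vnorm (dual A) \<phi> * vnorm A x" if x: "x \<in> carrier A" for x
    using K(2)[OF dual_mult(1)[OF \<phi> x]] mult_left_mono[OF dual_mult(2)[OF \<phi> x] K(1)] by (simp add: mult.assoc)
  have "bounded_functional A (\<lambda>a. \<Psi> (\<lambda>b\<in>carrier A. \<phi> (a \<boxtimes> b))) (K * vnorm (dual A) \<phi>)"
    using add scl bound K(1) bounded_functionalD(1)[OF bf] by (simp add: bounded_functional_def)
  then show ?thesis by (rule bounded_functional_dual)
qed

lemma arens_embed_left:
  assumes X: "X \<in> carrier A" and \<Psi>: "\<Psi> \<in> carrier (dual (dual A))" and \<phi>: "\<phi> \<in> carrier (dual A)"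
  shows "arens_mult A (bidual_embed A X) \<Psi> \<phi> = \<Psi> (\<lambda>b\<in>carrier A. \<phi> (X \<boxtimes> b))"
  using arens_inner_dual[OF \<Psi> \<phi>] X \<phi> by (simp add: arens_mult_def bidual_embed_def)

text \<open>Either product evaluates \<Psi> at the functional b \<mapsto> \<phi>(X b), on one side
  after exchanging X with the other factor. Commuting with the constant sequences is thereby
  automatic.\<close>

lemma arens_embed_commute:
  assumes X: "X \<in> carrier A" and \<Psi>: "\<Psi> \<in> carrier (dual (dual A))"
  shows "arens_mult A (bidual_embed A X) \<Psi> = arens_mult A \<Psi> (bidual_embed A X)"
proof
  fix \<phi>
  show "arens_mult A (bidual_embed A X) \<Psi> \<phi> = arens_mult A \<Psi> (bidual_embed A X) \<phi>"
  proof (cases "\<phi> \<in> carrier (dual A)")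
    case True
    have "(\<lambda>a\<in>carrier A. bidual_embed A X (\<lambda>b\<in>carrier A. \<phi> (a \<boxtimes> b))) = (\<lambda>b\<in>carrier A. \<phi> (X \<boxtimes> b))"
      using X dual_mult(1)[OF True] by (intro restrict_ext) (simp add: bidual_embed_def mult_comm)
    then show ?thesis using arens_embed_left[OF X \<Psi> True] True by (simp add: arens_mult_def)
  qed (simp add: arens_mult_def)
qed

end

context abelian_system
begin

lemma dual_action:
  assumes t: "t \<in> carrier G" and \<phi>: "\<phi> \<in> carrier (dual A)"
  shows "(\<lambda>v\<in>carrier A. \<phi> (\<alpha> t v)) \<in> carrier (dual A)"
    "vnorm (dual A) (\<lambda>v\<in>carrier A. \<phi> (\<alpha> t v)) \<le> vnorm (dual A) \<phi>"
proof -
  note bf = dual_bounded_functional[OF \<phi>]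
  have "cmod (\<phi> (\<alpha> t v)) \<le> vnorm (dual A) \<phi> * vnorm A v" if "v \<in> carrier A" for v
    using bounded_functionalD(4)[OF bf aut(1)[OF t that]] aut_isometric[OF t that] by simp
  then have bf': "bounded_functional A (\<lambda>v. \<phi> (\<alpha> t v)) (vnorm (dual A) \<phi>)"
    using bounded_functionalD(1-3)[OF bf] t by (simp add: bounded_functional_def aut)
  show 1: "(\<lambda>v\<in>carrier A. \<phi> (\<alpha> t v)) \<in> carrier (dual A)" by (rule bounded_functional_dual[OF bf'])
  show "vnorm (dual A) (\<lambda>v\<in>carrier A. \<phi> (\<alpha> t v)) \<le> vnorm (dual A) \<phi>"
    by (rule dual_norm_le[OF 1 bounded_functionalD(1)[OF bf']]) (simp add: bounded_functionalD(4)[OF bf'])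
qed

lemma bidual_map_apply:
  assumes t: "t \<in> carrier G" and \<phi>: "\<phi> \<in> carrier (dual A)" and a: "a \<in> carrier A"
  shows "bidual_map A (\<alpha> t) \<Phi> (\<lambda>c\<in>carrier A. \<phi> (a \<boxtimes> c)) = \<Phi> (\<lambda>v\<in>carrier A. \<phi> (a \<boxtimes> \<alpha> t v))"
  using dual_mult(1)[OF \<phi> a] t by (simp add: bidual_map_def aut cong: restrict_cong)

lemma bidual_map_closed:
  assumes t: "t \<in> carrier G" and \<Phi>: "\<Phi> \<in> carrier (dual (dual A))"
  shows "bidual_map A (\<alpha> t) \<Phi> \<in> carrier (dual (dual A))"
proof -
  obtain K where K: "K \<ge> 0" "\<And>\<phi>. \<phi> \<in> carrier (dual A) \<Longrightarrow> cmod (\<Phi> \<phi>) \<le> K * vnorm (dual A) \<phi>"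
    using bidualD(3)[OF \<Phi>] by blast
  show ?thesis
  proof (rule bidualI[where K = K])
    show "bidual_map A (\<alpha> t) \<Phi> \<in> extensional (carrier (dual A))" by (simp add: bidual_map_def)
    fix \<phi> assume \<phi>: "\<phi> \<in> carrier (dual A)"
    show "cmod (bidual_map A (\<alpha> t) \<Phi> \<phi>) \<le> K * vnorm (dual A) \<phi>"
      using K(2)[OF dual_action(1)[OF t \<phi>]] mult_left_mono[OF dual_action(2)[OF t \<phi>] K(1)] \<phi>
      by (simp add: bidual_map_def)
    note bf = dual_bounded_functional[OF \<phi>]
    show "bidual_map A (\<alpha> t) \<Phi> (\<lambda>x\<in>carrier A. c * \<phi> x) = c * bidual_map A (\<alpha> t) \<Phi> \<phi>" for c
    proof -
      have "(\<lambda>v\<in>carrier A. (\<lambda>x\<in>carrier A. c * \<phi> x) (\<alpha> t v)) = (\<lambda>v\<in>carrier A. c * (\<lambda>v\<in>carrier A. \<phi> (\<alpha> t v)) v)"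
        using t by (intro restrict_ext) (simp add: aut)
      then show ?thesis
        using bidualD(2)[OF \<Phi> dual_action(1)[OF t \<phi>], of c] \<phi> bounded_functional_dual[OF bounded_functional_scale[OF bf, of c]]
        by (simp add: bidual_map_def)
    qed
    fix \<theta> assume \<theta>: "\<theta> \<in> carrier (dual A)"
    have "(\<lambda>v\<in>carrier A. (\<lambda>x\<in>carrier A. \<phi> x + \<theta> x) (\<alpha> t v))
        = (\<lambda>v\<in>carrier A. (\<lambda>v\<in>carrier A. \<phi> (\<alpha> t v)) v + (\<lambda>v\<in>carrier A. \<theta> (\<alpha> t v)) v)"
      using t by (intro restrict_ext) (simp add: aut)
    then show "bidual_map A (\<alpha> t) \<Phi> (\<lambda>x\<in>carrier A. \<phi> x + \<theta> x) = bidual_map A (\<alpha> t) \<Phi> \<phi> + bidual_map A (\<alpha> t) \<Phi> \<theta>"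
      using bidualD(1)[OF \<Phi> dual_action(1)[OF t \<phi>] dual_action(1)[OF t \<theta>]] \<phi> \<theta>
        bounded_functional_dual[OF bounded_functional_add[OF bf dual_bounded_functional[OF \<theta>]]]
      by (simp add: bidual_map_def)
  qed
qed

lemma bounded_functional_action:
  "\<lbrakk>bounded_functional A \<psi> C; t \<in> carrier G\<rbrakk> \<Longrightarrow> bounded_functional A (\<lambda>b. \<psi> (\<alpha> t b)) C"
  by (simp add: bounded_functional_def aut) (metis aut(1) aut_isometric)

lemma point_sum_twist:
  assumes S: "S \<subseteq> chars A" and \<psi>: "bounded_functional A \<psi> C" and t: "t \<in> carrier G" and a: "a \<in> carrier A"
  shows "point_sum S (\<lambda>c. \<psi> (a \<boxtimes> \<alpha> t c)) = infsum (\<lambda>y. atom y (\<lambda>c. \<psi> (\<alpha> t c)) * act t y a) S"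
  unfolding point_sum_def
proof (rule infsum_cong)
  fix y assume "y \<in> S"
  then have y: "y \<in> chars A" using S by blast
  have it: "inv\<^bsub>G\<^esub> t \<in> carrier G" using t by simp
  have "atom y (\<lambda>c. \<psi> (a \<boxtimes> \<alpha> t c)) = atom y (\<lambda>c. \<psi> (\<alpha> t (\<alpha> (inv\<^bsub>G\<^esub> t) a \<boxtimes> c)))"
    using t it a by (intro atom_cong[OF y]) (simp add: aut action_inv)
  also have "\<dots> = y (\<alpha> (inv\<^bsub>G\<^esub> t) a) * atom y (\<lambda>c. \<psi> (\<alpha> t c))"
    by (rule atom_mult[OF y bounded_functional_action[OF \<psi> t]]) (use it a in \<open>simp add: aut\<close>)
  finally show "atom y (\<lambda>c. \<psi> (a \<boxtimes> \<alpha> t c)) = atom y (\<lambda>c. \<psi> (\<alpha> t c)) * act t y a"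
    using a by (simp add: act_apply)
qed

text \<open>This is the Arens product of the point projection over S with its translate by t,
  evaluated at \<psi>. Summing once more over S replaces t.y by the indicator of t.y \<in> S. For t
  = e the product is the projection itself; if t moves S off itself, it is 0.\<close>

lemma point_sum_double:
  assumes S: "S \<subseteq> chars A" and \<psi>: "bounded_functional A \<psi> C" and t: "t \<in> carrier G"
  shows "point_sum S (\<lambda>a. point_sum S (\<lambda>c. \<psi> (a \<boxtimes> \<alpha> t c)))
    = infsum (\<lambda>y. atom y (\<lambda>c. \<psi> (\<alpha> t c)) * (if act t y \<in> S then 1 else 0)) S"
proof -
  have "point_sum S (\<lambda>a. point_sum S (\<lambda>c. \<psi> (a \<boxtimes> \<alpha> t c)))
      = point_sum S (\<lambda>a. infsum (\<lambda>y. atom y (\<lambda>c. \<psi> (\<alpha> t c)) * act t y a) S)"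
    by (rule point_sum_cong[OF S]) (rule point_sum_twist[OF S \<psi> t])
  also have "\<dots> = infsum (\<lambda>y. atom y (\<lambda>c. \<psi> (\<alpha> t c)) * point_sum S (act t y)) S"
    using S act_chars[OF t]
    by (intro point_sum_series[OF S atom_abs_summable[OF S bounded_functional_action[OF \<psi> t]]])
      (auto intro: chars_subset)
  also have "\<dots> = infsum (\<lambda>y. atom y (\<lambda>c. \<psi> (\<alpha> t c)) * (if act t y \<in> S then 1 else 0)) S"
    using S act_chars[OF t] by (intro infsum_cong) (auto simp: point_sum_char[OF S])
  finally show ?thesis .
qed

text \<open>Isotropy groups along an orbit are conjugate.\<close>

lemma act_free:
  assumes s: "s \<in> carrier G" and y: "y \<in> free_chars A G \<alpha>" shows "act s y \<in> free_chars A G \<alpha>"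
proof -
  have yc: "y \<in> chars A" "y \<in> chars0 A" using y chars_subset by (auto simp: free_chars_def)
  have "t = \<one>\<^bsub>G\<^esub>" if t: "t \<in> carrier G" and fixed: "act t (act s y) = act s y" for t
  proof -
    have "act (inv\<^bsub>G\<^esub> s \<otimes>\<^bsub>G\<^esub> (t \<otimes>\<^bsub>G\<^esub> s)) y = y"
      using s t fixed act_inv(2)[OF s yc(2)] by (simp add: act_mult)
    then have "inv\<^bsub>G\<^esub> s \<otimes>\<^bsub>G\<^esub> (t \<otimes>\<^bsub>G\<^esub> s) = \<one>\<^bsub>G\<^esub>" using y s t by (auto simp: free_chars_def)
    then have "t \<otimes>\<^bsub>G\<^esub> s = s"
      using s t inv_solve_left[of "\<one>\<^bsub>G\<^esub>" s "t \<otimes>\<^bsub>G\<^esub> s"] by simp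
    moreover have "t = t \<otimes>\<^bsub>G\<^esub> s \<otimes>\<^bsub>G\<^esub> inv\<^bsub>G\<^esub> s" using s t by (simp add: m_assoc)
    ultimately show ?thesis using s by simp
  qed
  then show ?thesis using act_chars[OF s yc(1)] by (auto simp: free_chars_def)
qed

text \<open>The representative is chosen from the orbit alone, so points of one orbit share it. If
  both y and t.y were representatives they would coincide, which freeness excludes for t \<noteq>
  e.\<close>

lemma free_orbit_representatives:
  obtains S where "S \<subseteq> free_chars A G \<alpha>" "\<And>y. y \<in> free_chars A G \<alpha> \<Longrightarrow> \<exists>t\<in>carrier G. act t y \<in> S"
    "\<And>y t. \<lbrakk>y \<in> S; t \<in> carrier G; t \<noteq> \<one>\<^bsub>G\<^esub>\<rbrakk> \<Longrightarrow> act t y \<notin> S"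
proof -
  define orb where "orb y = {act t y |t. t \<in> carrier G}" for y
  define r where "r y = (SOME z. z \<in> orb y)" for y
  have orb_eq: "orb (act s y) = orb y" if s: "s \<in> carrier G" and y: "y \<in> chars0 A" for s y
  proof
    show "orb (act s y) \<subseteq> orb y"
      using s by (auto simp: orb_def simp flip: act_mult)
    have "act t y = act (t \<otimes>\<^bsub>G\<^esub> inv\<^bsub>G\<^esub> s) (act s y)" if "t \<in> carrier G" for t
      using s that act_inv(2)[OF s y] by (simp add: act_mult)
    then show "orb y \<subseteq> orb (act s y)" using s unfolding orb_def by blast
  qed
  have r: "r y \<in> orb y" if "y \<in> free_chars A G \<alpha>" for y
  proof -
    have "act \<one>\<^bsub>G\<^esub> y \<in> orb y" by (auto simp: orb_def)
    then show ?thesis unfolding r_def by (rule someI[of "\<lambda>z. z \<in> orb y"])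
  qed
  have c0: "y \<in> chars0 A" if "y \<in> free_chars A G \<alpha>" for y using that chars_subset by (auto simp: free_chars_def)
  show thesis
  proof
    show "r ` free_chars A G \<alpha> \<subseteq> free_chars A G \<alpha>" using r act_free by (force simp: orb_def)
    show "\<exists>t\<in>carrier G. act t y \<in> r ` free_chars A G \<alpha>" if y: "y \<in> free_chars A G \<alpha>" for y
    proof -
      obtain t where "t \<in> carrier G" "r y = act t y" using r[OF y] by (auto simp: orb_def)
      then show ?thesis using y by (metis imageI)
    qed
    fix y t assume y: "y \<in> r ` free_chars A G \<alpha>" and t: "t \<in> carrier G" "t \<noteq> \<one>\<^bsub>G\<^esub>"
    have rr: "r z = z" if z: "z \<in> r ` free_chars A G \<alpha>" for z
    proof -
      obtain w where w: "w \<in> free_chars A G \<alpha>" "z = r w" using z by blast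
      then obtain s where "s \<in> carrier G" "z = act s w" using r[OF w(1)] by (auto simp: orb_def)
      then have "orb z = orb w" using orb_eq c0[OF w(1)] by simp
      then show ?thesis using w(2) by (simp add: r_def)
    qed
    have yf: "y \<in> free_chars A G \<alpha>" using \<open>r ` _ \<subseteq> _\<close> y by blast
    show "act t y \<notin> r ` free_chars A G \<alpha>"
    proof
      assume ty: "act t y \<in> r ` free_chars A G \<alpha>"
      have "act t y = r (act t y)" using rr[OF ty] by simp
      also have "\<dots> = r y" unfolding r_def orb_eq[OF t(1) c0[OF yf]] ..
      also have "\<dots> = y" by (rule rr[OF y])
      finally show False using yf t by (auto simp: free_chars_def)
    qed
  qed
qed

section \<open>The Rokhlin projection and the density of moved characters\<close>

lemma rokhlin_star_iff:
  "rokhlin_star A G \<alpha> \<longleftrightarrow>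
    (let D = dual (B_infty A); \<gamma> = B_infty_action \<alpha>; \<iota> = (\<lambda>b. bidual_embed (B_infty A) (const_embed A b))
     in \<exists>p\<in>carrier (dual D). arens_mult (B_infty A) p p = p \<and> bidual_star (B_infty A) p = p \<and>
       (\<forall>b\<in>carrier A. arens_mult (B_infty A) (\<iota> b) p = arens_mult (B_infty A) p (\<iota> b)) \<and>
       (\<forall>t\<in>carrier G - {\<one>\<^bsub>G\<^esub>}. arens_mult (B_infty A) p (bidual_map (B_infty A) (\<gamma> t) p) = (\<lambda>\<phi>\<in>carrier D. 0)) \<and>
       (\<forall>b\<in>carrier A - {\<zero>v}. \<exists>t\<in>carrier G.
          arens_mult (B_infty A) (\<iota> b) (bidual_map (B_infty A) (\<gamma> t) p) \<noteq> (\<lambda>\<phi>\<in>carrier D. 0)))"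
  unfolding rokhlin_star_def Let_def bidual_def by (simp add: dual_def[of "dual (B_infty A)"])

lemma const_embed_simps:
  assumes a: "a \<in> carrier A" and b: "b \<in> carrier A"
  shows "const_embed A a \<in> carrier (B_infty A)"
    "const_embed A (a \<boxplus> b) = const_embed A a \<boxplus>\<^bsub>B_infty A\<^esub> const_embed A b"
    "const_embed A (a \<boxtimes> b) = const_embed A a \<boxtimes>\<^bsub>B_infty A\<^esub> const_embed A b"
    "const_embed A (c \<boxdot> a) = c \<boxdot>\<^bsub>B_infty A\<^esub> const_embed A a"
    "const_embed A (astar A a) = astar (B_infty A) (const_embed A a)"
    "t \<in> carrier G \<Longrightarrow> B_infty_action \<alpha> t (const_embed A a) = const_embed A (\<alpha> t a)"
    "vnorm (B_infty A) (const_embed A a) \<le> vnorm A a"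
proof -
  interpret L: abelian_system "linf A" G "linf_action \<alpha>" by (rule linf_system)
  note I = c0_closed_ideal
  have ac: "(\<lambda>n. a) \<in> carrier (linf A)" and bc: "(\<lambda>n. b) \<in> carrier (linf A)" using a b by (simp_all add: linf_const)
  have eqs: "(\<lambda>n. a \<boxplus> b) = (\<lambda>n. a) \<boxplus>\<^bsub>linf A\<^esub> (\<lambda>n. b)" "(\<lambda>n. a \<boxtimes> b) = (\<lambda>n. a) \<boxtimes>\<^bsub>linf A\<^esub> (\<lambda>n. b)"
    "(\<lambda>n. c \<boxdot> a) = c \<boxdot>\<^bsub>linf A\<^esub> (\<lambda>n. a)" "(\<lambda>n. astar A a) = astar (linf A) (\<lambda>n. a)" by (simp_all add: fun_eq_iff)
  show "const_embed A a \<in> carrier (B_infty A)"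
    unfolding B_infty_def const_embed_def by (rule L.coset_in_quotient[OF I ac])
  show "const_embed A (a \<boxplus> b) = const_embed A a \<boxplus>\<^bsub>B_infty A\<^esub> const_embed A b"
    "const_embed A (a \<boxtimes> b) = const_embed A a \<boxtimes>\<^bsub>B_infty A\<^esub> const_embed A b"
    "const_embed A (c \<boxdot> a) = c \<boxdot>\<^bsub>B_infty A\<^esub> const_embed A a"
    "const_embed A (astar A a) = astar (B_infty A) (const_embed A a)"
    unfolding B_infty_def const_embed_def eqs
    by (simp_all only: L.quotient_add[OF I ac bc] L.quotient_mult[OF I ac bc] L.quotient_scale[OF I ac] L.quotient_star[OF I ac])
  show "B_infty_action \<alpha> t (const_embed A a) = const_embed A (\<alpha> t a)" if "t \<in> carrier G"
    unfolding B_infty_action_def const_embed_def L.quotient_action_coset[OF I c0_invariant that ac]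
    by (simp add: linf_action_def)
  show "vnorm (B_infty A) (const_embed A a) \<le> vnorm A a"
    unfolding B_infty_def const_embed_def
    using L.quotient_norm_le[OF I ac] linf_norm_least[of A "\<lambda>n. a" "vnorm A a"] by simp
qed

text \<open>Functionals on the sequence algebra restrict to A along constant sequences. Evaluating
  atoms on these restrictions carries point projections to the bidual of the sequence
  algebra.\<close>

lemma const_embed_functional:
  assumes \<phi>: "\<phi> \<in> carrier (dual (B_infty A))"
  shows "bounded_functional A (\<lambda>b. \<phi> (const_embed A b)) (vnorm (dual (B_infty A)) \<phi>)"
proof -
  interpret C: abelian_system "B_infty A" G "B_infty_action \<alpha>" by (rule B_infty_system)
  have bf: "bounded_functional (B_infty A) \<phi> (vnorm (dual (B_infty A)) \<phi>)" by (rule C.dual_bounded_functional[OF \<phi>])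
  have "cmod (\<phi> (const_embed A b)) \<le> vnorm (dual (B_infty A)) \<phi> * vnorm A b" if b: "b \<in> carrier A" for b
    using bounded_functionalD(4)[OF bf const_embed_simps(1)[OF b b]]
      mult_left_mono[OF const_embed_simps(7)[OF b b] bounded_functionalD(1)[OF bf]] by linarith
  then show ?thesis
    using bounded_functionalD(1-3)[OF bf] by (simp add: bounded_functional_def const_embed_simps)
qed

text \<open>Characters are extended from \<open>A\<close> to the sequence algebra by limits along an ultrafilter.\<close>

lemma char_extension:
  assumes y: "y \<in> chars A"
  obtains \<phi> where "\<phi> \<in> carrier (dual (B_infty A))" "\<And>b. b \<in> carrier A \<Longrightarrow> \<phi> (const_embed A b) = y b"
proof -
  interpret L: abelian_system "linf A" G "linf_action \<alpha>" by (rule linf_system)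
  interpret C: abelian_system "B_infty A" G "B_infty_action \<alpha>" by (rule B_infty_system)
  note I = c0_closed_ideal
  have y0: "y \<in> chars0 A" using y by (rule chars_subset)
  obtain U where U: "ultra U" "U \<le> sequentially" using exists_ultra[of sequentially] by auto
  have Ub: "U \<noteq> bot" using U(1) by (simp add: ultra_def)
  define z where "z f = (if f \<in> carrier (linf A) then Lim U (\<lambda>n. y (f n)) else 0)" for f
  have lim: "((\<lambda>n. y (f n)) \<longlongrightarrow> z f) U" if f: "f \<in> carrier (linf A)" for f
  proof -
    have "cmod (y (f n)) \<le> vnorm (linf A) f" for n
      using char_bound[OF y0 linf_mem[OF f]] linf_norm_upper[OF f] by (rule order_trans)
    then have "((\<lambda>n. y (f n)) \<longlongrightarrow> Lim U (\<lambda>n. y (f n))) U" by (intro ultra_limit[OF U(1)] always_eventually) blast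
    then show ?thesis using f by (simp add: z_def)
  qed
  have zI: "z f = l" if "f \<in> carrier (linf A)" "((\<lambda>n. y (f n)) \<longlongrightarrow> l) U" for f l
    using tendsto_unique[OF Ub lim[OF that(1)] that(2)] .
  have const: "z (\<lambda>n. b) = y b" if "b \<in> carrier A" for b
    by (rule zI) (simp_all add: linf_const that)
  have "z \<in> chars0 (linf A)"
    unfolding chars0_def
  proof (intro CollectI conjI allI ballI impI)
    show "z f = 0" if "f \<notin> carrier (linf A)" for f using that by (simp add: z_def)
    fix f assume f: "f \<in> carrier (linf A)"
    show "z (c \<boxdot>\<^bsub>linf A\<^esub> f) = c * z f" for c
      using tendsto_mult_left[OF lim[OF f], of c] f y0
      by (intro zI) (simp_all add: L.aclosed char_simps linf_mem)
    show "z (astar (linf A) f) = cnj (z f)"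
      using tendsto_cnj[OF lim[OF f]] f y0 by (intro zI) (simp_all add: L.aclosed char_simps linf_mem)
    fix g assume g: "g \<in> carrier (linf A)"
    show "z (f \<boxplus>\<^bsub>linf A\<^esub> g) = z f + z g"
      using tendsto_add[OF lim[OF f] lim[OF g]] f g y0 by (intro zI) (simp_all add: L.aclosed char_simps linf_mem)
    show "z (f \<boxtimes>\<^bsub>linf A\<^esub> g) = z f * z g"
      using tendsto_mult[OF lim[OF f] lim[OF g]] f g y0 by (intro zI) (simp_all add: L.aclosed char_simps linf_mem)
  qed
  moreover have "z \<noteq> (\<lambda>_. 0)"
  proof -
    obtain u where "u \<in> carrier A" "y u = 1" using chars_unit[OF y] .
    then have "z (\<lambda>n. u) = 1" using const by simp
    then show ?thesis by (metis zero_neq_one)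
  qed
  \<comment> \<open>The ultrafilter refines the filter of tails, so null sequences have limit 0
    along it and the character descends to the quotient.\<close>
  moreover have "z f = 0" if "f \<in> c0_ideal A" for f
  proof -
    have f: "f \<in> carrier (linf A)" "(\<lambda>n. vnorm A (f n)) \<longlonglongrightarrow> 0" using that by (simp_all add: c0_ideal_def)
    have "(\<lambda>n. y (f n)) \<longlonglongrightarrow> 0"
      by (rule Lim_null_comparison[OF always_eventually f(2)]) (simp add: char_bound[OF y0] linf_mem[OF f(1)])
    then show ?thesis using f(1) U(2) by (intro zI) (auto intro: tendsto_mono)
  qed
  ultimately have z: "z \<in> zeros (linf A) (c0_ideal A)" by (simp add: zeros_def chars_def)
  define \<phi> where "\<phi> = quotient_char (linf A) (c0_ideal A) z"
  have "\<phi> \<in> chars (B_infty A)" unfolding B_infty_def \<phi>_def using L.chars_quotient[OF I] z by blast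
  then have "bounded_functional (B_infty A) \<phi> 1" by (intro C.char_bounded_functional chars_subset)
  then have "(\<lambda>X\<in>carrier (B_infty A). \<phi> X) \<in> carrier (dual (B_infty A))" by (rule C.bounded_functional_dual)
  moreover have "(\<lambda>X\<in>carrier (B_infty A). \<phi> X) (const_embed A b) = y b" if b: "b \<in> carrier A" for b
    using L.quotient_char_coset[OF I z linf_const[OF b]] const[OF b] const_embed_simps(1)[OF b b]
    by (simp add: \<phi>_def const_embed_def)
  ultimately show thesis by (rule that)
qed

theorem free_dense_imp_rokhlin_star:
  assumes dense: "dense_chars A (free_chars A G \<alpha>)"
  shows "rokhlin_star A G \<alpha>"
proof -
  let ?C = "B_infty A" and ?\<gamma> = "B_infty_action \<alpha>" and ?\<iota> = "const_embed A"
  interpret C: abelian_system ?C G ?\<gamma> by (rule B_infty_system)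
  obtain S where S: "S \<subseteq> free_chars A G \<alpha>" "\<And>y. y \<in> free_chars A G \<alpha> \<Longrightarrow> \<exists>t\<in>carrier G. act t y \<in> S"
    "\<And>y t. \<lbrakk>y \<in> S; t \<in> carrier G; t \<noteq> \<one>\<^bsub>G\<^esub>\<rbrakk> \<Longrightarrow> act t y \<notin> S" by (rule free_orbit_representatives) blast
  have SC: "S \<subseteq> chars A" using S(1) by (auto simp: free_chars_def)
  \<comment> \<open>The image of the point projection over S under the second dual of the embedding
    by constant sequences.\<close>
  define p where "p = (\<lambda>\<phi>\<in>carrier (dual ?C). point_sum S (\<lambda>b. \<phi> (?\<iota> b)))"
  have p_apply: "p (\<lambda>c\<in>carrier ?C. f c) = point_sum S (\<lambda>b. f (?\<iota> b))"
    if "(\<lambda>c\<in>carrier ?C. f c) \<in> carrier (dual ?C)" for f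
    using that unfolding p_def by (simp, intro point_sum_cong[OF SC]) (simp add: const_embed_simps)
  note bf = const_embed_functional
  have pN: "p \<in> carrier (dual (dual ?C))"
  proof (rule C.bidualI[where K = 1])
    show "p \<in> extensional (carrier (dual ?C))" by (simp add: p_def)
    fix \<phi> assume \<phi>: "\<phi> \<in> carrier (dual ?C)"
    note cbf = C.dual_bounded_functional[OF \<phi>]
    show "cmod (p \<phi>) \<le> 1 * vnorm (dual ?C) \<phi>" using point_sum_bound[OF SC bf[OF \<phi>]] \<phi> by (simp add: p_def)
    show "p (\<lambda>x\<in>carrier ?C. c * \<phi> x) = c * p \<phi>" for c
      using p_apply[OF C.bounded_functional_dual[OF C.bounded_functional_scale[OF cbf, of c]]]
        point_sum_scale[OF SC bf[OF \<phi>]] \<phi> by (simp add: p_def)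
    fix \<theta> assume \<theta>: "\<theta> \<in> carrier (dual ?C)"
    show "p (\<lambda>x\<in>carrier ?C. \<phi> x + \<theta> x) = p \<phi> + p \<theta>"
      using p_apply[OF C.bounded_functional_dual[OF C.bounded_functional_add[OF cbf C.dual_bounded_functional[OF \<theta>]]]]
        point_sum_add[OF SC bf[OF \<phi>] bf[OF \<theta>]] \<phi> \<theta> by (simp add: p_def)
  qed
  have twist_dual: "(\<lambda>v\<in>carrier ?C. \<phi> (a \<boxtimes>\<^bsub>?C\<^esub> ?\<gamma> t v)) \<in> carrier (dual ?C)"
    if "\<phi> \<in> carrier (dual ?C)" "t \<in> carrier G" "a \<in> carrier ?C" for \<phi> t a
  proof -
    have "(\<lambda>v\<in>carrier ?C. \<phi> (a \<boxtimes>\<^bsub>?C\<^esub> ?\<gamma> t v)) = (\<lambda>v\<in>carrier ?C. (\<lambda>c\<in>carrier ?C. \<phi> (a \<boxtimes>\<^bsub>?C\<^esub> c)) (?\<gamma> t v))"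
      using that by (intro restrict_ext) (simp add: C.aut)
    then show ?thesis using C.dual_action(1)[OF that(2) C.dual_mult(1)[OF that(1,3)]] by simp
  qed
  have map_apply: "bidual_map ?C (?\<gamma> t) p (\<lambda>c\<in>carrier ?C. \<phi> (?\<iota> b \<boxtimes>\<^bsub>?C\<^esub> c)) = point_sum S (\<lambda>c. \<phi> (?\<iota> (b \<boxtimes> \<alpha> t c)))"
    if \<phi>: "\<phi> \<in> carrier (dual ?C)" and t: "t \<in> carrier G" and b: "b \<in> carrier A" for \<phi> t b
  proof -
    have \<iota>b: "?\<iota> b \<in> carrier ?C" by (rule const_embed_simps(1)[OF b b])
    have "bidual_map ?C (?\<gamma> t) p (\<lambda>c\<in>carrier ?C. \<phi> (?\<iota> b \<boxtimes>\<^bsub>?C\<^esub> c)) = point_sum S (\<lambda>c. \<phi> (?\<iota> b \<boxtimes>\<^bsub>?C\<^esub> ?\<gamma> t (?\<iota> c)))"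
      unfolding C.bidual_map_apply[OF t \<phi> \<iota>b] by (rule p_apply[OF twist_dual[OF \<phi> t \<iota>b]])
    also have "\<dots> = point_sum S (\<lambda>c. \<phi> (?\<iota> (b \<boxtimes> \<alpha> t c)))"
      using b t by (intro point_sum_cong[OF SC]) (simp add: const_embed_simps aut)
    finally show ?thesis .
  qed
  have arens_map: "arens_mult ?C p (bidual_map ?C (?\<gamma> t) p) \<phi>
      = infsum (\<lambda>y. atom y (\<lambda>c. \<phi> (?\<iota> (\<alpha> t c))) * (if act t y \<in> S then 1 else 0)) S"
    if \<phi>: "\<phi> \<in> carrier (dual ?C)" and t: "t \<in> carrier G" for \<phi> t
  proof -
    have "arens_mult ?C p (bidual_map ?C (?\<gamma> t) p) \<phi>
        = point_sum S (\<lambda>b. bidual_map ?C (?\<gamma> t) p (\<lambda>c\<in>carrier ?C. \<phi> (?\<iota> b \<boxtimes>\<^bsub>?C\<^esub> c)))"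
      using \<phi> p_apply[OF C.arens_inner_dual[OF C.bidual_map_closed[OF t pN] \<phi>]] by (simp add: arens_mult_def)
    also have "\<dots> = point_sum S (\<lambda>b. point_sum S (\<lambda>c. \<phi> (?\<iota> (b \<boxtimes> \<alpha> t c))))"
      by (rule point_sum_cong[OF SC]) (rule map_apply[OF \<phi> t])
    finally show ?thesis using point_sum_double[OF SC bf[OF \<phi>] t] by simp
  qed
  \<comment> \<open>Idempotence and orthogonality share one computation: p p is the case t = e of
    \<open>arens_map\<close>, once translation by e is known to fix p.\<close>
  have map_one: "bidual_map ?C (?\<gamma> \<one>\<^bsub>G\<^esub>) p = p"
  proof
    fix \<phi>
    show "bidual_map ?C (?\<gamma> \<one>\<^bsub>G\<^esub>) p \<phi> = p \<phi>"
    proof (cases "\<phi> \<in> carrier (dual ?C)")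
      case True
      then have "(\<lambda>v\<in>carrier ?C. \<phi> (?\<gamma> \<one>\<^bsub>G\<^esub> v)) = \<phi>"
        by (intro extensionalityI[of _ "carrier ?C"]) (simp_all add: C.action_one dual_iff)
      then show ?thesis using True by (simp add: bidual_map_def)
    qed (simp add: bidual_map_def p_def)
  qed
  have idem: "arens_mult ?C p p = p"
  proof
    fix \<phi>
    show "arens_mult ?C p p \<phi> = p \<phi>"
    proof (cases "\<phi> \<in> carrier (dual ?C)")
      case True
      have "infsum (\<lambda>y. atom y (\<lambda>c. \<phi> (?\<iota> (\<alpha> \<one>\<^bsub>G\<^esub> c))) * (if act \<one>\<^bsub>G\<^esub> y \<in> S then 1 else 0)) S
          = infsum (\<lambda>y. atom y (\<lambda>c. \<phi> (?\<iota> c))) S"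
      proof (rule infsum_cong)
        fix y assume y: "y \<in> S"
        then have yc: "y \<in> chars A" using SC by blast
        have "atom y (\<lambda>c. \<phi> (?\<iota> (\<alpha> \<one>\<^bsub>G\<^esub> c))) = atom y (\<lambda>c. \<phi> (?\<iota> c))"
          by (rule atom_cong[OF yc]) (simp add: action_one)
        then show "atom y (\<lambda>c. \<phi> (?\<iota> (\<alpha> \<one>\<^bsub>G\<^esub> c))) * (if act \<one>\<^bsub>G\<^esub> y \<in> S then 1 else 0) = atom y (\<lambda>c. \<phi> (?\<iota> c))"
          using y act_one[OF chars_subset[OF yc]] by simp
      qed
      then show ?thesis
        using arens_map[OF True one_closed] True unfolding map_one by (simp add: p_def point_sum_def)
    qed (simp add: arens_mult_def p_def)
  qed
  have star: "bidual_star ?C p = p"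
  proof
    fix \<phi>
    show "bidual_star ?C p \<phi> = p \<phi>"
    proof (cases "\<phi> \<in> carrier (dual ?C)")
      case True
      have "p (\<lambda>a\<in>carrier ?C. cnj (\<phi> (astar ?C a))) = point_sum S (\<lambda>b. cnj (\<phi> (astar ?C (?\<iota> b))))"
        by (rule p_apply[OF C.bounded_functional_dual[OF C.bounded_functional_star[OF C.dual_bounded_functional[OF True]]]])
      also have "\<dots> = point_sum S (\<lambda>b. cnj (\<phi> (?\<iota> (astar A b))))"
        by (rule point_sum_cong[OF SC]) (simp add: const_embed_simps)
      also have "\<dots> = cnj (p \<phi>)" using point_sum_star[OF SC bf[OF True]] True by (simp add: p_def)
      finally show ?thesis using True by (simp add: bidual_star_def)
    qed (simp add: bidual_star_def p_def)
  qed
  have orth: "arens_mult ?C p (bidual_map ?C (?\<gamma> t) p) = (\<lambda>\<phi>\<in>carrier (dual ?C). 0)"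
    if t: "t \<in> carrier G - {\<one>\<^bsub>G\<^esub>}" for t
  proof
    fix \<phi>
    show "arens_mult ?C p (bidual_map ?C (?\<gamma> t) p) \<phi> = (\<lambda>\<phi>\<in>carrier (dual ?C). 0) \<phi>"
    proof (cases "\<phi> \<in> carrier (dual ?C)")
      case True
      have "infsum (\<lambda>y. atom y (\<lambda>c. \<phi> (?\<iota> (\<alpha> t c))) * (if act t y \<in> S then 1 else 0)) S = 0"
        using S(3) t by (intro infsum_0) simp
      then show ?thesis using arens_map[OF True, of t] t True by simp
    qed (simp add: arens_mult_def)
  qed
  have supp: "\<exists>t\<in>carrier G. arens_mult ?C (bidual_embed ?C (?\<iota> b)) (bidual_map ?C (?\<gamma> t) p) \<noteq> (\<lambda>\<phi>\<in>carrier (dual ?C). 0)"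
    if b: "b \<in> carrier A - {\<zero>v}" for b
  proof -
    have bc: "b \<in> carrier A" using b by blast
    obtain y where y: "y \<in> free_chars A G \<alpha>" "y b \<noteq> 0" using dense b by (auto simp: dense_chars_def)
    have yc: "y \<in> chars A" "y \<in> chars0 A" using y chars_subset by (auto simp: free_chars_def)
    \<comment> \<open>The free orbit of y meets S at s.y. The inverse of s is the group element t
      for which b does not annihilate t.p, as an extension of y to the sequence algebra
      detects.\<close>
    obtain s where s: "s \<in> carrier G" "act s y \<in> S" using S(2)[OF y(1)] by blast
    define t where "t = inv\<^bsub>G\<^esub> s"
    have t: "t \<in> carrier G" "inv\<^bsub>G\<^esub> t = s" using s by (simp_all add: t_def)
    obtain \<phi> where \<phi>: "\<phi> \<in> carrier (dual ?C)" "\<And>b. b \<in> carrier A \<Longrightarrow> \<phi> (?\<iota> b) = y b" by (rule char_extension[OF yc(1)]) blast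
    have "arens_mult ?C (bidual_embed ?C (?\<iota> b)) (bidual_map ?C (?\<gamma> t) p) \<phi> = point_sum S (\<lambda>c. \<phi> (?\<iota> (b \<boxtimes> \<alpha> t c)))"
      unfolding C.arens_embed_left[OF const_embed_simps(1)[OF bc bc] C.bidual_map_closed[OF t(1) pN] \<phi>(1)]
      by (rule map_apply[OF \<phi>(1) t(1) bc])
    also have "\<dots> = point_sum S (\<lambda>c. y b * act s y c)"
    proof (rule point_sum_cong[OF SC])
      fix c assume c: "c \<in> carrier A"
      have "inv\<^bsub>G\<^esub> s = t" by (simp add: t_def)
      then show "\<phi> (?\<iota> (b \<boxtimes> \<alpha> t c)) = y b * act s y c"
        using \<phi>(2)[of "b \<boxtimes> \<alpha> t c"] bc c t(1) yc(2) by (simp add: aclosed aut char_simps act_apply)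
    qed
    also have "\<dots> = y b * point_sum S (act s y)"
      by (rule point_sum_scale[OF SC char_bounded_functional[OF act_chars0[OF s(1) yc(2)]]])
    also have "\<dots> = y b" using point_sum_char[OF SC act_chars[OF s(1) yc(1)]] s(2) by simp
    finally have "arens_mult ?C (bidual_embed ?C (?\<iota> b)) (bidual_map ?C (?\<gamma> t) p) \<phi> \<noteq> (\<lambda>\<phi>\<in>carrier (dual ?C). 0) \<phi>"
      using y(2) \<phi>(1) by simp
    then show ?thesis using t(1) by metis
  qed
  show ?thesis
    unfolding rokhlin_star_iff Let_def
    using pN idem star orth supp C.arens_embed_commute[OF const_embed_simps(1) pN] by (intro bexI[of _ p]) blast+
qed

text \<open>If the inverse translate z of x equals x, there is nothing to prove. Otherwise x and z
  are both moved by t, so b and therefore a vanish at both. The hypothesis on a covers multiples of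
  b as well as members of the ideal of elements vanishing wherever b does.\<close>

lemma fixed_multiples:
  assumes t: "t \<in> carrier G" and b: "b \<in> carrier A" "\<And>x. x \<in> moved_chars A G \<alpha> t \<Longrightarrow> x b = 0"
    and a: "a \<in> carrier A" "\<And>x. \<lbrakk>x \<in> chars A; x b = 0\<rbrakk> \<Longrightarrow> x a = 0"
  shows "\<alpha> t a = a"
proof (rule eq_by_chars)
  fix x assume x: "x \<in> chars A"
  define z where "z = act (inv\<^bsub>G\<^esub> t) x"
  have z: "z \<in> chars A" "act t z = x"
    using act_chars[OF inv_closed[OF t] x] act_inv(1)[OF t chars_subset[OF x]] by (simp_all add: z_def)
  have za: "x (\<alpha> t a) = z a" using t a(1) by (simp add: z_def act_apply)
  show "x (\<alpha> t a) = x a"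
  proof (cases "z = x")
    case False
    then have "z \<in> moved_chars A G \<alpha> t" using z by (auto simp: moved_chars_def)
    then have "z a = 0" using b(2) a(2) z(1) by blast
    moreover have "x \<in> moved_chars A G \<alpha> t"
    proof -
      have "act t x \<noteq> x"
      proof
        assume "act t x = x"
        then have "z = x" using act_inv(2)[OF t chars_subset[OF x]] by (simp add: z_def)
        then show False using False by blast
      qed
      then show ?thesis using x by (simp add: moved_chars_def)
    qed
    then have "x a = 0" using b(2) a(2) x by blast
    ultimately show ?thesis using za by simp
  qed (simp add: za)
qed (use t a in \<open>simp_all add: aut\<close>)

theorem rokhlin_star_imp_moved_dense:
  assumes rok: "rokhlin_star A G \<alpha>" and t: "t \<in> carrier G" "t \<noteq> \<one>\<^bsub>G\<^esub>"
  shows "dense_chars A (moved_chars A G \<alpha> t)"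
proof (rule ccontr)
  let ?C = "B_infty A" and ?\<gamma> = "B_infty_action \<alpha>" and ?\<iota> = "const_embed A"
  assume "\<not> dense_chars A (moved_chars A G \<alpha> t)"
  then obtain b where b: "b \<in> carrier A" "b \<noteq> \<zero>v" "\<And>x. x \<in> moved_chars A G \<alpha> t \<Longrightarrow> x b = 0"
    by (auto simp: dense_chars_def)
  have fixed: "\<alpha> t (b \<boxtimes> c) = b \<boxtimes> c" if "c \<in> carrier A" for c
  proof (rule fixed_multiples[OF t(1) b(1)])
    show "x b = 0" if "x \<in> moved_chars A G \<alpha> t" for x using that by (rule b(3))
  qed (use that b(1) in \<open>simp_all add: aclosed char_simps chars_subset\<close>)
  interpret L: abelian_system "linf A" G "linf_action \<alpha>" by (rule linf_system)
  interpret C: abelian_system ?C G ?\<gamma> by (rule B_infty_system)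
  obtain p where pN: "p \<in> carrier (dual (dual ?C))" and idem: "arens_mult ?C p p = p"
    and orth: "\<And>t. t \<in> carrier G - {\<one>\<^bsub>G\<^esub>} \<Longrightarrow> arens_mult ?C p (bidual_map ?C (?\<gamma> t) p) = (\<lambda>\<phi>\<in>carrier (dual ?C). 0)"
    and supp: "\<And>b. b \<in> carrier A - {\<zero>v} \<Longrightarrow> \<exists>t\<in>carrier G.
          arens_mult ?C (bidual_embed ?C (?\<iota> b)) (bidual_map ?C (?\<gamma> t) p) \<noteq> (\<lambda>\<phi>\<in>carrier (dual ?C). 0)"
    using rok unfolding rokhlin_star_iff Let_def by blast
  obtain s where s: "s \<in> carrier G"
    "arens_mult ?C (bidual_embed ?C (?\<iota> b)) (bidual_map ?C (?\<gamma> s) p) \<noteq> (\<lambda>\<phi>\<in>carrier (dual ?C). 0)"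
    using supp[of b] b by blast
  then obtain \<phi> where "arens_mult ?C (bidual_embed ?C (?\<iota> b)) (bidual_map ?C (?\<gamma> s) p) \<phi> \<noteq> (\<lambda>\<phi>\<in>carrier (dual ?C). 0) \<phi>"
    by blast
  then have \<phi>: "\<phi> \<in> carrier (dual ?C)"
    and ne: "arens_mult ?C (bidual_embed ?C (?\<iota> b)) (bidual_map ?C (?\<gamma> s) p) \<phi> \<noteq> 0"
    by (cases "\<phi> \<in> carrier (dual ?C)"; simp add: arens_mult_def)+
  \<comment> \<open>Orthogonality is available for p rather than for s.p. The argument is therefore
    translated by the inverse of s: b becomes \<open>b'\<close> and t becomes its conjugate r, which
    is again different from e.\<close>
  define r where "r = inv\<^bsub>G\<^esub> s \<otimes>\<^bsub>G\<^esub> (t \<otimes>\<^bsub>G\<^esub> s)"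
  have is_G: "inv\<^bsub>G\<^esub> s \<in> carrier G" using s by simp
  have r: "r \<in> carrier G - {\<one>\<^bsub>G\<^esub>}"
  proof -
    have "t = \<one>\<^bsub>G\<^esub>" if "r = \<one>\<^bsub>G\<^esub>"
    proof -
      have "t \<otimes>\<^bsub>G\<^esub> s = s" using that s t inv_solve_left[of "\<one>\<^bsub>G\<^esub>" s "t \<otimes>\<^bsub>G\<^esub> s"] by (simp add: r_def)
      moreover have "t = t \<otimes>\<^bsub>G\<^esub> s \<otimes>\<^bsub>G\<^esub> inv\<^bsub>G\<^esub> s" using s t by (simp add: m_assoc)
      ultimately show ?thesis using s by simp
    qed
    then show ?thesis using s t by (auto simp: r_def)
  qed
  have rG: "r \<in> carrier G" using r by blast
  define b' where "b' = \<alpha> (inv\<^bsub>G\<^esub> s) b"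
  have b': "b' \<in> carrier A" "\<alpha> s b' = b" using b(1) s is_G by (simp_all add: b'_def aut action_inv)
  have fixed': "\<alpha> r (b' \<boxtimes> d) = b' \<boxtimes> d" if d: "d \<in> carrier A" for d
  proof -
    have "\<alpha> r (b' \<boxtimes> d) = \<alpha> (inv\<^bsub>G\<^esub> s) (\<alpha> t (\<alpha> s (b' \<boxtimes> d)))"
      using d b'(1) s t is_G by (simp add: r_def action_mult aut aclosed)
    also have "\<dots> = \<alpha> (inv\<^bsub>G\<^esub> s) (\<alpha> s (b' \<boxtimes> d))"
      using d b' s fixed[of "\<alpha> s d"] by (simp add: aut)
    finally show ?thesis using d b'(1) s by (simp add: action_inv aclosed)
  qed
  define B' where "B' = ?\<iota> b'"
  have B': "B' \<in> carrier ?C" unfolding B'_def by (rule const_embed_simps(1)[OF b'(1) b'(1)])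
  \<comment> \<open>The action is entrywise on representing sequences, and each entry is a multiple
    of \<open>b'\<close>, which r fixes.\<close>
  have \<gamma>fixed: "?\<gamma> r (B' \<boxtimes>\<^bsub>?C\<^esub> c) = B' \<boxtimes>\<^bsub>?C\<^esub> c" if c: "c \<in> carrier ?C" for c
  proof -
    obtain f where f: "f \<in> carrier (linf A)" "c = coset (linf A) (c0_ideal A) f"
      using L.quotient_cosetE[OF c0_closed_ideal] c unfolding B_infty_def by blast
    have bl: "(\<lambda>n. b') \<in> carrier (linf A)" by (rule linf_const[OF b'(1)])
    let ?g = "(\<lambda>n. b') \<boxtimes>\<^bsub>linf A\<^esub> f"
    have g: "?g \<in> carrier (linf A)" using bl f(1) by (rule L.mult_closed)
    have eq: "B' \<boxtimes>\<^bsub>?C\<^esub> c = coset (linf A) (c0_ideal A) ?g"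
      unfolding B'_def const_embed_def B_infty_def f(2) by (rule L.quotient_mult[OF c0_closed_ideal bl f(1)])
    have "linf_action \<alpha> r ?g = ?g" by (simp add: linf_action_def fun_eq_iff fixed' linf_mem[OF f(1)])
    then show ?thesis
      unfolding eq B_infty_action_def L.quotient_action_coset[OF c0_closed_ideal c0_invariant rG g] by simp
  qed
  define \<phi>' where "\<phi>' = (\<lambda>v\<in>carrier ?C. \<phi> (?\<gamma> s v))"
  have \<phi>': "\<phi>' \<in> carrier (dual ?C)" unfolding \<phi>'_def by (rule C.dual_action(1)[OF s(1) \<phi>])
  define \<psi> where "\<psi> = (\<lambda>c\<in>carrier ?C. \<phi>' (B' \<boxtimes>\<^bsub>?C\<^esub> c))"
  have \<psi>: "\<psi> \<in> carrier (dual ?C)" unfolding \<psi>_def by (rule C.dual_mult(1)[OF \<phi>' B'])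
  define \<theta> where "\<theta> = (\<lambda>d\<in>carrier ?C. \<phi>' (?\<gamma> r B' \<boxtimes>\<^bsub>?C\<^esub> d))"
  have \<theta>: "\<theta> \<in> carrier (dual ?C)" unfolding \<theta>_def by (rule C.dual_mult(1)[OF \<phi>' C.aut(1)[OF rG B']])
  have "arens_mult ?C (bidual_embed ?C (?\<iota> b)) (bidual_map ?C (?\<gamma> s) p) \<phi>
      = bidual_map ?C (?\<gamma> s) p (\<lambda>c\<in>carrier ?C. \<phi> (?\<iota> b \<boxtimes>\<^bsub>?C\<^esub> c))"
    by (rule C.arens_embed_left[OF const_embed_simps(1)[OF b(1) b(1)] C.bidual_map_closed[OF s(1) pN] \<phi>])
  also have "\<dots> = p (\<lambda>v\<in>carrier ?C. \<phi> (?\<iota> b \<boxtimes>\<^bsub>?C\<^esub> ?\<gamma> s v))"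
    by (rule C.bidual_map_apply[OF s(1) \<phi> const_embed_simps(1)[OF b(1) b(1)]])
  also have "(\<lambda>v\<in>carrier ?C. \<phi> (?\<iota> b \<boxtimes>\<^bsub>?C\<^esub> ?\<gamma> s v)) = \<psi>"
    unfolding \<psi>_def
  proof (rule restrict_ext)
    fix v assume v: "v \<in> carrier ?C"
    have "?\<gamma> s (B' \<boxtimes>\<^bsub>?C\<^esub> v) = ?\<iota> b \<boxtimes>\<^bsub>?C\<^esub> ?\<gamma> s v"
      using C.aut(4)[OF s(1) B' v] const_embed_simps(6)[OF b'(1) b'(1) s(1)] b'(2) by (simp add: B'_def)
    then show "\<phi> (?\<iota> b \<boxtimes>\<^bsub>?C\<^esub> ?\<gamma> s v) = \<phi>' (B' \<boxtimes>\<^bsub>?C\<^esub> v)"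
      using B' v by (simp add: \<phi>'_def C.mult_closed)
  qed
  also have "p \<psi> = p (\<lambda>a\<in>carrier ?C. p (\<lambda>c\<in>carrier ?C. \<psi> (a \<boxtimes>\<^bsub>?C\<^esub> c)))"
    using fun_cong[OF idem, of \<psi>] \<psi> by (simp add: arens_mult_def)
  also have "(\<lambda>a\<in>carrier ?C. p (\<lambda>c\<in>carrier ?C. \<psi> (a \<boxtimes>\<^bsub>?C\<^esub> c)))
      = (\<lambda>a\<in>carrier ?C. bidual_map ?C (?\<gamma> r) p (\<lambda>c\<in>carrier ?C. \<theta> (a \<boxtimes>\<^bsub>?C\<^esub> c)))"
  proof (rule restrict_ext)
    fix a assume a: "a \<in> carrier ?C"
    have "(\<lambda>c\<in>carrier ?C. \<psi> (a \<boxtimes>\<^bsub>?C\<^esub> c)) = (\<lambda>v\<in>carrier ?C. \<theta> (a \<boxtimes>\<^bsub>?C\<^esub> ?\<gamma> r v))"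
    proof (rule restrict_ext)
      fix c assume c: "c \<in> carrier ?C"
      have \<gamma>c: "?\<gamma> r c \<in> carrier ?C" "?\<gamma> r B' \<in> carrier ?C" using C.aut(1)[OF rG] c B' by blast+
      have "?\<gamma> r B' \<boxtimes>\<^bsub>?C\<^esub> (a \<boxtimes>\<^bsub>?C\<^esub> ?\<gamma> r c) = a \<boxtimes>\<^bsub>?C\<^esub> (?\<gamma> r B' \<boxtimes>\<^bsub>?C\<^esub> ?\<gamma> r c)"
        by (rule C.mult_left_comm[OF \<gamma>c(2) a \<gamma>c(1)])
      also have "?\<gamma> r B' \<boxtimes>\<^bsub>?C\<^esub> ?\<gamma> r c = B' \<boxtimes>\<^bsub>?C\<^esub> c"
        using C.aut(4)[OF rG B' c] \<gamma>fixed[OF c] by simp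
      also have "a \<boxtimes>\<^bsub>?C\<^esub> (B' \<boxtimes>\<^bsub>?C\<^esub> c) = B' \<boxtimes>\<^bsub>?C\<^esub> (a \<boxtimes>\<^bsub>?C\<^esub> c)" by (rule C.mult_left_comm[OF a B' c])
      finally show "\<psi> (a \<boxtimes>\<^bsub>?C\<^esub> c) = \<theta> (a \<boxtimes>\<^bsub>?C\<^esub> ?\<gamma> r c)"
        using a c \<gamma>c by (simp add: \<psi>_def \<theta>_def C.mult_closed)
    qed
    then show "p (\<lambda>c\<in>carrier ?C. \<psi> (a \<boxtimes>\<^bsub>?C\<^esub> c)) = bidual_map ?C (?\<gamma> r) p (\<lambda>c\<in>carrier ?C. \<theta> (a \<boxtimes>\<^bsub>?C\<^esub> c))"
      unfolding C.bidual_map_apply[OF rG \<theta> a] by simp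
  qed
  also have "p \<dots> = 0"
    using fun_cong[OF orth[OF r], of \<theta>] \<theta> by (simp add: arens_mult_def)
  finally show False using ne by simp
qed

end

section \<open>Proper outerness\<close>

lemma ideal_algebra_simps [simp]:
  "carrier (ideal_algebra B J) = J" "vadd (ideal_algebra B J) = vadd B" "vzero (ideal_algebra B J) = vzero B"
  "vscale (ideal_algebra B J) = vscale B" "vnorm (ideal_algebra B J) = vnorm B"
  "amult (ideal_algebra B J) = amult B" "astar (ideal_algebra B J) = astar B"
  by (simp_all add: ideal_algebra_def)

context abelian_cstar_algebra
begin

text \<open>Over a commutative ideal the left and right parts of a multiplier coincide: their
  difference d at x is annihilated by its own adjoint, so d = 0. The relation between u and its
  adjoint then says that conjugation by u is the identity.\<close>

lemma Ad_trivial: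
  assumes J: "closed_ideal A J" and u: "multiplier_unitary (ideal_algebra A J) u" and a: "a \<in> J"
  shows "Ad (ideal_algebra A J) u a = a"
proof -
  obtain L R where LR: "u = (L, R)" by fastforce
  let ?B = "ideal_algebra A J"
  have u_mem: "(L, R) \<in> carrier (multiplier_algebra ?B)"
    and u_right: "(L, R) \<boxtimes>\<^bsub>multiplier_algebra ?B\<^esub> astar (multiplier_algebra ?B) (L, R) = multiplier_one ?B"
    using u by (simp_all add: multiplier_unitary_def Let_def LR)
  have LJ: "L x \<in> J" and RJ: "R x \<in> J" if "x \<in> J" for x
    using u_mem that by (auto simp: multiplier_algebra_def bounded_linear_map_def linear_map_def Pi_iff)
  have mulL: "L (x \<boxtimes> y) = L x \<boxtimes> y" and mid: "R x \<boxtimes> y = x \<boxtimes> L y" if "x \<in> J" "y \<in> J" for x y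
    using u_mem that by (auto simp: multiplier_algebra_def)
  have JA: "x \<in> carrier A" if "x \<in> J" for x using ideal_in_carrier[OF J that] .
  have star: "astar A x \<in> J" if "x \<in> J" for x using closed_ideal_star[OF J that] .
  have RL: "R x = L x" if x: "x \<in> J" for x
  proof -
    define d where "d = vminus A (R x) (L x)"
    have d: "d \<in> J" unfolding d_def by (rule closed_idealD(6)[OF J RJ[OF x] LJ[OF x]])
    have ds: "astar A d \<in> J" by (rule star[OF d])
    \<comment> \<open>With y the adjoint of d, both sides equal L(x y): pull y into L, exchange the
      factors, pull x out again, and use the centralizer relation R(x) y = x L(y).\<close>
    have "L x \<boxtimes> astar A d = R x \<boxtimes> astar A d"
      using mulL[OF x ds] mulL[OF ds x] mid[OF x ds] mult_comm[OF JA[OF x] JA[OF ds]]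
        mult_comm[OF JA[OF LJ[OF ds]] JA[OF x]] by simp
    then have "d \<boxtimes> astar A d = \<zero>v"
      using mult_minus_left[OF JA[OF ds] JA[OF RJ[OF x]] JA[OF LJ[OF x]]] JA[OF ds] JA[OF RJ[OF x]]
      by (simp add: aclosed flip: d_def)
    then have "vnorm A d = 0"
      using cstar_identity[OF JA[OF d]] mult_comm[OF JA[OF d] JA[OF ds]] by simp
    then show ?thesis
      using norm_eq_zero[OF JA[OF d]] minus_eq_zero[OF JA[OF RJ[OF x]] JA[OF LJ[OF x]]] by (simp add: d_def)
  qed
  have "fst ((L, R) \<boxtimes>\<^bsub>multiplier_algebra ?B\<^esub> astar (multiplier_algebra ?B) (L, R)) a = a"
    using a unfolding u_right by (simp add: multiplier_one_def)
  then have "L (astar A (R (astar A a))) = a" using a by (simp add: multiplier_algebra_def)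
  then show ?thesis using a RL[OF star[OF a]] by (simp add: Ad_def LR multiplier_algebra_def)
qed

text \<open>Supplies the identity as an inner automorphism, from which an automorphism fixing an
  ideal pointwise has distance 0.\<close>

lemma multiplier_one_unitary:
  assumes J: "closed_ideal A J" shows "multiplier_unitary (ideal_algebra A J) (multiplier_one (ideal_algebra A J))"
proof -
  have JA: "x \<in> carrier A" if "x \<in> J" for x using ideal_in_carrier[OF J that] .
  have star: "astar A x \<in> J" if "x \<in> J" for x using closed_ideal_star[OF J that] .
  have mult: "x \<boxtimes> y \<in> J" if "x \<in> J" "y \<in> J" for x y using closed_idealD(7)[OF J JA[OF that(1)] that(2)] .
  let ?B = "ideal_algebra A J"
  have "bounded_linear_map ?B ?B (\<lambda>a\<in>J. a)"
    unfolding bounded_linear_map_def linear_map_def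
    using closed_idealD(4,5)[OF J] by (auto intro!: exI[of _ 1])
  then have "multiplier_one ?B \<in> carrier (multiplier_algebra ?B)"
    by (simp add: multiplier_one_def multiplier_algebra_def mult)
  moreover have "astar (multiplier_algebra ?B) (multiplier_one ?B) = multiplier_one ?B"
    using star JA by (simp add: multiplier_one_def multiplier_algebra_def star_star cong: restrict_cong)
  moreover have "multiplier_one ?B \<boxtimes>\<^bsub>multiplier_algebra ?B\<^esub> multiplier_one ?B = multiplier_one ?B"
    by (simp add: multiplier_one_def multiplier_algebra_def cong: restrict_cong)
  ultimately show ?thesis by (simp add: multiplier_unitary_def Let_def)
qed

end

section \<open>Proper outerness and moved characters\<close>

context abelian_system
begin

text \<open>The element is the difference of two bumps with disjoint supports, at x and at z. The
  supports are also kept inside the sets where chosen members of I do not vanish, so the difference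
  vanishes on the hull of I and lies in I.\<close>

lemma moved_opposite_values:
  assumes I: "closed_ideal A I" and x: "x \<in> chars A" "x \<notin> zeros A I" and z: "z \<in> chars A" "z \<notin> zeros A I" and "x \<noteq> z"
  obtains f where "f \<in> I" "vnorm A f \<le> 1" "x f = 1" "z f = - 1"
proof -
  have ev: "\<exists>b\<in>I. w b \<noteq> 0" if "w \<in> chars A" "w \<notin> zeros A I" for w using that by (auto simp: zeros_def)
  obtain b c where b: "b \<in> I" "x b \<noteq> 0" and c: "c \<in> I" "z c \<noteq> 0" using ev[OF x] ev[OF z] by blast
  obtain U0 V0 where UV: "open U0" "open V0" "x \<in> U0" "z \<in> V0" "U0 \<inter> V0 = {}"
    using hausdorff[OF \<open>x \<noteq> z\<close>] by blast
  have op: "open {w :: 'a \<Rightarrow> complex. w d \<noteq> 0}" for d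
    by (intro open_Collect_neq continuous_on_eval continuous_intros)
  define U where "U = U0 \<inter> {w. w b \<noteq> 0}"
  define V where "V = V0 \<inter> {w. w c \<noteq> 0}"
  have U: "open U" "x \<in> U" and V: "open V" "z \<in> V"
    unfolding U_def V_def using UV b c op by (auto intro!: open_Int)
  have disj: "U \<inter> V = {}" using UV(5) by (auto simp: U_def V_def)
  obtain e where e: "e \<in> bumps x U" using bumps_nonempty[OF x(1) U] by blast
  obtain d where d: "d \<in> bumps z V" using bumps_nonempty[OF z(1) V] by blast
  have ec: "e \<in> carrier A" and dc: "d \<in> carrier A" using e d by (simp_all add: bumps_def)
  have off: "w \<in> chars0 A \<Longrightarrow> w \<notin> U \<Longrightarrow> w e = 0" "w \<in> chars0 A \<Longrightarrow> w \<notin> V \<Longrightarrow> w d = 0"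
    "w \<in> chars0 A \<Longrightarrow> cmod (w e) \<le> 1" "w \<in> chars0 A \<Longrightarrow> cmod (w d) \<le> 1" for w
    using e d by (simp_all add: bumps_def)
  have x0: "x \<in> chars0 A" and z0: "z \<in> chars0 A" using x z by (simp_all add: chars_subset)
  let ?f = "vminus A e d"
  show thesis
  proof (rule that)
    show "?f \<in> I"
    proof (rule nullstellensatz[OF I])
      fix w assume w: "w \<in> zeros A I"
      then have w0: "w \<in> chars0 A" by (rule zeros_char0[OF I])
      have "w \<notin> U" "w \<notin> V" using w b(1) c(1) by (auto simp: U_def V_def zeros_def)
      then show "w ?f = 0" using off[OF w0] ec dc w0 by (simp add: char_minus)
    qed (simp add: aclosed ec dc)
    show "vnorm A ?f \<le> 1"
    proof (rule norm_le_by_chars)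
      fix w assume "w \<in> chars A"
      then have w0: "w \<in> chars0 A" by (rule chars_subset)
      show "cmod (w ?f) \<le> 1"
      proof (cases "w \<in> U")
        case True
        then have "w \<notin> V" using disj by blast
        then show ?thesis using off(2,3)[OF w0] ec dc w0 by (simp add: char_minus)
      qed (use off(1,4)[OF w0] ec dc w0 in \<open>simp add: char_minus\<close>)
    qed (simp_all add: aclosed ec dc)
    have "x \<notin> V" "z \<notin> U" using U V disj by auto
    then show "x ?f = 1" "z ?f = - 1"
      using e d x0 z0 ec dc off[of x] off[of z] by (simp_all add: char_minus bumps_def)
  qed
qed

theorem properly_outer_iff:
  assumes t: "t \<in> carrier G"
  shows "properly_outer A (\<alpha> t) \<longleftrightarrow> dense_chars A (moved_chars A G \<alpha> t)"
proof
  assume po: "properly_outer A (\<alpha> t)"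
  show "dense_chars A (moved_chars A G \<alpha> t)"
  proof (rule ccontr)
    assume "\<not> dense_chars A (moved_chars A G \<alpha> t)"
    then obtain b where b: "b \<in> carrier A" "b \<noteq> \<zero>v" "\<And>x. x \<in> moved_chars A G \<alpha> t \<Longrightarrow> x b = 0"
      by (auto simp: dense_chars_def)
    \<comment> \<open>All elements vanishing wherever b does. This ideal contains b, and t fixes it
      pointwise, so on it the distance to the identity is 0 instead of 2.\<close>
    define J where "J = kernel A {x \<in> chars A. x b = 0}"
    have J: "closed_ideal A J" unfolding J_def by (rule kernel_closed_ideal) (auto simp: chars_subset)
    have "b \<in> J" using b(1) by (simp add: J_def kernel_def)
    have fixed: "\<alpha> t a = a" if "a \<in> J" for a
    proof (rule fixed_multiples[OF t b(1)])
      show "x b = 0" if "x \<in> moved_chars A G \<alpha> t" for x using that by (rule b(3))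
    qed (use that in \<open>auto simp: J_def kernel_def\<close>)
    then have "\<alpha> t ` J = J" by force
    then have norm2: "opnorm (ideal_algebra A J) A
        (\<lambda>a. vminus A (\<alpha> t a) (Ad (ideal_algebra A J) (multiplier_one (ideal_algebra A J)) a)) = 2"
      using po J b(2) \<open>b \<in> J\<close> multiplier_one_unitary[OF J] unfolding properly_outer_def by blast
    have "vnorm A (vminus A (\<alpha> t a) (Ad (ideal_algebra A J) (multiplier_one (ideal_algebra A J)) a)) = 0" if "a \<in> J" for a
      using that fixed Ad_trivial[OF J multiplier_one_unitary[OF J] that] ideal_in_carrier[OF J that] by simp
    then have "opnorm (ideal_algebra A J) A
        (\<lambda>a. vminus A (\<alpha> t a) (Ad (ideal_algebra A J) (multiplier_one (ideal_algebra A J)) a))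
        = (SUP a\<in>{a \<in> J. vnorm A a \<le> 1}. 0)"
      unfolding opnorm_def by (intro SUP_cong) auto
    also have "\<dots> = 0"
    proof -
      have "\<zero>v \<in> {a \<in> J. vnorm A a \<le> 1}" using closed_idealD(3)[OF J] by simp
      then have "{a \<in> J. vnorm A a \<le> 1} \<noteq> {}" by blast
      then show ?thesis by simp
    qed
    finally show False using norm2 by simp
  qed
next
  assume dense: "dense_chars A (moved_chars A G \<alpha> t)"
  show "properly_outer A (\<alpha> t)"
    unfolding properly_outer_def
  proof (intro allI impI, elim conjE)
    fix I u
    assume I: "closed_ideal A I" and I0: "I \<noteq> {\<zero>v}" and tI: "\<alpha> t ` I = I"
      and u: "multiplier_unitary (ideal_algebra A I) u"
    let ?F = "\<lambda>a. vminus A (\<alpha> t a) (Ad (ideal_algebra A I) u a)"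
    have F: "vnorm A (?F a) = vnorm A (vminus A (\<alpha> t a) a)" if "a \<in> I" for a
      using Ad_trivial[OF I u that] by simp
    obtain b where b: "b \<in> I" "b \<noteq> \<zero>v" using I0 closed_idealD(3)[OF I] by blast
    obtain x where x: "x \<in> moved_chars A G \<alpha> t" "x b \<noteq> 0"
      using dense b ideal_in_carrier[OF I b(1)] by (auto simp: dense_chars_def)
    have xc: "x \<in> chars A" "x \<in> chars0 A" using x(1) by (auto simp: moved_chars_def chars_subset)
    \<comment> \<open>Evaluating a translated element at x amounts to evaluating the original
      element at z, which differs from x because t moves x.\<close>
    define z where "z = act (inv\<^bsub>G\<^esub> t) x"
    have zc: "z \<in> chars A" unfolding z_def by (rule act_chars[OF inv_closed[OF t] xc(1)])
    have "x \<noteq> z"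
    proof
      assume "x = z"
      then have "act t x = x" using act_inv(1)[OF t xc(2)] by (simp add: z_def)
      then show False using x(1) by (simp add: moved_chars_def)
    qed
    have z_apply: "x (\<alpha> t a) = z a" if "a \<in> carrier A" for a using t that by (simp add: z_def act_apply)
    have "x \<notin> zeros A I" using x(2) b(1) by (auto simp: zeros_def)
    \<comment> \<open>Equality \<open>\<alpha> t\<close> followed by the image of I being all of I
      is used here: b is the translate of some c in I, and z(c) = x(b) \<noteq> 0.\<close>
    moreover have "z \<notin> zeros A I"
    proof -
      obtain c where c: "c \<in> I" "b = \<alpha> t c" using tI b(1) by blast
      then have "z c \<noteq> 0" using z_apply[OF ideal_in_carrier[OF I c(1)]] x(2) by simp
      then show ?thesis using c(1) by (auto simp: zeros_def)
    qed
    ultimately obtain f where f: "f \<in> I" "vnorm A f \<le> 1" "x f = 1" "z f = - 1"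
      using moved_opposite_values[OF I xc(1) _ zc _ \<open>x \<noteq> z\<close>] by blast
    have fc: "f \<in> carrier A" by (rule ideal_in_carrier[OF I f(1)])
    have le: "vnorm A (?F a) \<le> 2" if "a \<in> {a \<in> I. vnorm A a \<le> 1}" for a
    proof -
      have a: "a \<in> I" "vnorm A a \<le> 1" "a \<in> carrier A" using that ideal_in_carrier[OF I] by auto
      have "vnorm A (vminus A (\<alpha> t a) a) \<le> vnorm A (\<alpha> t a) + vnorm A a"
        using norm_triangle[of "\<alpha> t a" "(-1) \<boxdot> a"] a t by (simp add: vminus_def aut aclosed norm_scale)
      then show ?thesis using F[OF a(1)] a aut_isometric[OF t a(3)] by simp
    qed
    \<comment> \<open>The translate of f has value z(f) = -1 at x while f has value 1 there;
      isometry of the action makes 2 the largest possible norm.\<close>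
    have "x (vminus A (\<alpha> t f) f) = - 2" using f(3,4) fc t xc(2) z_apply[OF fc] by (simp add: char_minus aut)
    then have "2 \<le> vnorm A (?F f)"
      using char_bound[OF xc(2), of "vminus A (\<alpha> t f) f"] F[OF f(1)] fc t by (simp add: aclosed aut)
    then have ge: "2 \<le> (SUP a\<in>{a \<in> I. vnorm A a \<le> 1}. vnorm A (?F a))"
      using f(1,2) le by (intro cSUP_upper2[of _ _ f] bdd_aboveI2[where M = 2]) auto
    have "(SUP a\<in>{a \<in> I. vnorm A a \<le> 1}. vnorm A (?F a)) \<le> 2"
      using f(1,2) le by (intro cSUP_least) auto
    then show "opnorm (ideal_algebra A I) A ?F = 2" using ge by (simp add: opnorm_def)
  qed
qed

section \<open>Baire category\<close>

lemma openin_moved_chars: "openin (top_of_set (chars A)) (moved_chars A G \<alpha> t)"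
proof -
  have "moved_chars A G \<alpha> t = chars A \<inter> (\<Union>a. {x. char_action A G \<alpha> t x a \<noteq> x a})"
    by (auto simp: moved_chars_def fun_eq_iff)
  moreover have "open {x. char_action A G \<alpha> t x a \<noteq> x a}" for a
    unfolding char_action_def by (cases "a \<in> carrier A") (auto intro!: open_Collect_neq continuous_on_eval continuous_intros)
  ultimately show ?thesis by (simp add: openin_open_Int open_UN)
qed

text \<open>The non-zero characters form an open subset of a compact Hausdorff space, the complement
  of the point at infinity, hence a locally compact regular space to which Baire's theorem applies.
  Intersecting with \<open>chars A\<close> keeps the statement meaningful for empty F.\<close>

lemma dense_Inter_moved:
  assumes F: "countable F" and dense: "\<And>t. t \<in> F \<Longrightarrow> dense_chars A (moved_chars A G \<alpha> t)"
  shows "dense_chars A (chars A \<inter> (\<Inter>t\<in>F. moved_chars A G \<alpha> t))"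
proof -
  let ?X = "top_of_set (chars A)" and ?D = "chars A \<inter> (\<Inter>t\<in>F. moved_chars A G \<alpha> t)"
  have cl: "?X closure_of D = chars A \<longleftrightarrow> dense_chars A D" if "D \<subseteq> chars A" for D
    using closure_of_chars[OF that] dense_chars_iff[OF that] by simp
  have moved: "moved_chars A G \<alpha> t \<subseteq> chars A" for t by (auto simp: moved_chars_def)
  have haus: "Hausdorff_space (euclidean :: ('a \<Rightarrow> complex) topology)"
    by (simp add: Hausdorff_space_def disjnt_def, metis hausdorff)
  have "locally_compact_space (top_of_set (chars0 A))"
    using compact_chars0 by (intro compact_imp_locally_compact_space) (simp add: compact_space_subtopology)
  moreover have "openin (top_of_set (chars0 A)) (chars A)"
  proof -
    have "chars A = chars0 A \<inter> - {\<lambda>_. 0}" by (auto simp: chars_def)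
    then show ?thesis by (simp add: openin_open_Int open_Compl)
  qed
  moreover have "Hausdorff_space (top_of_set (chars0 A))" by (rule Hausdorff_space_subtopology[OF haus])
  ultimately have "locally_compact_space (subtopology (top_of_set (chars0 A)) (chars A))"
    by (intro locally_compact_space_open_subset[of "top_of_set (chars0 A)" "chars A"]) blast+
  moreover have "subtopology (top_of_set (chars0 A)) (chars A) = ?X"
    by (simp add: subtopology_subtopology chars_def Int_absorb1)
  ultimately have lc: "locally_compact_space ?X" by simp
  moreover have "Hausdorff_space ?X" by (rule Hausdorff_space_subtopology[OF haus])
  ultimately have "regular_space ?X" using locally_compact_Hausdorff_imp_regular_space by blast
  have "?X closure_of (\<Inter>t\<in>F. moved_chars A G \<alpha> t) = topspace ?X"
  proof (rule Baire_category)
    show "completely_metrizable_space ?X \<or> locally_compact_space ?X \<and> regular_space ?X"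
      using lc \<open>regular_space ?X\<close> by blast
    show "countable ((\<lambda>t. moved_chars A G \<alpha> t) ` F)" using F by simp
    fix T assume "T \<in> (\<lambda>t. moved_chars A G \<alpha> t) ` F"
    then obtain t where t: "t \<in> F" "T = moved_chars A G \<alpha> t" by blast
    then show "openin ?X T \<and> ?X closure_of T = topspace ?X"
      using openin_moved_chars cl[OF moved] dense by simp
  qed
  then have "?X closure_of ?D = chars A"
    using closure_of_restrict[of ?X "\<Inter>t\<in>F. moved_chars A G \<alpha> t"] by simp
  then show ?thesis using cl[of ?D] by blast
qed

section \<open>Comparison of the freeness conditions\<close>

lemma dense_chars_mono: "\<lbrakk>dense_chars A D; D \<subseteq> E\<rbrakk> \<Longrightarrow> dense_chars A E"
  unfolding dense_chars_def by blast

lemma topologically_free_moved: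
  "topologically_free A G \<alpha> \<longleftrightarrow> (\<forall>t\<in>carrier G - {\<one>\<^bsub>G\<^esub>}. dense_chars A (moved_chars A G \<alpha> t))"
proof
  assume tf: "topologically_free A G \<alpha>"
  show "\<forall>t\<in>carrier G - {\<one>\<^bsub>G\<^esub>}. dense_chars A (moved_chars A G \<alpha> t)"
  proof
    fix t assume "t \<in> carrier G - {\<one>\<^bsub>G\<^esub>}"
    then have "dense_chars A (chars A \<inter> (\<Inter>s\<in>{t}. moved_chars A G \<alpha> s))"
      using tf[unfolded topologically_free_iff, rule_format, of "{t}"] by simp
    then show "dense_chars A (moved_chars A G \<alpha> t)" by (rule dense_chars_mono) auto
  qed
next
  assume d: "\<forall>t\<in>carrier G - {\<one>\<^bsub>G\<^esub>}. dense_chars A (moved_chars A G \<alpha> t)"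
  show "topologically_free A G \<alpha>"
    unfolding topologically_free_iff
  proof (intro allI impI dense_Inter_moved; elim conjE)
    show "dense_chars A (moved_chars A G \<alpha> t)" if "F \<subseteq> carrier G - {\<one>\<^bsub>G\<^esub>}" "t \<in> F" for F t
      using d that by blast
  qed (rule countable_finite)
qed

text \<open>The free characters are the intersection of the sets moved by the single elements t
  \<noteq> e; countability of the group lets Baire's theorem pass density to this
  intersection.\<close>

lemma free_dense_moved:
  assumes "countable (carrier G)"
  shows "dense_chars A (free_chars A G \<alpha>) \<longleftrightarrow> (\<forall>t\<in>carrier G - {\<one>\<^bsub>G\<^esub>}. dense_chars A (moved_chars A G \<alpha> t))"
proof
  assume "dense_chars A (free_chars A G \<alpha>)"
  then show "\<forall>t\<in>carrier G - {\<one>\<^bsub>G\<^esub>}. dense_chars A (moved_chars A G \<alpha> t)"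
    by (intro ballI, rule dense_chars_mono) (auto simp: free_chars_def moved_chars_def)
next
  assume d: "\<forall>t\<in>carrier G - {\<one>\<^bsub>G\<^esub>}. dense_chars A (moved_chars A G \<alpha> t)"
  have "dense_chars A (chars A \<inter> (\<Inter>t\<in>carrier G - {\<one>\<^bsub>G\<^esub>}. moved_chars A G \<alpha> t))"
    using assms d by (intro dense_Inter_moved countable_Diff) auto
  then show "dense_chars A (free_chars A G \<alpha>)"
    by (rule dense_chars_mono) (auto simp: free_chars_def moved_chars_def)
qed

theorem freeness_equivalences:
  assumes "countable (carrier G)"
  shows "topologically_free A G \<alpha> \<longleftrightarrow> dense_chars A (free_chars A G \<alpha>)"
    and "rokhlin_star A G \<alpha> \<longleftrightarrow> dense_chars A (free_chars A G \<alpha>)"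
    and "(\<forall>t\<in>carrier G. t \<noteq> \<one>\<^bsub>G\<^esub> \<longrightarrow> properly_outer A (\<alpha> t)) \<longleftrightarrow> dense_chars A (free_chars A G \<alpha>)"
proof -
  show "topologically_free A G \<alpha> \<longleftrightarrow> dense_chars A (free_chars A G \<alpha>)"
    unfolding topologically_free_moved free_dense_moved[OF assms] ..
  show "rokhlin_star A G \<alpha> \<longleftrightarrow> dense_chars A (free_chars A G \<alpha>)"
  proof
    assume "rokhlin_star A G \<alpha>"
    then show "dense_chars A (free_chars A G \<alpha>)"
      unfolding free_dense_moved[OF assms] using rokhlin_star_imp_moved_dense by simp
  qed (rule free_dense_imp_rokhlin_star)
  show "(\<forall>t\<in>carrier G. t \<noteq> \<one>\<^bsub>G\<^esub> \<longrightarrow> properly_outer A (\<alpha> t)) \<longleftrightarrow> dense_chars A (free_chars A G \<alpha>)"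
    unfolding free_dense_moved[OF assms] using properly_outer_iff by auto
qed

end

theorem mainTheorem4:
  fixes A :: "'a cstar" and G :: "'g monoid" and \<alpha> :: "'g \<Rightarrow> 'a \<Rightarrow> 'a"
  assumes "cstar_dynamical_system A G \<alpha>"
    and "abelian_cstar_algebra A"
    and "countable (carrier G)"
  shows
    "((\<forall>I. closed_ideal A I \<and> invariant G \<alpha> I \<longrightarrow>
         topologically_free (quotient_algebra A I) G (quotient_action \<alpha>))
       \<longleftrightarrow> essentially_free (spectrum_topology A) G (spectrum_action A G \<alpha>)) \<and>
     (essentially_free (spectrum_topology A) G (spectrum_action A G \<alpha>)
       \<longleftrightarrow> residual_rokhlin_star A G \<alpha>) \<and>
     (residual_rokhlin_star A G \<alpha>
       \<longleftrightarrow> (\<forall>I. closed_ideal A I \<and> invariant G \<alpha> I \<and> I \<noteq> carrier A \<longrightarrow>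
              (\<forall>t\<in>carrier G. t \<noteq> \<one>\<^bsub>G\<^esub> \<longrightarrow>
                 properly_outer (quotient_algebra A I) (quotient_action \<alpha> t))))"
proof -
  interpret abelian_system A G \<alpha> using assms(1,2) by (rule abelian_system.intro)
  define D where "D I \<longleftrightarrow>
    dense_chars (quotient_algebra A I) (free_chars (quotient_algebra A I) G (quotient_action \<alpha>))" for I
  define inv_ideal where "inv_ideal I \<longleftrightarrow> closed_ideal A I \<and> invariant G \<alpha> I" for I
  have equiv: "topologically_free (quotient_algebra A I) G (quotient_action \<alpha>) \<longleftrightarrow> D I"
    "rokhlin_star (quotient_algebra A I) G (quotient_action \<alpha>) \<longleftrightarrow> D I"
    "(\<forall>t\<in>carrier G. t \<noteq> \<one>\<^bsub>G\<^esub> \<longrightarrow> properly_outer (quotient_algebra A I) (quotient_action \<alpha> t)) \<longleftrightarrow> D I"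
    if "inv_ideal I" for I
    using abelian_system.freeness_equivalences[OF quotient_system assms(3)] that
    unfolding D_def inv_ideal_def by blast+
  have ess: "essentially_free (spectrum_topology A) G (spectrum_action A G \<alpha>) \<longleftrightarrow> (\<forall>I. inv_ideal I \<longrightarrow> D I)"
    unfolding essentially_free_iff D_def inv_ideal_def using free_dense_quotient_iff by simp
  have "invariant G \<alpha> (carrier A)" by (auto simp: invariant_def aut)
  \<comment> \<open>Condition (iv) omits the ideal I = A. There the density statement holds since
    every b already lies in I, so all four conditions range over the same ideals.\<close>
  then have whole: "D (carrier A)"
    unfolding D_def using free_dense_quotient_iff[OF closed_ideal_carrier] by simp
  have top: "(\<forall>I. closed_ideal A I \<and> invariant G \<alpha> I \<longrightarrow>
      topologically_free (quotient_algebra A I) G (quotient_action \<alpha>)) \<longleftrightarrow> (\<forall>I. inv_ideal I \<longrightarrow> D I)"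
    using equiv(1) by (simp add: inv_ideal_def)
  have rok: "residual_rokhlin_star A G \<alpha> \<longleftrightarrow> (\<forall>I. inv_ideal I \<longrightarrow> D I)"
    unfolding residual_rokhlin_star_def using equiv(2) by (simp add: inv_ideal_def)
  have out: "(\<forall>I. closed_ideal A I \<and> invariant G \<alpha> I \<and> I \<noteq> carrier A \<longrightarrow>
      (\<forall>t\<in>carrier G. t \<noteq> \<one>\<^bsub>G\<^esub> \<longrightarrow> properly_outer (quotient_algebra A I) (quotient_action \<alpha> t)))
      \<longleftrightarrow> (\<forall>I. inv_ideal I \<longrightarrow> D I)"
    using equiv(3) whole by (metis inv_ideal_def)
  show ?thesis unfolding top rok ess out by blast
qed

end
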